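(* Under the standing setting, assume $(\mathcal V,\varrho_0)$ is complete as a metric space (so that $\mathbf H_0$ is self-adjoint). Then: (i) $\inf\sigma(\mathbf H_0)=0$ if $\underline\mu=0$. If in addition $m(\mathcal V)=\sum_{v\in\mathcal V}m(v)=\infty$, then: (ii) $\inf\sigma_{\rm ess}(\mathbf H_0)=0$ if $\mu=0$; (iii) the spectrum of $\mathbf H_0$ is not purely discrete if $\mu<\infty$.
   Context: Standing setting: $\mathcal G_d=(\mathcal V,\mathcal E)$ is a graph with finite or countably infinite vertex and edge sets, connected, with no loops or multiple edges, locally finite ($1\le\deg(v)=\#\mathcal E_v<\infty$, $\mathcal E_v$ the edges incident to $v$); $u\sim v$ means $u,v$ are joined by the edge $e_{u,v}$. Each edge has length $|e|\in(0,\infty)$, $\sup_e|e|<\infty$, and is identified with $(0,|e|)$. $\mathbf H_0$ is the closure in $L^2(\mathcal G)=\bigoplus_eL^2(e)$ of $-d^2/dx^2$ (edgewise on $W^{2,2}(e)$) restricted to functions vanishing on all but finitely many edges and satisfying at every vertex $v$: $f_e(v)$ independent of $e\in\mathcal E_v$ and $\sum_{e\in\mathcal E_v}f_e'(v)=0$ ($f_e'(v)$ the derivative at $v$ in the direction into $e$). $m(v)=\sum_{e\in\mathcal E_v}|e|$, $m(X)=\sum_{v\in X}m(v)$. $\varrho_0(u,v)=\inf\sum_{k=1}^n|e_{v_{k-1},v_k}|$ over paths $u=v_0\sim\dots\sim v_n=v$; $B_r(v)=\{u:\varrho_0(u,v)\le r\}$. $\mu=\liminf_{r\to\infty}\frac1r\log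 m(B_r(v))$ (independent of the fixed $v\in\mathcal V$), $\underline\mu=\liminf_{r\to\infty}\frac1r\inf_{v\in\mathcal V}\log\frac{m(B_r(v))}{m(B_1(v))}$. *)

theory Defs
  imports "HOL-Analysis.Analysis"
begin

text \<open>A graph is given by a countable vertex type 'v (the vertex set is UNIV),
a countable edge type 'e, and endpoint maps src, tgt.  Each edge e is identified
with the interval (0, len e), the point 0 corresponding to src e and len e to tgt e.\<close>

definition edges_at :: "('e \<Rightarrow> 'v) \<Rightarrow> ('e \<Rightarrow> 'v) \<Rightarrow> 'v \<Rightarrow> 'e set" where
  "edges_at src tgt v = {e. src e = v \<or> tgt e = v}"

definition is_walk :: "('e \<Rightarrow> 'v) \<Rightarrow> ('e \<Rightarrow> 'v) \<Rightarrow> 'v \<Rightarrow> 'v \<Rightarrow> 'v list \<Rightarrow> 'e list \<Rightarrow> bool" where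
  "is_walk src tgt u v vs es \<longleftrightarrow>
     length vs = Suc (length es) \<and> hd vs = u \<and> last vs = v \<and>
     (\<forall>k < length es. {src (es ! k), tgt (es ! k)} = {vs ! k, vs ! Suc k})"

definition graph_setting ::
  "('e::countable \<Rightarrow> 'v::countable) \<Rightarrow> ('e \<Rightarrow> 'v) \<Rightarrow> ('e \<Rightarrow> real) \<Rightarrow> bool" where
  "graph_setting src tgt len \<longleftrightarrow>
     (\<forall>e. src e \<noteq> tgt e) \<comment> \<open>no loops\<close> \<and>
     (\<forall>e e'. {src e, tgt e} = {src e', tgt e'} \<longrightarrow> e = e') \<comment> \<open>no multiple edges\<close> \<and>
     (\<forall>v. finite (edges_at src tgt v) \<and> edges_at src tgt v \<noteq> {}) \<comment> \<open>1 \<le> deg v < \<infinity>\<close> \<and>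
     (\<forall>u v. \<exists>vs es. is_walk src tgt u v vs es) \<comment> \<open>connected\<close> \<and>
     (\<forall>e. 0 < len e) \<and> bdd_above (range len)"

definition rho0 :: "('e \<Rightarrow> 'v) \<Rightarrow> ('e \<Rightarrow> 'v) \<Rightarrow> ('e \<Rightarrow> real) \<Rightarrow> 'v \<Rightarrow> 'v \<Rightarrow> real" where
  "rho0 src tgt len u v =
     Inf {sum_list (map len es) | vs es. is_walk src tgt u v vs es}"

definition rho0_complete :: "('e \<Rightarrow> 'v) \<Rightarrow> ('e \<Rightarrow> 'v) \<Rightarrow> ('e \<Rightarrow> real) \<Rightarrow> bool" where
  "rho0_complete src tgt len \<longleftrightarrow>
     (\<forall>s :: nat \<Rightarrow> 'v.
        (\<forall>\<epsilon>>0. \<exists>N. \<forall>m\<ge>N. \<forall>n\<ge>N. rho0 src tgt len (s m) (s n) < \<epsilon>) \<longrightarrow>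
        (\<exists>v. (\<lambda>n. rho0 src tgt len (s n) v) \<longlonglongrightarrow> 0))"

definition mv :: "('e \<Rightarrow> 'v) \<Rightarrow> ('e \<Rightarrow> 'v) \<Rightarrow> ('e \<Rightarrow> real) \<Rightarrow> 'v \<Rightarrow> real" where
  "mv src tgt len v = (\<Sum>e\<in>edges_at src tgt v. len e)"

definition ball0 :: "('e \<Rightarrow> 'v) \<Rightarrow> ('e \<Rightarrow> 'v) \<Rightarrow> ('e \<Rightarrow> real) \<Rightarrow> real \<Rightarrow> 'v \<Rightarrow> 'v set" where
  "ball0 src tgt len r v = {u. rho0 src tgt len u v \<le> r}"

text \<open>m(B_r(v)) (balls are finite under completeness and local finiteness).\<close>
definition mball :: "('e \<Rightarrow> 'v) \<Rightarrow> ('e \<Rightarrow> 'v) \<Rightarrow> ('e \<Rightarrow> real) \<Rightarrow> real \<Rightarrow> 'v \<Rightarrow> real" where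
  "mball src tgt len r v = (\<Sum>u\<in>ball0 src tgt len r v. mv src tgt len u)"

definition mu_exp :: "('e \<Rightarrow> 'v) \<Rightarrow> ('e \<Rightarrow> 'v) \<Rightarrow> ('e \<Rightarrow> real) \<Rightarrow> 'v \<Rightarrow> ereal" where
  "mu_exp src tgt len v =
     Liminf at_top (\<lambda>r::real. ereal (ln (mball src tgt len r v) / r))"

definition mu_unif :: "('e \<Rightarrow> 'v) \<Rightarrow> ('e \<Rightarrow> 'v) \<Rightarrow> ('e \<Rightarrow> real) \<Rightarrow> ereal" where
  "mu_unif src tgt len =
     Liminf at_top (\<lambda>r::real.
        (INF v. ereal (ln (mball src tgt len r v / mball src tgt len 1 v))) / ereal r)"

type_synonym ('e) gfun = "'e \<Rightarrow> real \<Rightarrow> complex"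

definition gnorm2 :: "('e \<Rightarrow> real) \<Rightarrow> 'e gfun \<Rightarrow> ennreal" where
  "gnorm2 len f =
     (\<Sum>\<^sub>\<infinity>e. \<integral>\<^sup>+ x. ennreal (indicator {0<..<len e} x * (cmod (f e x))\<^sup>2) \<partial>lborel)"

definition L2G :: "('e \<Rightarrow> real) \<Rightarrow> 'e gfun set" where
  "L2G len = {f. (\<forall>e. (\<lambda>x. indicator {0<..<len e} x *\<^sub>R f e x) \<in> borel_measurable lborel)
                 \<and> gnorm2 len f < \<infinity>}"

definition gscale :: "complex \<Rightarrow> 'e gfun \<Rightarrow> 'e gfun" where
  "gscale c f = (\<lambda>e x. c * f e x)"

text \<open>W^{2,2}(0,l): f = f(0) + int_0^x u1, u1 = u1(0) + int_0^x u2, u2 in L^2(0,l).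
  Then u1 = f' and u2 = f''.\<close>
definition W22_with :: "real \<Rightarrow> (real \<Rightarrow> complex) \<Rightarrow> (real \<Rightarrow> complex) \<Rightarrow> (real \<Rightarrow> complex) \<Rightarrow> bool" where
  "W22_with l f u1 u2 \<longleftrightarrow>
     set_integrable lborel {0..l} u2 \<and>
     set_integrable lborel {0..l} (\<lambda>x. (cmod (u2 x))\<^sup>2) \<and>
     (\<forall>x\<in>{0..l}. u1 x = u1 0 + set_lebesgue_integral lborel {0..x} u2) \<and>
     (\<forall>x\<in>{0..l}. f x = f 0 + set_lebesgue_integral lborel {0..x} u1)"

text \<open>Graph of the minimal operator: -d^2/dx^2 on finitely supported edgewise W^{2,2}
  functions satisfying continuity and Kirchhoff conditions at each vertex.
  The derivative into e at src e is u1 e 0, at tgt e it is - u1 e (len e).\<close>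
definition H0min :: "('e \<Rightarrow> 'v) \<Rightarrow> ('e \<Rightarrow> 'v) \<Rightarrow> ('e \<Rightarrow> real) \<Rightarrow> ('e gfun \<times> 'e gfun) set" where
  "H0min src tgt len =
     {(f, (\<lambda>e x. - u2 e x)) | f u1 u2.
        finite {e. \<exists>x\<in>{0<..<len e}. f e x \<noteq> 0} \<and>
        (\<forall>e. W22_with (len e) (f e) (u1 e) (u2 e)) \<and>
        (\<forall>v. \<exists>c. \<forall>e. (src e = v \<longrightarrow> f e 0 = c) \<and> (tgt e = v \<longrightarrow> f e (len e) = c)) \<and>
        (\<forall>v. (\<Sum>e\<in>{e. src e = v}. u1 e 0) + (\<Sum>e\<in>{e. tgt e = v}. - u1 e (len e)) = 0)}"

definition H0 :: "('e \<Rightarrow> 'v) \<Rightarrow> ('e \<Rightarrow> 'v) \<Rightarrow> ('e \<Rightarrow> real) \<Rightarrow> ('e gfun \<times> 'e gfun) set" where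
  "H0 src tgt len =
     {(f, g). f \<in> L2G len \<and> g \<in> L2G len \<and>
        (\<exists>F G. (\<forall>n. (F n, G n) \<in> H0min src tgt len) \<and>
               (\<lambda>n. gnorm2 len (F n - f)) \<longlonglongrightarrow> 0 \<and>
               (\<lambda>n. gnorm2 len (G n - g)) \<longlonglongrightarrow> 0)}"

definition resolvent_set :: "('e \<Rightarrow> real) \<Rightarrow> ('e gfun \<times> 'e gfun) set \<Rightarrow> complex set" where
  "resolvent_set len T =
     {z. (\<forall>h\<in>L2G len. \<exists>(f, g)\<in>T. gnorm2 len (g - gscale z f - h) = 0) \<and>
         (\<exists>C::real. \<forall>(f, g)\<in>T. gnorm2 len f \<le> ennreal C * gnorm2 len (g - gscale z f))}"

definition spectrum_op :: "('e \<Rightarrow> real) \<Rightarrow> ('e gfun \<times> 'e gfun) set \<Rightarrow> complex set" where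
  "spectrum_op len T = - resolvent_set len T"

definition is_eigenvalue :: "('e \<Rightarrow> real) \<Rightarrow> ('e gfun \<times> 'e gfun) set \<Rightarrow> complex \<Rightarrow> bool" where
  "is_eigenvalue len T z \<longleftrightarrow>
     (\<exists>(f, g)\<in>T. gnorm2 len (g - gscale z f) = 0 \<and> gnorm2 len f \<noteq> 0)"

definition finite_multiplicity :: "('e \<Rightarrow> real) \<Rightarrow> ('e gfun \<times> 'e gfun) set \<Rightarrow> complex \<Rightarrow> bool" where
  "finite_multiplicity len T z \<longleftrightarrow>
     (\<exists>B. finite B \<and> (\<forall>(f, g)\<in>T. gnorm2 len (g - gscale z f) = 0 \<longrightarrow>
          (\<exists>c. gnorm2 len (f - (\<lambda>e x. \<Sum>b\<in>B. c b * b e x)) = 0)))"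

definition disc_spectrum :: "('e \<Rightarrow> real) \<Rightarrow> ('e gfun \<times> 'e gfun) set \<Rightarrow> complex set" where
  "disc_spectrum len T =
     {z \<in> spectrum_op len T. (\<exists>\<epsilon>>0. ball z \<epsilon> \<inter> spectrum_op len T = {z}) \<and>
        is_eigenvalue len T z \<and> finite_multiplicity len T z}"

definition ess_spectrum :: "('e \<Rightarrow> real) \<Rightarrow> ('e gfun \<times> 'e gfun) set \<Rightarrow> complex set" where
  "ess_spectrum len T = spectrum_op len T - disc_spectrum len T"

end

(* The Kirchhoff Laplacian is realised as a closed nonnegative symmetric relation on a Hilbert
   space. It is self-adjoint because testing an L^2 solution of f'' = f against flat cutoffs,
   which completeness provides, forces f = 0. Slow volume growth yields compactly supported
   functions of small slope that equal one on a fixed share of their support. Their Rayleigh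
   quotients put 0 into the spectrum in (i) and (ii). In infinite volume 0 is not an eigenvalue,
   since an eigenfunction would be constant, so 0 is then essential.

   For (iii) such functions span an infinite-dimensional space of bounded energy. The predicate
   finite_multiplicity admits non-measurable spanning functions, for which gnorm2 is only a lower
   integral, so it does not suffice to exhibit an isolated eigenvalue of infinite multiplicity:
   such eigenvalues have to be excluded. If all spectral points were isolated, there would be a
   lowest eigenvalue lam of infinite multiplicity, and the energy form minus lam would be
   nonnegative on functions supported off some finite set of edges. By infinite multiplicity an
   eigenfunction f /= 0 vanishes near that set. Then |f| is a null vector of a nonnegative form,
   hence a Kirchhoff solution itself, and a nonnegative solution that vanishes at a vertex has
   zero derivatives there and vanishes on the adjacent edges. Along walks this gives f = 0. *)
theory Submission
  imports Defs
begin

section \<open>Hilbert space model: square-integrable functions on the graph as a complete real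
  inner product space\<close>

section \<open>Square-integrable functions\<close>

text \<open>No spectral theorem is invoked. Spectral statements become lower bounds |(T - t) f|
  \<ge> k |f|, transported to the bounded operator \<open>B\<close> = (T + 1)^-1 by t -> 1/(t + 1).
  The supremum \<open>s\<close> of the form of \<open>B\<close> modulo finite codimension replaces
  the top of its essential spectrum, and \<open>lam = 1 / s - 1\<close> is the lowest eigenvalue of
  infinite multiplicity. Form inequalities are stated so that they survive graph limits; no closed
  form domain is built.

  Test functions have two parameters, the reciprocal slope \<open>T\<close> and the volume loss
  \<open>A\<close>, and Rayleigh quotient at most 9 A / T^2. For a zero exponent
  \<open>A = 2\<close> is fixed and \<open>T\<close> grows; for a finite exponent
  \<open>T = 1\<close> is fixed and \<open>A\<close> absorbs the growth.

  The detour through |f| is forced: unique continuation fails on metric graphs, where eigenfunctions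
  may have compact support, so the vanishing of f on a set of edges does not spread. At a zero of
  |f|, however, all derivatives into the edges have one sign, and the Kirchhoff condition then makes
  them vanish.\<close>

definition sq_int :: "'a measure \<Rightarrow> ('a \<Rightarrow> complex) set" where
  "sq_int M = {f \<in> borel_measurable M. integrable M (\<lambda>x. (cmod (f x))\<^sup>2)}"

lemma sq_intD:
  assumes "f \<in> sq_int M"
  shows "f \<in> borel_measurable M" "integrable M (\<lambda>x. (cmod (f x))\<^sup>2)"
  using assms by (auto simp: sq_int_def)

lemma sq_int_iff_nn_integral:
  assumes "f \<in> borel_measurable M"
  shows "f \<in> sq_int M \<longleftrightarrow> (\<integral>\<^sup>+x. ennreal ((cmod (f x))\<^sup>2) \<partial>M) < \<infinity>"
  using assms by (auto simp: sq_int_def integrable_iff_bounded)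

lemma sq_int_nn_integral:
  assumes "f \<in> sq_int M"
  shows "(\<integral>\<^sup>+x. ennreal ((cmod (f x))\<^sup>2) \<partial>M) = ennreal (\<integral>x. (cmod (f x))\<^sup>2 \<partial>M)"
  by (rule nn_integral_eq_integral) (use sq_intD[OF assms] in auto)

lemma cmod_add_power2_le: "(cmod (a + b))\<^sup>2 \<le> 2 * (cmod a)\<^sup>2 + 2 * (cmod b)\<^sup>2"
proof -
  have "(cmod (a + b))\<^sup>2 \<le> (cmod a + cmod b)\<^sup>2"
    by (intro power_mono norm_triangle_ineq) auto
  also have "\<dots> \<le> 2 * (cmod a)\<^sup>2 + 2 * (cmod b)\<^sup>2"
    using sum_squares_bound[of "cmod a" "cmod b"] by (simp add: power2_sum)
  finally show ?thesis .
qed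

lemma sq_int_zero [simp]: "(\<lambda>x. 0) \<in> sq_int M"
  by (simp add: sq_int_def)

lemma sq_int_add:
  assumes "f \<in> sq_int M" "g \<in> sq_int M"
  shows "(\<lambda>x. f x + g x) \<in> sq_int M"
proof -
  note [measurable] = sq_intD(1)[OF assms(1)] sq_intD(1)[OF assms(2)]
  have "integrable M (\<lambda>x. 2 * (cmod (f x))\<^sup>2 + 2 * (cmod (g x))\<^sup>2)"
    using sq_intD(2)[OF assms(1)] sq_intD(2)[OF assms(2)] by simp
  then have "integrable M (\<lambda>x. (cmod (f x + g x))\<^sup>2)"
    by (rule Bochner_Integration.integrable_bound) (auto intro!: AE_I2 simp: cmod_add_power2_le)
  then show ?thesis by (simp add: sq_int_def)
qed

lemma sq_int_mult:
  assumes "f \<in> sq_int M"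
  shows "(\<lambda>x. c * f x) \<in> sq_int M"
  using assms by (auto simp: sq_int_def norm_mult power_mult_distrib)

lemma sq_int_scaleR:
  assumes "f \<in> sq_int M"
  shows "(\<lambda>x. c *\<^sub>R f x) \<in> sq_int M"
  using sq_int_mult[OF assms, of "complex_of_real c"] by (simp add: scaleR_conv_of_real)

lemma sq_int_uminus:
  assumes "f \<in> sq_int M"
  shows "(\<lambda>x. - f x) \<in> sq_int M"
  using assms by (auto simp: sq_int_def)

lemma sq_int_diff:
  assumes "f \<in> sq_int M" "g \<in> sq_int M"
  shows "(\<lambda>x. f x - g x) \<in> sq_int M"
  using sq_int_add[OF assms(1) sq_int_uminus[OF assms(2)]] by simp

lemma sq_int_inner:
  assumes "f \<in> sq_int M" "g \<in> sq_int M"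
  shows "integrable M (\<lambda>x. f x \<bullet> g x)"
proof -
  note [measurable] = sq_intD(1)[OF assms(1)] sq_intD(1)[OF assms(2)]
  have *: "\<bar>f x \<bullet> g x\<bar> \<le> (cmod (f x))\<^sup>2 + (cmod (g x))\<^sup>2" for x
    using Cauchy_Schwarz_ineq2[of "f x" "g x"] sum_squares_bound[of "cmod (f x)" "cmod (g x)"]
      mult_nonneg_nonneg[of "cmod (f x)" "cmod (g x)"] by simp
  have "integrable M (\<lambda>x. (cmod (f x))\<^sup>2 + (cmod (g x))\<^sup>2)"
    using sq_intD(2)[OF assms(1)] sq_intD(2)[OF assms(2)] by simp
  then show ?thesis
    by (rule Bochner_Integration.integrable_bound) (use * in auto)
qed

text \<open>Along a subsequence with squared increments of size at most \<open>4\<^sup>-\<^sup>i\<close>, the weighted series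
  \<open>\<Sum>i. 2\<^sup>i |increment|\<^sup>2\<close> is integrable; this forces pointwise convergence without Minkowski's
  inequality.\<close>

lemma sq_int_complete:
  fixes F :: "nat \<Rightarrow> 'a \<Rightarrow> complex"
  assumes F: "\<And>n. F n \<in> sq_int M"
    and cauchy: "\<And>\<epsilon>. \<epsilon> > 0 \<Longrightarrow> \<exists>N. \<forall>m\<ge>N. \<forall>n\<ge>N. (\<integral>x. (cmod (F m x - F n x))\<^sup>2 \<partial>M) < \<epsilon>"
  shows "\<exists>f\<in>sq_int M. (\<lambda>n. \<integral>x. (cmod (F n x - f x))\<^sup>2 \<partial>M) \<longlonglongrightarrow> 0"
proof -
  have Fm [measurable]: "\<And>n. F n \<in> borel_measurable M"
    using F by (auto dest: sq_intD)
  have nn: "(\<integral>\<^sup>+x. ennreal ((cmod (F m x - F n x))\<^sup>2) \<partial>M) = ennreal (\<integral>x. (cmod (F m x - F n x))\<^sup>2 \<partial>M)" for m n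
    by (rule sq_int_nn_integral[OF sq_int_diff[OF F F]])
  have "\<exists>N. \<forall>i. \<forall>m\<ge>N i. \<forall>n\<ge>N i. (\<integral>x. (cmod (F m x - F n x))\<^sup>2 \<partial>M) < (1/4)^i"
    using cauchy[of "(1/4)^_"] by (intro choice) auto
  then obtain N where N: "\<And>i m n. m \<ge> N i \<Longrightarrow> n \<ge> N i \<Longrightarrow> (\<integral>x. (cmod (F m x - F n x))\<^sup>2 \<partial>M) < (1/4)^i"
    by blast
  \<comment> \<open>The sum dominates every \<open>N i\<close>, and the added 1 makes
    \<open>k i\<close> at least \<open>i\<close>, so \<open>F (k i)\<close> is far out in the
    sequence as well.\<close>
  define k where "k i = (\<Sum>j\<le>i. N j + 1)" for i
  have kN: "k i \<ge> N i" for i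
    unfolding k_def by (rule order_trans[of _ "N i + 1"]) (auto intro: member_le_sum)
  have kmono: "k i \<le> k (Suc i)" for i by (simp add: k_def)
  have ki: "k i \<ge> i" for i by (induction i) (auto simp: k_def)
  define D where "D i x = F (k (Suc i)) x - F (k i) x" for i x
  have Dm [measurable]: "D i \<in> borel_measurable M" for i unfolding D_def by measurable
  have "(\<integral>\<^sup>+x. (\<Sum>i. ennreal (2^i * (cmod (D i x))\<^sup>2)) \<partial>M) = (\<Sum>i. \<integral>\<^sup>+x. ennreal (2^i * (cmod (D i x))\<^sup>2) \<partial>M)"
    by (rule nn_integral_suminf) measurable
  also have "\<dots> \<le> (\<Sum>i. ennreal ((1/2)^i))"
  proof (rule suminf_le)
    fix i
    have "(\<integral>\<^sup>+x. ennreal (2^i * (cmod (D i x))\<^sup>2) \<partial>M) = ennreal (2^i) * (\<integral>\<^sup>+x. ennreal ((cmod (D i x))\<^sup>2) \<partial>M)"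
      by (subst nn_integral_cmult[symmetric]) (auto simp: ennreal_mult)
    also have "\<dots> \<le> ennreal (2^i) * ennreal ((1/4)^i)"
      unfolding D_def nn
      by (intro mult_left_mono ennreal_leI less_imp_le[OF N] kN order_trans[OF kN kmono]) auto
    also have "\<dots> = ennreal ((1/2)^i)"
      by (subst ennreal_mult[symmetric]) (auto simp: power_mult_distrib[symmetric])
    finally show "(\<integral>\<^sup>+x. ennreal (2^i * (cmod (D i x))\<^sup>2) \<partial>M) \<le> ennreal ((1/2)^i)" .
  qed auto
  also have "\<dots> < \<infinity>"
    by (subst suminf_ennreal2) (auto simp: summable_geometric)
  finally have "AE x in M. (\<Sum>i. ennreal (2^i * (cmod (D i x))\<^sup>2)) \<noteq> \<infinity>"
    by (intro nn_integral_noteq_infinite) auto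
  then have conv: "AE x in M. convergent (\<lambda>i. F (k i) x)"
  proof eventually_elim
    case (elim x)
    have "summable (\<lambda>i. 2^i * (cmod (D i x))\<^sup>2)"
      using elim by (intro summable_suminf_not_top) auto
    then have "Bseq (\<lambda>i. 2^i * (cmod (D i x))\<^sup>2)"
      by (intro convergent_imp_Bseq convergentI[OF summable_LIMSEQ_zero])
    then obtain C where C: "C > 0" "\<And>i. norm (2^i * (cmod (D i x))\<^sup>2) \<le> C"
      by (auto simp: Bseq_def)
    have "norm (D i x) \<le> sqrt C * (sqrt (1/2))^i" for i
    proof -
      have "(norm (D i x))\<^sup>2 \<le> C * (1/2)^i"
        using C(2)[of i] by (simp add: field_simps power_divide)
      then have "norm (D i x) \<le> sqrt (C * (1/2)^i)"
        by (intro real_le_rsqrt)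
      then show ?thesis by (simp add: real_sqrt_mult real_sqrt_power)
    qed
    moreover have "summable (\<lambda>i. sqrt C * (sqrt (1/2))^i)"
      by (intro summable_mult summable_geometric) (simp add: real_sqrt_divide)
    ultimately have D: "summable (\<lambda>i. D i x)"
      by (intro summable_comparison_test[of "\<lambda>i. D i x" "\<lambda>i. sqrt C * (sqrt (1/2))^i"]) blast+
    have "(\<Sum>i<n. D i x) + F (k 0) x = F (k n) x" for n
      by (induction n) (simp_all add: D_def algebra_simps)
    moreover have "convergent (\<lambda>n. (\<Sum>i<n. D i x) + F (k 0) x)"
      by (intro convergent_add convergent_const) (use D in \<open>simp add: summable_iff_convergent\<close>)
    ultimately show ?case by simp
  qed
  \<comment> \<open>Where the subsequence diverges, a null set, \<open>lim\<close> has an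
    unspecified value; measurability holds regardless.\<close>
  define f where "f x = lim (\<lambda>i. F (k i) x)" for x
  have fm [measurable]: "f \<in> borel_measurable M"
    unfolding f_def by measurable
  \<comment> \<open>Fatou's lemma carries the Cauchy estimate to the pointwise limit. It is kept in
    \<open>ennreal\<close> because \<open>F n - f\<close> is not yet known to be square
    integrable.\<close>
  have bound: "\<exists>N. \<forall>n\<ge>N. (\<integral>\<^sup>+x. ennreal ((cmod (F n x - f x))\<^sup>2) \<partial>M) \<le> ennreal \<epsilon>" if "\<epsilon> > 0" for \<epsilon>
  proof -
    obtain N0 where N0: "\<And>m n. m \<ge> N0 \<Longrightarrow> n \<ge> N0 \<Longrightarrow> (\<integral>x. (cmod (F m x - F n x))\<^sup>2 \<partial>M) < \<epsilon>"
      using cauchy[OF \<open>\<epsilon> > 0\<close>] by blast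
    have "(\<integral>\<^sup>+x. ennreal ((cmod (F n x - f x))\<^sup>2) \<partial>M) \<le> ennreal \<epsilon>" if n: "n \<ge> N0" for n
    proof -
      have "(\<integral>\<^sup>+x. ennreal ((cmod (F n x - f x))\<^sup>2) \<partial>M)
          = (\<integral>\<^sup>+x. liminf (\<lambda>i. ennreal ((cmod (F n x - F (k i) x))\<^sup>2)) \<partial>M)"
      proof (intro nn_integral_cong_AE)
        show "AE x in M. ennreal ((cmod (F n x - f x))\<^sup>2) = liminf (\<lambda>i. ennreal ((cmod (F n x - F (k i) x))\<^sup>2))"
          using conv
        proof eventually_elim
          case (elim x)
          then have "(\<lambda>i. F (k i) x) \<longlonglongrightarrow> f x"
            by (simp add: f_def convergent_LIMSEQ_iff)
          then have "(\<lambda>i. ennreal ((cmod (F n x - F (k i) x))\<^sup>2)) \<longlonglongrightarrow> ennreal ((cmod (F n x - f x))\<^sup>2)"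
            by (intro tendsto_intros tendsto_ennrealI)
          then show ?case by (intro lim_imp_Liminf[symmetric]) auto
        qed
      qed
      also have "\<dots> \<le> liminf (\<lambda>i. \<integral>\<^sup>+x. ennreal ((cmod (F n x - F (k i) x))\<^sup>2) \<partial>M)"
        by (rule nn_integral_liminf) measurable
      also have "\<dots> \<le> ennreal \<epsilon>"
      proof (rule Liminf_le)
        have "(\<integral>\<^sup>+x. ennreal ((cmod (F n x - F (k i) x))\<^sup>2) \<partial>M) \<le> ennreal \<epsilon>" if "i \<ge> N0" for i
          unfolding nn by (intro ennreal_leI less_imp_le N0 n order_trans[OF that ki])
        then show "\<forall>\<^sub>F i in sequentially. (\<integral>\<^sup>+x. ennreal ((cmod (F n x - F (k i) x))\<^sup>2) \<partial>M) \<le> ennreal \<epsilon>"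
          by (auto simp: eventually_sequentially)
      qed auto
      finally show ?thesis .
    qed
    then show ?thesis by blast
  qed
  obtain n1 where "(\<integral>\<^sup>+x. ennreal ((cmod (F n1 x - f x))\<^sup>2) \<partial>M) \<le> ennreal 1"
    using bound[of 1] by auto
  then have "(\<lambda>x. F n1 x - f x) \<in> sq_int M"
    by (subst sq_int_iff_nn_integral) (auto simp: less_top[symmetric] top_unique dest: order.strict_trans1)
  from sq_int_diff[OF F[of n1] this] have f: "f \<in> sq_int M" by simp
  have "(\<lambda>n. \<integral>x. (cmod (F n x - f x))\<^sup>2 \<partial>M) \<longlonglongrightarrow> 0"
  proof (rule LIMSEQ_I)
    fix r :: real assume "r > 0"
    then obtain N where N: "\<And>n. n \<ge> N \<Longrightarrow> (\<integral>\<^sup>+x. ennreal ((cmod (F n x - f x))\<^sup>2) \<partial>M) \<le> ennreal (r/2)"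
      using bound[of "r/2"] by auto
    have "norm ((\<integral>x. (cmod (F n x - f x))\<^sup>2 \<partial>M) - 0) < r" if "n \<ge> N" for n
      using N[OF that] \<open>r > 0\<close> unfolding sq_int_nn_integral[OF sq_int_diff[OF F f]]
      by (subst (asm) ennreal_le_iff) auto
    then show "\<exists>no. \<forall>n\<ge>no. norm ((\<integral>x. (cmod (F n x - f x))\<^sup>2 \<partial>M) - 0) < r" by blast
  qed
  with f show ?thesis by blast
qed

section \<open>The Hilbert space over a countable family of unit intervals\<close>

text \<open>Rescaling every edge to (0, 1) removes the lengths from the measure, so that the
  quotient type built on it depends on the edge type alone and not on \<open>len\<close>.\<close>

definition edge_measure :: "('e::countable \<times> real) measure" where
  "edge_measure = count_space UNIV \<Otimes>\<^sub>M restrict_space lborel {0<..<1}"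

text \<open>A partial equivalence: a function is related to itself exactly if it is square
  integrable, so one quotient both restricts the carrier and identifies functions that agree almost
  everywhere.\<close>

definition edge_l2_eq :: "('e::countable \<times> real \<Rightarrow> complex) \<Rightarrow> ('e \<times> real \<Rightarrow> complex) \<Rightarrow> bool" where
  "edge_l2_eq f g \<longleftrightarrow> f \<in> sq_int edge_measure \<and> g \<in> sq_int edge_measure \<and> (AE x in edge_measure. f x = g x)"

quotient_type 'e edge_l2 = "('e::countable) \<times> real \<Rightarrow> complex" / partial: edge_l2_eq
proof (rule part_equivpI)
  show "\<exists>f. edge_l2_eq f f"
    by (rule exI[of _ "\<lambda>x. 0"]) (simp add: edge_l2_eq_def)
  show "symp edge_l2_eq"
    by (auto simp: symp_def edge_l2_eq_def)
  show "transp edge_l2_eq"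
    by (auto simp: transp_def edge_l2_eq_def)
qed

instantiation edge_l2 :: (countable) real_vector
begin

lift_definition zero_edge_l2 :: "'a edge_l2" is "\<lambda>x. 0"
  by (simp add: edge_l2_eq_def)

lift_definition plus_edge_l2 :: "'a edge_l2 \<Rightarrow> 'a edge_l2 \<Rightarrow> 'a edge_l2" is "\<lambda>f g x. f x + g x"
  by (auto simp: edge_l2_eq_def sq_int_add)

lift_definition minus_edge_l2 :: "'a edge_l2 \<Rightarrow> 'a edge_l2 \<Rightarrow> 'a edge_l2" is "\<lambda>f g x. f x - g x"
  by (auto simp: edge_l2_eq_def sq_int_diff)

lift_definition uminus_edge_l2 :: "'a edge_l2 \<Rightarrow> 'a edge_l2" is "\<lambda>f x. - f x"
  by (auto simp: edge_l2_eq_def sq_int_uminus)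

lift_definition scaleR_edge_l2 :: "real \<Rightarrow> 'a edge_l2 \<Rightarrow> 'a edge_l2" is "\<lambda>c f x. c *\<^sub>R f x"
  by (auto simp: edge_l2_eq_def sq_int_scaleR)

instance
proof
  fix a b c :: "'a edge_l2" and r s :: real
  show "a + b + c = a + (b + c)"
    by transfer (simp add: edge_l2_eq_def sq_int_add sq_int_diff sq_int_uminus sq_int_scaleR algebra_simps)
  show "a + b = b + a"
    by transfer (simp add: edge_l2_eq_def sq_int_add sq_int_diff sq_int_uminus sq_int_scaleR algebra_simps)
  show "0 + a = a"
    by transfer (simp add: edge_l2_eq_def sq_int_add sq_int_diff sq_int_uminus sq_int_scaleR algebra_simps)
  show "- a + a = 0"
    by transfer (simp add: edge_l2_eq_def sq_int_add sq_int_diff sq_int_uminus sq_int_scaleR algebra_simps)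
  show "a - b = a + - b"
    by transfer (simp add: edge_l2_eq_def sq_int_add sq_int_diff sq_int_uminus sq_int_scaleR algebra_simps)
  show "r *\<^sub>R (a + b) = r *\<^sub>R a + r *\<^sub>R b"
    by transfer (simp add: edge_l2_eq_def sq_int_add sq_int_diff sq_int_uminus sq_int_scaleR algebra_simps)
  show "(r + s) *\<^sub>R a = r *\<^sub>R a + s *\<^sub>R a"
    by transfer (simp add: edge_l2_eq_def sq_int_add sq_int_diff sq_int_uminus sq_int_scaleR algebra_simps)
  show "r *\<^sub>R s *\<^sub>R a = (r * s) *\<^sub>R a"
    by transfer (simp add: edge_l2_eq_def sq_int_add sq_int_diff sq_int_uminus sq_int_scaleR algebra_simps)
  show "1 *\<^sub>R a = a"
    by transfer (simp add: edge_l2_eq_def sq_int_add sq_int_diff sq_int_uminus sq_int_scaleR algebra_simps)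
qed

end

instantiation edge_l2 :: (countable) real_inner
begin

text \<open>On complex numbers \<bullet> is the Euclidean product of the plane, so this is the real
  part of the complex inner product. The space is thus a real Hilbert space; the complex structure
  returns as the isometry \<open>imult\<close>.\<close>

lift_definition inner_edge_l2 :: "'a edge_l2 \<Rightarrow> 'a edge_l2 \<Rightarrow> real" is "\<lambda>f g. \<integral>x. f x \<bullet> g x \<partial>edge_measure"
proof -
  fix f f' g g' :: "'a \<times> real \<Rightarrow> complex"
  assume "edge_l2_eq f f'" "edge_l2_eq g g'"
  then show "(\<integral>x. f x \<bullet> g x \<partial>edge_measure) = (\<integral>x. f' x \<bullet> g' x \<partial>edge_measure)"
    unfolding edge_l2_eq_def
    by (intro integral_cong_AE borel_measurable_inner) (auto dest: sq_intD)
qed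

definition norm_edge_l2 :: "'a edge_l2 \<Rightarrow> real" where "norm_edge_l2 x = sqrt (x \<bullet> x)"
definition dist_edge_l2 :: "'a edge_l2 \<Rightarrow> 'a edge_l2 \<Rightarrow> real" where "dist_edge_l2 x y = norm (x - y)"
definition sgn_edge_l2 :: "'a edge_l2 \<Rightarrow> 'a edge_l2" where "sgn_edge_l2 x = x /\<^sub>R norm x"
definition uniformity_edge_l2 :: "('a edge_l2 \<times> 'a edge_l2) filter" where
  "uniformity_edge_l2 = (INF e\<in>{0 <..}. principal {(x, y). dist x y < e})"
definition open_edge_l2 :: "'a edge_l2 set \<Rightarrow> bool" where
  "open_edge_l2 U \<longleftrightarrow> (\<forall>x\<in>U. eventually (\<lambda>(x', y). x' = x \<longrightarrow> y \<in> U) uniformity)"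

instance
proof
  fix x y z :: "'a edge_l2" and r :: real and U :: "'a edge_l2 set"
  show "dist x y = norm (x - y)" by (rule dist_edge_l2_def)
  show "sgn x = x /\<^sub>R norm x" by (rule sgn_edge_l2_def)
  show "uniformity = (INF e\<in>{0 <..}. principal {(x, y). dist (x :: 'a edge_l2) y < e})"
    by (rule uniformity_edge_l2_def)
  show "open U = (\<forall>x\<in>U. \<forall>\<^sub>F (x', y) in uniformity. x' = x \<longrightarrow> y \<in> U)"
    by (rule open_edge_l2_def)
  show "norm x = sqrt (x \<bullet> x)" by (rule norm_edge_l2_def)
  show "x \<bullet> y = y \<bullet> x" by transfer (simp add: inner_commute)
  show "(x + y) \<bullet> z = x \<bullet> z + y \<bullet> z"
    by transfer (auto simp: edge_l2_eq_def inner_add_left sq_int_inner)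
  show "r *\<^sub>R x \<bullet> y = r * (x \<bullet> y)"
    by transfer (auto simp: edge_l2_eq_def)
  show "0 \<le> x \<bullet> x" by transfer auto
  show "(x \<bullet> x = 0) = (x = 0)"
  proof transfer
    fix f :: "'a \<times> real \<Rightarrow> complex"
    assume "edge_l2_eq f f"
    then have f: "f \<in> sq_int edge_measure" by (simp add: edge_l2_eq_def)
    have "(\<integral>x. f x \<bullet> f x \<partial>edge_measure) = 0 \<longleftrightarrow> (AE x in edge_measure. f x \<bullet> f x = 0)"
      by (rule integral_nonneg_eq_0_iff_AE) (use sq_int_inner[OF f f] in auto)
    with f show "((\<integral>x. f x \<bullet> f x \<partial>edge_measure) = 0) = edge_l2_eq f (\<lambda>x. 0)"
      by (simp add: edge_l2_eq_def)
  qed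
qed

end

lemma edge_l2_norm_abs:
  assumes "f \<in> sq_int edge_measure"
  shows "(norm (abs_edge_l2 f))\<^sup>2 = (\<integral>x. (cmod (f x))\<^sup>2 \<partial>edge_measure)"
proof -
  have "edge_l2_eq f f" using assms by (simp add: edge_l2_eq_def)
  then show ?thesis
    by (simp add: power2_norm_eq_inner inner_edge_l2.abs_eq)
qed

lemma edge_l2_abs_surj: "\<exists>f\<in>sq_int edge_measure. abs_edge_l2 f = x"
proof -
  have "edge_l2_eq (rep_edge_l2 x) (rep_edge_l2 x)" "abs_edge_l2 (rep_edge_l2 x) = x"
    using Quotient3_edge_l2 by (auto simp: Quotient3_def)
  then show ?thesis by (auto simp: edge_l2_eq_def)
qed

instance edge_l2 :: (countable) complete_space
proof
  fix X :: "nat \<Rightarrow> 'a edge_l2"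
  assume X: "Cauchy X"
  have "\<exists>F. \<forall>n. F n \<in> sq_int edge_measure \<and> abs_edge_l2 (F n) = X n"
    by (rule choice) (use edge_l2_abs_surj in blast)
  then obtain F where F: "\<And>n. F n \<in> sq_int edge_measure" "\<And>n. abs_edge_l2 (F n) = X n"
    by blast
  have [simp]: "edge_l2_eq g g" if "g \<in> sq_int edge_measure" for g :: "'a \<times> real \<Rightarrow> complex"
    using that by (simp add: edge_l2_eq_def)
  have diff: "(norm (abs_edge_l2 f - abs_edge_l2 g))\<^sup>2 = (\<integral>x. (cmod (f x - g x))\<^sup>2 \<partial>edge_measure)"
    if "f \<in> sq_int edge_measure" "g \<in> sq_int edge_measure" for f g :: "'a \<times> real \<Rightarrow> complex"
    using that by (simp add: minus_edge_l2.abs_eq edge_l2_norm_abs sq_int_diff)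
  have "\<exists>f\<in>sq_int edge_measure. (\<lambda>n. \<integral>x. (cmod (F n x - f x))\<^sup>2 \<partial>edge_measure) \<longlonglongrightarrow> 0"
  proof (rule sq_int_complete[OF F(1)])
    fix \<epsilon> :: real assume "\<epsilon> > 0"
    then obtain N where N: "\<And>m n. m \<ge> N \<Longrightarrow> n \<ge> N \<Longrightarrow> norm (X m - X n) < sqrt \<epsilon>"
      using X unfolding Cauchy_def dist_norm by (metis real_sqrt_gt_zero)
    have "(\<integral>x. (cmod (F m x - F n x))\<^sup>2 \<partial>edge_measure) < \<epsilon>" if "m \<ge> N" "n \<ge> N" for m n
    proof -
      have "(norm (X m - X n))\<^sup>2 < (sqrt \<epsilon>)\<^sup>2"
        using N[OF that] by (intro power_strict_mono) auto
      then show ?thesis using \<open>\<epsilon> > 0\<close> by (simp add: F(2)[symmetric] diff F(1))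
    qed
    then show "\<exists>N. \<forall>m\<ge>N. \<forall>n\<ge>N. (\<integral>x. (cmod (F m x - F n x))\<^sup>2 \<partial>edge_measure) < \<epsilon>" by blast
  qed
  then obtain f where f: "f \<in> sq_int edge_measure"
    "(\<lambda>n. \<integral>x. (cmod (F n x - f x))\<^sup>2 \<partial>edge_measure) \<longlonglongrightarrow> 0" by blast
  then have "(\<lambda>n. (norm (X n - abs_edge_l2 f))\<^sup>2) \<longlonglongrightarrow> 0"
    by (simp add: F(2)[symmetric] diff F(1))
  then have "(\<lambda>n. norm (X n - abs_edge_l2 f)) \<longlonglongrightarrow> 0"
    using tendsto_real_sqrt by fastforce
  then have "X \<longlonglongrightarrow> abs_edge_l2 f"
    using tendsto_norm_zero_iff LIM_zero_iff by blast
  then show "convergent X" by (auto simp: convergent_def)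
qed

lift_definition imult :: "'e::countable edge_l2 \<Rightarrow> 'e edge_l2" is "\<lambda>f x. \<i> * f x"
  by (auto simp: edge_l2_eq_def sq_int_mult)

definition cmult :: "complex \<Rightarrow> 'e::countable edge_l2 \<Rightarrow> 'e edge_l2" where
  "cmult z x = Re z *\<^sub>R x + Im z *\<^sub>R imult x"

lemma imult_add: "imult (x + y) = imult x + imult y"
  by transfer (simp add: edge_l2_eq_def sq_int_add sq_int_mult algebra_simps)

lemma imult_scaleR: "imult (c *\<^sub>R x) = c *\<^sub>R imult x"
  by transfer (simp add: edge_l2_eq_def sq_int_scaleR sq_int_mult)

lemma imult_imult: "imult (imult x) = - x"
  by transfer (simp add: edge_l2_eq_def sq_int_uminus sq_int_mult)

lemma inner_imult: "imult x \<bullet> imult y = x \<bullet> y"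
  by transfer (simp add: inner_complex_def algebra_simps)

lemma abs_edge_l2_diff:
  assumes "f \<in> sq_int edge_measure" "g \<in> sq_int edge_measure"
  shows "abs_edge_l2 f - abs_edge_l2 g = abs_edge_l2 (\<lambda>x. f x - g x)"
  using assms by (simp add: minus_edge_l2.abs_eq edge_l2_eq_def)

lemma abs_edge_l2_cmult:
  assumes f: "f \<in> sq_int edge_measure"
  shows "cmult z (abs_edge_l2 f) = abs_edge_l2 (\<lambda>x. z * f x)"
proof -
  have *: "edge_l2_eq g g" if "g \<in> sq_int edge_measure" for g :: "'a \<times> real \<Rightarrow> complex"
    using that by (simp add: edge_l2_eq_def)
  have "cmult z (abs_edge_l2 f) = abs_edge_l2 (\<lambda>x. Re z *\<^sub>R f x + Im z *\<^sub>R (\<i> * f x))"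
    unfolding cmult_def
    by (simp add: f * imult.abs_eq scaleR_edge_l2.abs_eq plus_edge_l2.abs_eq sq_int_scaleR sq_int_mult)
  also have "(\<lambda>x. Re z *\<^sub>R f x + Im z *\<^sub>R (\<i> * f x)) = (\<lambda>x. z * f x)"
    by (rule ext) (simp add: complex_eq_iff algebra_simps)
  finally show ?thesis .
qed

lemma abs_edge_l2_inner:
  assumes "f \<in> sq_int edge_measure" "g \<in> sq_int edge_measure"
  shows "abs_edge_l2 f \<bullet> abs_edge_l2 g = (\<integral>x. f x \<bullet> g x \<partial>edge_measure)"
  using assms by (simp add: inner_edge_l2.abs_eq edge_l2_eq_def)

section \<open>Embedding the functions on a metric graph\<close>

text \<open>Both sides are suprema of finite partial sums; monotone convergence along the
  enumeration by \<open>to_nat\<close> gives the nontrivial inequality. This links the unordered sum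
  in \<open>gnorm2\<close> to the product measure.\<close>

lemma nn_integral_count_space_infsum:
  fixes h :: "'a::countable \<Rightarrow> ennreal"
  shows "(\<integral>\<^sup>+e. h e \<partial>count_space UNIV) = (\<Sum>\<^sub>\<infinity>e. h e)"
proof -
  have fin: "(\<integral>\<^sup>+e. h e * indicator F e \<partial>count_space UNIV) = sum h F" if "finite F" for F
  proof -
    have "(\<integral>\<^sup>+e. h e * indicator F e \<partial>count_space UNIV) = (\<Sum>e\<in>F. h e * indicator F e)"
      by (rule nn_integral_count_space'[OF that]) auto
    then show ?thesis by simp
  qed
  have sup: "(\<Sum>\<^sub>\<infinity>e. h e) = (SUP F\<in>{F. finite F \<and> F \<subseteq> UNIV}. sum h F)"
    by (rule nonneg_infsum_complete) auto
  show ?thesis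
  proof (rule antisym)
    define F where "F n = {e::'a. to_nat e < n}" for n
    have F: "finite (F n)" for n
      unfolding F_def by (rule finite_imageD[of to_nat]) (auto intro: finite_subset[of _ "{..<n}"] inj_onI)
    have "h e = (SUP n. h e * indicator (F n) e)" for e
    proof (rule antisym)
      show "h e \<le> (SUP n. h e * indicator (F n) e)"
        by (rule SUP_upper2[of "Suc (to_nat e)"]) (auto simp: F_def)
      show "(SUP n. h e * indicator (F n) e) \<le> h e"
        by (rule SUP_least) (auto split: split_indicator)
    qed
    then have "(\<integral>\<^sup>+e. h e \<partial>count_space UNIV) = (\<integral>\<^sup>+e. (SUP n. h e * indicator (F n) e) \<partial>count_space UNIV)"
      by simp
    also have "\<dots> = (SUP n. \<integral>\<^sup>+e. h e * indicator (F n) e \<partial>count_space UNIV)"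
      by (intro nn_integral_monotone_convergence_SUP)
         (auto simp: incseq_def le_fun_def F_def split: split_indicator)
    also have "\<dots> \<le> (\<Sum>\<^sub>\<infinity>e. h e)"
      unfolding sup fin[OF F] by (intro SUP_least SUP_upper) (use F in auto)
    finally show "(\<integral>\<^sup>+e. h e \<partial>count_space UNIV) \<le> (\<Sum>\<^sub>\<infinity>e. h e)" .
    show "(\<Sum>\<^sub>\<infinity>e. h e) \<le> (\<integral>\<^sup>+e. h e \<partial>count_space UNIV)"
      unfolding sup
    proof (rule SUP_least)
      fix F :: "'a set" assume "F \<in> {F. finite F \<and> F \<subseteq> UNIV}"
      then have "sum h F = (\<integral>\<^sup>+e. h e * indicator F e \<partial>count_space UNIV)" by (simp add: fin)
      also have "\<dots> \<le> (\<integral>\<^sup>+e. h e \<partial>count_space UNIV)"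
        by (rule nn_integral_mono) (auto split: split_indicator)
      finally show "sum h F \<le> (\<integral>\<^sup>+e. h e \<partial>count_space UNIV)" .
    qed
  qed
qed

lemma sigma_finite_unit_interval: "sigma_finite_measure (restrict_space lborel {0<..<1::real})"
  by (rule sigma_finite_measure_restrict_space) (auto simp: lborel.sigma_finite_measure_axioms)

lemma pair_sigma_finite_edge_measure:
  "pair_sigma_finite (count_space (UNIV :: 'e::countable set)) (restrict_space lborel {0<..<1::real})"
  by (intro pair_sigma_finite.intro sigma_finite_unit_interval sigma_finite_measure_count_space_countable) auto

definition emb_fun :: "('e \<Rightarrow> real) \<Rightarrow> 'e gfun \<Rightarrow> 'e \<times> real \<Rightarrow> complex" where
  "emb_fun len f = (\<lambda>(e, t). complex_of_real (sqrt (len e)) * f e (len e * t))"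

text \<open>Every edge is rescaled to unit length; the factor \<open>sqrt (len e)\<close> keeps this isometric.\<close>
definition emb :: "('e::countable \<Rightarrow> real) \<Rightarrow> 'e gfun \<Rightarrow> 'e edge_l2" where
  "emb len f = abs_edge_l2 (emb_fun len f)"

definition edge_measurable :: "('e \<Rightarrow> real) \<Rightarrow> 'e gfun \<Rightarrow> bool" where
  "edge_measurable len f \<longleftrightarrow> (\<forall>e. (\<lambda>x. indicator {0<..<len e} x *\<^sub>R f e x) \<in> borel_measurable lborel)"

context
  fixes len :: "'e::countable \<Rightarrow> real"
  assumes len_pos: "\<And>e. 0 < len e"
begin

lemma emb_fun_measurable:
  assumes "edge_measurable len f"
  shows "emb_fun len f \<in> borel_measurable edge_measure"
  unfolding edge_measure_def
proof (rule measurable_pair_measure_countable1)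
  fix e
  have [measurable]: "(\<lambda>x. indicator {0<..<len e} x *\<^sub>R f e x) \<in> borel_measurable borel"
    using assms by (auto simp: edge_measurable_def)
  have "(\<lambda>t. complex_of_real (sqrt (len e)) * (\<lambda>x. indicator {0<..<len e} x *\<^sub>R f e x) (len e * t)) \<in> borel_measurable borel"
    by measurable
  also have "(\<lambda>t. complex_of_real (sqrt (len e)) * (\<lambda>x. indicator {0<..<len e} x *\<^sub>R f e x) (len e * t))
    = (\<lambda>t. indicator {0<..<1} t *\<^sub>R emb_fun len f (e, t))"
    using len_pos[of e] by (auto simp: emb_fun_def fun_eq_iff indicator_def mult_less_cancel_left1 zero_less_mult_iff)
  finally show "(\<lambda>t. emb_fun len f (e, t)) \<in> borel_measurable (restrict_space lborel {0<..<1})"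
    by (subst borel_measurable_restrict_space_iff) auto
qed auto

text \<open>Tonelli's theorem reduces the claim to one edge, where the substitution x = len e * t
  produces a Jacobian that the squared factor \<open>sqrt (len e)\<close> absorbs. Infinite values
  are covered, so finiteness of the right side decides square integrability of
  \<open>emb_fun len f\<close>.\<close>

lemma nn_integral_emb_fun:
  assumes "edge_measurable len f"
  shows "(\<integral>\<^sup>+p. ennreal ((cmod (emb_fun len f p))\<^sup>2) \<partial>edge_measure) = gnorm2 len f"
proof -
  note [measurable] = emb_fun_measurable[OF assms, unfolded edge_measure_def]
  have e: "(\<integral>\<^sup>+t. ennreal ((cmod (emb_fun len f (e, t)))\<^sup>2) \<partial>restrict_space lborel {0<..<1})
      = (\<integral>\<^sup>+x. ennreal (indicator {0<..<len e} x * (cmod (f e x))\<^sup>2) \<partial>lborel)" for e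
  proof -
    have [measurable]: "(\<lambda>x. indicator {0<..<len e} x *\<^sub>R f e x) \<in> borel_measurable borel"
      using assms by (auto simp: edge_measurable_def)
    have "(\<lambda>x. indicator {0<..<len e} x * (cmod (f e x))\<^sup>2) = (\<lambda>x. (cmod (indicator {0<..<len e} x *\<^sub>R f e x))\<^sup>2)"
      by (auto simp: fun_eq_iff indicator_def)
    also have "\<dots> \<in> borel_measurable borel" by measurable
    finally have [measurable]: "(\<lambda>x. indicator {0<..<len e} x * (cmod (f e x))\<^sup>2) \<in> borel_measurable borel" .
    have "(\<integral>\<^sup>+x. ennreal (indicator {0<..<len e} x * (cmod (f e x))\<^sup>2) \<partial>lborel)
      = ennreal \<bar>len e\<bar> * (\<integral>\<^sup>+t. ennreal (indicator {0<..<len e} (0 + len e * t) * (cmod (f e (0 + len e * t)))\<^sup>2) \<partial>lborel)"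
      using len_pos[of e] by (intro nn_integral_real_affine) auto
    also have "\<dots> = (\<integral>\<^sup>+t. ennreal \<bar>len e\<bar> * ennreal (indicator {0<..<len e} (0 + len e * t) * (cmod (f e (0 + len e * t)))\<^sup>2) \<partial>lborel)"
      by (rule nn_integral_cmult[symmetric]) measurable
    also have "\<dots> = (\<integral>\<^sup>+t. ennreal ((cmod (emb_fun len f (e, t)))\<^sup>2) * indicator {0<..<1} t \<partial>lborel)"
      using len_pos[of e]
      by (intro nn_integral_cong)
         (auto simp: emb_fun_def indicator_def mult_less_cancel_left1 zero_less_mult_iff norm_mult
            power_mult_distrib ennreal_mult[symmetric])
    also have "\<dots> = (\<integral>\<^sup>+t. ennreal ((cmod (emb_fun len f (e, t)))\<^sup>2) \<partial>restrict_space lborel {0<..<1})"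
      by (subst nn_integral_restrict_space) auto
    finally show ?thesis ..
  qed
  have "(\<integral>\<^sup>+p. ennreal ((cmod (emb_fun len f p))\<^sup>2) \<partial>edge_measure)
     = (\<integral>\<^sup>+e. \<integral>\<^sup>+t. ennreal ((cmod (emb_fun len f (e, t)))\<^sup>2) \<partial>restrict_space lborel {0<..<1} \<partial>count_space UNIV)"
    unfolding edge_measure_def
    by (rule sigma_finite_measure.nn_integral_fst[OF sigma_finite_unit_interval, symmetric]) measurable
  also have "\<dots> = gnorm2 len f"
    unfolding nn_integral_count_space_infsum e gnorm2_def ..
  finally show ?thesis .
qed

lemma L2G_iff_emb_fun:
  assumes "edge_measurable len f"
  shows "f \<in> L2G len \<longleftrightarrow> emb_fun len f \<in> sq_int edge_measure"
  using assms unfolding sq_int_iff_nn_integral[OF emb_fun_measurable[OF assms]] nn_integral_emb_fun[OF assms]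
  by (simp add: L2G_def edge_measurable_def)

lemma L2G_edge_measurable: "f \<in> L2G len \<Longrightarrow> edge_measurable len f"
  by (simp add: L2G_def edge_measurable_def)

lemma L2G_emb_fun: "f \<in> L2G len \<Longrightarrow> emb_fun len f \<in> sq_int edge_measure"
  using L2G_iff_emb_fun L2G_edge_measurable by blast

lemma gnorm2_emb: "f \<in> L2G len \<Longrightarrow> gnorm2 len f = ennreal ((norm (emb len f))\<^sup>2)"
  unfolding emb_def edge_l2_norm_abs[OF L2G_emb_fun]
  by (simp add: sq_int_nn_integral[OF L2G_emb_fun, symmetric] nn_integral_emb_fun L2G_edge_measurable)

lemma emb_fun_diff: "emb_fun len (f - g) = (\<lambda>p. emb_fun len f p - emb_fun len g p)"
  by (auto simp: emb_fun_def fun_eq_iff algebra_simps)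

lemma emb_fun_gscale: "emb_fun len (gscale c f) = (\<lambda>p. c * emb_fun len f p)"
  by (auto simp: emb_fun_def fun_eq_iff gscale_def)

lemma edge_measurable_diff:
  assumes "edge_measurable len f" "edge_measurable len g"
  shows "edge_measurable len (f - g)"
  unfolding edge_measurable_def
proof
  fix e
  have [measurable]: "(\<lambda>x. indicator {0<..<len e} x *\<^sub>R f e x) \<in> borel_measurable lborel"
    "(\<lambda>x. indicator {0<..<len e} x *\<^sub>R g e x) \<in> borel_measurable lborel"
    using assms by (simp_all only: edge_measurable_def)
  have "(\<lambda>x. indicator {0<..<len e} x *\<^sub>R f e x - indicator {0<..<len e} x *\<^sub>R g e x) \<in> borel_measurable lborel"
    by measurable
  then show "(\<lambda>x. indicator {0<..<len e} x *\<^sub>R (f - g) e x) \<in> borel_measurable lborel"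
    by (simp add: scaleR_diff_right)
qed

lemma edge_measurable_gscale:
  assumes "edge_measurable len f"
  shows "edge_measurable len (gscale c f)"
  unfolding edge_measurable_def
proof
  fix e
  have [measurable]: "(\<lambda>x. indicator {0<..<len e} x *\<^sub>R f e x) \<in> borel_measurable lborel"
    using assms by (simp only: edge_measurable_def)
  have "(\<lambda>x. c * (indicator {0<..<len e} x *\<^sub>R f e x)) \<in> borel_measurable lborel"
    by measurable
  then show "(\<lambda>x. indicator {0<..<len e} x *\<^sub>R gscale c f e x) \<in> borel_measurable lborel"
    by (simp add: gscale_def)
qed

lemma L2G_diff:
  assumes "f \<in> L2G len" "g \<in> L2G len"
  shows "f - g \<in> L2G len"
  using L2G_iff_emb_fun[OF edge_measurable_diff[OF assms[THEN L2G_edge_measurable]]]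
    sq_int_diff[OF assms[THEN L2G_emb_fun]]
  by (simp add: emb_fun_diff)

lemma L2G_gscale:
  assumes "f \<in> L2G len"
  shows "gscale c f \<in> L2G len"
  using L2G_iff_emb_fun[OF edge_measurable_gscale[OF assms[THEN L2G_edge_measurable]]]
    sq_int_mult[OF assms[THEN L2G_emb_fun]]
  by (simp add: emb_fun_gscale)

lemma emb_diff: "f \<in> L2G len \<Longrightarrow> g \<in> L2G len \<Longrightarrow> emb len (f - g) = emb len f - emb len g"
  by (simp add: emb_def emb_fun_diff abs_edge_l2_diff L2G_emb_fun)

lemma emb_gscale: "f \<in> L2G len \<Longrightarrow> emb len (gscale c f) = cmult c (emb len f)"
  by (simp add: emb_def emb_fun_gscale abs_edge_l2_cmult L2G_emb_fun)

lemma emb_surj: "\<exists>f\<in>L2G len. emb len f = x"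
proof -
  obtain g where g: "g \<in> sq_int edge_measure" "abs_edge_l2 g = x"
    using edge_l2_abs_surj by blast
  define f where "f e y = g (e, y / len e) / complex_of_real (sqrt (len e))" for e y
  have eq: "emb_fun len f = g"
  proof
    fix p show "emb_fun len f p = g p"
      using len_pos[of "fst p"] by (cases p) (auto simp: emb_fun_def f_def)
  qed
  have "edge_measurable len f"
    unfolding edge_measurable_def
  proof
    fix e
    have [measurable]: "g \<in> borel_measurable (count_space UNIV \<Otimes>\<^sub>M restrict_space lborel {0<..<1})"
      using g(1) by (simp add: sq_int_def edge_measure_def)
    have "(\<lambda>t. g (e, t)) \<in> borel_measurable (restrict_space lborel {0<..<1})"
      by measurable
    then have [measurable]: "(\<lambda>t. indicator {0<..<1} t *\<^sub>R g (e, t)) \<in> borel_measurable borel"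
      by (subst (asm) borel_measurable_restrict_space_iff) auto
    have "(\<lambda>y. (\<lambda>t. indicator {0<..<1} t *\<^sub>R g (e, t)) (y / len e) / complex_of_real (sqrt (len e))) \<in> borel_measurable borel"
      by measurable
    also have "(\<lambda>y. (\<lambda>t. indicator {0<..<1} t *\<^sub>R g (e, t)) (y / len e) / complex_of_real (sqrt (len e)))
      = (\<lambda>x. indicator {0<..<len e} x *\<^sub>R f e x)"
      using len_pos[of e] by (auto simp: f_def fun_eq_iff indicator_def zero_less_divide_iff)
    finally show "(\<lambda>x. indicator {0<..<len e} x *\<^sub>R f e x) \<in> borel_measurable lborel" by simp
  qed
  with g eq have "f \<in> L2G len" "emb len f = x"
    by (simp_all add: L2G_iff_emb_fun emb_def)
  then show ?thesis by blast
qed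

text \<open>Fubini's theorem and rescaling on each edge; the finite edge support of \<open>g\<close>
  turns the outer integral into a finite sum. \<open>L2G\<close> constrains functions on open edges,
  whereas primitives live on closed ones, so measurability is rebuilt by adding the two endpoint
  values.\<close>

lemma inner_emb:
  assumes f: "f \<in> L2G len" and g: "g \<in> L2G len" and E: "finite E"
    and supp: "\<And>e x. e \<notin> E \<Longrightarrow> x \<in> {0<..<len e} \<Longrightarrow> g e x = 0"
  shows "emb len f \<bullet> emb len g = (\<Sum>e\<in>E. LINT x:{0..len e}|lborel. f e x \<bullet> g e x)"
proof -
  let ?U = "restrict_space lborel {0<..<1::real}"
  interpret pair_sigma_finite "count_space (UNIV :: 'e set)" ?U
    by (rule pair_sigma_finite_edge_measure)
  have "emb len f \<bullet> emb len g = (\<integral>p. emb_fun len f p \<bullet> emb_fun len g p \<partial>edge_measure)"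
    by (simp add: emb_def abs_edge_l2_inner L2G_emb_fun f g)
  also have "\<dots> = (\<integral>e. \<integral>t. emb_fun len f (e, t) \<bullet> emb_fun len g (e, t) \<partial>?U \<partial>count_space UNIV)"
    using sq_int_inner[OF L2G_emb_fun[OF f] L2G_emb_fun[OF g]] unfolding edge_measure_def
    by (rule integral_fst'[symmetric])
  also have "\<dots> = (\<integral>e. (LINT x:{0..len e}|lborel. f e x \<bullet> g e x) \<partial>count_space UNIV)"
  proof (rule Bochner_Integration.integral_cong[OF refl])
    fix e
    have "(\<integral>t. emb_fun len f (e, t) \<bullet> emb_fun len g (e, t) \<partial>?U)
      = (\<integral>t. indicator {0<..<1} t *\<^sub>R (emb_fun len f (e, t) \<bullet> emb_fun len g (e, t)) \<partial>lborel)"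
      by (subst integral_restrict_space) auto
    also have "\<dots> = (\<integral>t. \<bar>len e\<bar> *\<^sub>R (indicator {0<..<len e} (0 + len e * t) *\<^sub>R (f e (0 + len e * t) \<bullet> g e (0 + len e * t))) \<partial>lborel)"
      using len_pos[of e]
      by (intro Bochner_Integration.integral_cong)
         (auto simp: emb_fun_def indicator_def mult_less_cancel_left1 zero_less_mult_iff
            inner_complex_def algebra_simps real_sqrt_mult_self[of "len e", symmetric] simp del: real_sqrt_mult_self)
    also have "\<dots> = \<bar>len e\<bar> *\<^sub>R (\<integral>t. indicator {0<..<len e} (0 + len e * t) *\<^sub>R (f e (0 + len e * t) \<bullet> g e (0 + len e * t)) \<partial>lborel)"
      by simp
    also have "\<dots> = (\<integral>x. indicator {0<..<len e} x *\<^sub>R (f e x \<bullet> g e x) \<partial>lborel)"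
      using len_pos[of e] by (intro lborel_integral_real_affine[symmetric]) auto
    also have "\<dots> = (LINT x:{0..len e}|lborel. f e x \<bullet> g e x)"
      unfolding set_lebesgue_integral_def
    proof (rule integral_cong_AE)
      have [measurable]: "(\<lambda>x. indicator {0<..<len e} x *\<^sub>R f e x) \<in> borel_measurable lborel"
         "(\<lambda>x. indicator {0<..<len e} x *\<^sub>R g e x) \<in> borel_measurable lborel"
        using f g by (auto simp: L2G_def)
      have "(\<lambda>x. (indicator {0<..<len e} x *\<^sub>R f e x) \<bullet> (indicator {0<..<len e} x *\<^sub>R g e x)) \<in> borel_measurable lborel"
        by measurable
      also have "(\<lambda>x. (indicator {0<..<len e} x *\<^sub>R f e x) \<bullet> (indicator {0<..<len e} x *\<^sub>R g e x))
          = (\<lambda>x. indicator {0<..<len e} x *\<^sub>R (f e x \<bullet> g e x))"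
        by (auto simp: fun_eq_iff indicator_def)
      finally show m [measurable]: "(\<lambda>x. indicator {0<..<len e} x *\<^sub>R (f e x \<bullet> g e x)) \<in> borel_measurable lborel" .
      have "(\<lambda>x. indicator {0<..<len e} x *\<^sub>R (f e x \<bullet> g e x)
           + indicator {0} x *\<^sub>R (f e 0 \<bullet> g e 0) + indicator {len e} x *\<^sub>R (f e (len e) \<bullet> g e (len e))) \<in> borel_measurable lborel"
        by measurable
      also have "(\<lambda>x. indicator {0<..<len e} x *\<^sub>R (f e x \<bullet> g e x)
           + indicator {0} x *\<^sub>R (f e 0 \<bullet> g e 0) + indicator {len e} x *\<^sub>R (f e (len e) \<bullet> g e (len e)))
          = (\<lambda>x. indicator {0..len e} x *\<^sub>R (f e x \<bullet> g e x))"
        using len_pos[of e] by (auto simp: fun_eq_iff indicator_def)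
      finally show "(\<lambda>x. indicator {0..len e} x *\<^sub>R (f e x \<bullet> g e x)) \<in> borel_measurable lborel" .
      have "AE x in lborel. x \<noteq> 0 \<and> x \<noteq> len e"
        by (auto intro: AE_lborel_singleton)
      then show "AE x in lborel. indicator {0<..<len e} x *\<^sub>R (f e x \<bullet> g e x) = indicator {0..len e} x *\<^sub>R (f e x \<bullet> g e x)"
        by eventually_elim (auto simp: indicator_def)
    qed
    finally show "(\<integral>t. emb_fun len f (e, t) \<bullet> emb_fun len g (e, t) \<partial>?U) = (LINT x:{0..len e}|lborel. f e x \<bullet> g e x)" .
  qed
  also have "\<dots> = (\<Sum>e\<in>E. LINT x:{0..len e}|lborel. f e x \<bullet> g e x)"
  proof -
    have z: "(LINT x:{0..len e}|lborel. f e x \<bullet> g e x) = 0" if "e \<notin> E" for e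
      unfolding set_lebesgue_integral_def
    proof (rule integral_eq_zero_AE)
      have "AE x in lborel. x \<noteq> 0 \<and> x \<noteq> len e"
        by (auto intro: AE_lborel_singleton)
      then show "AE x in lborel. indicator {0..len e} x *\<^sub>R (f e x \<bullet> g e x) = 0"
        by eventually_elim (use supp[OF that] in \<open>auto simp: indicator_def\<close>)
    qed
    then have sub: "{e. (LINT x:{0..len e}|lborel. f e x \<bullet> g e x) \<noteq> 0} \<subseteq> E" by blast
    show ?thesis
      by (subst lebesgue_integral_count_space_finite_support)
         (use finite_subset[OF sub E] E z in \<open>auto intro!: sum.mono_neutral_left\<close>)
  qed
  finally show ?thesis .
qed

end

section \<open>Abstract spectral theory: projections, bounded symmetric operators, self-adjoint
  relations\<close>

section \<open>Orthogonal projection\<close>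

lemma parallelogram:
  fixes x y :: "'h::real_inner"
  shows "(norm (x + y))\<^sup>2 + (norm (x - y))\<^sup>2 = 2 * (norm x)\<^sup>2 + 2 * (norm y)\<^sup>2"
  by (simp add: power2_norm_eq_inner algebra_simps inner_commute)

text \<open>A minimizing sequence is Cauchy by the parallelogram law. Its limit is a nearest point,
  and moving it along \<open>u\<close> by the optimal amount \<open>t\<close> cannot reduce the
  distance, which gives orthogonality.\<close>

lemma closed_subspace_projection:
  fixes V :: "'h::{real_inner,complete_space} set"
  assumes V: "subspace V" "closed V"
  shows "\<exists>v\<in>V. \<forall>w\<in>V. (y - v) \<bullet> w = 0"
proof -
  have ne: "V \<noteq> {}" using subspace_0[OF V(1)] by blast
  define d where "d = infdist y V"
  have d: "d \<ge> 0" "\<And>v. v \<in> V \<Longrightarrow> d \<le> norm (y - v)"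
    using infdist_le[of _ V y] by (auto simp: d_def infdist_nonneg dist_norm)
  have "\<exists>v\<in>V. norm (y - v) < d + 1 / Suc n" for n
  proof (rule ccontr)
    assume "\<not> ?thesis"
    then have "d + 1 / Suc n \<le> infdist y V"
      unfolding infdist_def using ne by (auto intro!: cINF_greatest simp: dist_norm not_less)
    then show False by (simp add: d_def)
  qed
  then obtain v where v: "\<And>n. v n \<in> V" "\<And>n. norm (y - v n) < d + 1 / Suc n" by metis
  have lim: "(\<lambda>n. (d + 1 / Suc n)\<^sup>2) \<longlonglongrightarrow> d\<^sup>2"
    using tendsto_power[OF tendsto_add[OF tendsto_const LIMSEQ_inverse_real_of_nat], of d 2]
    by (simp add: inverse_eq_divide)
  have close: "(norm (v m - v n))\<^sup>2 \<le> 2 * ((d + 1 / Suc m)\<^sup>2 - d\<^sup>2) + 2 * ((d + 1 / Suc n)\<^sup>2 - d\<^sup>2)" for m n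
  proof -
    have "(1/2) *\<^sub>R (v m + v n) \<in> V" using v(1) V(1) by (intro subspace_scale subspace_add)
    then have "d \<le> norm (y - (1/2) *\<^sub>R (v m + v n))" by (rule d)
    also have "y - (1/2) *\<^sub>R (v m + v n) = (1/2) *\<^sub>R ((y - v m) + (y - v n))"
      by (simp add: algebra_simps flip: scaleR_add_left)
    finally have "2 * d \<le> norm ((y - v m) + (y - v n))" by simp
    then have "(2 * d)\<^sup>2 \<le> (norm ((y - v m) + (y - v n)))\<^sup>2" using d(1) by (intro power_mono) auto
    moreover have "(norm (y - v m))\<^sup>2 \<le> (d + 1 / Suc m)\<^sup>2" "(norm (y - v n))\<^sup>2 \<le> (d + 1 / Suc n)\<^sup>2"
      using v(2)[of m] v(2)[of n] by (intro power_mono; simp)+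
    moreover have "(norm ((y - v m) + (y - v n)))\<^sup>2 + (norm (v m - v n))\<^sup>2 = 2 * (norm (y - v m))\<^sup>2 + 2 * (norm (y - v n))\<^sup>2"
      using parallelogram[of "y - v m" "y - v n"] by (simp add: norm_minus_commute)
    ultimately show ?thesis by (simp add: power_mult_distrib)
  qed
  have "Cauchy v"
    unfolding Cauchy_def dist_norm
  proof (intro allI impI)
    fix e :: real assume "e > 0"
    then have "\<forall>\<^sub>F n in sequentially. (d + 1 / Suc n)\<^sup>2 < d\<^sup>2 + e\<^sup>2 / 4"
      using lim by (intro order_tendstoD) auto
    then obtain N where N: "\<And>n. n \<ge> N \<Longrightarrow> (d + 1 / Suc n)\<^sup>2 < d\<^sup>2 + e\<^sup>2 / 4"
      by (auto simp: eventually_sequentially)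
    have "norm (v m - v n) < e" if "m \<ge> N" "n \<ge> N" for m n
    proof (rule power2_less_imp_less)
      show "(norm (v m - v n))\<^sup>2 < e\<^sup>2"
        using close[of m n] N[OF that(1)] N[OF that(2)] by simp
    qed (use \<open>e > 0\<close> in auto)
    then show "\<exists>M. \<forall>m\<ge>M. \<forall>n\<ge>M. norm (v m - v n) < e" by blast
  qed
  then obtain w where w: "v \<longlonglongrightarrow> w" using Cauchy_convergent_iff convergent_def by blast
  have wV: "w \<in> V" using V(2) v(1) w closed_sequentially by blast
  have "norm (y - w) \<le> d"
  proof (rule LIMSEQ_le)
    show "(\<lambda>n. norm (y - v n)) \<longlonglongrightarrow> norm (y - w)" by (intro tendsto_intros w)
    show "(\<lambda>n. d + 1 / Suc n) \<longlonglongrightarrow> d"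
      using tendsto_add[OF tendsto_const LIMSEQ_inverse_real_of_nat, of d] by (simp add: inverse_eq_divide)
  qed (use v(2) in \<open>auto intro: less_imp_le\<close>)
  have "(y - w) \<bullet> u = 0" if u: "u \<in> V" for u
  proof (cases "u = 0")
    case False
    define t where "t = ((y - w) \<bullet> u) / (u \<bullet> u)"
    have "w + t *\<^sub>R u \<in> V" using wV u V(1) by (intro subspace_add subspace_scale)
    then have "norm (y - w) \<le> norm (y - (w + t *\<^sub>R u))" using d(2) \<open>norm (y - w) \<le> d\<close> by fastforce
    then have "(norm (y - w))\<^sup>2 \<le> (norm ((y - w) - t *\<^sub>R u))\<^sup>2" by (intro power_mono) (auto simp: algebra_simps)
    then have "2 * t * ((y - w) \<bullet> u) \<le> t\<^sup>2 * (u \<bullet> u)"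
      unfolding power2_norm_eq_inner
      by (simp add: inner_diff_left inner_diff_right inner_commute power2_eq_square)
    moreover have "t * (u \<bullet> u) = (y - w) \<bullet> u" using False by (simp add: t_def)
    ultimately have "2 * (t * ((y - w) \<bullet> u)) \<le> t * ((y - w) \<bullet> u)"
      by (simp add: power2_eq_square mult.assoc)
    then have "((y - w) \<bullet> u)\<^sup>2 / (u \<bullet> u) \<le> 0" by (simp add: t_def power2_eq_square)
    then show ?thesis using False by (simp add: divide_le_0_iff) (metis inner_gt_zero_iff not_less power2_less_eq_zero_iff)
  qed simp
  with wV show ?thesis by blast
qed

lemma closed_subspace_eq_UNIV:
  fixes V :: "'h::{real_inner,complete_space} set"
  assumes "subspace V" "closed V" "\<And>x. (\<And>v. v \<in> V \<Longrightarrow> v \<bullet> x = 0) \<Longrightarrow> x = 0"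
  shows "V = UNIV"
proof -
  have "y \<in> V" for y
  proof -
    obtain v where v: "v \<in> V" "\<And>w. w \<in> V \<Longrightarrow> (y - v) \<bullet> w = 0"
      using closed_subspace_projection[OF assms(1,2)] by blast
    then have "y - v = 0" by (intro assms(3)) (simp add: inner_commute)
    with v show ?thesis by simp
  qed
  then show ?thesis by blast
qed

lemma subspace_closure:
  fixes V :: "'h::real_normed_vector set"
  assumes "subspace V"
  shows "subspace (closure V)"
proof (rule subspaceI)
  show "0 \<in> closure V" using subspace_0[OF assms] closure_subset by blast
  fix x y c assume x: "x \<in> closure V"
  obtain a where a: "\<And>n. a n \<in> V" "a \<longlonglongrightarrow> x" using x closure_sequential by blast
  have "(\<lambda>n. c *\<^sub>R a n) \<longlonglongrightarrow> c *\<^sub>R x" by (intro tendsto_intros a)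
  then show "c *\<^sub>R x \<in> closure V"
    using a(1) assms by (auto simp: closure_sequential intro!: exI[of _ "\<lambda>n. c *\<^sub>R a n"] subspace_scale)
  assume "y \<in> closure V"
  then obtain b where b: "\<And>n. b n \<in> V" "b \<longlonglongrightarrow> y" using closure_sequential by blast
  have "(\<lambda>n. a n + b n) \<longlonglongrightarrow> x + y" by (intro tendsto_intros a b)
  then show "x + y \<in> closure V"
    using a(1) b(1) assms by (auto simp: closure_sequential intro!: exI[of _ "\<lambda>n. a n + b n"] subspace_add)
qed

text \<open>The lower bound makes the range of T - A closed, and \<open>dense\<close> makes its
  orthogonal complement trivial. It is applied to A = -1, for the solvability of g + f = h, and to
  multiplication by a complex number.\<close>

lemma linear_relation_surj:
  fixes T :: "('h::{real_inner,complete_space} \<times> 'h) set"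
  assumes T: "subspace T" "closed T" and A: "bounded_linear A"
    and below: "\<And>f g. (f, g) \<in> T \<Longrightarrow> (norm f)\<^sup>2 \<le> C * (norm (g - A f))\<^sup>2"
    and dense: "\<And>x. (\<And>f g. (f, g) \<in> T \<Longrightarrow> (g - A f) \<bullet> x = 0) \<Longrightarrow> x = 0"
  shows "\<exists>f g. (f, g) \<in> T \<and> g - A f = h"
proof -
  interpret A: bounded_linear A by fact
  define R where "R = (\<lambda>(f, g). g - A f) ` T"
  have lin: "linear (\<lambda>p. snd p - A (fst p))"
    by (rule linearI) (auto simp: A.add A.scaleR algebra_simps)
  have "subspace R"
    unfolding R_def split_def by (rule linear_subspace_image[OF lin T(1)])
  moreover have "closed R"
    unfolding closed_sequential_limits
  proof (intro allI impI, elim conjE)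
    fix h l assume h: "\<forall>n. h n \<in> R" and l: "h \<longlonglongrightarrow> l"
    then have "\<forall>n. \<exists>p. p \<in> T \<and> h n = snd p - A (fst p)" unfolding R_def image_def split_def by blast
    then obtain p where p: "\<And>n. p n \<in> T" "\<And>n. h n = snd (p n) - A (fst (p n))" by metis
    have bd: "(norm (fst (p m) - fst (p n)))\<^sup>2 \<le> C * (norm (h m - h n))\<^sup>2" for m n
    proof -
      have "p m - p n \<in> T" using p(1) T(1) by (intro subspace_diff)
      then have "(fst (p m) - fst (p n), snd (p m) - snd (p n)) \<in> T" by (simp add: minus_prod_def)
      from below[OF this] show ?thesis by (simp add: p(2) A.diff algebra_simps)
    qed
    have "Cauchy (\<lambda>n. fst (p n))"
      unfolding Cauchy_def dist_norm
    proof (intro allI impI)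
      fix e :: real assume "e > 0"
      \<comment> \<open>\<open>C\<close> is an arbitrary real number, so a positive majorant is
        taken before dividing by its root.\<close>
      define C' where "C' = \<bar>C\<bar> + 1"
      have C': "C' > 0" "C \<le> C'" by (auto simp: C'_def)
      have "Cauchy h" using l by (rule LIMSEQ_imp_Cauchy)
      then obtain M where M: "\<And>m n. m \<ge> M \<Longrightarrow> n \<ge> M \<Longrightarrow> norm (h m - h n) < e / sqrt C'"
        unfolding Cauchy_def dist_norm using \<open>e > 0\<close> C' by (metis divide_pos_pos real_sqrt_gt_zero)
      have "norm (fst (p m) - fst (p n)) < e" if "m \<ge> M" "n \<ge> M" for m n
      proof (rule power2_less_imp_less)
        have "(norm (h m - h n))\<^sup>2 < (e / sqrt C')\<^sup>2"
          by (intro power_strict_mono M that) auto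
        then have "C' * (norm (h m - h n))\<^sup>2 < e\<^sup>2"
          using C' by (simp add: power_divide field_simps)
        moreover have "C * (norm (h m - h n))\<^sup>2 \<le> C' * (norm (h m - h n))\<^sup>2"
          using C' by (intro mult_right_mono) auto
        ultimately show "(norm (fst (p m) - fst (p n)))\<^sup>2 < e\<^sup>2" using bd[of m n] by simp
      qed (use \<open>e > 0\<close> in auto)
      then show "\<exists>M. \<forall>m\<ge>M. \<forall>n\<ge>M. norm (fst (p m) - fst (p n)) < e" by blast
    qed
    then obtain f where f: "(\<lambda>n. fst (p n)) \<longlonglongrightarrow> f" using Cauchy_convergent_iff convergent_def by blast
    have "(\<lambda>n. h n + A (fst (p n))) \<longlonglongrightarrow> l + A f"
      by (intro tendsto_intros l A.tendsto f)
    then have "(\<lambda>n. (fst (p n), snd (p n))) \<longlonglongrightarrow> (f, l + A f)"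
      using f by (intro tendsto_Pair) (simp_all add: p(2))
    then have "(f, l + A f) \<in> T"
      using T(2) p(1) closed_sequentially[of T p] by simp
    then show "l \<in> R" unfolding R_def by force
  qed
  moreover have "x = 0" if "\<And>v. v \<in> R \<Longrightarrow> v \<bullet> x = 0" for x
    by (rule dense) (use that in \<open>auto simp: R_def\<close>)
  ultimately have "R = UNIV" by (rule closed_subspace_eq_UNIV)
  then have "h \<in> R" by simp
  then show ?thesis by (auto simp: R_def)
qed

section \<open>Subspaces of infinite dimension\<close>

text \<open>One linear constraint lowers the dimension by at most one: if the constrained subspace
  were contained in \<open>span G\<close>, a single additional vector \<open>b\<close> would yield a
  finite spanning set for the whole. Infinite dimension is expressed as not lying in the span of any
  finite set.\<close>

lemma infinite_dim_orthogonal: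
  fixes S :: "'h::real_inner set"
  assumes S: "subspace S" "\<And>F. finite F \<Longrightarrow> \<not> S \<subseteq> span F" and F: "finite F"
  shows "\<exists>g\<in>S. g \<noteq> 0 \<and> (\<forall>x\<in>F. x \<bullet> g = 0)"
proof -
  have "subspace (S \<inter> {g. \<forall>x\<in>F. x \<bullet> g = 0}) \<and> (\<forall>G. finite G \<longrightarrow> \<not> S \<inter> {g. \<forall>x\<in>F. x \<bullet> g = 0} \<subseteq> span G)"
    using F
  proof (induction F)
    case empty
    then show ?case using S by simp
  next
    case (insert a F)
    define S' where "S' = S \<inter> {g. \<forall>x\<in>F. x \<bullet> g = 0}"
    have S': "subspace S'" "\<And>G. finite G \<Longrightarrow> \<not> S' \<subseteq> span G" using insert.IH by (auto simp: S'_def)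
    have eq: "S \<inter> {g. \<forall>x\<in>insert a F. x \<bullet> g = 0} = S' \<inter> {g. a \<bullet> g = 0}" by (auto simp: S'_def)
    have "\<not> S' \<inter> {g. a \<bullet> g = 0} \<subseteq> span G" if G: "finite G" for G
    proof
      assume sub: "S' \<inter> {g. a \<bullet> g = 0} \<subseteq> span G"
      have "\<exists>b. S' \<subseteq> span (insert b G)"
      proof (cases "\<exists>b\<in>S'. a \<bullet> b \<noteq> 0")
        case True
        then obtain b where b: "b \<in> S'" "a \<bullet> b \<noteq> 0" by blast
        have "y \<in> span (insert b G)" if y: "y \<in> S'" for y
        proof -
          define k where "k = (a \<bullet> y) / (a \<bullet> b)"
          have "y - k *\<^sub>R b \<in> S' \<inter> {g. a \<bullet> g = 0}"
            using y b S'(1) by (auto simp: k_def inner_diff_right intro!: subspace_diff subspace_scale)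
          then have "y - k *\<^sub>R b \<in> span G" using sub by blast
          then show ?thesis using span_breakdown_eq by blast
        qed
        then show ?thesis by blast
      next
        case False
        then have "S' \<subseteq> span G" using sub by blast
        then show ?thesis using S'(2)[OF G] by blast
      qed
      then show False using S'(2) G by blast
    qed
    moreover have "subspace (S' \<inter> {g. a \<bullet> g = 0})"
      by (intro subspace_inter S'(1)) (auto intro!: subspaceI simp: inner_add_right)
    ultimately show ?case unfolding eq by blast
  qed
  then have "\<not> S \<inter> {g. \<forall>x\<in>F. x \<bullet> g = 0} \<subseteq> span {}" by blast
  then show ?thesis by auto
qed

lemma orthonormal_sequence_infinite_dim:
  fixes e :: "nat \<Rightarrow> 'h::real_inner"
  assumes orth: "\<And>i j. i \<noteq> j \<Longrightarrow> e i \<bullet> e j = 0" and nz: "\<And>i. e i \<noteq> 0" and F: "finite F"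
  shows "\<not> span (range e) \<subseteq> span F"
proof
  assume sub: "span (range e) \<subseteq> span F"
  have inj: "inj e"
  proof (rule injI)
    fix i j assume "e i = e j"
    then show "i = j" using orth[of i j] nz[of i] by (metis inner_eq_zero_iff)
  qed
  have "independent (range e)"
    by (rule pairwise_orthogonal_independent)
       (use orth nz in \<open>auto simp: pairwise_def orthogonal_def, metis\<close>)
  moreover have "range e \<subseteq> span F" using sub span_superset by blast
  ultimately have "finite (range e)" using independent_span_bound[OF F] by blast
  then show False using finite_imageD[OF _ inj] by simp
qed

text \<open>Puts an element of the span in the form of an initial segment of the sequence, padded by
  zero coefficients, so that quadratic forms can be evaluated as diagonal sums.\<close>

lemma span_range_finite_sum:
  fixes e :: "nat \<Rightarrow> 'h::real_vector"
  assumes "g \<in> span (range e)"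
  shows "\<exists>n a. g = (\<Sum>i<n. a i *\<^sub>R e i)"
proof -
  have ext: "(\<Sum>i<n. a i *\<^sub>R e i) = (\<Sum>i<n + m. (if i < n then a i else 0) *\<^sub>R e i)" for n m and a :: "nat \<Rightarrow> real"
    by (rule sum.mono_neutral_cong_left) auto
  from assms show ?thesis
  proof (induction rule: span_induct_alt)
    case base
    show ?case by (intro exI[of _ 0]) simp
  next
    case (step c x y)
    then obtain j n a where x: "x = e j" and y: "y = (\<Sum>i<n. a i *\<^sub>R e i)" by auto
    have "c *\<^sub>R x = (\<Sum>i<Suc j + n. (if i = j then c else 0) *\<^sub>R e i)"
      unfolding x by (simp add: if_distrib[of "\<lambda>r. r *\<^sub>R _"] cong: if_cong)
    then have "c *\<^sub>R x + y = (\<Sum>i<n + Suc j. ((if i = j then c else 0) + (if i < n then a i else 0)) *\<^sub>R e i)"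
      unfolding y ext[of a n "Suc j"] by (simp only: scaleR_add_left sum.distrib add.commute[of "Suc j"])
    then show ?case
      by (intro exI[of _ "n + Suc j"] exI[of _ "\<lambda>i. (if i = j then c else 0) + (if i < n then a i else 0)"])
  qed
qed

section \<open>Bounded symmetric operators\<close>

locale bounded_symmetric =
  fixes A :: "'h::{real_inner,complete_space} \<Rightarrow> 'h" and N :: real
  assumes lin: "linear A" and sym: "A x \<bullet> y = x \<bullet> A y" and bound: "norm (A x) \<le> N * norm x"
begin

lemma add: "A (x + y) = A x + A y" and diff: "A (x - y) = A x - A y"
  and scale: "A (c *\<^sub>R x) = c *\<^sub>R A x" and zero: "A 0 = 0"
  using lin by (simp_all add: linear_add linear_diff linear_scale linear_0)

text \<open>Cauchy-Schwarz for the form of \<open>A\<close>, obtained by evaluating the form at g -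
  (1/M) A g and bounding the quadratic term by M |A g|^2. Nonnegativity enters at this one vector,
  which makes the estimate applicable when the form is nonnegative merely on a subspace containing
  it.\<close>

lemma norm_power2_le:
  assumes M: "M > 0" "N \<le> M" and pos: "0 \<le> A (g - (1/M) *\<^sub>R A g) \<bullet> (g - (1/M) *\<^sub>R A g)"
  shows "(norm (A g))\<^sup>2 \<le> M * (A g \<bullet> g)"
proof -
  have "A (A g) \<bullet> A g \<le> norm (A (A g)) * norm (A g)" by (rule norm_cauchy_schwarz)
  also have "\<dots> \<le> (M * norm (A g)) * norm (A g)"
    using bound[of "A g"] M by (intro mult_right_mono order_trans[OF bound] mult_right_mono) auto
  finally have 1: "A (A g) \<bullet> A g \<le> M * (norm (A g))\<^sup>2" by (simp add: power2_eq_square mult.assoc)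
  have "A (g - (1/M) *\<^sub>R A g) \<bullet> (g - (1/M) *\<^sub>R A g)
     = A g \<bullet> g - (2/M) * (norm (A g))\<^sup>2 + (1/M)\<^sup>2 * (A (A g) \<bullet> A g)"
    using M sym[of g "A g"] power2_norm_eq_inner[of "A g", unfolded power2_eq_square]
    by (simp add: diff scale inner_diff_left inner_diff_right sym[of "A g" g] power2_norm_eq_inner
        power2_eq_square inner_commute field_simps)
  also have "\<dots> \<le> A g \<bullet> g - (2/M) * (norm (A g))\<^sup>2 + (1/M)\<^sup>2 * (M * (norm (A g))\<^sup>2)"
    using 1 by (intro add_left_mono mult_left_mono) auto
  also have "\<dots> = A g \<bullet> g - (norm (A g))\<^sup>2 / M"
    using M by (simp add: power2_eq_square field_simps)
  finally have "(norm (A g))\<^sup>2 / M \<le> A g \<bullet> g" using pos by linarith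
  then show ?thesis using M by (simp add: pos_divide_le_eq mult.commute)
qed

lemma comp_bounded_symmetric: "bounded_symmetric (\<lambda>x. A (A x)) (N * N)"
proof (rule bounded_symmetric.intro)
  show "linear (\<lambda>x. A (A x))" using linear_compose[OF lin lin] by (simp add: o_def)
  show "A (A x) \<bullet> y = x \<bullet> A (A y)" for x y by (simp add: sym)
  show "norm (A (A x)) \<le> N * N * norm x" for x
  proof (cases "x = 0")
    case False
    then have "N \<ge> 0" using bound[of x] norm_ge_zero[of "A x"]
      by (metis order_trans zero_le_mult_iff norm_le_zero_iff)
    then have "N * norm (A x) \<le> N * (N * norm x)" using bound by (intro mult_left_mono)
    with bound[of "A x"] show ?thesis by simp
  qed (simp add: zero)
qed

lemma shift_bounded_symmetric: "bounded_symmetric (\<lambda>x. A x - c *\<^sub>R x) (N + \<bar>c\<bar>)"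
proof (rule bounded_symmetric.intro)
  show "linear (\<lambda>x. A x - c *\<^sub>R x)" by (rule linearI) (simp_all add: add scale algebra_simps)
  show "(A x - c *\<^sub>R x) \<bullet> y = x \<bullet> (A y - c *\<^sub>R y)" for x y
    by (simp add: inner_diff_left inner_diff_right sym)
  show "norm (A x - c *\<^sub>R x) \<le> (N + \<bar>c\<bar>) * norm x" for x
    using norm_triangle_ineq4[of "A x" "c *\<^sub>R x"] bound[of x] by (simp add: algebra_simps)
qed

text \<open>If \<open>d\<close> is the minimum modulus of \<open>A - c\<close>, then \<open>(A - c)\<^sup>2 - d\<^sup>2\<close> is nonnegative
  without being bounded below, so one of its factors \<open>A - (c \<plusminus> d)\<close> is not bounded below.\<close>
lemma spectral_gap:
  assumes gap: "\<And>t. \<bar>t - c\<bar> < r \<Longrightarrow> \<exists>k>0. \<forall>x. k * norm x \<le> norm (A x - t *\<^sub>R x)"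
  shows "r * norm x \<le> norm (A x - c *\<^sub>R x)"
proof (rule ccontr)
  assume "\<not> ?thesis"
  then have x: "norm (A x - c *\<^sub>R x) < r * norm x" by simp
  then have x0: "x \<noteq> 0" by (auto simp: zero)
  define S where "S = {norm (A y - c *\<^sub>R y) | y. norm y = 1}"
  have homog: "norm (A y - c *\<^sub>R y) / norm y \<in> S" if "y \<noteq> 0" for y
    unfolding S_def
  proof (intro CollectI exI conjI)
    show "norm ((1 / norm y) *\<^sub>R y) = 1" using that by simp
    have "A ((1 / norm y) *\<^sub>R y) - c *\<^sub>R (1 / norm y) *\<^sub>R y = (1 / norm y) *\<^sub>R (A y - c *\<^sub>R y)"
      by (simp add: scale algebra_simps)
    then show "norm (A y - c *\<^sub>R y) / norm y = norm (A ((1 / norm y) *\<^sub>R y) - c *\<^sub>R (1 / norm y) *\<^sub>R y)"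
      by simp
  qed
  define d where "d = Inf S"
  have bdd: "bdd_below S" by (rule bdd_belowI[of _ 0]) (auto simp: S_def)
  have Sne: "S \<noteq> {}" using homog[OF x0] by blast
  have d0: "d \<ge> 0" unfolding d_def using Sne by (intro cInf_greatest) (auto simp: S_def)
  have "d \<le> norm (A x - c *\<^sub>R x) / norm x" unfolding d_def by (rule cInf_lower[OF homog[OF x0] bdd])
  also have "\<dots> < r" using x x0 by (simp add: field_simps)
  finally have dr: "d < r" .
  have dle: "d * norm y \<le> norm (A y - c *\<^sub>R y)" for y
  proof (cases "y = 0")
    case False
    then have "d \<le> norm (A y - c *\<^sub>R y) / norm y" unfolding d_def by (intro cInf_lower[OF homog bdd])
    then show ?thesis using False by (simp add: field_simps)
  qed simp
  interpret D: bounded_symmetric "\<lambda>x. A x - c *\<^sub>R x" "N + \<bar>c\<bar>" by (rule shift_bounded_symmetric)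
  define M where "M = (N + \<bar>c\<bar>) * (N + \<bar>c\<bar>)"
  interpret D2: bounded_symmetric "\<lambda>x. A (A x - c *\<^sub>R x) - c *\<^sub>R (A x - c *\<^sub>R x)" M
    unfolding M_def by (rule D.comp_bounded_symmetric)
  interpret Q: bounded_symmetric "\<lambda>x. A (A x - c *\<^sub>R x) - c *\<^sub>R (A x - c *\<^sub>R x) - d\<^sup>2 *\<^sub>R x" "M + \<bar>d\<^sup>2\<bar>"
    by (rule D2.shift_bounded_symmetric)
  let ?Q = "\<lambda>x. A (A x - c *\<^sub>R x) - c *\<^sub>R (A x - c *\<^sub>R x) - d\<^sup>2 *\<^sub>R x"
  have Qin: "?Q y \<bullet> y = (norm (A y - c *\<^sub>R y))\<^sup>2 - d\<^sup>2 * (norm y)\<^sup>2" for y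
    using D.sym[of "A y - c *\<^sub>R y" y] by (simp add: inner_diff_left[of _ "d\<^sup>2 *\<^sub>R y"] power2_norm_eq_inner)
  have Qpos: "0 \<le> ?Q y \<bullet> y" for y
    unfolding Qin using power_mono[OF dle, of y 2] d0 by (simp add: power_mult_distrib)
  define P where "P = M + \<bar>d\<^sup>2\<bar> + 1"
  have P: "P > 0" by (simp add: P_def M_def add_nonneg_pos)
  have Qle: "(norm (?Q y))\<^sup>2 \<le> P * (?Q y \<bullet> y)" for y
    by (rule Q.norm_power2_le) (use P Qpos in \<open>simp_all add: P_def\<close>)
  obtain k1 where k1: "k1 > 0" "\<And>x. k1 * norm x \<le> norm (A x - (c + d) *\<^sub>R x)"
    using gap[of "c + d"] dr d0 by auto
  obtain k2 where k2: "k2 > 0" "\<And>x. k2 * norm x \<le> norm (A x - (c - d) *\<^sub>R x)"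
    using gap[of "c - d"] dr d0 by auto
  have Qge: "k1 * k2 * norm y \<le> norm (?Q y)" for y
  proof -
    have "k1 * (k2 * norm y) \<le> k1 * norm (A y - (c - d) *\<^sub>R y)" using k1 k2(2) by (intro mult_left_mono) auto
    also have "\<dots> \<le> norm (A (A y - (c - d) *\<^sub>R y) - (c + d) *\<^sub>R (A y - (c - d) *\<^sub>R y))" by (rule k1)
    also have "A (A y - (c - d) *\<^sub>R y) - (c + d) *\<^sub>R (A y - (c - d) *\<^sub>R y) = ?Q y"
      by (simp add: add diff scale algebra_simps power2_eq_square)
    finally show ?thesis by simp
  qed
  \<comment> \<open>The tolerance is chosen against \<open>Qge\<close> and \<open>Qle\<close>: a
    unit vector this close to the minimum \<open>d\<close> has |Q y|^2 \<le> P <Q y, y> < (k1 k2)^2,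
    although |Q y| \<ge> k1 k2.\<close>
  have "\<exists>s\<in>S. s < sqrt (d\<^sup>2 + (k1 * k2)\<^sup>2 / P)"
  proof -
    have "Inf S < sqrt (d\<^sup>2 + (k1 * k2)\<^sup>2 / P)"
      unfolding d_def[symmetric] using k1(1) k2(1) P d0 by (intro real_less_rsqrt) (simp add: zero_less_divide_iff)
    then show ?thesis using cInf_lessD[OF Sne] by blast
  qed
  then obtain y where y: "norm y = 1" "norm (A y - c *\<^sub>R y) < sqrt (d\<^sup>2 + (k1 * k2)\<^sup>2 / P)"
    by (auto simp: S_def)
  have "(norm (A y - c *\<^sub>R y))\<^sup>2 < (sqrt (d\<^sup>2 + (k1 * k2)\<^sup>2 / P))\<^sup>2"
    using y(2) by (intro power_strict_mono) auto
  also have "\<dots> = d\<^sup>2 + (k1 * k2)\<^sup>2 / P" using P by simp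
  finally have "(norm (A y - c *\<^sub>R y))\<^sup>2 - d\<^sup>2 < (k1 * k2)\<^sup>2 / P" by simp
  then have "P * ((norm (A y - c *\<^sub>R y))\<^sup>2 - d\<^sup>2) < (k1 * k2)\<^sup>2"
    using P by (simp add: pos_less_divide_eq mult.commute)
  moreover have "(k1 * k2)\<^sup>2 \<le> (norm (?Q y))\<^sup>2"
    using power_mono[OF Qge, of y 2] y(1) k1 k2 by simp
  moreover have "(norm (?Q y))\<^sup>2 \<le> P * ((norm (A y - c *\<^sub>R y))\<^sup>2 - d\<^sup>2)"
    using Qle[of y] unfolding Qin y(1) by simp
  ultimately show False by linarith
qed

text \<open>Since A^2 - t = (A - s)(A + s) with s^2 = t, the square has a spectral gap on (0,
  \<eta>^2), centred at \<eta>^2/2. Expanding |A^2 x - (\<eta>^2/2) x|^2 \<ge> (\<eta>^2/2)^2 |x|^2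
  gives the estimate on the range of \<open>A\<close>, and a vector orthogonal to the kernel is a
  limit of vectors in the range.\<close>

lemma isolated_zero_bounded_below:
  assumes "\<eta> > 0"
    and isol: "\<And>t. t \<noteq> 0 \<Longrightarrow> \<bar>t\<bar> < \<eta> \<Longrightarrow> \<exists>k>0. \<forall>x. k * norm x \<le> norm (A x - t *\<^sub>R x)"
    and orth: "\<And>x. A x = 0 \<Longrightarrow> x \<bullet> g = 0"
  shows "\<eta> * norm g \<le> norm (A g)"
proof -
  interpret A2: bounded_symmetric "\<lambda>x. A (A x)" "N * N" by (rule comp_bounded_symmetric)
  have gap: "(\<eta>\<^sup>2/2) * norm x \<le> norm (A (A x) - (\<eta>\<^sup>2/2) *\<^sub>R x)" for x
  proof (rule A2.spectral_gap)
    fix t assume t: "\<bar>t - \<eta>\<^sup>2/2\<bar> < \<eta>\<^sup>2/2"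
    then have t: "0 < t" "t < \<eta>\<^sup>2" by (auto simp: abs_if split: if_splits)
    define s where "s = sqrt t"
    have s: "s > 0" "s < \<eta>" "s * s = t" using t \<open>\<eta> > 0\<close> by (auto simp: s_def real_sqrt_less_iff intro: real_less_lsqrt)
    obtain k1 where k1: "k1 > 0" "\<And>x. k1 * norm x \<le> norm (A x - s *\<^sub>R x)" using isol[of s] s by auto
    obtain k2 where k2: "k2 > 0" "\<And>x. k2 * norm x \<le> norm (A x - (- s) *\<^sub>R x)" using isol[of "-s"] s by auto
    have "k1 * k2 * norm x \<le> norm (A (A x) - t *\<^sub>R x)" for x
    proof -
      have "k1 * (k2 * norm x) \<le> k1 * norm (A x - (- s) *\<^sub>R x)" using k1 k2(2) by (intro mult_left_mono) auto
      also have "\<dots> \<le> norm (A (A x - (- s) *\<^sub>R x) - s *\<^sub>R (A x - (- s) *\<^sub>R x))" by (rule k1)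
      also have "A (A x - (- s) *\<^sub>R x) - s *\<^sub>R (A x - (- s) *\<^sub>R x) = A (A x) - t *\<^sub>R x"
        by (simp add: add scale algebra_simps s(3)[symmetric])
      finally show ?thesis by simp
    qed
    then show "\<exists>k>0. \<forall>x. k * norm x \<le> norm (A (A x) - t *\<^sub>R x)"
      using k1 k2 by (intro exI[of _ "k1 * k2"]) simp
  qed
  have range: "\<eta> * norm (A x) \<le> norm (A (A x))" for x
  proof (rule power2_le_imp_le)
    have "((\<eta>\<^sup>2/2) * norm x)\<^sup>2 \<le> (norm (A (A x) - (\<eta>\<^sup>2/2) *\<^sub>R x))\<^sup>2"
      by (intro power_mono gap) auto
    also have "\<dots> = (norm (A (A x)))\<^sup>2 - \<eta>\<^sup>2 * (norm (A x))\<^sup>2 + (\<eta>\<^sup>2/2)\<^sup>2 * (norm x)\<^sup>2"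
      unfolding power2_norm_eq_inner
      by (simp add: inner_diff_left inner_diff_right sym[of x "A x"] inner_commute power2_eq_square algebra_simps)
    finally show "(\<eta> * norm (A x))\<^sup>2 \<le> (norm (A (A x)))\<^sup>2" by (simp add: power_mult_distrib power_divide)
  qed simp
  have sub: "subspace (closure (range A))"
    by (intro subspace_closure linear_subspace_image[OF lin]) simp
  obtain v where v: "v \<in> closure (range A)" "\<And>w. w \<in> closure (range A) \<Longrightarrow> (g - v) \<bullet> w = 0"
    using closed_subspace_projection[OF sub, of g] by auto
  \<comment> \<open>The residual of the projection is orthogonal to the range, hence by symmetry
    lies in the kernel; \<open>g\<close> is orthogonal to the kernel, which forces
    \<open>g = v\<close>.\<close>
  have "A (g - v) \<bullet> A (g - v) = (g - v) \<bullet> A (A (g - v))" by (rule sym)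
  also have "\<dots> = 0" by (intro v(2) closure_subset[THEN subsetD]) auto
  finally have "A (g - v) = 0" by simp
  then have "(g - v) \<bullet> g = 0" by (rule orth)
  with v(2)[OF v(1)] have "(g - v) \<bullet> (g - v) = 0" by (simp add: inner_diff_right)
  then have gv: "g = v" by simp
  obtain y where y: "\<And>n. y n \<in> range A" "y \<longlonglongrightarrow> g" using v(1) gv closure_sequential by blast
  interpret bl: bounded_linear A
    by (rule bounded_linear_intro[of _ N]) (simp_all add: add scale bound mult.commute)
  show ?thesis
  proof (rule LIMSEQ_le)
    show "(\<lambda>n. \<eta> * norm (y n)) \<longlonglongrightarrow> \<eta> * norm g" by (intro tendsto_intros y)
    show "(\<lambda>n. norm (A (y n))) \<longlonglongrightarrow> norm (A g)" by (intro tendsto_intros bl.tendsto y)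
    have "\<eta> * norm (y n) \<le> norm (A (y n))" for n using range y(1)[of n] by auto
    then show "\<exists>N. \<forall>n\<ge>N. \<eta> * norm (y n) \<le> norm (A (y n))" by blast
  qed
qed

text \<open>Outside finitely many eigenvectors the supremum of the quadratic form is a spectral point,
  hence by isolation an eigenvalue; it cannot exceed \<open>s\<close> infinitely often, since the form
  would then be at least \<open>s + \<eta>\<close> on a space of infinite dimension.\<close>
lemma finite_positive_part:
  assumes \<eta>: "\<eta> > 0" and gap: "\<And>r. 0 < r \<Longrightarrow> r < \<eta> \<Longrightarrow> \<exists>k>0. \<forall>x. k * norm x \<le> norm (A x - (s + r) *\<^sub>R x)"
    and isol: "\<And>b. s < b \<Longrightarrow> \<not> (\<exists>k>0. \<forall>x. k * norm x \<le> norm (A x - b *\<^sub>R x)) \<Longrightarrow>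
       \<exists>\<eta>>0. \<forall>r. r \<noteq> 0 \<longrightarrow> \<bar>r\<bar> < \<eta> \<longrightarrow> (\<exists>k>0. \<forall>x. k * norm x \<le> norm (A x - b *\<^sub>R x - r *\<^sub>R x))"
    and F1: "finite F1" "\<And>g. (\<forall>x\<in>F1. x \<bullet> g = 0) \<Longrightarrow> A g \<bullet> g \<le> (s + \<eta> / 2) * (norm g)\<^sup>2"
  shows "\<exists>F. finite F \<and> (\<forall>g. (\<forall>x\<in>F. x \<bullet> g = 0) \<longrightarrow> A g \<bullet> g \<le> s * (norm g)\<^sup>2)"
proof (rule ccontr)
  assume no: "\<not> ?thesis"
  \<comment> \<open>Eigenvalues of size at least s + \<eta> exceed the bound s + \<eta>/2 that holds
    on the complement of \<open>F1\<close>; this difference yields the final contradiction.\<close>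
  define eig where "eig x \<longleftrightarrow> norm x = 1 \<and> (\<exists>b\<ge>s + \<eta>. A x = b *\<^sub>R x)" for x
  \<comment> \<open>The orthogonal complement \<open>W\<close> of finitely many eigenvectors is
    invariant. Since the claim is assumed to fail for \<open>E\<close>, the supremum
    \<open>b\<close> of the form on \<open>W\<close> exceeds \<open>s\<close>, and by
    \<open>norm_power2_le\<close> near-maximizers in \<open>W\<close> are approximate
    eigenvectors.\<close>
  have step: "\<exists>y. eig y \<and> (\<forall>x\<in>E. x \<bullet> y = 0)"
    if E: "finite E" "\<And>x. x \<in> E \<Longrightarrow> eig x" "\<And>x y. x \<in> E \<Longrightarrow> y \<in> E \<Longrightarrow> x \<noteq> y \<Longrightarrow> x \<bullet> y = 0" for E
  proof -
    define W where "W = {g. \<forall>x\<in>E. x \<bullet> g = 0}"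
    have W: "subspace W" by (auto simp: W_def inner_add_right intro!: subspaceI)
    have AW: "A g \<in> W" if "g \<in> W" for g
      unfolding W_def
    proof (intro CollectI ballI)
      fix x assume x: "x \<in> E"
      then obtain b where "A x = b *\<^sub>R x" using E(2) by (auto simp: eig_def)
      moreover have "x \<bullet> g = 0" using that x by (simp add: W_def)
      ultimately show "x \<bullet> A g = 0" using sym[of x g] by simp
    qed
    define S where "S = {A g \<bullet> g | g. g \<in> W \<and> norm g = 1}"
    define b where "b = Sup S"
    from no E(1) obtain g0 where g0: "g0 \<in> W" "s * (norm g0)\<^sup>2 < A g0 \<bullet> g0" by (auto simp: W_def not_le)
    then have g0n: "g0 \<noteq> 0" by (auto simp: zero)
    have normalize: "A g \<bullet> g / (norm g)\<^sup>2 \<in> S" if "g \<in> W" "g \<noteq> 0" for g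
      unfolding S_def
      by (intro CollectI exI[of _ "(1 / norm g) *\<^sub>R g"])
         (use that W in \<open>auto simp: scale power2_eq_square intro: subspace_scale\<close>)
    have bdd: "bdd_above S"
    proof (rule bdd_aboveI[of _ N])
      fix t assume "t \<in> S"
      then obtain g where g: "t = A g \<bullet> g" "norm g = 1" by (auto simp: S_def)
      show "t \<le> N" using norm_cauchy_schwarz[of "A g" g] bound[of g] g by simp
    qed
    have Sne: "S \<noteq> {}" using normalize[OF g0(1) g0n] by blast
    have "s < A g0 \<bullet> g0 / (norm g0)\<^sup>2" using g0(2) g0n by (simp add: pos_less_divide_eq)
    also have "\<dots> \<le> b" unfolding b_def by (rule cSup_upper[OF normalize[OF g0(1) g0n] bdd])
    finally have sb: "s < b" .
    have upper: "A g \<bullet> g \<le> b * (norm g)\<^sup>2" if "g \<in> W" for g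
    proof (cases "g = 0")
      case False
      have "A g \<bullet> g / (norm g)\<^sup>2 \<le> b" unfolding b_def by (rule cSup_upper[OF normalize[OF that False] bdd])
      then show ?thesis using False by (simp add: pos_divide_le_eq)
    qed (simp add: zero)
    define M where "M = \<bar>N\<bar> + \<bar>b\<bar> + 1"
    have M: "M > 0" by (simp add: M_def)
    interpret C: bounded_symmetric "\<lambda>x. b *\<^sub>R x - A x" "N + \<bar>b\<bar>"
    proof (rule bounded_symmetric.intro)
      interpret D: bounded_symmetric "\<lambda>x. A x - b *\<^sub>R x" "N + \<bar>b\<bar>" by (rule shift_bounded_symmetric)
      show "linear (\<lambda>x. b *\<^sub>R x - A x)" by (rule linearI) (simp_all add: add scale algebra_simps)
      show "(b *\<^sub>R x - A x) \<bullet> y = x \<bullet> (b *\<^sub>R y - A y)" for x y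
        using D.sym[of x y] by (simp add: inner_diff_left inner_diff_right)
      show "norm (b *\<^sub>R x - A x) \<le> (N + \<bar>b\<bar>) * norm x" for x
        using D.bound[of x] by (simp add: norm_minus_commute[of "_ *\<^sub>R x"])
    qed
    have approx: "\<exists>g\<in>W. norm g = 1 \<and> norm (A g - b *\<^sub>R g) < \<delta>" if \<delta>: "\<delta> > 0" for \<delta>
    proof -
      have "b - \<delta>\<^sup>2 / (2 * M) < Sup S" using \<delta> M by (simp add: b_def)
      then obtain t where "t \<in> S" "b - \<delta>\<^sup>2 / (2 * M) < t" using less_cSupD[OF Sne] by blast
      then obtain g where g: "g \<in> W" "norm g = 1" "b - \<delta>\<^sup>2 / (2 * M) < A g \<bullet> g" by (auto simp: S_def)
      have "(norm (b *\<^sub>R g - A g))\<^sup>2 \<le> M * ((b *\<^sub>R g - A g) \<bullet> g)"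
      proof (rule C.norm_power2_le[OF M])
        show "N + \<bar>b\<bar> \<le> M" by (simp add: M_def)
        have "g - (1/M) *\<^sub>R (b *\<^sub>R g - A g) \<in> W"
          using W g(1) AW by (intro subspace_diff subspace_scale) auto
        from upper[OF this]
        show "0 \<le> (b *\<^sub>R (g - (1/M) *\<^sub>R (b *\<^sub>R g - A g)) - A (g - (1/M) *\<^sub>R (b *\<^sub>R g - A g))) \<bullet> (g - (1/M) *\<^sub>R (b *\<^sub>R g - A g))"
          by (simp add: inner_diff_left[of "b *\<^sub>R _"] power2_norm_eq_inner)
      qed
      also have "(b *\<^sub>R g - A g) \<bullet> g = b - A g \<bullet> g" using g(2) by (simp add: inner_diff_left norm_eq_1)
      also have "M * (b - A g \<bullet> g) < M * (\<delta>\<^sup>2 / M)"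
      proof (rule mult_strict_left_mono[OF _ M])
        have "\<delta>\<^sup>2 / (2 * M) \<le> \<delta>\<^sup>2 / M" using M by (intro divide_left_mono) auto
        then show "b - A g \<bullet> g < \<delta>\<^sup>2 / M" using g(3) by linarith
      qed
      also have "\<dots> = \<delta>\<^sup>2" using M by simp
      finally have "norm (b *\<^sub>R g - A g) < \<delta>" using \<delta> by (simp add: power2_less_imp_less)
      then show ?thesis using g(1,2) by (auto simp: norm_minus_commute[of "b *\<^sub>R g"])
    qed
    have nb: "\<not> (\<exists>k>0. \<forall>x. k * norm x \<le> norm (A x - b *\<^sub>R x))"
    proof
      assume "\<exists>k>0. \<forall>x. k * norm x \<le> norm (A x - b *\<^sub>R x)"
      then obtain k where k: "k > 0" "\<And>x. k * norm x \<le> norm (A x - b *\<^sub>R x)" by blast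
      obtain g where "norm g = 1" "norm (A g - b *\<^sub>R g) < k" using approx[OF k(1)] by blast
      with k(2)[of g] show False by simp
    qed
    have sb': "s + \<eta> \<le> b"
    proof (rule ccontr)
      assume "\<not> s + \<eta> \<le> b"
      then show False using gap[of "b - s"] nb sb by simp
    qed
    obtain \<eta>' where \<eta>': "\<eta>' > 0" "\<And>r. r \<noteq> 0 \<Longrightarrow> \<bar>r\<bar> < \<eta>' \<Longrightarrow> \<exists>k>0. \<forall>x. k * norm x \<le> norm (A x - b *\<^sub>R x - r *\<^sub>R x)"
      using isol[OF sb nb] by blast
    interpret D: bounded_symmetric "\<lambda>x. A x - b *\<^sub>R x" "N + \<bar>b\<bar>" by (rule shift_bounded_symmetric)
    obtain g where g: "g \<in> W" "norm g = 1" "norm (A g - b *\<^sub>R g) < \<eta>'" using approx[OF \<eta>'(1)] by blast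
    have "\<exists>k. A k - b *\<^sub>R k = 0 \<and> k \<bullet> g \<noteq> 0"
    proof (rule ccontr)
      assume "\<not> ?thesis"
      then have "\<And>k. A k - b *\<^sub>R k = 0 \<Longrightarrow> k \<bullet> g = 0" by blast
      from D.isolated_zero_bounded_below[OF \<eta>' this] g show False by simp
    qed
    then obtain k where k: "A k = b *\<^sub>R k" "k \<bullet> g \<noteq> 0" by auto
    \<comment> \<open>The eigenvector \<open>k\<close> need not lie in \<open>W\<close>. Removing
      its components along \<open>E\<close> keeps it in the eigenspace, because components at other
      eigenvalues are zero, and it remains nonzero because \<open>g\<close>, which lies in
      \<open>W\<close>, still detects it.\<close>
    define k' where "k' = k - (\<Sum>x\<in>E. (k \<bullet> x) *\<^sub>R x)"
    have "A (\<Sum>x\<in>E. (k \<bullet> x) *\<^sub>R x) = (\<Sum>x\<in>E. A ((k \<bullet> x) *\<^sub>R x))" by (rule linear_sum[OF lin])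
    also have "\<dots> = (\<Sum>x\<in>E. b *\<^sub>R (k \<bullet> x) *\<^sub>R x)"
    proof (rule sum.cong[OF refl])
      fix x assume x: "x \<in> E"
      then obtain c where c: "A x = c *\<^sub>R x" using E(2) by (auto simp: eig_def)
      have "b * (k \<bullet> x) = c * (k \<bullet> x)" using sym[of k x] k(1) c by simp
      then show "A ((k \<bullet> x) *\<^sub>R x) = b *\<^sub>R (k \<bullet> x) *\<^sub>R x" by (auto simp: scale c)
    qed
    finally have Ak': "A k' = b *\<^sub>R k'" by (simp add: k'_def diff k(1) scaleR_sum_right scaleR_diff_right)
    have k'W: "x \<bullet> k' = 0" if x: "x \<in> E" for x
    proof -
      have "x \<bullet> (\<Sum>y\<in>E. (k \<bullet> y) *\<^sub>R y) = (\<Sum>y\<in>E. if y = x then k \<bullet> x else 0)"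
        unfolding inner_sum_right
      proof (rule sum.cong[OF refl])
        fix y assume "y \<in> E"
        then show "x \<bullet> (k \<bullet> y) *\<^sub>R y = (if y = x then k \<bullet> x else 0)"
          using E(2)[OF x] E(3)[OF x, of y] by (auto simp: eig_def norm_eq_1)
      qed
      then show ?thesis using x E(1) by (simp add: k'_def inner_diff_right inner_commute)
    qed
    have "(\<Sum>x\<in>E. (k \<bullet> x) *\<^sub>R x) \<bullet> g = 0"
      using g(1) by (simp add: inner_sum_left W_def)
    then have "k' \<noteq> 0" using k(2) by (auto simp: k'_def inner_diff_left)
    then have "eig ((1 / norm k') *\<^sub>R k')"
      using Ak' sb' by (auto simp: eig_def scale intro!: exI[of _ b])
    then show ?thesis using k'W by (intro exI[of _ "(1 / norm k') *\<^sub>R k'"]) simp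
  qed
  \<comment> \<open>The choice is meaningful as long as the list is an orthogonal family of
    eigenvectors; \<open>inv\<close> maintains this along the recursion, and the list remembers all
    earlier choices.\<close>
  define pick where "pick xs = (SOME y. eig y \<and> (\<forall>x\<in>set xs. x \<bullet> y = 0))" for xs
  define L where "L = rec_nat [] (\<lambda>n xs. pick xs # xs)"
  define e where "e n = pick (L n)" for n
  have L: "L 0 = []" "L (Suc n) = e n # L n" for n by (simp_all add: L_def e_def)
  have pick: "eig (pick xs) \<and> (\<forall>x\<in>set xs. x \<bullet> pick xs = 0)"
    if "\<forall>x\<in>set xs. eig x" "\<forall>x\<in>set xs. \<forall>y\<in>set xs. x \<noteq> y \<longrightarrow> x \<bullet> y = 0" for xs
    unfolding pick_def by (rule someI_ex, rule step) (use that in auto)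
  have inv: "(\<forall>x\<in>set (L n). eig x) \<and> (\<forall>x\<in>set (L n). \<forall>y\<in>set (L n). x \<noteq> y \<longrightarrow> x \<bullet> y = 0)" for n
  proof (induction n)
    case (Suc n)
    then show ?case using pick[of "L n"] by (auto simp: L(2) e_def inner_commute)
  qed (simp add: L(1))
  note pick_L = pick[OF conjunct1[OF inv] conjunct2[OF inv]]
  have e: "eig (e n)" for n unfolding e_def by (rule conjunct1[OF pick_L])
  have e2: "x \<bullet> e n = 0" if "x \<in> set (L n)" for x n
    unfolding e_def by (rule bspec[OF conjunct2[OF pick_L] that])
  have mem: "e i \<in> set (L n)" if "i < n" for i n
    using that by (induction n) (auto simp: L(2) less_Suc_eq)
  have orth: "e i \<bullet> e j = 0" if "i \<noteq> j" for i j
  proof (cases "i < j")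
    case True
    then show ?thesis by (intro e2 mem)
  next
    case False
    then have "e j \<bullet> e i = 0" using that by (intro e2 mem) simp
    then show ?thesis by (simp add: inner_commute)
  qed
  have nz: "e i \<noteq> 0" for i using e[of i] by (auto simp: eig_def)
  have inf: "\<not> span (range e) \<subseteq> span F" if "finite F" for F
    by (rule orthonormal_sequence_infinite_dim[OF _ nz that]) (rule orth)
  \<comment> \<open>The eigenvectors span an infinite-dimensional space, which must meet the
    complement of \<open>F1\<close>; there the form would be both at least s + \<eta> and at most s
    + \<eta>/2 times the squared norm.\<close>
  obtain g where g: "g \<in> span (range e)" "g \<noteq> 0" "\<forall>x\<in>F1. x \<bullet> g = 0"
    using infinite_dim_orthogonal[OF subspace_span inf F1(1)] by blast
  obtain n a where ga: "g = (\<Sum>i<n. a i *\<^sub>R e i)" using span_range_finite_sum[OF g(1)] by blast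
  have "\<exists>b. \<forall>i. b i \<ge> s + \<eta> \<and> A (e i) = b i *\<^sub>R e i"
    by (rule choice) (use e in \<open>simp add: eig_def\<close>)
  then obtain b where b: "\<And>i. b i \<ge> s + \<eta>" "\<And>i. A (e i) = b i *\<^sub>R e i" by blast
  have diag: "(\<Sum>i<n. c i *\<^sub>R e i) \<bullet> (\<Sum>j<n. a j *\<^sub>R e j) = (\<Sum>i<n. c i * a i)" for c
  proof -
    have "(\<Sum>i<n. c i *\<^sub>R e i) \<bullet> (\<Sum>j<n. a j *\<^sub>R e j) = (\<Sum>i<n. \<Sum>j<n. if j = i then c i * a i else 0)"
      unfolding inner_sum_left unfolding inner_sum_right
    proof (intro sum.cong refl)
      fix i j
      show "c i *\<^sub>R e i \<bullet> a j *\<^sub>R e j = (if j = i then c i * a i else 0)"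
        using orth[of i j] e[of i] by (auto simp: eig_def norm_eq_1)
    qed
    then show ?thesis by simp
  qed
  have "A g = (\<Sum>i<n. (a i * b i) *\<^sub>R e i)"
    unfolding ga by (subst linear_sum[OF lin]) (simp add: scale b(2))
  then have "A g \<bullet> g = (\<Sum>i<n. (a i * b i) * a i)" unfolding ga diag[symmetric] by simp
  moreover have "(\<Sum>i<n. (s + \<eta>) * (a i * a i)) \<le> (\<Sum>i<n. (a i * b i) * a i)"
  proof (rule sum_mono)
    fix i
    have "(s + \<eta>) * (a i * a i) \<le> b i * (a i * a i)" by (intro mult_right_mono b(1)) simp
    then show "(s + \<eta>) * (a i * a i) \<le> a i * b i * a i" by (simp add: mult.commute mult.left_commute)
  qed
  moreover have "(\<Sum>i<n. (s + \<eta>) * (a i * a i)) = (s + \<eta>) * (norm g)\<^sup>2"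
    using diag[of a] by (simp add: power2_norm_eq_inner ga sum_distrib_left)
  ultimately have "(s + \<eta>) * (norm g)\<^sup>2 \<le> A g \<bullet> g" by simp
  with F1(2)[OF g(3)] have "(s + \<eta>) * (norm g)\<^sup>2 \<le> (s + \<eta> / 2) * (norm g)\<^sup>2" by simp
  then show False using g(2) \<eta> by simp
qed

end

section \<open>Nonnegative self-adjoint relations\<close>

text \<open>A closed relation instead of an operator: a graph closure is linear and closed at once,
  with no question of single values. Surjectivity of T + 1 stands for self-adjointness, and
  \<open>J\<close> is multiplication by the imaginary unit on a real Hilbert space.\<close>

locale nonneg_selfadjoint =
  fixes T :: "('h::{real_inner,complete_space} \<times> 'h) set" and J :: "'h \<Rightarrow> 'h"
  assumes T_subspace: "subspace T" and T_closed: "closed T"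
    and T_sym: "(f, g) \<in> T \<Longrightarrow> (f', g') \<in> T \<Longrightarrow> g \<bullet> f' = f \<bullet> g'"
    and T_nonneg: "(f, g) \<in> T \<Longrightarrow> 0 \<le> f \<bullet> g"
    and T_surj: "\<exists>f. (f, h - f) \<in> T"
    and J_add: "J (x + y) = J x + J y" and J_scale: "J (c *\<^sub>R x) = c *\<^sub>R J x"
    and J_J: "J (J x) = - x" and J_inner: "J x \<bullet> J y = x \<bullet> y"
    and T_J: "(f, g) \<in> T \<Longrightarrow> (J f, J g) \<in> T"
begin

definition cm :: "complex \<Rightarrow> 'h \<Rightarrow> 'h" where "cm z x = Re z *\<^sub>R x + Im z *\<^sub>R J x"

definition below :: "complex \<Rightarrow> bool" where
  "below z \<longleftrightarrow> (\<exists>C. \<forall>(f, g)\<in>T. (norm f)\<^sup>2 \<le> C * (norm (g - cm z f))\<^sup>2)"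

definition res :: "complex \<Rightarrow> bool" where
  "res z \<longleftrightarrow> below z \<and> (\<forall>h. \<exists>(f, g)\<in>T. g - cm z f = h)"

lemma T_add: "(f, g) \<in> T \<Longrightarrow> (f', g') \<in> T \<Longrightarrow> (f + f', g + g') \<in> T"
  using subspace_add[OF T_subspace, of "(f, g)" "(f', g')"] by simp

lemma T_diff: "(f, g) \<in> T \<Longrightarrow> (f', g') \<in> T \<Longrightarrow> (f - f', g - g') \<in> T"
  using subspace_diff[OF T_subspace, of "(f, g)" "(f', g')"] by (simp add: minus_prod_def)

lemma T_scale: "(f, g) \<in> T \<Longrightarrow> (c *\<^sub>R f, c *\<^sub>R g) \<in> T"
  using subspace_scale[OF T_subspace, of "(f, g)" c] by simp

lemma J_norm: "norm (J x) = norm x"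
  by (simp add: norm_eq_sqrt_inner J_inner)

lemma J_skew: "J x \<bullet> y = - (x \<bullet> J y)"
  using J_inner[of "J x" y] by (simp add: J_J)

lemma J_self: "x \<bullet> J x = 0" "J x \<bullet> x = 0"
  using J_skew[of x x] by (simp_all add: inner_commute)

lemma bounded_linear_cm: "bounded_linear (cm z)"
proof (rule bounded_linear_intro)
  fix x
  have "norm (cm z x) \<le> norm (Re z *\<^sub>R x) + norm (Im z *\<^sub>R J x)"
    unfolding cm_def by (rule norm_triangle_ineq)
  then show "norm (cm z x) \<le> norm x * (\<bar>Re z\<bar> + \<bar>Im z\<bar>)" by (simp add: J_norm algebra_simps)
qed (simp_all add: cm_def J_add J_scale algebra_simps)

text \<open>Commuting with \<open>J\<close> upgrades real symmetry to complex symmetry; this is the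
  statement that the complex form <T f, f> is real.\<close>

lemma T_J_orth:
  assumes "(f, g) \<in> T" shows "g \<bullet> J f = 0"
proof -
  have "g \<bullet> J f = f \<bullet> J g" by (rule T_sym[OF assms T_J[OF assms]])
  also have "\<dots> = - (g \<bullet> J f)" using J_skew[of f g] by (simp add: inner_commute)
  finally show ?thesis by simp
qed

text \<open>|(T - z) f|^2 = |(T - Re z) f|^2 + (Im z)^2 |f|^2, because the cross terms are killed by
  \<open>T_J_orth\<close>; the source of the resolvent bound 1/|Im z|.\<close>

lemma norm_shift:
  assumes "(f, g) \<in> T"
  shows "(norm (g - cm z f))\<^sup>2 = (norm (g - Re z *\<^sub>R f))\<^sup>2 + (Im z)\<^sup>2 * (norm f)\<^sup>2"
  unfolding cm_def power2_norm_eq_inner using T_J_orth[OF assms]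
  by (simp add: inner_diff_left inner_diff_right inner_add_left inner_add_right J_inner J_self
      inner_commute power2_eq_square algebra_simps)

lemma below_off_halfline:
  assumes "Im z \<noteq> 0 \<or> Re z < 0"
  shows "below z"
proof (cases "Im z = 0")
  case False
  have "(norm f)\<^sup>2 \<le> (1 / (Im z)\<^sup>2) * (norm (g - cm z f))\<^sup>2" if "(f, g) \<in> T" for f g
    unfolding norm_shift[OF that] using False by (simp add: field_simps)
  then show ?thesis unfolding below_def by (intro exI[of _ "1 / (Im z)\<^sup>2"]) auto
next
  case True
  with assms have neg: "Re z < 0" by simp
  have "(norm f)\<^sup>2 \<le> (1 / (Re z)\<^sup>2) * (norm (g - cm z f))\<^sup>2" if "(f, g) \<in> T" for f g
  proof -
    have "(norm (g - Re z *\<^sub>R f))\<^sup>2 = (norm g)\<^sup>2 - 2 * (Re z * (f \<bullet> g)) + (Re z)\<^sup>2 * (norm f)\<^sup>2"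
      unfolding power2_norm_eq_inner
      by (simp add: inner_diff_left inner_diff_right inner_commute power2_eq_square algebra_simps)
    moreover have "Re z * (f \<bullet> g) \<le> 0"
      using T_nonneg[OF that] neg by (simp add: mult_nonpos_nonneg)
    ultimately have "(Re z)\<^sup>2 * (norm f)\<^sup>2 \<le> (norm (g - Re z *\<^sub>R f))\<^sup>2"
      using zero_le_power2[of "norm g"] by linarith
    then show ?thesis unfolding norm_shift[OF that] using neg True by (simp add: field_simps)
  qed
  then show ?thesis unfolding below_def by (intro exI[of _ "1 / (Re z)\<^sup>2"]) auto
qed

text \<open>With (T + 1) k = x + y, symmetry makes x - k orthogonal to the range of T + 1, which is
  the whole space. Hence T contains its adjoint.\<close>

lemma adjoint_in_T:
  assumes "\<And>f g. (f, g) \<in> T \<Longrightarrow> g \<bullet> x = f \<bullet> y"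
  shows "(x, y) \<in> T"
proof -
  obtain k where k: "(k, (x + y) - k) \<in> T" using T_surj by blast
  have "(f + g) \<bullet> (x - k) = 0" if "(f, g) \<in> T" for f g
    using assms[OF that] T_sym[OF that k]
    by (simp add: inner_add_left inner_diff_right inner_add_right)
  moreover obtain f where "(f, (x - k) - f) \<in> T" using T_surj by blast
  ultimately have "(f + ((x - k) - f)) \<bullet> (x - k) = 0" by blast
  then have "x = k" by simp
  with k show ?thesis by simp
qed

text \<open>A vector orthogonal to the range of T - z is by \<open>adjoint_in_T\<close> an
  eigenvector at \<open>cnj z\<close>; that point also lies off the half-line, so the vector is zero
  and the range is dense.\<close>

lemma res_off_halfline:
  assumes z: "Im z \<noteq> 0 \<or> Re z < 0"
  shows "res z"
proof -
  have b: "below z" by (rule below_off_halfline[OF z])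
  then obtain C where C: "\<And>f g. (f, g) \<in> T \<Longrightarrow> (norm f)\<^sup>2 \<le> C * (norm (g - cm z f))\<^sup>2"
    unfolding below_def by blast
  have "\<exists>f g. (f, g) \<in> T \<and> g - cm z f = h" for h
  proof (rule linear_relation_surj[OF T_subspace T_closed bounded_linear_cm C])
    fix x assume x: "\<And>f g. (f, g) \<in> T \<Longrightarrow> (g - cm z f) \<bullet> x = 0"
    have "(x, cm (cnj z) x) \<in> T"
    proof (rule adjoint_in_T)
      fix f g assume "(f, g) \<in> T"
      from x[OF this] show "g \<bullet> x = f \<bullet> cm (cnj z) x"
        by (simp add: cm_def inner_diff_left inner_add_left inner_add_right inner_diff_right J_skew)
    qed
    moreover have "below (cnj z)" using z by (intro below_off_halfline) auto
    ultimately show "x = 0" unfolding below_def by fastforce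
  qed
  then show ?thesis using b unfolding res_def by fast
qed

text \<open>If T has an inverse of norm at most K, then its form is at least 1/K: evaluate the form
  at f - (1/K) T^-1 f. Functions of small Rayleigh quotient therefore place 0 in the
  spectrum.\<close>

lemma res_zero_form_bound:
  assumes "res 0"
  shows "\<exists>C>0. \<forall>(f, g)\<in>T. (norm f)\<^sup>2 \<le> C * (f \<bullet> g)"
proof -
  obtain C where C: "\<And>f g. (f, g) \<in> T \<Longrightarrow> (norm f)\<^sup>2 \<le> C * (norm g)\<^sup>2"
    and surj: "\<And>h. \<exists>f. (f, h) \<in> T"
    using assms unfolding res_def below_def cm_def by fastforce
  define K where "K = sqrt (\<bar>C\<bar> + 1)"
  have K: "K > 0" by (simp add: K_def)
  have "(norm f)\<^sup>2 \<le> K * (f \<bullet> g)" if fg: "(f, g) \<in> T" for f g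
  proof -
    obtain k where k: "(k, f) \<in> T" using surj by blast
    have "(norm k)\<^sup>2 \<le> (\<bar>C\<bar> + 1) * (norm f)\<^sup>2"
      by (rule order_trans[OF C[OF k]]) (intro mult_right_mono, auto)
    then have "norm k \<le> sqrt ((\<bar>C\<bar> + 1) * (norm f)\<^sup>2)" by (rule real_le_rsqrt)
    then have "norm k \<le> K * norm f" by (simp add: K_def real_sqrt_mult)
    then have "k \<bullet> f \<le> K * (norm f)\<^sup>2"
      using norm_cauchy_schwarz[of k f] mult_right_mono[of "norm k" "K * norm f" "norm f"]
      by (simp add: power2_eq_square mult.assoc)
    moreover have "(f - (1/K) *\<^sub>R k, g - (1/K) *\<^sub>R f) \<in> T" by (intro T_diff T_scale fg k)
    then have "0 \<le> (f - (1/K) *\<^sub>R k) \<bullet> (g - (1/K) *\<^sub>R f)" by (rule T_nonneg)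
    moreover have "k \<bullet> g = f \<bullet> f" using T_sym[OF fg k] by (simp add: inner_commute)
    moreover have "(f - (1/K) *\<^sub>R k) \<bullet> (g - (1/K) *\<^sub>R f)
      = f \<bullet> g - (2/K) * (f \<bullet> f) + (1/K)\<^sup>2 * (k \<bullet> f)"
      using \<open>k \<bullet> g = f \<bullet> f\<close>
      by (simp add: inner_diff_left inner_diff_right power2_eq_square diff_divide_distrib)
    ultimately have "0 \<le> f \<bullet> g - (2/K) * (norm f)\<^sup>2 + (1/K)\<^sup>2 * (k \<bullet> f)" "k \<bullet> f \<le> K * (norm f)\<^sup>2"
      unfolding power2_norm_eq_inner by simp_all
    moreover from this(2) have "(1/K)\<^sup>2 * (k \<bullet> f) \<le> (1/K)\<^sup>2 * (K * (norm f)\<^sup>2)" by (intro mult_left_mono) auto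
    moreover have "(1/K)\<^sup>2 * (K * (norm f)\<^sup>2) = (norm f)\<^sup>2 / K" using K by (simp add: power2_eq_square)
    moreover have "(2/K) * (norm f)\<^sup>2 = (norm f)\<^sup>2 / K + (norm f)\<^sup>2 / K" by simp
    ultimately have "(norm f)\<^sup>2 / K \<le> f \<bullet> g" by linarith
    then show ?thesis using K by (simp add: field_simps)
  qed
  with K show ?thesis by (intro exI[of _ K]) auto
qed

text \<open>The operator (T + 1)^-1. Nonnegativity makes T + 1 injective, so the choice is
  determined.\<close>

definition B :: "'h \<Rightarrow> 'h" where "B h = (SOME f. (f, h - f) \<in> T)"

lemma B_T: "(B h, h - B h) \<in> T"
  unfolding B_def by (rule someI_ex) (rule T_surj)

lemma B_unique:
  assumes "(f, h - f) \<in> T" shows "B h = f"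
proof -
  have "(B h - f, (h - B h) - (h - f)) \<in> T" by (rule T_diff[OF B_T assms])
  from T_nonneg[OF this] have "0 \<le> - ((B h - f) \<bullet> (B h - f))"
    by (simp add: inner_diff_left inner_diff_right)
  then have "(B h - f) \<bullet> (B h - f) = 0" using inner_ge_zero[of "B h - f"] by linarith
  then show ?thesis by simp
qed

lemma B_of_T: "(f, g) \<in> T \<Longrightarrow> B (f + g) = f"
  by (rule B_unique) simp

lemma B_norm_le_inner: "(norm (B x))\<^sup>2 \<le> B x \<bullet> x"
  using T_nonneg[OF B_T[of x]] by (simp add: inner_diff_right power2_norm_eq_inner)

sublocale B: bounded_symmetric B 1
proof (rule bounded_symmetric.intro)
  show "linear B"
  proof (rule linearI)
    show "B (x + y) = B x + B y" for x y
      by (rule B_unique) (use T_add[OF B_T[of x] B_T[of y]] in \<open>simp add: algebra_simps\<close>)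
    show "B (c *\<^sub>R x) = c *\<^sub>R B x" for c x
      by (rule B_unique) (use T_scale[OF B_T[of x], of c] in \<open>simp add: algebra_simps\<close>)
  qed
  show "B x \<bullet> y = x \<bullet> B y" for x y
    using T_sym[OF B_T[of x] B_T[of y]] by (simp add: inner_diff_left inner_diff_right)
  show "norm (B x) \<le> 1 * norm x" for x
  proof (cases "B x = 0")
    case False
    have "norm (B x) * norm (B x) \<le> norm (B x) * norm x"
      using B_norm_le_inner[of x] norm_cauchy_schwarz[of "B x" x] by (simp add: power2_eq_square)
    then show ?thesis using False by simp
  qed simp
qed

lemma B_nonneg: "0 \<le> B x \<bullet> x"
  using B_norm_le_inner[of x] by (metis order_trans zero_le_power2)

text \<open>Nonnegativity of \<open>B\<close> at h - (K + 1) g with h = (T + 1) g. It amounts to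
  |g|^4 \<le> <B g, g> <(T + 1) g, g>, the Cauchy-Schwarz inequality between T + 1 and its
  inverse.\<close>

lemma B_lower:
  assumes "(g, g') \<in> T" "g \<bullet> g' \<le> K * (norm g)\<^sup>2" "K \<ge> 0"
  shows "(norm g)\<^sup>2 / (K + 1) \<le> B g \<bullet> g"
proof -
  define h where "h = g + g'"
  define q where "q = (norm g)\<^sup>2"
  define M where "M = K + 1"
  have M: "M > 0" using assms(3) by (simp add: M_def)
  have Bh: "B h = g" unfolding h_def by (rule B_of_T[OF assms(1)])
  have p: "g \<bullet> h \<le> M * q"
    using assms(2) by (simp add: h_def q_def M_def inner_add_right power2_norm_eq_inner algebra_simps)
  have "h \<bullet> B g = q"
    using B.sym[of h g] Bh by (simp add: q_def power2_norm_eq_inner)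
  moreover have "g \<bullet> g = q" by (simp add: q_def power2_norm_eq_inner)
  ultimately have "B (h - M *\<^sub>R g) \<bullet> (h - M *\<^sub>R g) = g \<bullet> h - 2 * M * q + M\<^sup>2 * (B g \<bullet> g)"
    by (simp add: B.diff B.scale Bh inner_diff_left inner_diff_right inner_commute power2_eq_square
        algebra_simps)
  with B_nonneg[of "h - M *\<^sub>R g"] p have "M * q \<le> M * (M * (B g \<bullet> g))"
    by (simp add: power2_eq_square)
  then have "q \<le> M * (B g \<bullet> g)" using M by simp
  then show ?thesis unfolding q_def[symmetric] M_def[symmetric] using M by (simp add: field_simps)
qed

text \<open>\<open>s\<close> is the supremum of the quadratic form of \<open>B\<close> modulo subspaces of finite
  codimension; near-maximisers orthogonal to enough vectors are approximate eigenvectors.\<close>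
lemma weyl_sequence:
  assumes S: "subspace S" "\<And>F. finite F \<Longrightarrow> \<not> S \<subseteq> span F"
    and \<delta>: "\<delta> > 0" "\<And>g. g \<in> S \<Longrightarrow> \<delta> * (norm g)\<^sup>2 \<le> B g \<bullet> g"
  obtains s where "s \<ge> \<delta>" "\<And>F \<epsilon>. finite F \<Longrightarrow> \<epsilon> > 0 \<Longrightarrow>
    \<exists>g. norm g = 1 \<and> (\<forall>x\<in>F. x \<bullet> g = 0) \<and> norm (B g - s *\<^sub>R g) \<le> \<epsilon>"
    "\<And>\<epsilon>. \<epsilon> > 0 \<Longrightarrow> \<exists>F. finite F \<and> (\<forall>g. (\<forall>x\<in>F. x \<bullet> g = 0) \<longrightarrow> B g \<bullet> g \<le> (s + \<epsilon>) * (norm g)\<^sup>2)"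
proof -
  define U where "U = {t. \<exists>F. finite F \<and> (\<forall>g. (\<forall>x\<in>F. x \<bullet> g = 0) \<longrightarrow> B g \<bullet> g \<le> t * (norm g)\<^sup>2)}"
  have lower: "\<delta> \<le> t" if "t \<in> U" for t
  proof -
    from that obtain F where F: "finite F" "\<forall>g. (\<forall>x\<in>F. x \<bullet> g = 0) \<longrightarrow> B g \<bullet> g \<le> t * (norm g)\<^sup>2"
      unfolding U_def by blast
    obtain g where g: "g \<in> S" "g \<noteq> 0" "\<forall>x\<in>F. x \<bullet> g = 0"
      using infinite_dim_orthogonal[OF S F(1)] by blast
    have "\<delta> * (norm g)\<^sup>2 \<le> t * (norm g)\<^sup>2" using F(2) g(3) \<delta>(2)[OF g(1)] by fastforce
    then show ?thesis using g(2) by simp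
  qed
  have "1 \<in> U"
  proof -
    have "B g \<bullet> g \<le> 1 * (norm g)\<^sup>2" for g
      using norm_cauchy_schwarz[of "B g" g] mult_right_mono[OF B.bound[of g], of "norm g"]
      by (simp add: power2_eq_square)
    then show ?thesis unfolding U_def by (intro CollectI exI[of _ "{}"]) simp
  qed
  then have Une: "U \<noteq> {}" by blast
  have Ubdd: "bdd_below U" using lower by (rule bdd_belowI)
  define s where "s = Inf U"
  have s: "s \<ge> \<delta>" unfolding s_def by (rule cInf_greatest[OF Une lower])
  have near_s: "\<exists>F. finite F \<and> (\<forall>g. (\<forall>x\<in>F. x \<bullet> g = 0) \<longrightarrow> B g \<bullet> g \<le> (s + \<epsilon>) * (norm g)\<^sup>2)" if \<epsilon>: "\<epsilon> > 0" for \<epsilon>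
  proof -
    have "\<exists>t\<in>U. t < s + \<epsilon>" using cInf_lessD[OF Une, of "s + \<epsilon>"] \<epsilon> by (auto simp: s_def)
    then obtain t F1 where t: "t < s + \<epsilon>" and F1: "finite F1" "\<forall>g. (\<forall>x\<in>F1. x \<bullet> g = 0) \<longrightarrow> B g \<bullet> g \<le> t * (norm g)\<^sup>2"
      unfolding U_def by blast
    have "B g \<bullet> g \<le> (s + \<epsilon>) * (norm g)\<^sup>2" if "\<forall>x\<in>F1. x \<bullet> g = 0" for g
      using F1(2)[rule_format, of g] that mult_right_mono[of t "s + \<epsilon>" "(norm g)\<^sup>2"] t by simp
    with F1(1) show ?thesis by blast
  qed
  show ?thesis
  proof (rule that[OF s])
    fix F :: "'h set" and \<epsilon> :: real assume F: "finite F" and \<epsilon>: "\<epsilon> > 0"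
    \<comment> \<open>With \<epsilon>' \<le> 1 this exceeds the norm bound 1 + |s + \<epsilon>'| of
      (s + \<epsilon>') - B. The choice of \<epsilon>' then gives a squared residual of at most 2 M
      \<epsilon>' \<le> (\<epsilon>/2)^2; the other half of \<epsilon> pays for replacing s +
      \<epsilon>' by s.\<close>
    define M where "M = s + 3"
    define \<epsilon>' where "\<epsilon>' = min 1 (\<epsilon>\<^sup>2 / (8 * M))"
    have M: "M > 0" using s \<delta> by (simp add: M_def)
    have \<epsilon>': "0 < \<epsilon>'" "\<epsilon>' \<le> 1" "8 * M * \<epsilon>' \<le> \<epsilon>\<^sup>2"
      using \<epsilon> M by (auto simp: \<epsilon>'_def min_def field_simps)
    obtain F1 where F1: "finite F1" "\<forall>g. (\<forall>x\<in>F1. x \<bullet> g = 0) \<longrightarrow> B g \<bullet> g \<le> (s + \<epsilon>') * (norm g)\<^sup>2"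
      using near_s[OF \<epsilon>'(1)] by blast
    then have F1': "B g \<bullet> g \<le> (s + \<epsilon>') * (norm g)\<^sup>2" if "\<forall>x\<in>F1. x \<bullet> g = 0" for g
      using that by blast
    define F2 where "F2 = F \<union> F1 \<union> B ` F1"
    have "finite F2" using F F1 by (simp add: F2_def)
    moreover have "s - \<epsilon>' \<notin> U" using cInf_lower[OF _ Ubdd, of "s - \<epsilon>'"] \<epsilon>'(1) by (auto simp: s_def)
    ultimately obtain g0 where g0: "\<forall>x\<in>F2. x \<bullet> g0 = 0" "\<not> B g0 \<bullet> g0 \<le> (s - \<epsilon>') * (norm g0)\<^sup>2"
      unfolding U_def by blast
    then have g0n: "g0 \<noteq> 0" by (auto simp: B.zero)
    define g where "g = (1 / norm g0) *\<^sub>R g0"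
    have g: "norm g = 1" "\<forall>x\<in>F2. x \<bullet> g = 0" using g0 g0n by (auto simp: g_def)
    have "B g \<bullet> g = (B g0 \<bullet> g0) / (norm g0)\<^sup>2" by (simp add: g_def B.scale power2_eq_square)
    then have gB: "s - \<epsilon>' < B g \<bullet> g" using g0(2) g0n by (simp add: pos_less_divide_eq)
    interpret A: bounded_symmetric "\<lambda>x. (s + \<epsilon>') *\<^sub>R x - B x" "1 + \<bar>s + \<epsilon>'\<bar>"
    proof (rule bounded_symmetric.intro)
      interpret D: bounded_symmetric "\<lambda>x. B x - (s + \<epsilon>') *\<^sub>R x" "1 + \<bar>s + \<epsilon>'\<bar>" by (rule B.shift_bounded_symmetric)
      show "linear (\<lambda>x. (s + \<epsilon>') *\<^sub>R x - B x)"
        by (rule linearI) (simp_all add: B.add B.scale algebra_simps)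
      show "((s + \<epsilon>') *\<^sub>R x - B x) \<bullet> y = x \<bullet> ((s + \<epsilon>') *\<^sub>R y - B y)" for x y
        using D.sym[of x y] by (simp add: inner_diff_left inner_diff_right)
      show "norm ((s + \<epsilon>') *\<^sub>R x - B x) \<le> (1 + \<bar>s + \<epsilon>'\<bar>) * norm x" for x
        using D.bound[of x] by (simp add: norm_minus_commute[of "_ *\<^sub>R x"])
    qed
    let ?A = "\<lambda>x. (s + \<epsilon>') *\<^sub>R x - B x"
    have orth: "\<forall>x\<in>F1. x \<bullet> (g - (1/M) *\<^sub>R ?A g) = 0"
    proof
      fix x assume x: "x \<in> F1"
      have "x \<bullet> B g = 0" using g(2) x B.sym[of x g] by (simp add: F2_def)
      moreover have "x \<bullet> g = 0" using g(2) x by (simp add: F2_def)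
      ultimately show "x \<bullet> (g - (1/M) *\<^sub>R ?A g) = 0" by (simp add: inner_diff_right)
    qed
    have "(norm (?A g))\<^sup>2 \<le> M * (?A g \<bullet> g)"
    proof (rule A.norm_power2_le[OF M])
      show "1 + \<bar>s + \<epsilon>'\<bar> \<le> M" using s \<delta> \<epsilon>' by (simp add: M_def)
      show "0 \<le> ?A (g - (1/M) *\<^sub>R ?A g) \<bullet> (g - (1/M) *\<^sub>R ?A g)"
        using F1'[OF orth] by (simp add: inner_diff_left[of "(s + \<epsilon>') *\<^sub>R _"] power2_norm_eq_inner)
    qed
    also have "?A g \<bullet> g = (s + \<epsilon>') - B g \<bullet> g"
      using g(1) by (simp add: inner_diff_left norm_eq_1)
    also have "M * ((s + \<epsilon>') - B g \<bullet> g) \<le> M * (2 * \<epsilon>')" using gB M by (intro mult_left_mono) auto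
    finally have "(norm (?A g))\<^sup>2 \<le> (\<epsilon> / 2)\<^sup>2" using \<epsilon>'(3) by (simp add: power_divide)
    then have 1: "norm (?A g) \<le> \<epsilon> / 2" using \<epsilon> by (simp add: power2_le_iff_abs_le)
    have "\<epsilon>' \<le> \<epsilon> / 2"
    proof (rule power2_le_imp_le)
      have "\<epsilon>'\<^sup>2 \<le> \<epsilon>'" using \<epsilon>' by (simp add: power2_eq_square mult_left_le_one_le)
      also have "4 * \<epsilon>' \<le> 8 * M * \<epsilon>'" using \<epsilon>'(1) s \<delta> by (intro mult_right_mono) (auto simp: M_def)
      finally show "\<epsilon>'\<^sup>2 \<le> (\<epsilon> / 2)\<^sup>2" using \<epsilon>'(3) by (simp add: power_divide)
    qed (use \<epsilon> in auto)
    moreover have "norm (B g - s *\<^sub>R g) \<le> norm (?A g) + norm (\<epsilon>' *\<^sub>R g)"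
    proof -
      have "B g - s *\<^sub>R g = \<epsilon>' *\<^sub>R g - ?A g" by (simp add: algebra_simps)
      then show ?thesis using norm_triangle_ineq4[of "\<epsilon>' *\<^sub>R g" "?A g"] by (metis add.commute)
    qed
    ultimately have "norm (B g - s *\<^sub>R g) \<le> \<epsilon>" using 1 g(1) \<epsilon>'(1) by simp
    moreover have "\<forall>x\<in>F. x \<bullet> g = 0" using g(2) by (simp add: F2_def)
    ultimately show "\<exists>g. norm g = 1 \<and> (\<forall>x\<in>F. x \<bullet> g = 0) \<and> norm (B g - s *\<^sub>R g) \<le> \<epsilon>"
      using g(1) by blast
  qed (rule near_s)
qed

text \<open>For f = B x one has (T - t) f = -(t + 1) (B - 1/(t + 1)) x. A bound on f alone is not
  enough, but x = (T - t) f + (t + 1) f recovers the norm of x.\<close>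

lemma below_transfer:
  assumes b: "below (complex_of_real t)" and t: "t > -1"
  shows "\<exists>k>0. \<forall>x. k * norm x \<le> norm (B x - (1 / (t + 1)) *\<^sub>R x)"
proof -
  obtain C0 where C0: "\<And>f g. (f, g) \<in> T \<Longrightarrow> (norm f)\<^sup>2 \<le> C0 * (norm (g - t *\<^sub>R f))\<^sup>2"
    using b unfolding below_def cm_def by fastforce
  define C where "C = sqrt (\<bar>C0\<bar> + 1)"
  have Cpos: "C > 0" by (simp add: C_def)
  have C: "norm f \<le> C * norm (g - t *\<^sub>R f)" if "(f, g) \<in> T" for f g
  proof -
    have "(norm f)\<^sup>2 \<le> (\<bar>C0\<bar> + 1) * (norm (g - t *\<^sub>R f))\<^sup>2"
      by (rule order_trans[OF C0[OF that]]) (intro mult_right_mono, auto)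
    then have "norm f \<le> sqrt ((\<bar>C0\<bar> + 1) * (norm (g - t *\<^sub>R f))\<^sup>2)" by (rule real_le_rsqrt)
    then show ?thesis by (simp add: C_def real_sqrt_mult)
  qed
  define k where "k = 1 / ((1 + (t + 1) * C) * (t + 1))"
  have den: "1 + (t + 1) * C > 0" using t Cpos by (simp add: add_pos_nonneg)
  have "k * norm x \<le> norm (B x - (1 / (t + 1)) *\<^sub>R x)" for x
  proof -
    let ?y = "(x - B x) - t *\<^sub>R B x"
    define u where "u = (1 / (t + 1)) *\<^sub>R x"
    have u: "(t + 1) *\<^sub>R u = x" using t by (simp add: u_def)
    have "norm x \<le> norm ?y + norm ((t + 1) *\<^sub>R B x)"
      using norm_triangle_ineq[of ?y "(t + 1) *\<^sub>R B x"] by (simp add: algebra_simps)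
    also have "\<dots> \<le> norm ?y + (t + 1) * (C * norm ?y)"
      using C[OF B_T[of x]] t by (simp add: mult_left_mono)
    also have "\<dots> = (1 + (t + 1) * C) * norm ?y" by (simp add: algebra_simps)
    also have "?y = (t + 1) *\<^sub>R u - (t + 1) *\<^sub>R B x"
      by (subst u) (simp add: algebra_simps)
    also have "\<dots> = - (t + 1) *\<^sub>R (B x - u)"
      by (simp add: algebra_simps)
    also have "norm \<dots> = (t + 1) * norm (B x - u)" unfolding norm_scaleR using t by simp
    finally have "norm x \<le> ((1 + (t + 1) * C) * (t + 1)) * norm (B x - u)" by (simp only: mult.assoc)
    then show ?thesis using den t unfolding k_def u_def by (simp add: pos_divide_le_eq mult.commute)
  qed
  moreover have "k > 0" using den t by (simp add: k_def)
  ultimately show ?thesis by blast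
qed

text \<open>The energy bound on \<open>S\<close> keeps the number \<open>s\<close> of
  \<open>weyl_sequence\<close> positive, so \<open>lam = 1 / s - 1\<close> exists. Approximate
  eigenvectors at \<open>s\<close> avoiding any finite set, combined with isolation, give an
  eigenspace of infinite dimension; \<open>finite_positive_part\<close> then improves s + \<eta>/2
  to s off finitely many directions.\<close>

theorem infinite_multiplicity_bottom:
  assumes S: "subspace S" "\<And>F. finite F \<Longrightarrow> \<not> S \<subseteq> span F"
    and K: "K \<ge> 0" "\<And>g. g \<in> S \<Longrightarrow> \<exists>g'. (g, g') \<in> T \<and> g \<bullet> g' \<le> K * (norm g)\<^sup>2"
    and isol: "\<And>t::real. \<not> below (complex_of_real t) \<Longrightarrow>
      \<exists>\<epsilon>>0. \<forall>t'::real. t' \<noteq> t \<longrightarrow> \<bar>t' - t\<bar> < \<epsilon> \<longrightarrow> below (complex_of_real t')"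
  obtains lam :: real where "lam > -1"
    "\<And>F. finite F \<Longrightarrow> \<exists>f. (f, lam *\<^sub>R f) \<in> T \<and> f \<notin> span F"
    "\<exists>F. finite F \<and> (\<forall>g. (\<forall>x\<in>F. x \<bullet> g = 0) \<longrightarrow> (lam + 1) * (B g \<bullet> g) \<le> (norm g)\<^sup>2)"
proof -
  define \<delta> where "\<delta> = 1 / (K + 1)"
  have \<delta>: "\<delta> > 0" using K by (simp add: \<delta>_def)
  have low: "\<delta> * (norm g)\<^sup>2 \<le> B g \<bullet> g" if "g \<in> S" for g
    using K(2)[OF that] B_lower[of g _ K] K(1) by (auto simp: \<delta>_def)
  obtain s where s: "s \<ge> \<delta>" and weyl: "\<And>F \<epsilon>. finite F \<Longrightarrow> \<epsilon> > 0 \<Longrightarrow>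
      \<exists>g. norm g = 1 \<and> (\<forall>x\<in>F. x \<bullet> g = 0) \<and> norm (B g - s *\<^sub>R g) \<le> \<epsilon>"
    and fin: "\<And>\<epsilon>. \<epsilon> > 0 \<Longrightarrow> \<exists>F. finite F \<and> (\<forall>g. (\<forall>x\<in>F. x \<bullet> g = 0) \<longrightarrow> B g \<bullet> g \<le> (s + \<epsilon>) * (norm g)\<^sup>2)"
    using weyl_sequence[OF S \<delta> low] by metis
  have s0: "s > 0" using s \<delta> by simp
  define lam where "lam = 1 / s - 1"
  have nb: "\<not> (\<exists>k>0. \<forall>x. k * norm x \<le> norm (B x - s *\<^sub>R x))"
  proof
    assume "\<exists>k>0. \<forall>x. k * norm x \<le> norm (B x - s *\<^sub>R x)"
    then obtain k where k: "k > 0" "\<And>x. k * norm x \<le> norm (B x - s *\<^sub>R x)" by blast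
    obtain g where "norm g = 1" "norm (B g - s *\<^sub>R g) \<le> k / 2"
      using weyl[of "{}" "k/2"] k(1) by auto
    with k(2)[of g] k(1) show False by simp
  qed
  \<comment> \<open>Isolation is pulled back along b -> 1/b - 1. Restricting to |r| < b keeps b + r
    positive, where this map is continuous and injective.\<close>
  have isolB: "\<exists>\<eta>>0. \<forall>r. r \<noteq> 0 \<longrightarrow> \<bar>r\<bar> < \<eta> \<longrightarrow> (\<exists>k>0. \<forall>x. k * norm x \<le> norm (B x - b *\<^sub>R x - r *\<^sub>R x))"
    if b: "b > 0" and nb: "\<not> (\<exists>k>0. \<forall>x. k * norm x \<le> norm (B x - b *\<^sub>R x))" for b
  proof -
    have "\<not> below (complex_of_real (1 / b - 1))"
      using below_transfer[of "1 / b - 1"] b nb by auto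
    then obtain \<epsilon> where \<epsilon>: "\<epsilon> > 0" "\<And>t::real. t \<noteq> 1 / b - 1 \<Longrightarrow> \<bar>t - (1 / b - 1)\<bar> < \<epsilon> \<Longrightarrow> below (complex_of_real t)"
      using isol by blast
    have "((\<lambda>r. 1 / (b + r) - 1) \<longlongrightarrow> 1 / (b + 0) - 1) (at 0)"
      using b by (intro tendsto_intros) auto
    then have "\<forall>\<^sub>F r in at 0. dist (1 / (b + r) - 1) (1 / b - 1) < \<epsilon>"
      using \<epsilon> by (intro tendstoD) simp_all
    then obtain d where d: "d > 0" "\<And>r. r \<noteq> 0 \<Longrightarrow> \<bar>r\<bar> < d \<Longrightarrow> \<bar>(1 / (b + r) - 1) - (1 / b - 1)\<bar> < \<epsilon>"
      by (auto simp: eventually_at dist_real_def)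
    have "\<exists>k>0. \<forall>x. k * norm x \<le> norm (B x - b *\<^sub>R x - r *\<^sub>R x)" if "r \<noteq> 0" "\<bar>r\<bar> < min d b" for r
    proof -
      have sr: "b + r > 0" using that(2) by (auto simp: abs_less_iff)
      have "1 / (b + r) - 1 \<noteq> 1 / b - 1" using sr b that(1) by simp
      then have "below (complex_of_real (1 / (b + r) - 1))"
        using d(2)[OF that(1)] that(2) by (intro \<epsilon>(2)) auto
      from below_transfer[OF this] sr show ?thesis by (simp add: algebra_simps)
    qed
    then show ?thesis using d(1) b by (intro exI[of _ "min d b"]) auto
  qed
  obtain \<eta> where \<eta>: "\<eta> > 0" "\<And>r. r \<noteq> 0 \<Longrightarrow> \<bar>r\<bar> < \<eta> \<Longrightarrow> \<exists>k>0. \<forall>x. k * norm x \<le> norm (B x - s *\<^sub>R x - r *\<^sub>R x)"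
    using isolB[OF s0 nb] by blast
  show ?thesis
  proof (rule that[of lam])
    show "lam > -1" using s0 by (simp add: lam_def)
    fix F :: "'h set" assume F: "finite F"
    show "\<exists>f. (f, lam *\<^sub>R f) \<in> T \<and> f \<notin> span F"
    proof (rule ccontr)
      assume "\<not> ?thesis"
      then have eig: "\<And>f. (f, lam *\<^sub>R f) \<in> T \<Longrightarrow> f \<in> span F" by blast
      interpret A: bounded_symmetric "\<lambda>x. B x - s *\<^sub>R x" "1 + \<bar>s\<bar>" by (rule B.shift_bounded_symmetric)
      obtain g where g: "norm g = 1" "\<forall>x\<in>F. x \<bullet> g = 0" "norm (B g - s *\<^sub>R g) \<le> \<eta> / 2"
        using weyl[OF F, of "\<eta>/2"] \<eta> by auto
      \<comment> \<open>If \<open>span F\<close> held every eigenvector at \<open>lam\<close>, then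
        \<open>g\<close>, orthogonal to \<open>F\<close>, would be orthogonal to the kernel of B -
        s, and isolation would bound (B - s) g below by \<eta>, twice its actual bound.\<close>
      have "\<eta> * norm g \<le> norm (B g - s *\<^sub>R g)"
      proof (rule A.isolated_zero_bounded_below[OF \<eta>])
        fix x assume "B x - s *\<^sub>R x = 0"
        then have Bx: "B x = s *\<^sub>R x" by simp
        have "((1/s) *\<^sub>R (B x), (1/s) *\<^sub>R (x - B x)) \<in> T" by (rule T_scale[OF B_T])
        then have "(x, lam *\<^sub>R x) \<in> T" using s0 by (simp add: Bx lam_def algebra_simps)
        then have "x \<in> span F" by (rule eig)
        then show "x \<bullet> g = 0"
        proof (induction rule: span_induct)
          show "subspace {x. x \<bullet> g = 0}" by (auto intro!: subspaceI simp: inner_add_left)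
        qed (use g(2) in auto)
      qed auto
      with g \<eta> show False by simp
    qed
  next
    obtain F1 where F1: "finite F1" "\<And>g. (\<forall>x\<in>F1. x \<bullet> g = 0) \<Longrightarrow> B g \<bullet> g \<le> (s + \<eta> / 2) * (norm g)\<^sup>2"
      using fin[of "\<eta> / 2"] \<eta>(1) by auto
    have "\<exists>F. finite F \<and> (\<forall>g. (\<forall>x\<in>F. x \<bullet> g = 0) \<longrightarrow> B g \<bullet> g \<le> s * (norm g)\<^sup>2)"
    proof (rule B.finite_positive_part[OF \<eta>(1) _ _ F1])
      show "\<exists>k>0. \<forall>x. k * norm x \<le> norm (B x - (s + r) *\<^sub>R x)" if "0 < r" "r < \<eta>" for r
        using \<eta>(2)[of r] that by (simp add: algebra_simps)
    qed (use isolB s0 in auto)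
    moreover have "(lam + 1) * t \<le> n" if "t \<le> s * n" for t n :: real
      using mult_left_mono[OF that, of "1 / s"] s0 by (simp add: lam_def)
    ultimately show "\<exists>F. finite F \<and> (\<forall>g. (\<forall>x\<in>F. x \<bullet> g = 0) \<longrightarrow> (lam + 1) * (B g \<bullet> g) \<le> (norm g)\<^sup>2)"
      by blast
  qed
qed

end

text \<open>\<open>R x c\<close> reads: the vector \<open>x\<close> is represented by the coefficients \<open>c\<close>, which vanish
  outside the finite index set \<open>P\<close>.\<close>
lemma finite_span_of_coefficients:
  fixes J :: "'h::real_vector \<Rightarrow> 'h" and R :: "'h \<Rightarrow> ('b \<Rightarrow> complex) \<Rightarrow> bool"
  assumes P: "finite P"
    and R_zero: "\<And>x. R x (\<lambda>b. 0) \<Longrightarrow> x = 0"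
    and R_diff: "\<And>x y c d. R x c \<Longrightarrow> R y d \<Longrightarrow> R (x - y) (\<lambda>b. c b - d b)"
    and R_mult: "\<And>x c z. R x c \<Longrightarrow> R (Re z *\<^sub>R x + Im z *\<^sub>R J x) (\<lambda>b. z * c b)"
    and E: "subspace E" "\<And>x. x \<in> E \<Longrightarrow> J x \<in> E"
    and rep: "\<And>x. x \<in> E \<Longrightarrow> \<exists>c. R x c \<and> (\<forall>b. b \<notin> P \<longrightarrow> c b = 0)"
  shows "\<exists>F. finite F \<and> E \<subseteq> span F"
  using P E rep
proof (induction P arbitrary: E)
  case empty
  have "x = 0" if x: "x \<in> E" for x
  proof -
    obtain c where c: "R x c" "\<forall>b. c b = 0" using empty(3)[OF x] by auto
    then have "c = (\<lambda>b. 0)" by auto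
    with c(1) R_zero show ?thesis by blast
  qed
  then have "E \<subseteq> span {}" by auto
  then show ?case by blast
next
  case (insert a P)
  \<comment> \<open>Induction on the index set: \<open>E0\<close> holds the vectors with a
    representation avoiding the index \<open>a\<close>. \<open>R\<close> is a relation, so one
    vector may have several coefficient families.\<close>
  define E0 where "E0 = {x \<in> E. \<exists>c. R x c \<and> (\<forall>b. b \<notin> P \<longrightarrow> c b = 0)}"
  have E: "subspace E" "\<And>x. x \<in> E \<Longrightarrow> J x \<in> E" by (fact insert.prems)+
  have comb: "Re z *\<^sub>R x + Im z *\<^sub>R J x \<in> E0" if x: "x \<in> E0" for x z
  proof -
    obtain c where c: "R x c" "\<forall>b. b \<notin> P \<longrightarrow> c b = 0" and xE: "x \<in> E" using x by (auto simp: E0_def)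
    have "Re z *\<^sub>R x + Im z *\<^sub>R J x \<in> E" using xE E by (intro subspace_add subspace_scale) auto
    moreover have "\<forall>b. b \<notin> P \<longrightarrow> z * c b = 0" using c(2) by simp
    ultimately show ?thesis using R_mult[OF c(1), of z] by (auto simp: E0_def)
  qed
  have diff: "x - y \<in> E0" if xy: "x \<in> E0" "y \<in> E0" for x y
  proof -
    obtain c d where c: "R x c" "\<forall>b. b \<notin> P \<longrightarrow> c b = 0" and d: "R y d" "\<forall>b. b \<notin> P \<longrightarrow> d b = 0"
      using xy by (auto simp: E0_def)
    have "x - y \<in> E" using xy E(1) by (intro subspace_diff) (auto simp: E0_def)
    moreover have "\<forall>b. b \<notin> P \<longrightarrow> c b - d b = 0" using c(2) d(2) by simp
    ultimately show ?thesis using R_diff[OF c(1) d(1)] by (auto simp: E0_def)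
  qed
  show ?case
  proof (cases "E0 = E")
    case True
    have "\<exists>F. finite F \<and> E0 \<subseteq> span F"
      by (rule insert.IH) (use True E in \<open>auto simp: E0_def\<close>)
    with True show ?thesis by simp
  next
    case False
    moreover have "E0 \<subseteq> E" by (auto simp: E0_def)
    ultimately obtain x1 where x1: "x1 \<in> E" "x1 \<notin> E0" by blast
    obtain c1 where c1: "R x1 c1" "\<forall>b. b \<notin> insert a P \<longrightarrow> c1 b = 0" using insert.prems(3)[OF x1(1)] by blast
    have c1a: "c1 a \<noteq> 0" using x1 c1 by (auto simp: E0_def)
    \<comment> \<open>Complex elimination of the coefficient at \<open>a\<close> by a multiple of
      \<open>x1\<close>; over the reals it costs the two vectors \<open>x1\<close> and
      \<open>J x1\<close>.\<close>
    have red: "\<exists>z. x - (Re z *\<^sub>R x1 + Im z *\<^sub>R J x1) \<in> E0" if x: "x \<in> E" for x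
    proof -
      obtain c where c: "R x c" "\<forall>b. b \<notin> insert a P \<longrightarrow> c b = 0" using insert.prems(3)[OF x] by blast
      define z where "z = c a / c1 a"
      have "R (x - (Re z *\<^sub>R x1 + Im z *\<^sub>R J x1)) (\<lambda>b. c b - z * c1 b)"
        by (rule R_diff[OF c(1) R_mult[OF c1(1)]])
      moreover have "\<forall>b. b \<notin> P \<longrightarrow> c b - z * c1 b = 0"
      proof (intro allI impI)
        fix b assume "b \<notin> P"
        then show "c b - z * c1 b = 0"
          using c(2) c1(2) c1a by (cases "b = a") (simp_all add: z_def)
      qed
      moreover have "x - (Re z *\<^sub>R x1 + Im z *\<^sub>R J x1) \<in> E"
        using x x1(1) E by (intro subspace_diff subspace_add subspace_scale) auto
      ultimately show ?thesis unfolding E0_def by blast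
    qed
    have "subspace E0"
    proof (rule subspaceI)
      \<comment> \<open>No representation of 0 is given in advance. It arises as the difference of
        an element of \<open>E0\<close> with itself, and \<open>red\<close> supplies such an
        element.\<close>
      show "0 \<in> E0"
      proof (cases "E0 = {}")
        case True
        obtain z where "0 - (Re z *\<^sub>R x1 + Im z *\<^sub>R J x1) \<in> E0" using red[of 0] subspace_0[OF E(1)] by blast
        with True show ?thesis by blast
      next
        case False
        then show ?thesis using diff by (metis diff_self ex_in_conv)
      qed
      then show "x + y \<in> E0" if "x \<in> E0" "y \<in> E0" for x y
        using diff[OF that(1) diff[OF \<open>0 \<in> E0\<close> that(2)]] by simp
      show "r *\<^sub>R x \<in> E0" if "x \<in> E0" for x r
        using comb[OF that, of "complex_of_real r"] by simp
    qed
    moreover have "J x \<in> E0" if "x \<in> E0" for x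
      using comb[OF that, of \<i>] by simp
    ultimately have "\<exists>F. finite F \<and> E0 \<subseteq> span F"
      by (intro insert.IH) (auto simp: E0_def)
    then obtain F where F: "finite F" "E0 \<subseteq> span F" by blast
    have "x \<in> span (F \<union> {x1, J x1})" if x: "x \<in> E" for x
    proof -
      obtain z where z: "x - (Re z *\<^sub>R x1 + Im z *\<^sub>R J x1) \<in> E0" using red[OF x] by blast
      then have "x - (Re z *\<^sub>R x1 + Im z *\<^sub>R J x1) \<in> span (F \<union> {x1, J x1})"
        using F(2) span_mono[of F "F \<union> {x1, J x1}"] by blast
      moreover have "Re z *\<^sub>R x1 + Im z *\<^sub>R J x1 \<in> span (F \<union> {x1, J x1})"
        by (intro span_add span_scale span_base) auto
      ultimately have "x - (Re z *\<^sub>R x1 + Im z *\<^sub>R J x1) + (Re z *\<^sub>R x1 + Im z *\<^sub>R J x1) \<in> span (F \<union> {x1, J x1})"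
        by (rule span_add)
      then show ?thesis by simp
    qed
    then show ?thesis using F(1) by (intro exI[of _ "F \<union> {x1, J x1}"]) auto
  qed
qed

section \<open>Analysis on a single edge: absolute continuity, interpolation, regularity,
  uniqueness\<close>

section \<open>Primitives on a compact interval\<close>

text \<open>Absolute continuity in integral form, matching the two layers of
  \<open>W22_with\<close>. The derivative is merely integrable, which covers the pair of first and
  second derivatives.\<close>

definition primitive_on :: "real \<Rightarrow> (real \<Rightarrow> complex) \<Rightarrow> (real \<Rightarrow> complex) \<Rightarrow> bool" where
  "primitive_on l F u \<longleftrightarrow> set_integrable lborel {0..l} u \<and> (\<forall>x\<in>{0..l}. F x = F 0 + (LBINT t:{0..x}. u t))"

lemma primitive_onD:
  assumes "primitive_on l F u"
  shows "set_integrable lborel {0..l} u" "\<And>x. x \<in> {0..l} \<Longrightarrow> F x = F 0 + (LBINT t:{0..x}. u t)"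
  using assms unfolding primitive_on_def by blast+

lemma primitive_on_eq_integral:
  assumes "primitive_on l F u" "x \<in> {0..l}"
  shows "F x = F 0 + integral {0..x} u"
proof -
  have "set_integrable lborel {0..x} u"
    by (rule set_integrable_subset[OF primitive_onD(1)[OF assms(1)]]) (use assms(2) in auto)
  then show ?thesis using primitive_onD(2)[OF assms] set_borel_integral_eq_integral(2) by metis
qed

lemma primitive_on_continuous:
  assumes "primitive_on l F u"
  shows "continuous_on {0..l} F"
proof -
  have "u integrable_on {0..l}"
    by (rule set_borel_integral_eq_integral(1)[OF primitive_onD(1)[OF assms]])
  then have "continuous_on {0..l} (\<lambda>x. F 0 + integral {0..x} u)"
    by (intro continuous_on_add continuous_on_const indefinite_integral_continuous_1)
  then show ?thesis
    by (rule continuous_on_eq) (rule primitive_on_eq_integral[OF assms, symmetric])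
qed

lemma primitive_on_deriv:
  assumes "primitive_on l F u" "continuous_on {0..l} u" "x \<in> {0..l}"
  shows "(F has_vector_derivative u x) (at x within {0..l})"
proof -
  have "((\<lambda>x. F 0 + integral {0..x} u) has_vector_derivative 0 + u x) (at x within {0..l})"
    by (intro has_vector_derivative_add has_vector_derivative_const integral_has_vector_derivative assms)
  then have "((\<lambda>x. F 0 + integral {0..x} u) has_vector_derivative u x) (at x within {0..l})" by simp
  from has_vector_derivative_transform[OF assms(3) primitive_on_eq_integral[OF assms(1)] this]
  show ?thesis by blast
qed

lemma primitive_onI_deriv:
  assumes deriv: "\<And>x. x \<in> {0..l} \<Longrightarrow> (F has_vector_derivative u x) (at x within {0..l})"
    and cont: "continuous_on {0..l} u"
  shows "primitive_on l F u"
  unfolding primitive_on_def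
proof (intro conjI ballI)
  show "set_integrable lborel {0..l} u" by (rule borel_integrable_atLeastAtMost'[OF cont])
  fix x assume x: "x \<in> {0..l}"
  have "(LBINT t:{0..x}. u t) = F x - F 0"
    unfolding set_lebesgue_integral_def
  proof (rule integral_FTC_atLeastAtMost)
    show "continuous_on {0..x} u" by (rule continuous_on_subset[OF cont]) (use x in auto)
    show "(F has_vector_derivative u y) (at y within {0..x})" if "0 \<le> y" "y \<le> x" for y
      by (rule has_vector_derivative_within_subset[OF deriv]) (use x that in auto)
  qed (use x in auto)
  then show "F x = F 0 + (LBINT t:{0..x}. u t)" by simp
qed

lemma primitive_onI_integral:
  assumes "set_integrable lborel {0..l} u"
  shows "primitive_on l (\<lambda>x. LBINT t:{0..x}. u t) u"
proof -
  have "(LBINT t:{0..0}. u t) = 0"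
    unfolding set_lebesgue_integral_def
    by (rule integral_eq_zero_AE) (use AE_lborel_singleton[of "0::real"] in \<open>eventually_elim, auto simp: indicator_def\<close>)
  then show ?thesis using assms by (simp add: primitive_on_def)
qed

lemma primitive_on_add:
  assumes "primitive_on l F u" "primitive_on l G v"
  shows "primitive_on l (\<lambda>x. F x + G x) (\<lambda>x. u x + v x)"
  unfolding primitive_on_def
proof (intro conjI ballI)
  show "set_integrable lborel {0..l} (\<lambda>x. u x + v x)"
    by (intro set_integral_add primitive_onD(1)[OF assms(1)] primitive_onD(1)[OF assms(2)])
  fix x assume x: "x \<in> {0..l}"
  have "set_integrable lborel {0..x} u" "set_integrable lborel {0..x} v"
    by (rule set_integrable_subset[OF primitive_onD(1)[OF assms(1)]] set_integrable_subset[OF primitive_onD(1)[OF assms(2)]], use x in auto)+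
  then show "F x + G x = F 0 + G 0 + (LBINT t:{0..x}. u t + v t)"
    by (simp add: set_integral_add primitive_onD(2)[OF assms(1) x] primitive_onD(2)[OF assms(2) x])
qed

lemma primitive_on_uminus:
  assumes "primitive_on l F u"
  shows "primitive_on l (\<lambda>x. - F x) (\<lambda>x. - u x)"
  unfolding primitive_on_def
proof (intro conjI ballI)
  show "set_integrable lborel {0..l} (\<lambda>x. - u x)"
    using set_integrable_mult_right[of "-1" lborel "{0..l}" u] primitive_onD(1)[OF assms] by simp
  fix x assume x: "x \<in> {0..l}"
  have "set_integrable lborel {0..x} u"
    by (rule set_integrable_subset[OF primitive_onD(1)[OF assms]]) (use x in auto)
  then show "- F x = - F 0 + (LBINT t:{0..x}. - u t)"
    by (simp add: set_integral_uminus primitive_onD(2)[OF assms x])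
qed

lemma primitive_on_diff:
  assumes "primitive_on l F u" "primitive_on l G v"
  shows "primitive_on l (\<lambda>x. F x - G x) (\<lambda>x. u x - v x)"
  using primitive_on_add[OF assms(1) primitive_on_uminus[OF assms(2)]] by simp

lemma set_integrable_inner_continuous:
  fixes F v :: "real \<Rightarrow> complex"
  assumes F: "continuous_on {0..l} F" and v: "set_integrable lborel {0..l} v"
  shows "set_integrable lborel {0..l} (\<lambda>x. F x \<bullet> v x)"
proof -
  have "bounded (F ` {0..l})" by (intro compact_imp_bounded compact_continuous_image F compact_Icc)
  then obtain C where C: "\<And>x. x \<in> {0..l} \<Longrightarrow> norm (F x) \<le> C"
    unfolding bounded_iff by blast
  have [measurable]: "(\<lambda>x. indicator {0..l} x *\<^sub>R F x) \<in> borel_measurable borel"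
    by (rule borel_measurable_continuous_on_indicator[OF _ F]) simp
  have [measurable]: "(\<lambda>x. indicator {0..l} x *\<^sub>R v x) \<in> borel_measurable borel"
    using v by (simp add: set_integrable_def borel_measurable_integrable)
  have eq: "(\<lambda>x. indicator {0..l} x *\<^sub>R (F x \<bullet> v x)) = (\<lambda>x. (indicator {0..l} x *\<^sub>R F x) \<bullet> (indicator {0..l} x *\<^sub>R v x))"
    by (auto simp: fun_eq_iff indicator_def)
  have "integrable lborel (\<lambda>x. C * norm (indicator {0..l} x *\<^sub>R v x))"
    using v by (intro integrable_mult_right integrable_norm) (simp add: set_integrable_def)
  then show ?thesis
    unfolding set_integrable_def
  proof (rule Bochner_Integration.integrable_bound)
    show "(\<lambda>x. indicator {0..l} x *\<^sub>R (F x \<bullet> v x)) \<in> borel_measurable lborel"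
      unfolding eq by measurable
    show "AE x in lborel. norm (indicator {0..l} x *\<^sub>R (F x \<bullet> v x)) \<le> norm (C * norm (indicator {0..l} x *\<^sub>R v x))"
    proof (rule AE_I2)
      fix x
      show "norm (indicator {0..l} x *\<^sub>R (F x \<bullet> v x)) \<le> norm (C * norm (indicator {0..l} x *\<^sub>R v x))"
      proof (cases "x \<in> {0..l}")
        case True
        have "norm (F x \<bullet> v x) \<le> norm (F x) * norm (v x)" using Cauchy_Schwarz_ineq2[of "F x" "v x"] by simp
        also have "\<dots> \<le> C * norm (v x)" by (intro mult_right_mono C True) simp
        also have "\<dots> \<le> \<bar>C\<bar> * norm (v x)" by (intro mult_right_mono) auto
        finally show ?thesis using True by (simp add: abs_mult)
      qed simp
    qed
  qed
qed

lemma set_integrable_continuous_inner: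
  fixes F v :: "real \<Rightarrow> complex"
  assumes "continuous_on {0..l} F" "set_integrable lborel {0..l} v"
  shows "set_integrable lborel {0..l} (\<lambda>x. v x \<bullet> F x)"
  using set_integrable_inner_continuous[OF assms] by (simp add: inner_commute)

text \<open>Both derivatives are merely integrable, so the formula is obtained from Fubini's theorem by
  splitting the square along its diagonal.\<close>
lemma primitive_on_by_parts:
  assumes l: "0 \<le> l" and F: "primitive_on l F u" and G: "primitive_on l G v"
  shows "(LBINT x:{0..l}. u x \<bullet> G x) + (LBINT x:{0..l}. F x \<bullet> v x) = F l \<bullet> G l - F 0 \<bullet> G 0"
proof -
  define U where "U x = indicator {0..l} x *\<^sub>R u x" for x
  define V where "V x = indicator {0..l} x *\<^sub>R v x" for x
  have Ui: "integrable lborel U" and Vi: "integrable lborel V"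
    using primitive_onD(1)[OF F] primitive_onD(1)[OF G] by (simp_all add: set_integrable_def U_def[abs_def] V_def[abs_def])
  have [measurable]: "U \<in> borel_measurable borel" "V \<in> borel_measurable borel"
    using Ui Vi by (simp_all add: borel_measurable_integrable)
  have intU: "(\<integral>x. U x \<partial>lborel) = F l - F 0" and intV: "(\<integral>x. V x \<partial>lborel) = G l - G 0"
    using primitive_onD(2)[OF F, of l] primitive_onD(2)[OF G, of l] l
    by (simp_all add: U_def[abs_def] V_def[abs_def] set_lebesgue_integral_def)
  have int: "integrable (lborel \<Otimes>\<^sub>M lborel) (\<lambda>p. P p *\<^sub>R (U (fst p) \<bullet> V (snd p)))"
    if [measurable]: "P \<in> borel_measurable (borel \<Otimes>\<^sub>M borel)" and P: "\<And>p. \<bar>P p\<bar> \<le> 1" for P :: "real \<times> real \<Rightarrow> real"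
  proof (rule Bochner_Integration.integrable_bound)
    show "integrable (lborel \<Otimes>\<^sub>M lborel) (\<lambda>p. norm (U (fst p)) * norm (V (snd p)))"
      by (rule lborel_pair.Fubini_integrable) (use Ui Vi in auto)
    show "AE p in lborel \<Otimes>\<^sub>M lborel. norm (P p *\<^sub>R (U (fst p) \<bullet> V (snd p))) \<le> norm (norm (U (fst p)) * norm (V (snd p)))"
    proof (rule AE_I2)
      fix p
      have "\<bar>P p\<bar> * \<bar>U (fst p) \<bullet> V (snd p)\<bar> \<le> 1 * (norm (U (fst p)) * norm (V (snd p)))"
        by (intro mult_mono P Cauchy_Schwarz_ineq2) auto
      then show "norm (P p *\<^sub>R (U (fst p) \<bullet> V (snd p))) \<le> norm (norm (U (fst p)) * norm (V (snd p)))"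
        by (simp add: abs_mult)
    qed
  qed measurable
  \<comment> \<open>The diagonal is assigned to \<open>P1\<close>, so the two indicators add up to 1
    everywhere; in the slices of \<open>P2\<close> the missing endpoint is a null set.\<close>
  define P1 where "P1 p = (if snd p \<le> fst p then 1 else 0::real)" for p :: "real \<times> real"
  define P2 where "P2 p = (if fst p < snd p then 1 else 0::real)" for p :: "real \<times> real"
  have [measurable]: "P1 \<in> borel_measurable (borel \<Otimes>\<^sub>M borel)" "P2 \<in> borel_measurable (borel \<Otimes>\<^sub>M borel)"
    unfolding P1_def P2_def by measurable
  have i1: "integrable (lborel \<Otimes>\<^sub>M lborel) (\<lambda>p. P1 p *\<^sub>R (U (fst p) \<bullet> V (snd p)))"
    by (rule int) (auto simp: P1_def)
  have i2: "integrable (lborel \<Otimes>\<^sub>M lborel) (\<lambda>p. P2 p *\<^sub>R (U (fst p) \<bullet> V (snd p)))"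
    by (rule int) (auto simp: P2_def)
  have i0: "integrable (lborel \<Otimes>\<^sub>M lborel) (\<lambda>p. U (fst p) \<bullet> V (snd p))"
    using int[of "\<lambda>_. 1"] by simp
  have cut1: "integrable lborel (\<lambda>y. P1 (x, y) *\<^sub>R V y)" for x
    by (rule Bochner_Integration.integrable_bound[OF Vi]) (auto simp: P1_def)
  have cut2: "integrable lborel (\<lambda>x. P2 (x, y) *\<^sub>R U x)" for y
    by (rule Bochner_Integration.integrable_bound[OF Ui]) (auto simp: P2_def)
  have "(\<integral>p. P1 p *\<^sub>R (U (fst p) \<bullet> V (snd p)) \<partial>(lborel \<Otimes>\<^sub>M lborel)) = (\<integral>x. \<integral>y. P1 (x, y) *\<^sub>R (U x \<bullet> V y) \<partial>lborel \<partial>lborel)"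
    using lborel_pair.integral_fst'[OF i1] by simp
  also have "\<dots> = (\<integral>x. U x \<bullet> (\<integral>y. P1 (x, y) *\<^sub>R V y \<partial>lborel) \<partial>lborel)"
    by (intro Bochner_Integration.integral_cong refl, subst integral_inner_right[symmetric]) (use cut1 in auto)
  also have "\<dots> = (\<integral>x. U x \<bullet> (G x - G 0) \<partial>lborel)"
  proof (intro Bochner_Integration.integral_cong refl)
    fix x show "U x \<bullet> (\<integral>y. P1 (x, y) *\<^sub>R V y \<partial>lborel) = U x \<bullet> (G x - G 0)"
    proof (cases "x \<in> {0..l}")
      case True
      have "(\<integral>y. P1 (x, y) *\<^sub>R V y \<partial>lborel) = (LBINT t:{0..x}. v t)"
        unfolding set_lebesgue_integral_def
        by (intro Bochner_Integration.integral_cong refl) (use True in \<open>auto simp: P1_def V_def indicator_def\<close>)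
      with primitive_onD(2)[OF G True] show ?thesis by simp
    qed (simp add: U_def)
  qed
  also have "\<dots> = (\<integral>x. U x \<bullet> G x \<partial>lborel) - (\<integral>x. U x \<bullet> G 0 \<partial>lborel)"
    unfolding inner_diff_right
  proof (rule Bochner_Integration.integral_diff)
    show "integrable lborel (\<lambda>x. U x \<bullet> G x)"
      using set_integrable_continuous_inner[OF primitive_on_continuous[OF G] primitive_onD(1)[OF F]]
      by (simp add: set_integrable_def U_def)
  qed (use Ui in auto)
  also have "(\<integral>x. U x \<bullet> G 0 \<partial>lborel) = (F l - F 0) \<bullet> G 0"
    using Ui intU by simp
  also have "(\<integral>x. U x \<bullet> G x \<partial>lborel) = (LBINT x:{0..l}. u x \<bullet> G x)"
    by (simp add: set_lebesgue_integral_def U_def)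
  finally have A: "(\<integral>p. P1 p *\<^sub>R (U (fst p) \<bullet> V (snd p)) \<partial>(lborel \<Otimes>\<^sub>M lborel)) = (LBINT x:{0..l}. u x \<bullet> G x) - (F l - F 0) \<bullet> G 0" .
  have "(\<integral>p. P2 p *\<^sub>R (U (fst p) \<bullet> V (snd p)) \<partial>(lborel \<Otimes>\<^sub>M lborel)) = (\<integral>y. \<integral>x. P2 (x, y) *\<^sub>R (U x \<bullet> V y) \<partial>lborel \<partial>lborel)"
    using lborel_pair.integral_snd[of "\<lambda>x y. P2 (x, y) *\<^sub>R (U x \<bullet> V y)"] i2 by (simp add: split_def)
  also have "\<dots> = (\<integral>y. (\<integral>x. P2 (x, y) *\<^sub>R U x \<partial>lborel) \<bullet> V y \<partial>lborel)"
    by (intro Bochner_Integration.integral_cong refl, subst integral_inner_left[symmetric]) (use cut2 in auto)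
  also have "\<dots> = (\<integral>y. (F y - F 0) \<bullet> V y \<partial>lborel)"
  proof (intro Bochner_Integration.integral_cong refl)
    fix y show "(\<integral>x. P2 (x, y) *\<^sub>R U x \<partial>lborel) \<bullet> V y = (F y - F 0) \<bullet> V y"
    proof (cases "y \<in> {0..l}")
      case True
      have "(\<integral>x. P2 (x, y) *\<^sub>R U x \<partial>lborel) = (LBINT t:{0..y}. u t)"
        unfolding set_lebesgue_integral_def
      proof (rule integral_cong_AE)
        show "(\<lambda>x. P2 (x, y) *\<^sub>R U x) \<in> borel_measurable lborel" by measurable
        show "(\<lambda>x. indicator {0..y} x *\<^sub>R u x) \<in> borel_measurable lborel"
          using set_integrable_subset[OF primitive_onD(1)[OF F], of "{0..y}"] True
          by (simp add: set_integrable_def borel_measurable_integrable)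
        show "AE x in lborel. P2 (x, y) *\<^sub>R U x = indicator {0..y} x *\<^sub>R u x"
          using AE_lborel_singleton[of y]
          by eventually_elim (use True in \<open>auto simp: P2_def U_def indicator_def\<close>)
      qed
      with primitive_onD(2)[OF F True] show ?thesis by simp
    qed (simp add: V_def)
  qed
  also have "\<dots> = (\<integral>x. F x \<bullet> V x \<partial>lborel) - (\<integral>x. F 0 \<bullet> V x \<partial>lborel)"
    unfolding inner_diff_left
  proof (rule Bochner_Integration.integral_diff)
    show "integrable lborel (\<lambda>x. F x \<bullet> V x)"
      using set_integrable_inner_continuous[OF primitive_on_continuous[OF F] primitive_onD(1)[OF G]]
      by (simp add: set_integrable_def V_def)
  qed (use Vi in auto)
  also have "(\<integral>x. F 0 \<bullet> V x \<partial>lborel) = F 0 \<bullet> (G l - G 0)"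
    using Vi intV by simp
  also have "(\<integral>x. F x \<bullet> V x \<partial>lborel) = (LBINT x:{0..l}. F x \<bullet> v x)"
    by (simp add: set_lebesgue_integral_def V_def)
  finally have B: "(\<integral>p. P2 p *\<^sub>R (U (fst p) \<bullet> V (snd p)) \<partial>(lborel \<Otimes>\<^sub>M lborel)) = (LBINT x:{0..l}. F x \<bullet> v x) - F 0 \<bullet> (G l - G 0)" .
  have "(\<integral>p. P1 p *\<^sub>R (U (fst p) \<bullet> V (snd p)) \<partial>(lborel \<Otimes>\<^sub>M lborel)) + (\<integral>p. P2 p *\<^sub>R (U (fst p) \<bullet> V (snd p)) \<partial>(lborel \<Otimes>\<^sub>M lborel))
      = (\<integral>p. P1 p *\<^sub>R (U (fst p) \<bullet> V (snd p)) + P2 p *\<^sub>R (U (fst p) \<bullet> V (snd p)) \<partial>(lborel \<Otimes>\<^sub>M lborel))"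
    by (rule Bochner_Integration.integral_add[symmetric, OF i1 i2])
  also have "\<dots> = (\<integral>p. U (fst p) \<bullet> V (snd p) \<partial>(lborel \<Otimes>\<^sub>M lborel))"
    by (intro Bochner_Integration.integral_cong refl) (auto simp: P1_def P2_def)
  also have "\<dots> = (\<integral>x. \<integral>y. U x \<bullet> V y \<partial>lborel \<partial>lborel)"
    using lborel_pair.integral_fst'[OF i0] by simp
  also have "\<dots> = (\<integral>x. U x \<bullet> (\<integral>y. V y \<partial>lborel) \<partial>lborel)"
    by (intro Bochner_Integration.integral_cong refl) (use Vi in auto)
  also have "\<dots> = (\<integral>x. U x \<partial>lborel) \<bullet> (\<integral>y. V y \<partial>lborel)" using Ui by simp
  also have "\<dots> = (F l - F 0) \<bullet> (G l - G 0)"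
    by (simp add: intU intV)
  finally have "((LBINT x:{0..l}. u x \<bullet> G x) - (F l - F 0) \<bullet> G 0) + ((LBINT x:{0..l}. F x \<bullet> v x) - F 0 \<bullet> (G l - G 0)) = (F l - F 0) \<bullet> (G l - G 0)"
    unfolding A B .
  then show ?thesis by (simp add: inner_diff_left inner_diff_right)
qed

text \<open>Integrability of \<open>u1\<close>, demanded by \<open>primitive_on\<close>, comes from
  its continuity as a primitive of \<open>u2\<close>.\<close>

lemma W22_with_iff:
  assumes "0 \<le> l"
  shows "W22_with l f u1 u2 \<longleftrightarrow> primitive_on l f u1 \<and> primitive_on l u1 u2 \<and> set_integrable lborel {0..l} (\<lambda>x. (cmod (u2 x))\<^sup>2)"
proof
  assume W: "W22_with l f u1 u2"
  then have u1: "primitive_on l u1 u2" unfolding W22_with_def primitive_on_def by blast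
  have "set_integrable lborel {0..l} u1"
    by (rule borel_integrable_atLeastAtMost'[OF primitive_on_continuous[OF u1]])
  with W u1 show "primitive_on l f u1 \<and> primitive_on l u1 u2 \<and> set_integrable lborel {0..l} (\<lambda>x. (cmod (u2 x))\<^sup>2)"
    unfolding W22_with_def primitive_on_def by blast
next
  assume "primitive_on l f u1 \<and> primitive_on l u1 u2 \<and> set_integrable lborel {0..l} (\<lambda>x. (cmod (u2 x))\<^sup>2)"
  then show "W22_with l f u1 u2" unfolding W22_with_def primitive_on_def by blast
qed

section \<open>Cubic Hermite interpolation\<close>

text \<open>Together with \<open>hermite_d\<close>, the higher coefficients of the cubic with values
  \<open>a0\<close>, \<open>a1\<close> and slopes \<open>b0\<close>, \<open>b1\<close> at 0 and
  \<open>l\<close>. Cubics allow values and slopes at the vertices to be prescribed independently on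
  each edge.\<close>

definition hermite_c :: "real \<Rightarrow> complex \<Rightarrow> complex \<Rightarrow> complex \<Rightarrow> complex \<Rightarrow> complex" where
  "hermite_c l a0 a1 b0 b1 = 3 * (a1 - a0) / (of_real l)\<^sup>2 - (2 * b0 + b1) / of_real l"

definition hermite_d :: "real \<Rightarrow> complex \<Rightarrow> complex \<Rightarrow> complex \<Rightarrow> complex \<Rightarrow> complex" where
  "hermite_d l a0 a1 b0 b1 = 2 * (a0 - a1) / (of_real l)^3 + (b0 + b1) / (of_real l)\<^sup>2"

definition hermite :: "real \<Rightarrow> complex \<Rightarrow> complex \<Rightarrow> complex \<Rightarrow> complex \<Rightarrow> real \<Rightarrow> complex" where
  "hermite l a0 a1 b0 b1 x = a0 + b0 * of_real x + hermite_c l a0 a1 b0 b1 * (of_real x)\<^sup>2 + hermite_d l a0 a1 b0 b1 * (of_real x)^3"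

definition hermite1 :: "real \<Rightarrow> complex \<Rightarrow> complex \<Rightarrow> complex \<Rightarrow> complex \<Rightarrow> real \<Rightarrow> complex" where
  "hermite1 l a0 a1 b0 b1 x = b0 + 2 * hermite_c l a0 a1 b0 b1 * of_real x + 3 * hermite_d l a0 a1 b0 b1 * (of_real x)\<^sup>2"

definition hermite2 :: "real \<Rightarrow> complex \<Rightarrow> complex \<Rightarrow> complex \<Rightarrow> complex \<Rightarrow> real \<Rightarrow> complex" where
  "hermite2 l a0 a1 b0 b1 x = 2 * hermite_c l a0 a1 b0 b1 + 6 * hermite_d l a0 a1 b0 b1 * of_real x"

lemma hermite_start [simp]: "hermite l a0 a1 b0 b1 0 = a0" "hermite1 l a0 a1 b0 b1 0 = b0"
  by (simp_all add: hermite_def hermite1_def)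

lemma hermite_end:
  assumes "l \<noteq> 0"
  shows "hermite l a0 a1 b0 b1 l = a1" "hermite1 l a0 a1 b0 b1 l = b1"
proof -
  define L where "L = complex_of_real l"
  have L: "L \<noteq> 0" using assms by (simp add: L_def)
  define t where "t = (a1 - a0) / L"
  have t: "3 * (a1 - a0) / L = 3 * t" "2 * (a0 - a1) / L = - 2 * t" "t * L = a1 - a0"
    using L by (simp_all add: t_def flip: minus_divide_left)
  have "(q / L\<^sup>2 - r / L) * L = q / L - r" "(q / L^3 + r / L\<^sup>2) * L\<^sup>2 = q / L + r" for q r
    using L by (simp_all add: left_diff_distrib distrib_right power2_eq_square power3_eq_cube)
  then have c: "hermite_c l a0 a1 b0 b1 * L = 3 * t - (2 * b0 + b1)"
    and d: "hermite_d l a0 a1 b0 b1 * L\<^sup>2 = - 2 * t + (b0 + b1)"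
    unfolding hermite_c_def hermite_d_def L_def[symmetric] t[symmetric] by blast+
  have "hermite1 l a0 a1 b0 b1 l = b0 + 2 * (hermite_c l a0 a1 b0 b1 * L) + 3 * (hermite_d l a0 a1 b0 b1 * L\<^sup>2)"
    by (simp only: hermite1_def L_def mult.assoc)
  also have "\<dots> = b1" unfolding c d by (simp add: algebra_simps)
  finally show "hermite1 l a0 a1 b0 b1 l = b1" .
  have "hermite l a0 a1 b0 b1 l = a0 + b0 * L + (hermite_c l a0 a1 b0 b1 * L) * L + (hermite_d l a0 a1 b0 b1 * L\<^sup>2) * L"
    by (simp only: hermite_def L_def power2_eq_square power3_eq_cube mult.assoc)
  also have "\<dots> = a0 + t * L" unfolding c d by (simp add: algebra_simps)
  also have "\<dots> = a1" by (simp add: t)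
  finally show "hermite l a0 a1 b0 b1 l = a1" .
qed

lemma hermite_zero [simp]: "hermite l 0 0 0 0 x = 0" "hermite1 l 0 0 0 0 x = 0" "hermite2 l 0 0 0 0 x = 0"
  by (simp_all add: hermite_def hermite1_def hermite2_def hermite_c_def hermite_d_def)

lemma hermite_const [simp]: "hermite l a a 0 0 x = a"
  by (simp add: hermite_def hermite_c_def hermite_d_def)

lemma primitive_on_of_field_derivative:
  assumes "\<And>z. (f has_field_derivative f' z) (at z)" "continuous_on UNIV f'"
  shows "primitive_on l (\<lambda>x. f (of_real x)) (\<lambda>x. f' (of_real x))"
proof (rule primitive_onI_deriv)
  show "((\<lambda>x. f (of_real x)) has_vector_derivative f' (of_real x)) (at x within {0..l})" for x
    by (rule has_vector_derivative_real_field[OF assms(1)])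
  show "continuous_on {0..l} (\<lambda>x. f' (complex_of_real x))"
    by (rule continuous_on_compose2[OF assms(2)]) (auto intro: continuous_intros)
qed

lemma hermite_primitive:
  "primitive_on l (hermite l a0 a1 b0 b1) (hermite1 l a0 a1 b0 b1)"
  "primitive_on l (hermite1 l a0 a1 b0 b1) (hermite2 l a0 a1 b0 b1)"
  "primitive_on l (hermite2 l a0 a1 b0 b1) (\<lambda>x. 6 * hermite_d l a0 a1 b0 b1)"
proof -
  define c d where "c = hermite_c l a0 a1 b0 b1" and "d = hermite_d l a0 a1 b0 b1"
  have "primitive_on l (\<lambda>x. (\<lambda>z. a0 + b0 * z + c * z\<^sup>2 + d * z^3) (of_real x)) (\<lambda>x. (\<lambda>z. b0 + 2 * c * z + 3 * d * z\<^sup>2) (of_real x))"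
    by (rule primitive_on_of_field_derivative) (auto intro!: derivative_eq_intros continuous_intros)
  then show "primitive_on l (hermite l a0 a1 b0 b1) (hermite1 l a0 a1 b0 b1)"
    by (simp add: hermite_def[abs_def] hermite1_def[abs_def] c_def d_def)
  have "primitive_on l (\<lambda>x. (\<lambda>z. b0 + 2 * c * z + 3 * d * z\<^sup>2) (of_real x)) (\<lambda>x. (\<lambda>z. 2 * c + 6 * d * z) (of_real x))"
    by (rule primitive_on_of_field_derivative) (auto intro!: derivative_eq_intros continuous_intros)
  then show "primitive_on l (hermite1 l a0 a1 b0 b1) (hermite2 l a0 a1 b0 b1)"
    by (simp add: hermite1_def[abs_def] hermite2_def[abs_def] c_def d_def)
  have "primitive_on l (\<lambda>x. (\<lambda>z. 2 * c + 6 * d * z) (of_real x)) (\<lambda>x. (\<lambda>z. 6 * d) (of_real x))"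
    by (rule primitive_on_of_field_derivative) (auto intro!: derivative_eq_intros continuous_intros)
  then show "primitive_on l (hermite2 l a0 a1 b0 b1) (\<lambda>x. 6 * hermite_d l a0 a1 b0 b1)"
    by (simp add: hermite2_def[abs_def] c_def d_def)
qed

lemma hermite_W22:
  assumes "0 \<le> l"
  shows "W22_with l (hermite l a0 a1 b0 b1) (hermite1 l a0 a1 b0 b1) (hermite2 l a0 a1 b0 b1)"
proof -
  have "continuous_on {0..l} (hermite2 l a0 a1 b0 b1)"
    by (rule primitive_on_continuous[OF hermite_primitive(3)])
  then have "set_integrable lborel {0..l} (\<lambda>x. (cmod (hermite2 l a0 a1 b0 b1 x))\<^sup>2)"
    by (intro borel_integrable_atLeastAtMost' continuous_on_power continuous_on_norm)
  with hermite_primitive assms show ?thesis by (simp add: W22_with_iff)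
qed

section \<open>Regularity of weak solutions on an interval\<close>

lemma set_integrable_inner_of_squares:
  fixes f g :: "real \<Rightarrow> complex"
  assumes "set_integrable lborel {0..l} f" "set_integrable lborel {0..l} (\<lambda>x. (cmod (f x))\<^sup>2)"
    and "set_integrable lborel {0..l} g" "set_integrable lborel {0..l} (\<lambda>x. (cmod (g x))\<^sup>2)"
  shows "set_integrable lborel {0..l} (\<lambda>x. f x \<bullet> g x)"
proof -
  have "(\<lambda>x. indicator {0..l} x *\<^sub>R h x) \<in> sq_int lborel"
    if "set_integrable lborel {0..l} h" "set_integrable lborel {0..l} (\<lambda>x. (cmod (h x))\<^sup>2)" for h :: "real \<Rightarrow> complex"
  proof -
    have "(\<lambda>x. (cmod (indicator {0..l} x *\<^sub>R h x))\<^sup>2) = (\<lambda>x. indicator {0..l} x *\<^sub>R (cmod (h x))\<^sup>2)"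
      by (auto simp: fun_eq_iff indicator_def)
    then show ?thesis using that by (simp add: sq_int_def set_integrable_def borel_measurable_integrable)
  qed
  from sq_int_inner[OF this[OF assms(1,2)] this[OF assms(3,4)]]
  have "integrable lborel (\<lambda>x. (indicator {0..l} x *\<^sub>R f x) \<bullet> (indicator {0..l} x *\<^sub>R g x))" .
  also have "(\<lambda>x. (indicator {0..l} x *\<^sub>R f x) \<bullet> (indicator {0..l} x *\<^sub>R g x)) = (\<lambda>x. indicator {0..l} x *\<^sub>R (f x \<bullet> g x))"
    by (auto simp: fun_eq_iff indicator_def)
  finally show ?thesis by (simp add: set_integrable_def)
qed

lemma set_integrable_square_diff:
  fixes f g :: "real \<Rightarrow> complex"
  assumes "set_integrable lborel {0..l} f" "set_integrable lborel {0..l} (\<lambda>x. (cmod (f x))\<^sup>2)"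
    and g: "continuous_on {0..l} g"
  shows "set_integrable lborel {0..l} (\<lambda>x. (cmod (f x - g x))\<^sup>2)"
proof -
  have gi: "set_integrable lborel {0..l} g" "set_integrable lborel {0..l} (\<lambda>x. (cmod (g x))\<^sup>2)"
    using g by (auto intro!: borel_integrable_atLeastAtMost' continuous_intros)
  have "(\<lambda>x. (cmod (f x - g x))\<^sup>2) = (\<lambda>x. (cmod (f x))\<^sup>2 - 2 * (f x \<bullet> g x) + (cmod (g x))\<^sup>2)"
    by (auto simp: fun_eq_iff power2_norm_eq_inner inner_diff_left inner_diff_right inner_commute)
  then show ?thesis
    using set_integral_add(1)[OF set_integral_diff(1)[OF assms(2) set_integrable_mult_right[of 2, OF _ ]] gi(2)]
      set_integrable_inner_of_squares[OF assms(1,2) gi] by auto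
qed

text \<open>With \<open>H0\<close> a second primitive of \<open>\<kappa> h\<close>, subtracting from a second primitive of \<open>h - H0\<close> its cubic
  Hermite interpolant yields an admissible test function; testing with it shows that its second derivative
  vanishes, so \<open>h - H0\<close> is affine.\<close>
lemma weak_solution_regular:
  assumes l: "0 < l" and h: "set_integrable lborel {0..l} h" "set_integrable lborel {0..l} (\<lambda>x. (cmod (h x))\<^sup>2)"
    and weak: "\<And>f u1 u2. W22_with l f u1 u2 \<Longrightarrow> f 0 = 0 \<Longrightarrow> f l = 0 \<Longrightarrow> u1 0 = 0 \<Longrightarrow> u1 l = 0 \<Longrightarrow>
       (LBINT x:{0..l}. h x \<bullet> (\<kappa> *\<^sub>R f x - u2 x)) = 0"
  shows "\<exists>h0 h1. primitive_on l h0 h1 \<and> primitive_on l h1 (\<lambda>x. \<kappa> *\<^sub>R h x) \<and> (AE x in lborel. x \<in> {0..l} \<longrightarrow> h x = h0 x)"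
proof -
  have \<kappa>h: "set_integrable lborel {0..l} (\<lambda>x. \<kappa> *\<^sub>R h x)" using h(1) by simp
  define H1 where "H1 x = (LBINT t:{0..x}. \<kappa> *\<^sub>R h t)" for x
  define H0 where "H0 x = (LBINT t:{0..x}. H1 t)" for x
  have H1: "primitive_on l H1 (\<lambda>x. \<kappa> *\<^sub>R h x)" unfolding H1_def[abs_def] by (rule primitive_onI_integral[OF \<kappa>h])
  have H1i: "set_integrable lborel {0..l} H1"
    by (rule borel_integrable_atLeastAtMost'[OF primitive_on_continuous[OF H1]])
  have H0: "primitive_on l H0 H1" unfolding H0_def[abs_def] by (rule primitive_onI_integral[OF H1i])
  define w where "w x = h x - H0 x" for x
  have H0c: "continuous_on {0..l} H0" by (rule primitive_on_continuous[OF H0])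
  have w: "set_integrable lborel {0..l} w" "set_integrable lborel {0..l} (\<lambda>x. (cmod (w x))\<^sup>2)"
    unfolding w_def using set_integral_diff(1)[OF h(1) borel_integrable_atLeastAtMost'[OF H0c]]
      set_integrable_square_diff[OF h H0c] by auto
  define W1 where "W1 x = (LBINT t:{0..x}. w t)" for x
  define W0 where "W0 x = (LBINT t:{0..x}. W1 t)" for x
  have W1: "primitive_on l W1 w" unfolding W1_def[abs_def] by (rule primitive_onI_integral[OF w(1)])
  have W0: "primitive_on l W0 W1" unfolding W0_def[abs_def]
    by (rule primitive_onI_integral[OF borel_integrable_atLeastAtMost'[OF primitive_on_continuous[OF W1]]])
  have at0: "(LBINT t:{0..0}. v t) = 0" for v :: "real \<Rightarrow> complex"
    unfolding set_lebesgue_integral_def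
    by (rule integral_eq_zero_AE) (use AE_lborel_singleton[of "0::real"] in \<open>eventually_elim, auto simp: indicator_def\<close>)
  have z: "W1 0 = 0" "W0 0 = 0" "H1 0 = 0" "H0 0 = 0" unfolding W1_def W0_def H1_def H0_def by (rule at0)+
  define p where "p = hermite l 0 (W0 l) 0 (W1 l)"
  define p1 where "p1 = hermite1 l 0 (W0 l) 0 (W1 l)"
  define p2 where "p2 = hermite2 l 0 (W0 l) 0 (W1 l)"
  define k where "k = 6 * hermite_d l 0 (W0 l) 0 (W1 l)"
  have p: "primitive_on l p p1" "primitive_on l p1 p2" "primitive_on l p2 (\<lambda>x. k)"
    unfolding p_def p1_def p2_def k_def by (rule hermite_primitive)+
  have pend: "p 0 = 0" "p1 0 = 0" "p l = W0 l" "p1 l = W1 l"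
    using l by (simp_all add: p_def p1_def hermite_end)
  define f where "f x = W0 x - p x" for x
  define u1 where "u1 x = W1 x - p1 x" for x
  define u2 where "u2 x = w x - p2 x" for x
  have f: "primitive_on l f u1" unfolding f_def[abs_def] u1_def[abs_def] by (rule primitive_on_diff[OF W0 p(1)])
  have u1: "primitive_on l u1 u2" unfolding u1_def[abs_def] u2_def[abs_def] by (rule primitive_on_diff[OF W1 p(2)])
  have p2c: "continuous_on {0..l} p2" by (rule primitive_on_continuous[OF p(3)])
  have u2sq: "set_integrable lborel {0..l} (\<lambda>x. (cmod (u2 x))\<^sup>2)"
    unfolding u2_def by (rule set_integrable_square_diff[OF w p2c])
  have bd: "f 0 = 0" "f l = 0" "u1 0 = 0" "u1 l = 0" by (simp_all add: f_def u1_def z pend)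
  have u2i: "set_integrable lborel {0..l} u2" by (rule primitive_onD(1)[OF u1])
  have l0: "0 \<le> l" using l by simp
  have fc: "continuous_on {0..l} f" by (rule primitive_on_continuous[OF f])
  have "W22_with l f u1 u2" unfolding W22_with_iff[OF l0] using f u1 u2sq by blast
  \<comment> \<open>The endpoint conditions remove all boundary terms, so \<open>h\<close> and
    \<open>H0\<close> have the same pairing with \<open>u2\<close>, and the affine function
    \<open>p2\<close> pairs to zero. As \<open>u2 = h - H0 - p2\<close>, its square norm
    vanishes.\<close>
  from weak[OF this bd] have "(LBINT x:{0..l}. (\<kappa> *\<^sub>R h x) \<bullet> f x - h x \<bullet> u2 x) = 0"
    by (simp add: inner_diff_right)
  then have e1: "(LBINT x:{0..l}. (\<kappa> *\<^sub>R h x) \<bullet> f x) = (LBINT x:{0..l}. h x \<bullet> u2 x)"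
    using set_integral_diff(2)[OF set_integrable_continuous_inner[OF fc \<kappa>h] set_integrable_inner_of_squares[OF h u2i u2sq]] by simp
  have e2: "(LBINT x:{0..l}. (\<kappa> *\<^sub>R h x) \<bullet> f x) + (LBINT x:{0..l}. H1 x \<bullet> u1 x) = 0"
    using primitive_on_by_parts[OF l0 H1 f] bd by simp
  have e3: "(LBINT x:{0..l}. H1 x \<bullet> u1 x) + (LBINT x:{0..l}. H0 x \<bullet> u2 x) = 0"
    using primitive_on_by_parts[OF l0 H0 u1] bd by simp
  have e4: "(LBINT x:{0..l}. p2 x \<bullet> u2 x) = 0"
  proof -
    have "primitive_on l (\<lambda>x. k) (\<lambda>x. 0)" by (rule primitive_onI_deriv) auto
    from primitive_on_by_parts[OF l0 this f] have "(LBINT x:{0..l}. k \<bullet> u1 x) = 0" using bd by simp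
    with primitive_on_by_parts[OF l0 p(3) u1] bd show ?thesis by simp
  qed
  have i: "set_integrable lborel {0..l} (\<lambda>x. h x \<bullet> u2 x)" "set_integrable lborel {0..l} (\<lambda>x. H0 x \<bullet> u2 x)"
    "set_integrable lborel {0..l} (\<lambda>x. p2 x \<bullet> u2 x)"
    by (rule set_integrable_inner_of_squares[OF h u2i u2sq] set_integrable_inner_continuous[OF H0c u2i]
        set_integrable_inner_continuous[OF p2c u2i])+
  have "(LBINT x:{0..l}. (cmod (u2 x))\<^sup>2) = (LBINT x:{0..l}. (h x \<bullet> u2 x - H0 x \<bullet> u2 x) - p2 x \<bullet> u2 x)"
    by (simp add: u2_def w_def power2_norm_eq_inner inner_diff_left)
  also have "\<dots> = (LBINT x:{0..l}. h x \<bullet> u2 x) - (LBINT x:{0..l}. H0 x \<bullet> u2 x) - (LBINT x:{0..l}. p2 x \<bullet> u2 x)"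
    using i by (simp add: set_integral_diff)
  also have "\<dots> = 0" using e1 e2 e3 e4 by simp
  finally have "(\<integral>x. indicator {0..l} x *\<^sub>R (cmod (u2 x))\<^sup>2 \<partial>lborel) = 0" by (simp add: set_lebesgue_integral_def)
  then have "AE x in lborel. indicator {0..l} x *\<^sub>R (cmod (u2 x))\<^sup>2 = 0"
    by (subst (asm) integral_nonneg_eq_0_iff_AE) (use u2sq in \<open>auto simp: set_integrable_def\<close>)
  then have ae: "AE x in lborel. x \<in> {0..l} \<longrightarrow> h x = H0 x + p2 x"
    by eventually_elim (auto simp: u2_def w_def algebra_simps)
  have "primitive_on l (\<lambda>x. k) (\<lambda>x. 0)" by (rule primitive_onI_deriv) auto
  with primitive_on_add[OF H1 this] have "primitive_on l (\<lambda>x. H1 x + k) (\<lambda>x. \<kappa> *\<^sub>R h x)" by simp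
  with primitive_on_add[OF H0 p(3)] ae show ?thesis by blast
qed

text \<open>Gronwall's argument: \<open>C = 1 + \<bar>\<kappa>\<bar>\<close> bounds the growth rate
  of |h0|^2 + |h1|^2, so an exponential weight makes it monotone. The sign \<sigma> is chosen so
  that it decreases from 0 for data at the left end and increases to 0 for data at the right
  end.\<close>

lemma initial_value_zero:
  assumes h0: "primitive_on l h0 h1" and h1: "primitive_on l h1 (\<lambda>x. \<kappa> *\<^sub>R h x)"
    and ae: "AE x in lborel. x \<in> {0..l} \<longrightarrow> h x = h0 x"
    and z: "a = 0 \<or> a = l" "h0 a = 0" "h1 a = 0" and x: "x \<in> {0..l}"
  shows "h0 x = 0"
proof -
  have c0: "continuous_on {0..l} h0" and c1: "continuous_on {0..l} h1"
    using primitive_on_continuous h0 h1 by blast+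
  \<comment> \<open>Replacing \<open>h\<close> by its continuous version \<open>h0\<close> makes the
    derivative of \<open>h1\<close> continuous, hence classical.\<close>
  have "primitive_on l h1 (\<lambda>x. \<kappa> *\<^sub>R h0 x)"
    unfolding primitive_on_def
  proof (intro conjI ballI)
    show "set_integrable lborel {0..l} (\<lambda>x. \<kappa> *\<^sub>R h0 x)"
      by (intro borel_integrable_atLeastAtMost' continuous_intros c0)
    fix y assume y: "y \<in> {0..l}"
    have cy: "continuous_on {0..y} h0" by (rule continuous_on_subset[OF c0]) (use y in auto)
    have "(LBINT t:{0..y}. \<kappa> *\<^sub>R h t) = (LBINT t:{0..y}. \<kappa> *\<^sub>R h0 t)"
      unfolding set_lebesgue_integral_def
    proof (rule integral_cong_AE)
      have "set_integrable lborel {0..y} (\<lambda>t. \<kappa> *\<^sub>R h t)"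
        by (rule set_integrable_subset[OF primitive_onD(1)[OF h1]]) (use y in auto)
      then show "(\<lambda>t. indicator {0..y} t *\<^sub>R \<kappa> *\<^sub>R h t) \<in> borel_measurable lborel"
        unfolding set_integrable_def by (rule borel_measurable_integrable)
      have "set_integrable lborel {0..y} (\<lambda>t. \<kappa> *\<^sub>R h0 t)"
        by (intro borel_integrable_atLeastAtMost' continuous_intros cy)
      then show "(\<lambda>t. indicator {0..y} t *\<^sub>R \<kappa> *\<^sub>R h0 t) \<in> borel_measurable lborel"
        unfolding set_integrable_def by (rule borel_measurable_integrable)
      show "AE t in lborel. indicator {0..y} t *\<^sub>R \<kappa> *\<^sub>R h t = indicator {0..y} t *\<^sub>R \<kappa> *\<^sub>R h0 t"
        using ae by eventually_elim (use y in \<open>auto simp: indicator_def\<close>)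
    qed
    with primitive_onD(2)[OF h1 y] show "h1 y = h1 0 + (LBINT t:{0..y}. \<kappa> *\<^sub>R h0 t)" by simp
  qed
  then have d1: "(h1 has_vector_derivative \<kappa> *\<^sub>R h0 y) (at y within {0..l})" if "y \<in> {0..l}" for y
    by (rule primitive_on_deriv) (use that c0 in \<open>auto intro!: continuous_intros\<close>)
  have d0: "(h0 has_vector_derivative h1 y) (at y within {0..l})" if "y \<in> {0..l}" for y
    by (rule primitive_on_deriv[OF h0 c1 that])
  define C where "C = 1 + \<bar>\<kappa>\<bar>"
  define D where "D \<sigma> y = exp (\<sigma> * C * y) * (h0 y \<bullet> h0 y + h1 y \<bullet> h1 y)" for \<sigma> y :: real
  define D' where "D' \<sigma> y = exp (\<sigma> * C * y) * (\<sigma> * C * (h0 y \<bullet> h0 y + h1 y \<bullet> h1 y) + 2 * (1 + \<kappa>) * (h0 y \<bullet> h1 y))" for \<sigma> y :: real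
  have deriv: "(D \<sigma> has_real_derivative D' \<sigma> y) (at y within {0..l})" if y: "y \<in> {0..l}" for \<sigma> y
  proof -
    have "((\<lambda>y. h0 y \<bullet> h0 y) has_vector_derivative h0 y \<bullet> h1 y + h1 y \<bullet> h0 y) (at y within {0..l})"
      "((\<lambda>y. h1 y \<bullet> h1 y) has_vector_derivative h1 y \<bullet> (\<kappa> *\<^sub>R h0 y) + (\<kappa> *\<^sub>R h0 y) \<bullet> h1 y) (at y within {0..l})"
      using bounded_bilinear.has_vector_derivative[OF bounded_bilinear_inner d0[OF y] d0[OF y]]
        bounded_bilinear.has_vector_derivative[OF bounded_bilinear_inner d1[OF y] d1[OF y]] by blast+
    note this[folded has_real_derivative_iff_has_vector_derivative]
    then show ?thesis
      unfolding D_def D'_def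
      by (auto intro!: derivative_eq_intros simp: inner_commute algebra_simps)
  qed
  have cross: "\<bar>2 * (1 + \<kappa>) * (h0 y \<bullet> h1 y)\<bar> \<le> C * (h0 y \<bullet> h0 y + h1 y \<bullet> h1 y)" for y
  proof -
    have "2 * \<bar>h0 y \<bullet> h1 y\<bar> \<le> 2 * (norm (h0 y) * norm (h1 y))" using Cauchy_Schwarz_ineq2[of "h0 y" "h1 y"] by simp
    also have "\<dots> \<le> (norm (h0 y))\<^sup>2 + (norm (h1 y))\<^sup>2" using sum_squares_bound[of "norm (h0 y)" "norm (h1 y)"] by simp
    finally have "2 * \<bar>h0 y \<bullet> h1 y\<bar> \<le> h0 y \<bullet> h0 y + h1 y \<bullet> h1 y" by (simp add: power2_norm_eq_inner)
    moreover have "\<bar>1 + \<kappa>\<bar> \<le> C" by (simp add: C_def)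
    ultimately have "\<bar>1 + \<kappa>\<bar> * (2 * \<bar>h0 y \<bullet> h1 y\<bar>) \<le> C * (h0 y \<bullet> h0 y + h1 y \<bullet> h1 y)"
      by (intro mult_mono) auto
    moreover have "\<bar>2 * (1 + \<kappa>) * t\<bar> = \<bar>1 + \<kappa>\<bar> * (2 * \<bar>t\<bar>)" for t :: real
      by (simp only: abs_mult abs_numeral mult_ac)
    ultimately show ?thesis by simp
  qed
  have mvt: "\<exists>y\<in>{u..v}. D \<sigma> v - D \<sigma> u = D' \<sigma> y * (v - u)" if "0 \<le> u" "u \<le> v" "v \<le> l" for u v \<sigma>
  proof -
    have "\<exists>y\<in>{u..v}. D \<sigma> v - D \<sigma> u = (\<lambda>h. D' \<sigma> y * h) (v - u)"
    proof (rule mvt_very_simple[OF that(2)])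
      fix y assume "u \<le> y" "y \<le> v"
      then have "(D \<sigma> has_real_derivative D' \<sigma> y) (at y within {u..v})"
        by (intro has_field_derivative_subset[OF deriv]) (use that in auto)
      then show "(D \<sigma> has_derivative (\<lambda>h. D' \<sigma> y * h)) (at y within {u..v})"
        by (simp add: has_field_derivative_def)
    qed
    then show ?thesis by simp
  qed
  define \<sigma> where "\<sigma> = (if a = 0 then -1 else 1 :: real)"
  have "D \<sigma> x \<le> 0"
  proof (cases "a = 0")
    case True
    obtain y where y: "D \<sigma> x - D \<sigma> 0 = D' \<sigma> y * (x - 0)" using mvt[of 0 x \<sigma>] x by auto
    have "D' \<sigma> y \<le> 0"
      unfolding D'_def using True cross[of y] by (intro mult_nonneg_nonpos) (auto simp: \<sigma>_def)
    then have "D' \<sigma> y * (x - 0) \<le> 0" using x by (intro mult_nonpos_nonneg) auto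
    moreover have "D \<sigma> 0 = 0" using z True by (simp add: D_def)
    ultimately show ?thesis using y by simp
  next
    case False
    obtain y where y: "D \<sigma> l - D \<sigma> x = D' \<sigma> y * (l - x)" using mvt[of x l \<sigma>] x by auto
    have "0 \<le> D' \<sigma> y"
      unfolding D'_def using False cross[of y] by (intro mult_nonneg_nonneg) (auto simp: \<sigma>_def)
    then have "0 \<le> D' \<sigma> y * (l - x)" using x by (intro mult_nonneg_nonneg) auto
    moreover have "D \<sigma> l = 0" using z False by (simp add: D_def)
    ultimately show ?thesis using y by simp
  qed
  then have "h0 x \<bullet> h0 x + h1 x \<bullet> h1 x \<le> 0" by (simp add: D_def mult_le_0_iff)
  then have "h0 x \<bullet> h0 x \<le> 0" using inner_ge_zero[of "h1 x"] by linarith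
  then show ?thesis by (metis inner_ge_zero antisym inner_eq_zero_iff)
qed

section \<open>Geometry of the path metric: finite balls, volume growth, cutoffs\<close>

section \<open>Walks and the path metric\<close>

text \<open>Walks with the total length as an index, so that facts about them follow by rule
  induction instead of list indexing.\<close>

inductive walk_len :: "('e \<Rightarrow> 'v) \<Rightarrow> ('e \<Rightarrow> 'v) \<Rightarrow> ('e \<Rightarrow> real) \<Rightarrow> 'v \<Rightarrow> 'v \<Rightarrow> real \<Rightarrow> bool"
  for src tgt len where
  walk_nil: "walk_len src tgt len u u 0"
| walk_step: "{src e, tgt e} = {u, w} \<Longrightarrow> walk_len src tgt len w v L \<Longrightarrow> walk_len src tgt len u v (len e + L)"

lemma walk_len_iff:
  "walk_len src tgt len u v L \<longleftrightarrow> (\<exists>vs es. is_walk src tgt u v vs es \<and> L = sum_list (map len es))"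
proof
  assume "walk_len src tgt len u v L"
  then show "\<exists>vs es. is_walk src tgt u v vs es \<and> L = sum_list (map len es)"
  proof induction
    case (walk_nil u)
    have "is_walk src tgt u u [u] []" by (simp add: is_walk_def)
    then show ?case by force
  next
    case (walk_step e u w v L)
    then obtain vs es where w: "is_walk src tgt w v vs es" "L = sum_list (map len es)" by blast
    have ne: "vs \<noteq> []" using w(1) by (auto simp: is_walk_def)
    then have vs: "vs \<noteq> []" "vs ! 0 = w" using w(1) by (simp_all add: is_walk_def flip: hd_conv_nth)
    have "is_walk src tgt u v (u # vs) (e # es)"
      using w(1) vs walk_step.hyps(1) by (auto simp: is_walk_def nth_Cons split: nat.splits)
    then show ?case using w(2) by (intro exI[of _ "u # vs"] exI[of _ "e # es"]) simp
  qed
next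
  assume "\<exists>vs es. is_walk src tgt u v vs es \<and> L = sum_list (map len es)"
  then obtain vs es where w: "is_walk src tgt u v vs es" and L: "L = sum_list (map len es)" by blast
  have "walk_len src tgt len u v (sum_list (map len es))"
    using w
  proof (induction es arbitrary: u vs)
    case Nil
    then obtain x where "vs = [x]" by (auto simp: is_walk_def length_Suc_conv)
    with Nil show ?case by (auto simp: is_walk_def intro: walk_nil)
  next
    case (Cons e es)
    then obtain w vs' where vs: "vs = u # w # vs'" by (auto simp: is_walk_def length_Suc_conv)
    have step: "\<And>k. k < length (e # es) \<Longrightarrow> {src ((e # es) ! k), tgt ((e # es) ! k)} = {vs ! k, vs ! Suc k}"
      using Cons.prems by (simp add: is_walk_def)
    have "is_walk src tgt w v (w # vs') es"
      using Cons.prems step[of "Suc _"] vs by (auto simp: is_walk_def)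
    from Cons.IH[OF this] show ?case
      using step[of 0] vs by (auto intro!: walk_step[of src e tgt u w])
  qed
  with L show "walk_len src tgt len u v L" by simp
qed

lemma rho0_walk_len: "rho0 src tgt len u v = Inf {L. walk_len src tgt len u v L}"
  unfolding rho0_def walk_len_iff by (rule arg_cong[of _ _ Inf]) auto

locale metric_graph =
  fixes src tgt :: "'e::countable \<Rightarrow> 'v::countable" and len :: "'e \<Rightarrow> real"
  assumes setting: "graph_setting src tgt len"
begin

abbreviation "walk \<equiv> walk_len src tgt len"
abbreviation "rho \<equiv> rho0 src tgt len"
abbreviation "M r v \<equiv> mball src tgt len r v"

definition touching :: "'v set \<Rightarrow> 'e set" where "touching X = {e. src e \<in> X \<or> tgt e \<in> X}"

lemma len_pos: "0 < len e" and no_loop: "src e \<noteq> tgt e"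
  and finite_edges_at: "finite (edges_at src tgt v)" and edges_at_nonempty: "edges_at src tgt v \<noteq> {}"
  using setting by (auto simp: graph_setting_def)

lemma len_bound: "\<exists>l>0. \<forall>e. len e \<le> l"
proof -
  have "bdd_above (range len)" using setting by (auto simp: graph_setting_def)
  then obtain l where "\<And>e. len e \<le> l" by (auto simp: bdd_above_def)
  then show ?thesis by (intro exI[of _ "max 1 l"]) (auto simp: le_max_iff_disj)
qed

lemma connected: "\<exists>L. walk u v L"
  using setting walk_len_iff[of src tgt len u v] by (auto simp: graph_setting_def)

lemma walk_nonneg: "walk u v L \<Longrightarrow> 0 \<le> L"
  by (induction rule: walk_len.induct) (auto intro!: add_nonneg_nonneg less_imp_le[OF len_pos])

lemma walk_trans: "walk u v L \<Longrightarrow> walk v w L' \<Longrightarrow> walk u w (L + L')"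
  by (induction rule: walk_len.induct) (auto simp: add.assoc intro: walk_step)

lemma walk_edge: "{src e, tgt e} = {u, w} \<Longrightarrow> walk u w (len e)"
  using walk_step[OF _ walk_nil, of src e tgt u w len] by simp

lemma walk_sym: "walk u v L \<Longrightarrow> walk v u L"
proof (induction rule: walk_len.induct)
  case (walk_step e u w v L)
  have "walk w u (len e)" by (rule walk_edge) (use walk_step.hyps(1) in auto)
  from walk_trans[OF walk_step.IH this] show ?case by (simp add: add.commute)
qed (rule walk_nil)

lemma bdd_below_walks: "bdd_below {L. walk u v L}"
  by (rule bdd_belowI[of _ 0]) (auto dest: walk_nonneg)

lemma rho_le: "walk u v L \<Longrightarrow> rho u v \<le> L"
  unfolding rho0_walk_len by (rule cInf_lower) (auto intro: bdd_below_walks)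

lemma rho_less: "rho u v < t \<Longrightarrow> \<exists>L<t. walk u v L"
  unfolding rho0_walk_len using cInf_lessD[of "{L. walk u v L}" t] connected[of u v] by auto

lemma rho_nonneg: "0 \<le> rho u v"
  unfolding rho0_walk_len by (rule cInf_greatest) (use connected walk_nonneg in auto)

lemma rho_self [simp]: "rho u u = 0"
  using rho_le[OF walk_nil] rho_nonneg[of u u] by (rule antisym)

lemma rho_sym: "rho u v = rho v u"
  unfolding rho0_walk_len by (rule arg_cong[of _ _ Inf]) (auto intro: walk_sym)

lemma rho_triangle: "rho u w \<le> rho u v + rho v w"
proof (rule field_le_epsilon)
  fix e :: real assume "e > 0"
  then obtain L L' where "L < rho u v + e/2" "walk u v L" "L' < rho v w + e/2" "walk v w L'"
    using rho_less[of u v "rho u v + e/2"] rho_less[of v w "rho v w + e/2"] by auto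
  with rho_le[OF walk_trans, of u v L w L'] show "rho u w \<le> rho u v + rho v w + e" by simp
qed

lemma rho_edge: "rho (src e) (tgt e) \<le> len e"
  by (rule rho_le[OF walk_edge]) simp

lemma rho_edge_diff: "\<bar>rho (src e) v - rho (tgt e) v\<bar> \<le> len e"
  using rho_triangle[of "src e" v "tgt e"] rho_triangle[of "tgt e" v "src e"] rho_edge[of e] rho_sym[of "src e" "tgt e"]
  by linarith

lemma touching_UN: "touching X = (\<Union>v\<in>X. edges_at src tgt v)"
  by (auto simp: touching_def edges_at_def)

lemma finite_touching: "finite X \<Longrightarrow> finite (touching X)"
  by (simp add: touching_UN finite_edges_at)

section \<open>Finiteness of balls\<close>

definition other :: "'e \<Rightarrow> 'v \<Rightarrow> 'v" where "other e u = (if src e = u then tgt e else src e)"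

lemma other_edge: "e \<in> edges_at src tgt u \<Longrightarrow> {src e, tgt e} = {u, other e u}"
  by (auto simp: edges_at_def other_def)

text \<open>The step of Koenig's lemma: a walk from \<open>u\<close> to another vertex starts with
  one of finitely many edges, so infinitely many targets remain behind at least one of them, within
  the radius left over.\<close>

lemma infinite_ball_step:
  assumes "infinite {w. rho u w < t}"
  shows "\<exists>e\<in>edges_at src tgt u. infinite {w. rho (other e u) w < t - len e}"
proof (rule ccontr)
  assume "\<not> ?thesis"
  then have "finite (insert u (\<Union>e\<in>edges_at src tgt u. {w. rho (other e u) w < t - len e}))"
    using finite_edges_at by auto
  moreover have "{w. rho u w < t} \<subseteq> insert u (\<Union>e\<in>edges_at src tgt u. {w. rho (other e u) w < t - len e})"
  proof
    fix x assume "x \<in> {w. rho u w < t}"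
    then obtain L where L: "L < t" "walk u x L" using rho_less by blast
    from L(2) show "x \<in> insert u (\<Union>e\<in>edges_at src tgt u. {w. rho (other e u) w < t - len e})"
    proof cases
      case (walk_step e w L')
      have e: "e \<in> edges_at src tgt u" and "other e u = w"
        using walk_step(2) no_loop[of e] by (auto simp: edges_at_def other_def doubleton_eq_iff)
      moreover have "rho w x < t - len e" using rho_le[OF walk_step(3)] L(1) walk_step(1) by simp
      ultimately show ?thesis by auto
    qed simp
  qed
  ultimately show False using assms finite_subset by blast
qed

text \<open>An infinite ball could be followed along edges for ever; the path has finite total length, so by
  completeness it would converge to a vertex, but a vertex has no other vertices nearby.\<close>
lemma finite_balls:
  assumes complete: "rho0_complete src tgt len"
  shows "finite {w. rho u w < t}"
proof (rule ccontr)
  assume inf: "infinite {w. rho u w < t}"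
  \<comment> \<open>A state is a vertex with the radius still available. The radii decrease by the
    edge lengths and stay nonnegative, which bounds the length of the whole path.\<close>
  define bad where "bad p \<longleftrightarrow> infinite {w. rho (fst p) w < snd p}" for p :: "'v \<times> real"
  have "\<exists>f. f 0 = (u, t) \<and> (\<forall>n. bad (f n)) \<and> (\<forall>n. \<exists>e. {src e, tgt e} = {fst (f n), fst (f (Suc n))} \<and> snd (f (Suc n)) = snd (f n) - len e)"
  proof -
    have "\<exists>f. \<forall>n. (bad (f n) \<and> (n = 0 \<longrightarrow> f n = (u, t))) \<and> (\<exists>e. {src e, tgt e} = {fst (f n), fst (f (Suc n))} \<and> snd (f (Suc n)) = snd (f n) - len e)"
    proof (rule dependent_nat_choice)
      show "\<exists>x. bad x \<and> ((0::nat) = 0 \<longrightarrow> x = (u, t))" using inf by (auto simp: bad_def)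
      fix x :: "'v \<times> real" and n :: nat
      assume "bad x \<and> (n = 0 \<longrightarrow> x = (u, t))"
      then obtain e where e: "e \<in> edges_at src tgt (fst x)" "infinite {w. rho (other e (fst x)) w < snd x - len e}"
        using infinite_ball_step by (auto simp: bad_def)
      then show "\<exists>y. (bad y \<and> (Suc n = 0 \<longrightarrow> y = (u, t))) \<and> (\<exists>e. {src e, tgt e} = {fst x, fst y} \<and> snd y = snd x - len e)"
        using other_edge[OF e(1)]
        by (intro exI[of _ "(other e (fst x), snd x - len e)"]) (auto simp: bad_def)
    qed
    then show ?thesis by blast
  qed
  then obtain f where f: "\<And>n. bad (f n)"
    "\<And>n. \<exists>e. {src e, tgt e} = {fst (f n), fst (f (Suc n))} \<and> snd (f (Suc n)) = snd (f n) - len e" by blast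
  define s where "s n = fst (f n)" for n
  define b where "b n = snd (f n)" for n
  have b0: "0 \<le> b n" for n
  proof (rule ccontr)
    assume "\<not> 0 \<le> b n"
    then have "\<not> rho (s n) w < b n" for w using rho_nonneg[of "s n" w] by linarith
    then have "{w. rho (s n) w < b n} = {}" by blast
    with f(1)[of n] show False by (simp add: bad_def s_def b_def)
  qed
  have step: "rho (s n) (s (Suc n)) \<le> b n - b (Suc n)" "b (Suc n) \<le> b n" "s n \<noteq> s (Suc n)" for n
  proof -
    obtain e where e: "{src e, tgt e} = {s n, s (Suc n)}" "b (Suc n) = b n - len e"
      using f(2)[of n] by (auto simp: s_def b_def)
    show "rho (s n) (s (Suc n)) \<le> b n - b (Suc n)" using rho_le[OF walk_edge[OF e(1)]] e(2) by simp
    show "b (Suc n) \<le> b n" using e(2) len_pos[of e] by simp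
    show "s n \<noteq> s (Suc n)" using e(1) no_loop[of e] by (auto simp: doubleton_eq_iff)
  qed
  have mn: "rho (s m) (s (m + k)) \<le> b m - b (m + k)" for m k
  proof (induction k)
    case (Suc k)
    then show ?case using rho_triangle[of "s m" "s (m + Suc k)" "s (m + k)"] step(1)[of "m + k"] by simp
  qed simp
  have le: "rho (s m) (s n) \<le> \<bar>b m - b n\<bar>" for m n
  proof (cases "m \<le> n")
    case True
    then show ?thesis using mn[of m "n - m"] by simp
  next
    case False
    then show ?thesis using mn[of n "m - n"] rho_sym[of "s m" "s n"] by simp
  qed
  have "convergent b"
  proof (rule Bseq_monoseq_convergent)
    show "monoseq b" using step(2) by (auto simp: monoseq_Suc)
    have "b n \<le> b 0" for n by (induction n) (auto intro: order_trans[OF step(2)])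
    then have "\<bar>b n\<bar> \<le> b 0" for n using b0[of n] by simp
    then show "Bseq b" by (intro BseqI'[of _ "b 0"]) simp
  qed
  then have "Cauchy b" by (rule convergent_Cauchy)
  then have "\<forall>\<epsilon>>0. \<exists>N. \<forall>m\<ge>N. \<forall>n\<ge>N. rho (s m) (s n) < \<epsilon>"
    unfolding Cauchy_def dist_real_def using le by (meson le_less_trans)
  then obtain v where v: "(\<lambda>n. rho (s n) v) \<longlonglongrightarrow> 0"
    using complete unfolding rho0_complete_def by blast
  \<comment> \<open>The shortest edge at the limit \<open>v\<close>: no other vertex is closer than
    this, while the path changes its vertex at every step and so cannot settle at
    \<open>v\<close>.\<close>
  define d where "d = Min (len ` edges_at src tgt v)"
  have d: "d > 0" unfolding d_def using finite_edges_at edges_at_nonempty len_pos by (subst Min_gr_iff) auto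
  have near: "x = v" if xv: "rho x v < d" for x
  proof -
    obtain L where L: "L < d" "walk v x L" using rho_less[of v x d] xv rho_sym[of x v] by auto
    from L(2) show ?thesis
    proof cases
      case (walk_step e w L')
      have "e \<in> edges_at src tgt v" using walk_step(2) by (auto simp: edges_at_def doubleton_eq_iff)
      then have "d \<le> len e" unfolding d_def using finite_edges_at by (intro Min_le) auto
      with walk_nonneg[OF walk_step(3)] L(1) walk_step(1) show ?thesis by simp
    qed simp
  qed
  have "\<forall>\<^sub>F n in sequentially. rho (s n) v < d" using v d by (rule order_tendstoD)
  then obtain N where "\<And>n. n \<ge> N \<Longrightarrow> rho (s n) v < d" by (auto simp: eventually_sequentially)
  then have "s N = v" "s (Suc N) = v" by (auto intro!: near)
  with step(3)[of N] show False by simp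
qed

end

section \<open>Volume growth\<close>

text \<open>Iterating a gain of \<open>A\<close> per step of length \<open>T\<close>; the number of
  whole steps up to \<open>r\<close> is a floor, which costs the -1.\<close>

lemma growth_bound:
  fixes M :: "real \<Rightarrow> real"
  assumes mono: "\<And>r r'. s1 \<le> r \<Longrightarrow> r \<le> r' \<Longrightarrow> M r \<le> M r'" and pos: "M s1 > 0" and T: "T > 0" and A: "A > 1"
    and grow: "\<And>s. s \<ge> s1 \<Longrightarrow> A * M s < M (s + T)" and r: "r \<ge> s1"
  shows "ln (M s1) + ((r - s1) / T - 1) * ln A \<le> ln (M r)"
proof -
  have pow: "A ^ k * M s1 \<le> M (s1 + real k * T)" for k
  proof (induction k)
    case (Suc k)
    have "A ^ Suc k * M s1 \<le> A * M (s1 + real k * T)" using Suc A by simp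
    also have "\<dots> \<le> M ((s1 + real k * T) + T)" using T by (intro less_imp_le[OF grow]) simp
    finally show ?case by (simp add: algebra_simps)
  qed simp
  define k where "k = nat \<lfloor>(r - s1) / T\<rfloor>"
  have q: "0 \<le> (r - s1) / T" using r T by simp
  have k: "real k \<le> (r - s1) / T" "(r - s1) / T - 1 \<le> real k"
    using q unfolding k_def by (simp_all add: of_nat_nat)
  have "s1 + real k * T \<le> r" using k(1) T by (simp add: field_simps)
  then have "M (s1 + real k * T) \<le> M r" using T by (intro mono) auto
  with pow[of k] have le: "A ^ k * M s1 \<le> M r" by simp
  have "((r - s1) / T - 1) * ln A \<le> real k * ln A" using k(2) A by (intro mult_right_mono) auto
  also have "\<dots> + ln (M s1) = ln (A ^ k * M s1)" using A pos by (simp add: ln_mult ln_realpow)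
  also have "\<dots> \<le> ln (M r)" using le A pos by (subst ln_le_cancel_iff) (auto intro: less_le_trans[OF _ le])
  finally show ?thesis by simp
qed

lemma clamp_diff: "\<bar>max 0 (min 1 a) - max 0 (min 1 b)\<bar> \<le> \<bar>a - b\<bar>" for a b :: real
  by (auto simp: max_def min_def abs_if)

lemma min_diff: "\<bar>min a b - min c d\<bar> \<le> max \<bar>a - c\<bar> \<bar>b - d\<bar>" for a b c d :: real
  by (auto simp: max_def min_def abs_if)

locale complete_metric_graph = metric_graph src tgt len
  for src tgt :: "'e::countable \<Rightarrow> 'v::countable" and len :: "'e \<Rightarrow> real" +
  assumes complete: "rho0_complete src tgt len"
begin

lemma finite_ball0: "finite (ball0 src tgt len r v)"
proof (rule finite_subset)
  show "ball0 src tgt len r v \<subseteq> {w. rho v w < r + 1}"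
    using rho_sym[of _ v] by (auto simp: ball0_def)
qed (rule finite_balls[OF complete])

lemma mv_pos: "0 < mv src tgt len v"
  unfolding mv_def using finite_edges_at edges_at_nonempty len_pos by (intro sum_pos) auto

lemma mball_mono: "r \<le> r' \<Longrightarrow> M r v \<le> M r' v"
  unfolding mball_def using finite_ball0 mv_pos
  by (intro sum_mono2) (auto simp: ball0_def intro: less_imp_le)

lemma mball_nonneg: "0 \<le> M r v"
  unfolding mball_def by (intro sum_nonneg less_imp_le[OF mv_pos])

lemma mball_pos:
  assumes "0 \<le> r" shows "0 < M r v"
proof -
  have "mv src tgt len v \<le> M r v"
    unfolding mball_def by (rule member_le_sum) (use assms finite_ball0 mv_pos in \<open>auto simp: ball0_def intro: less_imp_le\<close>)
  with mv_pos[of v] show ?thesis by simp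
qed

text \<open>Double counting: an edge touching \<open>X\<close> has one or two endpoints in
  \<open>X\<close> and is counted that often in the vertex volume.\<close>

lemma volume_touching:
  assumes "finite X"
  shows "(\<Sum>u\<in>X. mv src tgt len u) \<le> 2 * (\<Sum>e\<in>touching X. len e)"
    and "(\<Sum>e\<in>touching X. len e) \<le> (\<Sum>u\<in>X. mv src tgt len u)"
proof -
  have "(\<Sum>u\<in>X. mv src tgt len u) = (\<Sum>u\<in>X. \<Sum>e\<in>touching X. if u \<in> {src e, tgt e} then len e else 0)"
  proof (rule sum.cong[OF refl])
    fix u assume u: "u \<in> X"
    have eq: "edges_at src tgt u = {e \<in> touching X. u \<in> {src e, tgt e}}" using u by (auto simp: edges_at_def touching_def)
    show "mv src tgt len u = (\<Sum>e\<in>touching X. if u \<in> {src e, tgt e} then len e else 0)"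
      unfolding mv_def eq using finite_touching[OF assms] by (subst sum.inter_filter[symmetric]) auto
  qed
  also have "\<dots> = (\<Sum>e\<in>touching X. \<Sum>u\<in>X. if u \<in> {src e, tgt e} then len e else 0)" by (rule sum.swap)
  also have "\<dots> = (\<Sum>e\<in>touching X. real (card (X \<inter> {src e, tgt e})) * len e)"
  proof (rule sum.cong[OF refl])
    fix e
    have "(\<Sum>u\<in>X. if u \<in> {src e, tgt e} then len e else 0) = (\<Sum>u\<in>{u \<in> X. u \<in> {src e, tgt e}}. len e)"
      using assms by (subst sum.inter_filter[symmetric]) auto
    also have "{u \<in> X. u \<in> {src e, tgt e}} = X \<inter> {src e, tgt e}" by auto
    finally show "(\<Sum>u\<in>X. if u \<in> {src e, tgt e} then len e else 0) = real (card (X \<inter> {src e, tgt e})) * len e" by simp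
  qed
  finally have eq: "(\<Sum>u\<in>X. mv src tgt len u) = (\<Sum>e\<in>touching X. real (card (X \<inter> {src e, tgt e})) * len e)" .
  have card2: "card (X \<inter> {src e, tgt e}) \<le> 2" for e
    using card_mono[of "{src e, tgt e}" "X \<inter> {src e, tgt e}"] card_insert_le_m1[of 2 "{tgt e}" "src e"] by simp
  show "(\<Sum>u\<in>X. mv src tgt len u) \<le> 2 * (\<Sum>e\<in>touching X. len e)"
    unfolding eq sum_distrib_left using card2 len_pos
    by (intro sum_mono mult_right_mono) (auto intro: less_imp_le)
  show "(\<Sum>e\<in>touching X. len e) \<le> (\<Sum>u\<in>X. mv src tgt len u)"
    unfolding eq
  proof (rule sum_mono)
    fix e assume "e \<in> touching X"
    then have "card (X \<inter> {src e, tgt e}) > 0" by (subst card_gt_0_iff) (auto simp: touching_def)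
    then have "1 \<le> real (card (X \<inter> {src e, tgt e}))" by simp
    from mult_right_mono[OF this, of "len e"] len_pos[of e]
    show "len e \<le> real (card (X \<inter> {src e, tgt e})) * len e" by simp
  qed
qed

text \<open>If every step of length \<open>T\<close> beyond \<open>s1\<close> multiplied the volume
  by more than \<open>A\<close>, the exponent would be at least ln A / T up to constants. Half of
  that rate absorbs the constants once r \<ge> R.\<close>

lemma slow_growth:
  assumes mu: "mu_exp src tgt len v < ereal (ln A / (2 * T))" and T: "T > 0" and A: "A > 1" and s1: "s1 \<ge> 0"
  shows "\<exists>s\<ge>s1. M (s + T) v \<le> A * M s v"
proof (rule ccontr)
  assume "\<not> ?thesis"
  then have grow: "\<And>s. s \<ge> s1 \<Longrightarrow> A * M s v < M (s + T) v" by (meson not_le)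
  define c where "c = ln A / (2 * T)"
  define R where "R = max (max 1 s1) ((s1 / T * ln A + ln A - ln (M s1 v)) / c)"
  have c: "c > 0" using A T by (simp add: c_def)
  have "ereal c \<le> ereal (ln (M r v) / r)" if r: "r \<ge> R" for r
  proof -
    have r1: "r \<ge> 1" "r \<ge> s1" "(s1 / T * ln A + ln A - ln (M s1 v)) / c \<le> r" using r by (auto simp: R_def)
    from r1(3) have "s1 / T * ln A + ln A - ln (M s1 v) \<le> r * c" using c by (simp add: pos_divide_le_eq)
    moreover have "ln (M s1 v) + ((r - s1) / T - 1) * ln A \<le> ln (M r v)"
      by (rule growth_bound[OF mball_mono mball_pos[OF s1] T A grow r1(2)])
    moreover have "((r - s1) / T - 1) * ln A = 2 * (r * c) - s1 / T * ln A - ln A"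
      using T by (simp add: c_def field_simps)
    ultimately have "r * c \<le> ln (M r v)" by simp
    then show ?thesis using r1(1) by (simp add: pos_le_divide_eq mult.commute)
  qed
  then have "\<forall>\<^sub>F r in at_top. ereal c \<le> ereal (ln (M r v) / r)"
    by (auto simp: eventually_at_top_linorder)
  then have "ereal c \<le> mu_exp src tgt len v" unfolding mu_exp_def by (rule Liminf_bounded)
  with mu show False by (simp add: c_def)
qed

text \<open>As for a fixed centre, but starting at radius 1: the division by the volume of the unit
  ball cancels the initial constant, so that the threshold \<open>R\<close> is the same for all
  centres and the infimum can be taken.\<close>

lemma slow_growth_uniform:
  assumes mu: "mu_unif src tgt len < ereal (ln A / (2 * T))" and T: "T > 0" and A: "A > 1"
  shows "\<exists>v. \<exists>s\<ge>1. M (s + T) v \<le> A * M s v"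
proof (rule ccontr)
  assume "\<not> ?thesis"
  then have grow: "\<And>v s. s \<ge> 1 \<Longrightarrow> A * M s v < M (s + T) v" by (meson not_le)
  define c where "c = ln A / (2 * T)"
  define R where "R = max 1 ((1 / T * ln A + ln A) / c)"
  have c: "c > 0" using A T by (simp add: c_def)
  have "ereal c \<le> (INF v. ereal (ln (M r v / M 1 v))) / ereal r" if r: "r \<ge> R" for r
  proof -
    have r1: "r \<ge> 1" "(1 / T * ln A + ln A) / c \<le> r" using r by (auto simp: R_def)
    have "ereal (r * c) \<le> (INF v. ereal (ln (M r v / M 1 v)))"
    proof (rule INF_greatest)
      fix v
      from r1(2) have "1 / T * ln A + ln A \<le> r * c" using c by (simp add: pos_divide_le_eq)
      moreover have "ln (M 1 v) + ((r - 1) / T - 1) * ln A \<le> ln (M r v)"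
        by (rule growth_bound[where M = "\<lambda>s. M s v", OF mball_mono mball_pos T A grow r1(1)]) auto
      moreover have "((r - 1) / T - 1) * ln A = 2 * (r * c) - 1 / T * ln A - ln A"
        using T by (simp add: c_def field_simps)
      moreover have "ln (M r v / M 1 v) = ln (M r v) - ln (M 1 v)"
        using mball_pos[of r v] mball_pos[of 1 v] r1(1) by (simp add: ln_div)
      ultimately show "ereal (r * c) \<le> ereal (ln (M r v / M 1 v))" by simp
    qed
    then have "ereal (r * c) / ereal r \<le> (INF v. ereal (ln (M r v / M 1 v))) / ereal r"
      using r1(1) by (intro ereal_divide_right_mono) auto
    then show ?thesis using r1(1) by simp
  qed
  then have "\<forall>\<^sub>F r in at_top. ereal c \<le> (INF v. ereal (ln (M r v / M 1 v))) / ereal r"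
    by (auto simp: eventually_at_top_linorder)
  then have "ereal c \<le> mu_unif src tgt len" unfolding mu_unif_def by (rule Liminf_bounded)
  with mu show False by (simp add: c_def)
qed

lemma infinite_volume:
  assumes "(\<Sum>\<^sub>\<infinity>v. ennreal (mv src tgt len v)) = \<infinity>"
  shows "\<exists>s1\<ge>0. \<forall>s\<ge>s1. K \<le> M s v"
proof -
  have "(SUP F\<in>{F. finite F \<and> F \<subseteq> UNIV}. \<Sum>u\<in>F. ennreal (mv src tgt len u)) = \<infinity>"
    using assms by (subst (asm) nonneg_infsum_complete) auto
  then have "ennreal K < (SUP F\<in>{F. finite F \<and> F \<subseteq> UNIV}. \<Sum>u\<in>F. ennreal (mv src tgt len u))"
    by (simp only:) simp
  then have "\<exists>F\<in>{F. finite F \<and> F \<subseteq> UNIV}. ennreal K < (\<Sum>u\<in>F. ennreal (mv src tgt len u))"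
    unfolding less_SUP_iff .
  then obtain F where F: "finite F" "ennreal K < (\<Sum>u\<in>F. ennreal (mv src tgt len u))" by auto
  then have "ennreal K < ennreal (\<Sum>u\<in>F. mv src tgt len u)"
    using mv_pos by (simp add: sum_ennreal less_imp_le)
  then have K: "K \<le> (\<Sum>u\<in>F. mv src tgt len u)"
    by (metis ennreal_leI leD linear)
  define s1 where "s1 = Max (insert 0 ((\<lambda>u. rho u v) ` F))"
  have s1: "s1 \<ge> 0" "\<And>u. u \<in> F \<Longrightarrow> rho u v \<le> s1" using F(1) by (auto simp: s1_def)
  have "K \<le> M s v" if "s \<ge> s1" for s
  proof -
    have "(\<Sum>u\<in>F. mv src tgt len u) \<le> M s v"
      unfolding mball_def using that s1(2) mv_pos
      by (intro sum_mono2 finite_ball0) (auto simp: ball0_def intro: less_imp_le order_trans)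
    with K show ?thesis by simp
  qed
  with s1 show ?thesis by blast
qed

section \<open>Cutoff functions\<close>

text \<open>A cone over the distance from \<open>src e0\<close>, raised by
  \<open>\<eta> * len e0\<close> so as to reach 1 at the other endpoint as well, and clamped to
  [0, 1]. Its support lies in a ball and is therefore finite.\<close>

lemma cutoff_exists:
  assumes "\<eta> > 0"
  shows "\<exists>\<phi>::'v \<Rightarrow> real. finite {v. \<phi> v \<noteq> 0} \<and> \<phi> (src e0) = 1 \<and> \<phi> (tgt e0) = 1
     \<and> (\<forall>e. \<bar>\<phi> (src e) - \<phi> (tgt e)\<bar> \<le> \<eta> * len e)"
proof -
  define v where "v = src e0"
  define \<phi> where "\<phi> u = max 0 (min 1 (1 + \<eta> * len e0 - \<eta> * rho u v))" for u
  have "{u. \<phi> u \<noteq> 0} \<subseteq> ball0 src tgt len ((1 + \<eta> * len e0) / \<eta>) v"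
  proof
    fix u assume "u \<in> {u. \<phi> u \<noteq> 0}"
    then have "\<eta> * rho u v \<le> 1 + \<eta> * len e0" by (auto simp: \<phi>_def max_def min_def split: if_splits)
    then show "u \<in> ball0 src tgt len ((1 + \<eta> * len e0) / \<eta>) v"
      using assms by (simp add: ball0_def pos_le_divide_eq mult.commute)
  qed
  then have "finite {u. \<phi> u \<noteq> 0}" using finite_ball0 finite_subset by blast
  moreover have "\<phi> (src e0) = 1" using assms len_pos[of e0] by (simp add: \<phi>_def v_def)
  moreover have "\<eta> * rho (tgt e0) v \<le> \<eta> * len e0"
    using assms rho_edge[of e0] rho_sym by (intro mult_left_mono) (auto simp: v_def)
  then have "\<phi> (tgt e0) = 1" by (simp add: \<phi>_def)
  moreover have "\<bar>\<phi> (src e) - \<phi> (tgt e)\<bar> \<le> \<eta> * len e" for e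
  proof -
    have "\<bar>\<phi> (src e) - \<phi> (tgt e)\<bar> \<le> \<bar>\<eta> * rho (tgt e) v - \<eta> * rho (src e) v\<bar>"
      unfolding \<phi>_def by (rule order_trans[OF clamp_diff]) simp
    also have "\<dots> = \<eta> * \<bar>rho (src e) v - rho (tgt e) v\<bar>"
      using assms by (simp add: abs_mult abs_minus_commute flip: right_diff_distrib)
    also have "\<dots> \<le> \<eta> * len e" using assms rho_edge_diff by (intro mult_left_mono) auto
    finally show ?thesis .
  qed
  ultimately show ?thesis by blast
qed

text \<open>A Foelner-type datum: 1/T is the slope, 1/(4A) the share of the support on which the
  profile is flat at height 1. The Rayleigh quotient of the resulting test function is of order A /
  T^2.\<close>

definition test_profile :: "('v \<Rightarrow> real) \<Rightarrow> real \<Rightarrow> real \<Rightarrow> bool" where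
  "test_profile \<phi> T A \<longleftrightarrow> finite {v. \<phi> v \<noteq> 0} \<and> (\<forall>e. \<bar>\<phi> (src e) - \<phi> (tgt e)\<bar> \<le> len e / T)
     \<and> 0 < (\<Sum>e\<in>{e \<in> touching {v. \<phi> v \<noteq> 0}. \<phi> (src e) = 1 \<and> \<phi> (tgt e) = 1}. len e)
     \<and> (\<Sum>e\<in>touching {v. \<phi> v \<noteq> 0}. len e)
         \<le> 4 * A * (\<Sum>e\<in>{e \<in> touching {v. \<phi> v \<noteq> 0}. \<phi> (src e) = 1 \<and> \<phi> (tgt e) = 1}. len e)"

text \<open>A trapezoid in the distance from \<open>v\<close>, rising on [s0, s0 + T] and falling on
  [s + l, s + l + T]. The margin \<open>l\<close> puts both ends of an edge touching the
  \<open>s\<close>-ball on the plateau. The 4 arises since edges account for at least half of the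
  vertex volume and the removed inner ball for at most a quarter.\<close>

lemma test_profile_exists:
  assumes T: "T > 0" and A: "A > 0" and l: "\<And>e. len e \<le> l" and s: "s \<ge> 0"
    and grow: "M (s + (l + T)) v \<le> A * M s v" and inner: "4 * M (s0 + T) v \<le> M s v"
  shows "\<exists>\<phi>. test_profile \<phi> T A \<and> (\<forall>u. \<phi> u \<noteq> 0 \<longrightarrow> s0 < rho u v)"
proof -
  define \<phi> where "\<phi> u = min (max 0 (min 1 ((s + l + T - rho u v) / T))) (max 0 (min 1 ((rho u v - s0) / T)))" for u
  define X where "X = {u. \<phi> u \<noteq> 0}"
  define E1 where "E1 = {e \<in> touching X. \<phi> (src e) = 1 \<and> \<phi> (tgt e) = 1}"
  have X: "rho u v < s + l + T" "s0 < rho u v" if "u \<in> X" for u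
  proof -
    have "min (max 0 (min 1 a)) (max 0 (min 1 b)) = 0" if "a \<le> 0 \<or> b \<le> 0" for a b :: real
      using that by (auto simp: min_def max_def)
    with that have "0 < (s + l + T - rho u v) / T \<and> 0 < (rho u v - s0) / T"
      unfolding X_def \<phi>_def by (auto simp: not_le[symmetric])
    with T show "rho u v < s + l + T" "s0 < rho u v" by (auto simp: zero_less_divide_iff)
  qed
  have Xsub: "X \<subseteq> ball0 src tgt len (s + (l + T)) v" using X(1) by (force simp: ball0_def)
  then have fin: "finite X" using finite_ball0 finite_subset by blast
  have one: "\<phi> u = 1" if "s0 + T \<le> rho u v" "rho u v \<le> s + l" for u
    using that T by (simp add: \<phi>_def)
  have lip: "\<bar>\<phi> (src e) - \<phi> (tgt e)\<bar> \<le> len e / T" for e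
  proof -
    have "\<bar>\<phi> (src e) - \<phi> (tgt e)\<bar> \<le> max \<bar>(s + l + T - rho (src e) v) / T - (s + l + T - rho (tgt e) v) / T\<bar>
        \<bar>(rho (src e) v - s0) / T - (rho (tgt e) v - s0) / T\<bar>"
      unfolding \<phi>_def by (rule order_trans[OF min_diff]) (intro max.mono clamp_diff)
    also have "\<dots> = \<bar>rho (src e) v - rho (tgt e) v\<bar> / T"
      using T by (simp add: abs_minus_commute flip: diff_divide_distrib)
    also have "\<dots> \<le> len e / T" using rho_edge_diff T by (intro divide_right_mono) auto
    finally show ?thesis .
  qed
  let ?Ball = "ball0 src tgt len s v" and ?Inner = "ball0 src tgt len (s0 + T) v"
  have "touching ?Ball - touching ?Inner \<subseteq> E1"
  proof
    fix e assume e: "e \<in> touching ?Ball - touching ?Inner"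
    have "rho (src e) v \<le> s + l" "rho (tgt e) v \<le> s + l" "s0 + T \<le> rho (src e) v" "s0 + T \<le> rho (tgt e) v"
      using e rho_edge_diff[of e v] l[of e] len_pos[of e] by (auto simp: touching_def ball0_def)
    then have "\<phi> (src e) = 1" "\<phi> (tgt e) = 1" by (auto intro: one)
    then show "e \<in> E1" by (simp add: E1_def X_def touching_def)
  qed
  then have "(\<Sum>e\<in>touching ?Ball - touching ?Inner. len e) \<le> (\<Sum>e\<in>E1. len e)"
    using finite_touching[OF fin] len_pos by (intro sum_mono2) (auto simp: E1_def intro: less_imp_le)
  moreover have "(\<Sum>e\<in>touching ?Ball. len e) \<le> (\<Sum>e\<in>touching ?Ball - touching ?Inner. len e) + (\<Sum>e\<in>touching ?Inner. len e)"
  proof -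
    have "(\<Sum>e\<in>touching ?Ball. len e) \<le> (\<Sum>e\<in>(touching ?Ball - touching ?Inner) \<union> touching ?Inner. len e)"
      using finite_touching[OF finite_ball0] len_pos by (intro sum_mono2) (auto intro: less_imp_le)
    also have "\<dots> = (\<Sum>e\<in>touching ?Ball - touching ?Inner. len e) + (\<Sum>e\<in>touching ?Inner. len e)"
      by (rule sum.union_disjoint) (simp_all add: finite_touching[OF finite_ball0] Int_commute)
    finally show ?thesis .
  qed
  moreover have "(\<Sum>e\<in>touching ?Inner. len e) \<le> M (s0 + T) v"
    unfolding mball_def by (rule volume_touching(2)[OF finite_ball0])
  moreover have "M s v \<le> 2 * (\<Sum>e\<in>touching ?Ball. len e)"
    unfolding mball_def by (rule volume_touching(1)[OF finite_ball0])
  ultimately have E1: "M s v / 4 \<le> (\<Sum>e\<in>E1. len e)" using inner by simp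
  have "(\<Sum>e\<in>touching X. len e) \<le> (\<Sum>u\<in>X. mv src tgt len u)" by (rule volume_touching(2)[OF fin])
  also have "\<dots> \<le> M (s + (l + T)) v"
    unfolding mball_def using Xsub mv_pos by (intro sum_mono2 finite_ball0) (auto intro: less_imp_le)
  also have "\<dots> \<le> A * M s v" by (rule grow)
  also have "\<dots> = 4 * A * (M s v / 4)" by simp
  also have "\<dots> \<le> 4 * A * (\<Sum>e\<in>E1. len e)" using A E1 by (intro mult_left_mono) auto
  finally have "(\<Sum>e\<in>touching X. len e) \<le> 4 * A * (\<Sum>e\<in>E1. len e)" .
  moreover have "0 < (\<Sum>e\<in>E1. len e)" using E1 mball_pos[OF s, of v] by simp
  ultimately have "test_profile \<phi> T A"
    unfolding test_profile_def using fin lip by (simp add: E1_def X_def)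
  moreover have "\<forall>u. \<phi> u \<noteq> 0 \<longrightarrow> s0 < rho u v" using X(2) by (auto simp: X_def)
  ultimately show ?thesis by blast
qed

lemma test_profile_of_slow_growth:
  assumes "T > 0" "A > 0" "\<And>e. len e \<le> l" "s \<ge> 0" "M (s + (l + T)) v \<le> A * M s v"
  shows "\<exists>\<phi>. test_profile \<phi> T A"
proof -
  \<comment> \<open>The inner radius s0 = -T - 1 is negative enough for the inner ball to be empty,
    so the profile is a full plateau around \<open>v\<close>.\<close>
  have "ball0 src tgt len (- T - 1 + T) v = {}" using rho_nonneg[of _ v] by (auto simp: ball0_def not_le) (metis add.inverse_inverse less_eq_real_def not_le order_less_le_trans zero_less_one neg_0_le_iff_le)
  then have "M (- T - 1 + T) v = 0" unfolding mball_def by simp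
  then have "4 * M (- T - 1 + T) v \<le> M s v" using mball_nonneg by simp
  from test_profile_exists[OF assms this] show ?thesis by blast
qed

text \<open>The slope stays at 1, and \<open>A\<close> is chosen with ln A / (2 (l + 1)) = n + 1,
  above the exponent. Infinite volume lets the outer radius grow until the ball containing
  \<open>E\<close> has at most a quarter of the volume and can be cut out.\<close>

lemma far_test_profiles:
  assumes mu: "mu_exp src tgt len v < \<infinity>" and vol: "(\<Sum>\<^sub>\<infinity>v. ennreal (mv src tgt len v)) = \<infinity>"
  shows "\<exists>A>0. \<forall>E. finite E \<longrightarrow> (\<exists>\<phi>. test_profile \<phi> 1 A \<and> touching {v. \<phi> v \<noteq> 0} \<inter> E = {})"
proof -
  obtain l where l: "l > 0" "\<And>e. len e \<le> l" using len_bound by blast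
  obtain n :: nat where n: "mu_exp src tgt len v < ereal (real n)"
    using mu less_PInf_Ex_of_nat by auto
  define T where "T = l + 1"
  define A where "A = exp (2 * T * (real n + 1))"
  have T: "T > 0" using l by (simp add: T_def)
  have A: "A > 1" using T by (simp add: A_def)
  have lnA: "ln A / (2 * T) = real n + 1" using T by (simp add: A_def)
  have mu': "mu_exp src tgt len v < ereal (ln A / (2 * T))"
    unfolding lnA by (rule less_le_trans[OF n]) simp
  have "\<exists>\<phi>. test_profile \<phi> 1 A \<and> touching {v. \<phi> v \<noteq> 0} \<inter> E = {}" if E: "finite E" for E
  proof -
    define b where "b = Max (insert 0 ((\<lambda>e. max (rho (src e) v) (rho (tgt e) v)) ` E))"
    have b: "rho (src e) v \<le> b" "rho (tgt e) v \<le> b" if "e \<in> E" for e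
    proof -
      have "max (rho (src e) v) (rho (tgt e) v) \<le> b" unfolding b_def using E that by (intro Max_ge) auto
      then show "rho (src e) v \<le> b" "rho (tgt e) v \<le> b" by auto
    qed
    obtain s1 where s1: "s1 \<ge> 0" "\<And>s. s \<ge> s1 \<Longrightarrow> 4 * M (b + 1) v \<le> M s v"
      using infinite_volume[OF vol] by blast
    obtain s where s: "s \<ge> s1" "M (s + T) v \<le> A * M s v" using slow_growth[OF mu' T A s1(1)] by blast
    have "\<exists>\<phi>. test_profile \<phi> 1 A \<and> (\<forall>u. \<phi> u \<noteq> 0 \<longrightarrow> b < rho u v)"
      by (rule test_profile_exists[where l=l and s=s]) (use l s s1 A in \<open>auto simp: T_def\<close>)
    then obtain \<phi> where \<phi>: "test_profile \<phi> 1 A" "\<And>u. \<phi> u \<noteq> 0 \<Longrightarrow> b < rho u v" by blast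
    have "touching {v. \<phi> v \<noteq> 0} \<inter> E = {}" using b \<phi>(2) by (force simp: touching_def)
    with \<phi>(1) show ?thesis by blast
  qed
  with A show ?thesis by (intro exI[of _ A]) auto
qed

end

section \<open>From edges to the graph: Green's formula, vertex conditions, localization\<close>

section \<open>Edgewise integrability\<close>

lemma set_integrable_open_measurable:
  assumes "set_integrable lborel {0..l} (f :: real \<Rightarrow> complex)"
  shows "(\<lambda>x. indicator {0<..<l} x *\<^sub>R f x) \<in> borel_measurable lborel"
proof -
  have [measurable]: "(\<lambda>x. indicator {0..l} x *\<^sub>R f x) \<in> borel_measurable lborel"
    using assms by (simp add: set_integrable_def borel_measurable_integrable)
  have "(\<lambda>x. indicator {0<..<l} x *\<^sub>R (indicator {0..l} x *\<^sub>R f x)) \<in> borel_measurable lborel"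
    by measurable
  also have "(\<lambda>x. indicator {0<..<l} x *\<^sub>R (indicator {0..l} x *\<^sub>R f x)) = (\<lambda>x. indicator {0<..<l} x *\<^sub>R f x)"
    by (auto simp: fun_eq_iff indicator_def)
  finally show ?thesis .
qed

lemma nn_integral_open_eq_set_integral:
  fixes f :: "real \<Rightarrow> complex"
  assumes "set_integrable lborel {0..l} (\<lambda>x. (cmod (f x))\<^sup>2)"
  shows "(\<integral>\<^sup>+x. ennreal (indicator {0<..<l} x * (cmod (f x))\<^sup>2) \<partial>lborel) = ennreal (LBINT x:{0..l}. (cmod (f x))\<^sup>2)"
proof -
  have "(\<integral>\<^sup>+x. ennreal (indicator {0<..<l} x * (cmod (f x))\<^sup>2) \<partial>lborel)
      = (\<integral>\<^sup>+x. ennreal (indicator {0..l} x *\<^sub>R (cmod (f x))\<^sup>2) \<partial>lborel)"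
  proof (rule nn_integral_cong_AE)
    show "AE x in lborel. ennreal (indicator {0<..<l} x * (cmod (f x))\<^sup>2) = ennreal (indicator {0..l} x *\<^sub>R (cmod (f x))\<^sup>2)"
      using AE_lborel_singleton[of "0::real"] AE_lborel_singleton[of l]
      by eventually_elim (auto simp: indicator_def)
  qed
  also have "\<dots> = ennreal (LBINT x:{0..l}. (cmod (f x))\<^sup>2)"
    unfolding set_lebesgue_integral_def
    by (rule nn_integral_eq_integral) (use assms in \<open>auto simp: set_integrable_def\<close>)
  finally show ?thesis .
qed

lemma set_integrable_square_continuous:
  fixes f :: "real \<Rightarrow> complex"
  assumes "continuous_on {0..l} f"
  shows "set_integrable lborel {0..l} (\<lambda>x. (cmod (f x))\<^sup>2)"
  by (intro borel_integrable_atLeastAtMost' continuous_intros assms)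

context metric_graph
begin

lemma gnorm2_zero_outside:
  assumes E: "finite E" "\<And>e x. e \<notin> E \<Longrightarrow> x \<in> {0<..<len e} \<Longrightarrow> f e x = 0"
  shows "gnorm2 len f = (\<Sum>e\<in>E. \<integral>\<^sup>+x. ennreal (indicator {0<..<len e} x * (cmod (f e x))\<^sup>2) \<partial>lborel)"
proof -
  have "(\<integral>\<^sup>+x. ennreal (indicator {0<..<len e} x * (cmod (f e x))\<^sup>2) \<partial>lborel) = 0" if "e \<notin> E" for e
    by (rule trans[OF nn_integral_cong[of _ _ "\<lambda>x. 0"]]) (use E(2)[OF that] in \<open>auto simp: indicator_def\<close>)
  then show ?thesis
    unfolding gnorm2_def nn_integral_count_space_infsum[symmetric]
    by (intro nn_integral_count_space' E) auto
qed

lemma L2G_finite_support: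
  assumes E: "finite E" "\<And>e x. e \<notin> E \<Longrightarrow> x \<in> {0<..<len e} \<Longrightarrow> f e x = 0"
    and int: "\<And>e. e \<in> E \<Longrightarrow> set_integrable lborel {0..len e} (f e)"
    and sq: "\<And>e. e \<in> E \<Longrightarrow> set_integrable lborel {0..len e} (\<lambda>x. (cmod (f e x))\<^sup>2)"
  shows "f \<in> L2G len"
proof -
  have "(\<lambda>x. indicator {0<..<len e} x *\<^sub>R f e x) \<in> borel_measurable lborel" for e
  proof (cases "e \<in> E")
    case True
    then show ?thesis by (intro set_integrable_open_measurable int)
  next
    case False
    then have "(\<lambda>x. indicator {0<..<len e} x *\<^sub>R f e x) = (\<lambda>x. 0)"
      using E(2)[OF False] by (auto simp: fun_eq_iff indicator_def)
    then show ?thesis by simp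
  qed
  note m = this
  have "gnorm2 len f = (\<Sum>e\<in>E. ennreal (LBINT x:{0..len e}. (cmod (f e x))\<^sup>2))"
    by (subst gnorm2_zero_outside[where E=E]) (use E in \<open>auto intro!: sum.cong nn_integral_open_eq_set_integral sq\<close>)
  also have "\<dots> = ennreal (\<Sum>e\<in>E. LBINT x:{0..len e}. (cmod (f e x))\<^sup>2)"
    by (rule sum_ennreal) (auto simp: set_lebesgue_integral_def intro!: integral_nonneg_AE)
  finally have "gnorm2 len f < \<infinity>" by simp
  with m show ?thesis by (simp add: L2G_def)
qed

lemma L2G_edge:
  assumes "f \<in> L2G len"
  shows "set_integrable lborel {0..len e} (f e)" "set_integrable lborel {0..len e} (\<lambda>x. (cmod (f e x))\<^sup>2)"
proof -
  let ?l = "len e"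
  have [measurable]: "(\<lambda>x. indicator {0<..<?l} x *\<^sub>R f e x) \<in> borel_measurable lborel"
    using assms by (simp add: L2G_def)
  have "(\<lambda>x. indicator {0<..<?l} x *\<^sub>R f e x + indicator {0} x *\<^sub>R f e 0 + indicator {?l} x *\<^sub>R f e ?l) \<in> borel_measurable lborel"
    by measurable
  also have "(\<lambda>x. indicator {0<..<?l} x *\<^sub>R f e x + indicator {0} x *\<^sub>R f e 0 + indicator {?l} x *\<^sub>R f e ?l)
      = (\<lambda>x. indicator {0..?l} x *\<^sub>R f e x)"
    using len_pos[of e] by (auto simp: fun_eq_iff indicator_def)
  finally have m [measurable]: "(\<lambda>x. indicator {0..?l} x *\<^sub>R f e x) \<in> borel_measurable lborel" .
  have "(\<lambda>x. (cmod (indicator {0..?l} x *\<^sub>R f e x))\<^sup>2) \<in> borel_measurable lborel" by measurable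
  also have eq: "(\<lambda>x. (cmod (indicator {0..?l} x *\<^sub>R f e x))\<^sup>2) = (\<lambda>x. indicator {0..?l} x *\<^sub>R (cmod (f e x))\<^sup>2)"
    by (auto simp: fun_eq_iff indicator_def)
  finally have m2: "(\<lambda>x. indicator {0..?l} x *\<^sub>R (cmod (f e x))\<^sup>2) \<in> borel_measurable lborel" .
  have "(\<integral>\<^sup>+x. ennreal (indicator {0..?l} x *\<^sub>R (cmod (f e x))\<^sup>2) \<partial>lborel)
      = (\<integral>\<^sup>+x. ennreal (indicator {0<..<?l} x * (cmod (f e x))\<^sup>2) \<partial>lborel)"
  proof (rule nn_integral_cong_AE)
    show "AE x in lborel. ennreal (indicator {0..?l} x *\<^sub>R (cmod (f e x))\<^sup>2) = ennreal (indicator {0<..<?l} x * (cmod (f e x))\<^sup>2)"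
      using AE_lborel_singleton[of "0::real"] AE_lborel_singleton[of ?l]
      by eventually_elim (auto simp: indicator_def)
  qed
  also have "\<dots> \<le> gnorm2 len f"
    unfolding gnorm2_def nn_integral_count_space_infsum[symmetric]
    by (rule nn_integral_ge_point) simp
  also have "\<dots> < \<infinity>" using assms by (simp add: L2G_def)
  finally show sq: "set_integrable lborel {0..?l} (\<lambda>x. (cmod (f e x))\<^sup>2)"
    unfolding set_integrable_def by (intro integrableI_nonneg m2) auto
  have "set_integrable lborel {0..?l} (\<lambda>x. 1 + (cmod (f e x))\<^sup>2)"
    by (intro set_integral_add(1) sq borel_integrable_atLeastAtMost' continuous_intros)
  then show "set_integrable lborel {0..?l} (f e)"
    unfolding set_integrable_def
  proof (rule Bochner_Integration.integrable_bound[OF _ m])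
    have "norm (f e x) \<le> 1 + (norm (f e x))\<^sup>2" for x
      using sum_squares_bound[of 1 "norm (f e x)"] norm_ge_zero[of "f e x"] by (simp del: norm_ge_zero)
    then show "AE x in lborel. norm (indicator {0..?l} x *\<^sub>R f e x) \<le> norm (indicator {0..?l} x *\<^sub>R (1 + (cmod (f e x))\<^sup>2))"
      by (intro AE_I2) (auto simp: indicator_def)
  qed
qed

lemma gnorm2_edge_sum:
  assumes "f \<in> L2G len"
  shows "gnorm2 len f = (\<Sum>\<^sub>\<infinity>e. ennreal (LBINT x:{0..len e}. (cmod (f e x))\<^sup>2))"
  unfolding gnorm2_def by (simp add: nn_integral_open_eq_set_integral[OF L2G_edge(2)[OF assms]])

lemma edge_sum_le:
  assumes f: "f \<in> L2G len" and E: "finite E"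
  shows "(\<Sum>e\<in>E. LBINT x:{0..len e}. (cmod (f e x))\<^sup>2) \<le> (norm (emb len f))\<^sup>2"
proof -
  have nn: "0 \<le> (LBINT x:{0..len e}. (cmod (f e x))\<^sup>2)" for e
    unfolding set_lebesgue_integral_def by (rule integral_nonneg_AE) auto
  have "ennreal (\<Sum>e\<in>E. LBINT x:{0..len e}. (cmod (f e x))\<^sup>2) = (\<Sum>e\<in>E. ennreal (LBINT x:{0..len e}. (cmod (f e x))\<^sup>2))"
    using nn by (simp add: sum_ennreal)
  also have "\<dots> \<le> (\<Sum>\<^sub>\<infinity>e. ennreal (LBINT x:{0..len e}. (cmod (f e x))\<^sup>2))"
    by (subst nonneg_infsum_complete) (auto intro!: SUP_upper E)
  also have "\<dots> = ennreal ((norm (emb len f))\<^sup>2)"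
    using gnorm2_edge_sum[OF f] gnorm2_emb[OF len_pos f] by simp
  finally show ?thesis by simp
qed

lemma emb_eq_zero:
  assumes f: "f \<in> L2G len" and z: "\<And>e. (LBINT x:{0..len e}. (cmod (f e x))\<^sup>2) = 0"
  shows "emb len f = 0"
proof -
  have "ennreal ((norm (emb len f))\<^sup>2) = 0"
    using gnorm2_edge_sum[OF f] gnorm2_emb[OF len_pos f] by (simp add: z)
  then show ?thesis by simp
qed

section \<open>Admissible functions and Green's formula\<close>

definition vertex_continuous :: "('e \<Rightarrow> real \<Rightarrow> complex) \<Rightarrow> bool" where
  "vertex_continuous f \<longleftrightarrow> (\<forall>v. \<exists>c. \<forall>e. (src e = v \<longrightarrow> f e 0 = c) \<and> (tgt e = v \<longrightarrow> f e (len e) = c))"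

definition flux :: "('e \<Rightarrow> real \<Rightarrow> complex) \<Rightarrow> 'v \<Rightarrow> complex" where
  "flux u v = (\<Sum>e\<in>{e. src e = v}. u e 0) + (\<Sum>e\<in>{e. tgt e = v}. - u e (len e))"

definition admissible :: "('e \<Rightarrow> real \<Rightarrow> complex) \<Rightarrow> ('e \<Rightarrow> real \<Rightarrow> complex) \<Rightarrow> ('e \<Rightarrow> real \<Rightarrow> complex) \<Rightarrow> bool" where
  "admissible f u1 u2 \<longleftrightarrow> finite {e. \<exists>x\<in>{0<..<len e}. f e x \<noteq> 0} \<and>
     (\<forall>e. W22_with (len e) (f e) (u1 e) (u2 e)) \<and> vertex_continuous f \<and> (\<forall>v. flux u1 v = 0)"

lemma H0min_iff: "(F, G) \<in> H0min src tgt len \<longleftrightarrow> (\<exists>u1 u2. admissible F u1 u2 \<and> G = (\<lambda>e x. - u2 e x))"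
  unfolding H0min_def admissible_def vertex_continuous_def flux_def by blast

lemma len_nonneg: "0 \<le> len e" using len_pos[of e] by simp

lemma finite_src: "finite {e. src e = v}" and finite_tgt: "finite {e. tgt e = v}"
  using finite_edges_at[of v] by (auto simp: edges_at_def elim: rev_finite_subset)

lemma flux_edges_at:
  "flux u v = (\<Sum>e\<in>edges_at src tgt v. if src e = v then u e 0 else - u e (len e))"
proof -
  have "edges_at src tgt v = {e. src e = v} \<union> {e. tgt e = v}" by (auto simp: edges_at_def)
  then have "(\<Sum>e\<in>edges_at src tgt v. if src e = v then u e 0 else - u e (len e))
      = (\<Sum>e\<in>{e. src e = v}. if src e = v then u e 0 else - u e (len e)) + (\<Sum>e\<in>{e. tgt e = v}. if src e = v then u e 0 else - u e (len e))"
    using no_loop finite_src finite_tgt by (simp only:) (rule sum.union_disjoint, auto dest: sym)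
  also have "(\<Sum>e\<in>{e. src e = v}. if src e = v then u e 0 else - u e (len e)) = (\<Sum>e\<in>{e. src e = v}. u e 0)"
    by (rule sum.cong) auto
  also have "(\<Sum>e\<in>{e. tgt e = v}. if src e = v then u e 0 else - u e (len e)) = (\<Sum>e\<in>{e. tgt e = v}. - u e (len e))"
    using no_loop by (intro sum.cong) auto
  finally show ?thesis by (simp add: flux_def)
qed

lemma vertex_values:
  assumes "vertex_continuous f"
  obtains c where "\<And>e. f e 0 = c (src e)" "\<And>e. f e (len e) = c (tgt e)"
proof -
  have "\<exists>c. \<forall>v e. (src e = v \<longrightarrow> f e 0 = c v) \<and> (tgt e = v \<longrightarrow> f e (len e) = c v)"
    using assms unfolding vertex_continuous_def by (intro choice) blast
  then show ?thesis using that by blast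
qed

lemma continuous_zero_ends:
  fixes F :: "real \<Rightarrow> complex"
  assumes "continuous_on {0..l} F" "0 < l" "\<And>x. x \<in> {0<..<l} \<Longrightarrow> F x = 0" "x \<in> {0..l}"
  shows "F x = 0"
proof -
  have cl: "closure {0<..<l} = {0..l}" using assms(2) by simp
  show ?thesis
    by (rule continuous_constant_on_closure[of "{0<..<l}" F 0]) (use assms cl in auto)
qed

text \<open>Edgewise integration by parts with the boundary terms regrouped by vertices: continuity
  of \<phi> factors out its vertex value, leaving the flux. Edges outside \<open>E\<close> may be
  added to complete the flux, since \<phi> vanishes at their ends by continuity.\<close>

lemma green:
  assumes E: "finite E" and u: "\<And>e. e \<in> E \<Longrightarrow> primitive_on (len e) (u1 e) (u2 e)"
    and \<phi>: "\<And>e. primitive_on (len e) (\<phi> e) (\<phi>1 e)" "vertex_continuous \<phi>"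
    and supp: "\<And>e x. e \<notin> E \<Longrightarrow> x \<in> {0<..<len e} \<Longrightarrow> \<phi> e x = 0"
    and flux: "\<And>e. e \<in> E \<Longrightarrow> \<phi> e 0 = 0 \<or> flux u1 (src e) = 0" "\<And>e. e \<in> E \<Longrightarrow> \<phi> e (len e) = 0 \<or> flux u1 (tgt e) = 0"
  shows "(\<Sum>e\<in>E. (LBINT x:{0..len e}. u2 e x \<bullet> \<phi> e x) + (LBINT x:{0..len e}. u1 e x \<bullet> \<phi>1 e x)) = 0"
proof -
  obtain c where c: "\<And>e. \<phi> e 0 = c (src e)" "\<And>e. \<phi> e (len e) = c (tgt e)" using vertex_values[OF \<phi>(2)] by blast
  have ends: "c (src e) = 0" "c (tgt e) = 0" if "e \<notin> E" for e
    using continuous_zero_ends[OF primitive_on_continuous[OF \<phi>(1)] len_pos supp[OF that]] len_nonneg c by (metis atLeastAtMost_iff order_refl)+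
  define V where "V = src ` E \<union> tgt ` E"
  have V: "finite V" using E by (simp add: V_def)
  have "(\<Sum>e\<in>E. (LBINT x:{0..len e}. u2 e x \<bullet> \<phi> e x) + (LBINT x:{0..len e}. u1 e x \<bullet> \<phi>1 e x))
     = (\<Sum>e\<in>E. u1 e (len e) \<bullet> c (tgt e) - u1 e 0 \<bullet> c (src e))"
    by (intro sum.cong refl) (simp add: primitive_on_by_parts[OF len_nonneg u \<phi>(1)] c)
  also have "\<dots> = (\<Sum>e\<in>E. u1 e (len e) \<bullet> c (tgt e)) - (\<Sum>e\<in>E. u1 e 0 \<bullet> c (src e))" by (rule sum_subtractf)
  also have "(\<Sum>e\<in>E. u1 e (len e) \<bullet> c (tgt e)) = (\<Sum>v\<in>V. \<Sum>e\<in>{e \<in> E. tgt e = v}. u1 e (len e) \<bullet> c (tgt e))"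
    by (rule sum.group[symmetric]) (use E V in \<open>auto simp: V_def\<close>)
  also have "\<dots> = (\<Sum>v\<in>V. \<Sum>e\<in>{e. tgt e = v}. u1 e (len e) \<bullet> c v)"
    by (rule sum.cong[OF refl], rule sum.mono_neutral_cong_left[OF finite_tgt]) (auto, metis ends(2) inner_zero_right)
  also have "(\<Sum>e\<in>E. u1 e 0 \<bullet> c (src e)) = (\<Sum>v\<in>V. \<Sum>e\<in>{e \<in> E. src e = v}. u1 e 0 \<bullet> c (src e))"
    by (rule sum.group[symmetric]) (use E V in \<open>auto simp: V_def\<close>)
  also have "\<dots> = (\<Sum>v\<in>V. \<Sum>e\<in>{e. src e = v}. u1 e 0 \<bullet> c v)"
    by (rule sum.cong[OF refl], rule sum.mono_neutral_cong_left[OF finite_src]) (auto, metis ends(1) inner_zero_right)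
  also have "(\<Sum>v\<in>V. \<Sum>e\<in>{e. tgt e = v}. u1 e (len e) \<bullet> c v) - (\<Sum>v\<in>V. \<Sum>e\<in>{e. src e = v}. u1 e 0 \<bullet> c v)
      = (\<Sum>v\<in>V. - (flux u1 v \<bullet> c v))"
    by (simp add: sum_subtractf[symmetric] flux_def inner_add_left inner_sum_left sum_negf algebra_simps)
  also have "\<dots> = 0"
  proof (rule sum.neutral, rule ballI)
    fix v assume "v \<in> V"
    then have "c v = 0 \<or> flux u1 v = 0" using flux c by (auto simp: V_def)
    then show "- (flux u1 v \<bullet> c v) = 0" by auto
  qed
  finally show ?thesis .
qed

lemma admissibleD:
  assumes "admissible f u1 u2"
  shows "primitive_on (len e) (f e) (u1 e)" "primitive_on (len e) (u1 e) (u2 e)"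
    "set_integrable lborel {0..len e} (\<lambda>x. (cmod (u2 e x))\<^sup>2)" "vertex_continuous f" "flux u1 v = 0"
    "finite {e. \<exists>x\<in>{0<..<len e}. f e x \<noteq> 0}"
  using assms unfolding admissible_def W22_with_iff[OF len_nonneg] by blast+

lemma admissible_L2G:
  assumes "admissible f u1 u2"
  shows "f \<in> L2G len"
proof (rule L2G_finite_support[OF admissibleD(6)[OF assms]])
  have c: "continuous_on {0..len e} (f e)" for e by (rule primitive_on_continuous[OF admissibleD(1)[OF assms]])
  show "set_integrable lborel {0..len e} (f e)" "set_integrable lborel {0..len e} (\<lambda>x. (cmod (f e x))\<^sup>2)" for e
    by (rule borel_integrable_atLeastAtMost'[OF c] set_integrable_square_continuous[OF c])+
qed auto

lemma primitive_on_zero: "primitive_on l (\<lambda>x. 0) (\<lambda>x. 0)"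
  by (rule primitive_onI_deriv) auto

lemma primitive_on_mult:
  assumes "primitive_on l F u"
  shows "primitive_on l (\<lambda>x. z * F x) (\<lambda>x. z * u x)"
  unfolding primitive_on_def
proof (intro conjI ballI)
  show "set_integrable lborel {0..l} (\<lambda>x. z * u x)" using primitive_onD(1)[OF assms] by simp
  fix x assume x: "x \<in> {0..l}"
  show "z * F x = z * F 0 + (LBINT t:{0..x}. z * u t)"
    using primitive_onD(2)[OF assms x] by (simp add: distrib_left[symmetric])
qed

lemma set_integrable_square_combine:
  fixes f g :: "real \<Rightarrow> complex"
  assumes f: "set_integrable lborel {0..l} f" "set_integrable lborel {0..l} (\<lambda>x. (cmod (f x))\<^sup>2)"
    and g: "set_integrable lborel {0..l} g" "set_integrable lborel {0..l} (\<lambda>x. (cmod (g x))\<^sup>2)"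
  shows "set_integrable lborel {0..l} (\<lambda>x. (cmod (f x + z * g x))\<^sup>2)"
proof -
  have zg: "set_integrable lborel {0..l} (\<lambda>x. z * g x)" "set_integrable lborel {0..l} (\<lambda>x. (cmod (z * g x))\<^sup>2)"
    using g by (simp_all add: norm_mult power_mult_distrib)
  have "(\<lambda>x. (cmod (f x + z * g x))\<^sup>2) = (\<lambda>x. ((cmod (f x))\<^sup>2 + (cmod (z * g x))\<^sup>2) + 2 * (f x \<bullet> (z * g x)))"
    by (rule ext) (simp add: power2_norm_eq_inner inner_add_left inner_add_right inner_commute)
  then show ?thesis
    using set_integral_add(1)[OF set_integral_add(1)[OF f(2) zg(2)]
        set_integrable_mult_right[of 2, OF set_integrable_inner_of_squares[OF f zg]]] by simp
qed

lemma admissible_combine: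
  assumes f: "admissible f u1 u2" and g: "admissible g w1 w2"
  shows "admissible (\<lambda>e x. f e x + z * g e x) (\<lambda>e x. u1 e x + z * w1 e x) (\<lambda>e x. u2 e x + z * w2 e x)"
  unfolding admissible_def W22_with_iff[OF len_nonneg]
proof (intro conjI allI)
  show "finite {e. \<exists>x\<in>{0<..<len e}. f e x + z * g e x \<noteq> 0}"
    by (rule finite_subset[OF _ finite_UnI[OF admissibleD(6)[OF f] admissibleD(6)[OF g]]]) auto
  show "primitive_on (len e) (\<lambda>x. f e x + z * g e x) (\<lambda>x. u1 e x + z * w1 e x)"
    "primitive_on (len e) (\<lambda>x. u1 e x + z * w1 e x) (\<lambda>x. u2 e x + z * w2 e x)" for e
    by (intro primitive_on_add primitive_on_mult admissibleD(1,2)[OF f] admissibleD(1,2)[OF g])+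
  show "set_integrable lborel {0..len e} (\<lambda>x. (cmod (u2 e x + z * w2 e x))\<^sup>2)" for e
    by (rule set_integrable_square_combine[OF primitive_onD(1)[OF admissibleD(2)[OF f]] admissibleD(3)[OF f]
          primitive_onD(1)[OF admissibleD(2)[OF g]] admissibleD(3)[OF g]])
  obtain c d where "\<And>e. f e 0 = c (src e)" "\<And>e. f e (len e) = c (tgt e)" "\<And>e. g e 0 = d (src e)" "\<And>e. g e (len e) = d (tgt e)"
    using vertex_values[OF admissibleD(4)[OF f]] vertex_values[OF admissibleD(4)[OF g]] by metis
  then show "vertex_continuous (\<lambda>e x. f e x + z * g e x)"
    unfolding vertex_continuous_def by (intro allI exI[of _ "c _ + z * d _"]) auto
  have "flux (\<lambda>e x. u1 e x + z * w1 e x) v = flux u1 v + z * flux w1 v" for v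
    unfolding flux_edges_at sum_distrib_left sum.distrib[symmetric]
    by (rule sum.cong) (auto simp: algebra_simps)
  then show "flux (\<lambda>e x. u1 e x + z * w1 e x) v = 0" for v using admissibleD(5)[OF f] admissibleD(5)[OF g] by simp
qed

lemma admissible_zero: "admissible (\<lambda>e x. 0) (\<lambda>e x. 0) (\<lambda>e x. 0)"
  unfolding admissible_def W22_with_iff[OF len_nonneg]
  by (auto simp: primitive_on_zero vertex_continuous_def flux_def set_integrable_def)

lemma admissible_single:
  assumes W: "W22_with (len a) f u1 u2" and z: "f 0 = 0" "f (len a) = 0" "u1 0 = 0" "u1 (len a) = 0"
  shows "admissible (\<lambda>e. if e = a then f else (\<lambda>x. 0)) (\<lambda>e. if e = a then u1 else (\<lambda>x. 0)) (\<lambda>e. if e = a then u2 else (\<lambda>x. 0))"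
  unfolding admissible_def
proof (intro conjI allI)
  show "finite {e. \<exists>x\<in>{0<..<len e}. (if e = a then f else (\<lambda>x. 0)) x \<noteq> 0}"
    by (rule finite_subset[of _ "{a}"]) auto
  have "W22_with (len e) (\<lambda>x. 0) (\<lambda>x. 0) (\<lambda>x. 0)" for e
    unfolding W22_with_iff[OF len_nonneg] by (simp add: primitive_on_zero set_integrable_def)
  then show "W22_with (len e) (if e = a then f else (\<lambda>x. 0)) (if e = a then u1 else (\<lambda>x. 0)) (if e = a then u2 else (\<lambda>x. 0))" for e
    using W by simp
  show "vertex_continuous (\<lambda>e. if e = a then f else (\<lambda>x. 0))"
    unfolding vertex_continuous_def by (intro allI exI[of _ 0]) (use z in auto)
  show "flux (\<lambda>e. if e = a then u1 else (\<lambda>x. 0)) v = 0" for v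
  proof -
    have "(if e = a then u1 else (\<lambda>x. 0)) 0 = 0" "(if e = a then u1 else (\<lambda>x. 0)) (len e) = 0" for e
      using z by auto
    then show ?thesis by (simp only: flux_def minus_zero sum.neutral_const add_0)
  qed
qed

text \<open>Reduces the construction of admissible functions to finitely many numbers: vertex values
  \<open>c\<close> and edge slopes with zero sum at every vertex.\<close>

lemma admissible_hermite:
  assumes fin: "finite E" "\<And>e. e \<notin> E \<Longrightarrow> a0 e = 0 \<and> a1 e = 0 \<and> b0 e = 0 \<and> b1 e = 0"
    and val: "\<And>e. a0 e = c (src e)" "\<And>e. a1 e = c (tgt e)"
    and flux: "\<And>v. (\<Sum>e\<in>edges_at src tgt v. if src e = v then b0 e else - b1 e) = 0"
  shows "admissible (\<lambda>e. hermite (len e) (a0 e) (a1 e) (b0 e) (b1 e)) (\<lambda>e. hermite1 (len e) (a0 e) (a1 e) (b0 e) (b1 e))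
     (\<lambda>e. hermite2 (len e) (a0 e) (a1 e) (b0 e) (b1 e))"
  unfolding admissible_def
proof (intro conjI allI)
  show "finite {e. \<exists>x\<in>{0<..<len e}. hermite (len e) (a0 e) (a1 e) (b0 e) (b1 e) x \<noteq> 0}"
    by (rule finite_subset[OF _ fin(1)]) (use fin(2) in force)
  show "W22_with (len e) (hermite (len e) (a0 e) (a1 e) (b0 e) (b1 e)) (hermite1 (len e) (a0 e) (a1 e) (b0 e) (b1 e))
     (hermite2 (len e) (a0 e) (a1 e) (b0 e) (b1 e))" for e
    by (rule hermite_W22[OF len_nonneg])
  have ne: "len e \<noteq> 0" for e using len_pos[of e] by simp
  show "vertex_continuous (\<lambda>e. hermite (len e) (a0 e) (a1 e) (b0 e) (b1 e))"
    unfolding vertex_continuous_def by (intro allI exI[of _ "c _"]) (auto simp: hermite_end[OF ne] val)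
  show "flux (\<lambda>e. hermite1 (len e) (a0 e) (a1 e) (b0 e) (b1 e)) v = 0" for v
    unfolding flux_edges_at
    by (rule trans[OF sum.cong[OF refl] flux]) (auto simp: hermite_end[OF ne])
qed

section \<open>Weak solutions on the graph\<close>

text \<open>\<open>weak_solution \<kappa> E0 h\<close>: \<open>h\<close> solves \<open>h'' = \<kappa> h\<close> with Kirchhoff conditions, tested
  against admissible functions vanishing on the edges in \<open>E0\<close>.\<close>
definition weak_solution :: "real \<Rightarrow> 'e set \<Rightarrow> ('e \<Rightarrow> real \<Rightarrow> complex) \<Rightarrow> bool" where
  "weak_solution \<kappa> E0 h \<longleftrightarrow> (\<forall>e. set_integrable lborel {0..len e} (h e) \<and> set_integrable lborel {0..len e} (\<lambda>x. (cmod (h e x))\<^sup>2)) \<and>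
     (\<forall>f u1 u2 E. admissible f u1 u2 \<longrightarrow> finite E \<longrightarrow> E \<inter> E0 = {} \<longrightarrow>
        (\<forall>e x. e \<notin> E \<longrightarrow> f e x = 0 \<and> u1 e x = 0 \<and> u2 e x = 0) \<longrightarrow>
        (\<Sum>e\<in>E. LBINT x:{0..len e}. h e x \<bullet> (\<kappa> *\<^sub>R f e x - u2 e x)) = 0)"

text \<open>\<open>h0\<close> is the continuously differentiable representative of \<open>h\<close>
  and \<open>h1\<close> its derivative. The equation keeps \<open>h\<close> on the right, because
  \<open>h0\<close> agrees with it merely almost everywhere.\<close>

definition classical_on :: "real \<Rightarrow> real \<Rightarrow> (real \<Rightarrow> complex) \<Rightarrow> (real \<Rightarrow> complex) \<Rightarrow> (real \<Rightarrow> complex) \<Rightarrow> bool" where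
  "classical_on \<kappa> l h h0 h1 \<longleftrightarrow> primitive_on l h0 h1 \<and> primitive_on l h1 (\<lambda>x. \<kappa> *\<^sub>R h x)
     \<and> (AE x in lborel. x \<in> {0..l} \<longrightarrow> h x = h0 x)"

lemma weak_solution_classical:
  assumes h: "weak_solution \<kappa> E0 h" and e: "a \<notin> E0"
  shows "\<exists>h0 h1. classical_on \<kappa> (len a) (h a) h0 h1"
  unfolding classical_on_def
proof (rule weak_solution_regular[OF len_pos])
  show "set_integrable lborel {0..len a} (h a)" "set_integrable lborel {0..len a} (\<lambda>x. (cmod (h a x))\<^sup>2)"
    using h by (simp_all add: weak_solution_def)
  fix f u1 u2 assume W: "W22_with (len a) f u1 u2" and z: "f 0 = 0" "f (len a) = 0" "u1 0 = 0" "u1 (len a) = 0"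
  have "(\<Sum>e\<in>{a}. LBINT x:{0..len e}. h e x \<bullet> (\<kappa> *\<^sub>R (if e = a then f else (\<lambda>x. 0)) x - (if e = a then u2 else (\<lambda>x. 0)) x)) = 0"
    using h[unfolded weak_solution_def, THEN conjunct2, rule_format, OF admissible_single[OF W z], of "{a}"] e by auto
  then show "(LBINT x:{0..len a}. h a x \<bullet> (\<kappa> *\<^sub>R f x - u2 x)) = 0" by simp
qed

text \<open>Two integrations by parts convert the weak equation into a pure boundary identity, from
  which test functions concentrated near one vertex read off the vertex conditions.\<close>

lemma weak_solution_boundary:
  assumes h: "weak_solution \<kappa> E0 h" and f: "admissible f u1 u2" and E: "finite E" "E \<inter> E0 = {}"
    and supp: "\<And>e x. e \<notin> E \<Longrightarrow> f e x = 0 \<and> u1 e x = 0 \<and> u2 e x = 0"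
    and cl: "\<And>e. e \<in> E \<Longrightarrow> classical_on \<kappa> (len e) (h e) (h0 e) (h1 e)"
  shows "(\<Sum>e\<in>E. (h1 e (len e) \<bullet> f e (len e) - h1 e 0 \<bullet> f e 0) - (h0 e (len e) \<bullet> u1 e (len e) - h0 e 0 \<bullet> u1 e 0)) = 0"
proof -
  have "0 = (\<Sum>e\<in>E. LBINT x:{0..len e}. h e x \<bullet> (\<kappa> *\<^sub>R f e x - u2 e x))"
    using h f E supp unfolding weak_solution_def by simp
  also have "\<dots> = (\<Sum>e\<in>E. (h1 e (len e) \<bullet> f e (len e) - h1 e 0 \<bullet> f e 0) - (h0 e (len e) \<bullet> u1 e (len e) - h0 e 0 \<bullet> u1 e 0))"
  proof (rule sum.cong[OF refl])
    fix e assume e: "e \<in> E"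
    note c = cl[OF e, unfolded classical_on_def]
    have p: "primitive_on (len e) (h0 e) (h1 e)" "primitive_on (len e) (h1 e) (\<lambda>x. \<kappa> *\<^sub>R h e x)"
      and ae: "AE x in lborel. x \<in> {0..len e} \<longrightarrow> h e x = h0 e x" using c by blast+
    have hi: "set_integrable lborel {0..len e} (h e)" "set_integrable lborel {0..len e} (\<lambda>x. (cmod (h e x))\<^sup>2)"
      using h by (simp_all add: weak_solution_def)
    have fc: "continuous_on {0..len e} (f e)" by (rule primitive_on_continuous[OF admissibleD(1)[OF f]])
    note u2i = primitive_onD(1)[OF admissibleD(2)[OF f], of e] admissibleD(3)[OF f, of e]
    have i1: "set_integrable lborel {0..len e} (\<lambda>x. (\<kappa> *\<^sub>R h e x) \<bullet> f e x)"
      by (rule set_integrable_continuous_inner[OF fc primitive_onD(1)[OF p(2)]])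
    have i2: "set_integrable lborel {0..len e} (\<lambda>x. h e x \<bullet> u2 e x)" by (rule set_integrable_inner_of_squares[OF hi u2i])
    have i3: "set_integrable lborel {0..len e} (\<lambda>x. h0 e x \<bullet> u2 e x)"
      by (rule set_integrable_inner_continuous[OF primitive_on_continuous[OF p(1)] u2i(1)])
    have "(LBINT x:{0..len e}. h e x \<bullet> (\<kappa> *\<^sub>R f e x - u2 e x)) = (LBINT x:{0..len e}. (\<kappa> *\<^sub>R h e x) \<bullet> f e x - h e x \<bullet> u2 e x)"
      by (simp add: inner_diff_right)
    also have "\<dots> = (LBINT x:{0..len e}. (\<kappa> *\<^sub>R h e x) \<bullet> f e x) - (LBINT x:{0..len e}. h e x \<bullet> u2 e x)"
      by (rule set_integral_diff(2)[OF i1 i2])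
    also have "(LBINT x:{0..len e}. h e x \<bullet> u2 e x) = (LBINT x:{0..len e}. h0 e x \<bullet> u2 e x)"
      unfolding set_lebesgue_integral_def
    proof (rule integral_cong_AE)
      show "AE x in lborel. indicator {0..len e} x *\<^sub>R (h e x \<bullet> u2 e x) = indicator {0..len e} x *\<^sub>R (h0 e x \<bullet> u2 e x)"
        using ae by eventually_elim (auto simp: indicator_def)
    qed (use i2 i3 in \<open>simp_all add: set_integrable_def borel_measurable_integrable\<close>)
    finally show "(LBINT x:{0..len e}. h e x \<bullet> (\<kappa> *\<^sub>R f e x - u2 e x))
       = (h1 e (len e) \<bullet> f e (len e) - h1 e 0 \<bullet> f e 0) - (h0 e (len e) \<bullet> u1 e (len e) - h0 e 0 \<bullet> u1 e 0)"
      using primitive_on_by_parts[OF len_nonneg p(2) admissibleD(1)[OF f]]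
        primitive_on_by_parts[OF len_nonneg p(1) admissibleD(2)[OF f]] by simp
  qed
  finally show ?thesis by simp
qed

text \<open>The test function has slope zero at all ends, value \<open>flux h1 v\<close> at
  \<open>v\<close> and 0 at the other vertices; the boundary identity becomes minus the squared
  modulus of the flux.\<close>

lemma weak_solution_flux:
  assumes h: "weak_solution \<kappa> E0 h" and v: "edges_at src tgt v \<inter> E0 = {}"
    and cl: "\<And>e. e \<in> edges_at src tgt v \<Longrightarrow> classical_on \<kappa> (len e) (h e) (h0 e) (h1 e)"
  shows "flux h1 v = 0"
proof -
  define c where "c = flux h1 v"
  define a0 where "a0 e = (if src e = v then c else 0)" for e
  define a1 where "a1 e = (if tgt e = v then c else 0)" for e
  have adm: "admissible (\<lambda>e. hermite (len e) (a0 e) (a1 e) 0 0) (\<lambda>e. hermite1 (len e) (a0 e) (a1 e) 0 0)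
     (\<lambda>e. hermite2 (len e) (a0 e) (a1 e) 0 0)"
    by (rule admissible_hermite[OF finite_edges_at, of v _ _ _ _ "\<lambda>w. if w = v then c else 0"])
       (auto simp: a0_def a1_def edges_at_def intro!: sum.neutral)
  have ne: "len e \<noteq> 0" for e using len_pos[of e] by simp
  have "(\<Sum>e\<in>edges_at src tgt v. (h1 e (len e) \<bullet> hermite (len e) (a0 e) (a1 e) 0 0 (len e) - h1 e 0 \<bullet> hermite (len e) (a0 e) (a1 e) 0 0 0)
      - (h0 e (len e) \<bullet> hermite1 (len e) (a0 e) (a1 e) 0 0 (len e) - h0 e 0 \<bullet> hermite1 (len e) (a0 e) (a1 e) 0 0 0)) = 0"
    by (rule weak_solution_boundary[OF h adm finite_edges_at v _ cl]) (auto simp: a0_def a1_def edges_at_def)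
  then have "0 = (\<Sum>e\<in>edges_at src tgt v. h1 e (len e) \<bullet> a1 e - h1 e 0 \<bullet> a0 e)"
    by (simp add: hermite_end[OF ne])
  also have "\<dots> = (\<Sum>e\<in>edges_at src tgt v. - ((if src e = v then h1 e 0 else - h1 e (len e)) \<bullet> c))"
    using no_loop no_loop[symmetric] by (intro sum.cong refl) (auto simp: a0_def a1_def edges_at_def)
  also have "\<dots> = - (flux h1 v \<bullet> c)"
    unfolding flux_edges_at by (simp add: inner_sum_left sum_negf)
  finally show ?thesis by (simp add: c_def)
qed

text \<open>For two edges at \<open>v\<close> the test function has all vertex values 0 and slopes
  \<open>c\<close>, \<open>-c\<close> into these edges at \<open>v\<close>, so its flux vanishes.
  With \<open>c\<close> the difference of the two boundary values, the boundary identity says c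
  \<bullet> c = 0.\<close>

lemma weak_solution_continuous:
  assumes h: "weak_solution \<kappa> {} h" and cl: "\<And>e. classical_on \<kappa> (len e) (h e) (h0 e) (h1 e)"
  shows "vertex_continuous h0"
  unfolding vertex_continuous_def
proof
  fix v
  define val where "val e = (if src e = v then h0 e 0 else h0 e (len e))" for e
  have ne: "len e \<noteq> 0" for e using len_pos[of e] by simp
  have eq: "val p = val q" if p: "p \<in> edges_at src tgt v" and q: "q \<in> edges_at src tgt v" for p q
  proof (cases "p = q")
    case False
    define c where "c = val p - val q"
    define d where "d e = (if e = p then c else if e = q then - c else 0)" for e
    define b0 where "b0 e = (if src e = v then d e else 0)" for e
    define b1 where "b1 e = (if tgt e = v then - d e else 0)" for e
    have fl: "(\<Sum>e\<in>edges_at src tgt w. if src e = w then b0 e else - b1 e) = 0" for w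
    proof (cases "w = v")
      case True
      have "(\<Sum>e\<in>edges_at src tgt w. if src e = w then b0 e else - b1 e) = (\<Sum>e\<in>edges_at src tgt v. d e)"
        unfolding True by (rule sum.cong) (auto simp: b0_def b1_def edges_at_def)
      also have "\<dots> = (\<Sum>e\<in>{p, q}. d e)"
        by (rule sum.mono_neutral_right) (use p q finite_edges_at in \<open>auto simp: d_def\<close>)
      finally show ?thesis using False by (simp add: d_def)
    next
      case w: False
      show ?thesis
        by (rule sum.neutral) (use w no_loop in \<open>auto simp: b0_def b1_def edges_at_def\<close>)
    qed
    have adm: "admissible (\<lambda>e. hermite (len e) 0 0 (b0 e) (b1 e)) (\<lambda>e. hermite1 (len e) 0 0 (b0 e) (b1 e))
       (\<lambda>e. hermite2 (len e) 0 0 (b0 e) (b1 e))"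
      by (rule admissible_hermite[of "{p, q}" _ _ _ _ "\<lambda>w. 0", OF _ _ _ _ fl]) (auto simp: b0_def b1_def d_def)
    have "(\<Sum>e\<in>{p, q}. (h1 e (len e) \<bullet> hermite (len e) 0 0 (b0 e) (b1 e) (len e) - h1 e 0 \<bullet> hermite (len e) 0 0 (b0 e) (b1 e) 0)
        - (h0 e (len e) \<bullet> hermite1 (len e) 0 0 (b0 e) (b1 e) (len e) - h0 e 0 \<bullet> hermite1 (len e) 0 0 (b0 e) (b1 e) 0)) = 0"
      by (rule weak_solution_boundary[OF h adm _ _ _ cl]) (auto simp: b0_def b1_def d_def)
    then have "0 = (\<Sum>e\<in>{p, q}. h0 e 0 \<bullet> b0 e - h0 e (len e) \<bullet> b1 e)"
      by (simp add: hermite_end[OF ne])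
    also have "\<dots> = (\<Sum>e\<in>{p, q}. val e \<bullet> d e)"
      using p q no_loop[of p] no_loop[of q]
      by (intro sum.cong refl) (auto simp: val_def b0_def b1_def edges_at_def)
    also have "\<dots> = c \<bullet> c" using False by (simp add: d_def c_def inner_diff_left inner_diff_right)
    finally show ?thesis by (simp add: c_def)
  qed simp
  obtain p where p: "p \<in> edges_at src tgt v" using edges_at_nonempty[of v] by blast
  show "\<exists>c. \<forall>e. (src e = v \<longrightarrow> h0 e 0 = c) \<and> (tgt e = v \<longrightarrow> h0 e (len e) = c)"
  proof (intro exI[of _ "val p"] allI conjI impI)
    fix e
    show "h0 e 0 = val p" if "src e = v"
      using eq[OF p, of e] that by (simp add: val_def edges_at_def)
    show "h0 e (len e) = val p" if "tgt e = v"
      using eq[OF p, of e] that no_loop[of e] by (auto simp: val_def edges_at_def)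
  qed
qed

end

section \<open>Localization of weak solutions\<close>

lemma primitive_on_scaleR:
  assumes F: "primitive_on l F u" "continuous_on {0..l} u"
    and r: "\<And>x. x \<in> {0..l} \<Longrightarrow> (r has_real_derivative r' x) (at x within {0..l})" "continuous_on {0..l} r'"
  shows "primitive_on l (\<lambda>x. r x *\<^sub>R F x) (\<lambda>x. r x *\<^sub>R u x + r' x *\<^sub>R F x)"
proof (rule primitive_onI_deriv)
  have rc: "continuous_on {0..l} r" by (rule DERIV_continuous_on[OF r(1)])
  show "continuous_on {0..l} (\<lambda>x. r x *\<^sub>R u x + r' x *\<^sub>R F x)"
    by (intro continuous_intros rc r(2) F(2) primitive_on_continuous[OF F(1)])
  show "((\<lambda>x. r x *\<^sub>R F x) has_vector_derivative r x *\<^sub>R u x + r' x *\<^sub>R F x) (at x within {0..l})" if "x \<in> {0..l}" for x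
    by (rule has_vector_derivative_scaleR[OF r(1)[OF that] primitive_on_deriv[OF F that]])
qed

lemma set_integral_nonneg: "(\<And>x. x \<in> A \<Longrightarrow> 0 \<le> f x) \<Longrightarrow> 0 \<le> (LINT x:A|M. f x :: real)"
  unfolding set_lebesgue_integral_def by (rule integral_nonneg_AE) (auto simp: indicator_def)

context metric_graph
begin

definition cut :: "('v \<Rightarrow> real) \<Rightarrow> 'e \<Rightarrow> real \<Rightarrow> real" where
  "cut \<phi> e x = \<phi> (src e) + (\<phi> (tgt e) - \<phi> (src e)) / len e * x"

definition cut1 :: "('v \<Rightarrow> real) \<Rightarrow> 'e \<Rightarrow> real" where
  "cut1 \<phi> e = (\<phi> (tgt e) - \<phi> (src e)) / len e"

lemma cut_deriv: "(cut \<phi> e has_real_derivative cut1 \<phi> e) (at x within S)"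
  unfolding cut_def[abs_def] cut1_def using len_pos[of e] by (auto intro!: derivative_eq_intros)

lemma cut_ends: "cut \<phi> e 0 = \<phi> (src e)" "cut \<phi> e (len e) = \<phi> (tgt e)"
  using len_pos[of e] by (simp_all add: cut_def)

lemma cut_continuous: "continuous_on S (cut \<phi> e)"
  unfolding cut_def[abs_def] by (intro continuous_intros)

lemma cut_const: "\<phi> (src e) = c \<Longrightarrow> \<phi> (tgt e) = c \<Longrightarrow> cut \<phi> e x = c" "\<phi> (src e) = c \<Longrightarrow> \<phi> (tgt e) = c \<Longrightarrow> cut1 \<phi> e = 0"
  by (simp_all add: cut_def cut1_def)

lemma cut1_le:
  assumes "\<bar>\<phi> (src e) - \<phi> (tgt e)\<bar> \<le> \<eta> * len e"
  shows "(cut1 \<phi> e)\<^sup>2 \<le> \<eta>\<^sup>2"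
proof -
  have "\<bar>cut1 \<phi> e\<bar> \<le> \<eta>"
    using assms len_pos[of e] by (simp add: cut1_def abs_minus_commute pos_divide_le_eq)
  then show ?thesis by (metis abs_ge_zero order_trans abs_le_square_iff abs_of_nonneg)
qed

lemma classical_onD:
  assumes "classical_on \<kappa> l h h0 h1"
  shows "primitive_on l h0 h1" "primitive_on l h1 (\<lambda>x. \<kappa> *\<^sub>R h x)" "AE x in lborel. x \<in> {0..l} \<longrightarrow> h x = h0 x"
    "continuous_on {0..l} h0" "continuous_on {0..l} h1"
  using assms primitive_on_continuous unfolding classical_on_def by blast+

text \<open>The IMS localization formula: test the equation with \<chi>^2 h, where \<chi> is
  \<open>cut \<phi>\<close>, and use h' \<bullet> (\<chi>^2 h)' = |(\<chi> h)'|^2 - |\<chi>'|^2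
  |h|^2. The Kirchhoff condition and continuity of \<open>h\<close> remove the boundary
  terms.\<close>

lemma weak_solution_localization:
  assumes h: "weak_solution \<kappa> {} h" and cl: "\<And>e. classical_on \<kappa> (len e) (h e) (h0 e) (h1 e)"
    and \<phi>: "finite {v. \<phi> v \<noteq> 0}"
  shows "(\<Sum>e\<in>touching {v. \<phi> v \<noteq> 0}. LBINT x:{0..len e}. (cmod (cut \<phi> e x *\<^sub>R h1 e x + cut1 \<phi> e *\<^sub>R h0 e x))\<^sup>2 + \<kappa> * (cmod (cut \<phi> e x *\<^sub>R h0 e x))\<^sup>2)
     = (\<Sum>e\<in>touching {v. \<phi> v \<noteq> 0}. (cut1 \<phi> e)\<^sup>2 * (LBINT x:{0..len e}. (cmod (h0 e x))\<^sup>2))"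
proof -
  let ?E = "touching {v. \<phi> v \<noteq> 0}"
  have E: "finite ?E" by (rule finite_touching[OF \<phi>])
  have off: "\<phi> (src e) = 0" "\<phi> (tgt e) = 0" if "e \<notin> ?E" for e using that by (auto simp: touching_def)
  define \<Psi> where "\<Psi> e x = (cut \<phi> e x)\<^sup>2 *\<^sub>R h0 e x" for e x
  define \<Psi>1 where "\<Psi>1 e x = (cut \<phi> e x)\<^sup>2 *\<^sub>R h1 e x + (2 * cut \<phi> e x * cut1 \<phi> e) *\<^sub>R h0 e x" for e x
  have p: "primitive_on (len e) (\<Psi> e) (\<Psi>1 e)" for e
    unfolding \<Psi>_def[abs_def] \<Psi>1_def[abs_def]
  proof (rule primitive_on_scaleR[OF classical_onD(1)[OF cl] classical_onD(5)[OF cl]])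
    show "((\<lambda>x. (cut \<phi> e x)\<^sup>2) has_real_derivative 2 * cut \<phi> e x * cut1 \<phi> e) (at x within {0..len e})" for x
      by (rule derivative_eq_intros cut_deriv | simp)+
    show "continuous_on {0..len e} (\<lambda>x. 2 * cut \<phi> e x * cut1 \<phi> e)"
      by (intro continuous_intros cut_continuous)
  qed
  obtain c where c: "\<And>e. h0 e 0 = c (src e)" "\<And>e. h0 e (len e) = c (tgt e)"
    using vertex_values[OF weak_solution_continuous[OF h cl]] by blast
  have vc: "vertex_continuous \<Psi>"
    unfolding vertex_continuous_def
    by (intro allI exI[of _ "(\<phi> _)\<^sup>2 *\<^sub>R c _"]) (auto simp: \<Psi>_def cut_ends c)
  have "(\<Sum>e\<in>?E. (LBINT x:{0..len e}. (\<kappa> *\<^sub>R h e x) \<bullet> \<Psi> e x) + (LBINT x:{0..len e}. h1 e x \<bullet> \<Psi>1 e x)) = 0"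
  proof (rule green[OF E classical_onD(2)[OF cl] p vc])
    show "\<Psi> e x = 0" if "e \<notin> ?E" for e x using cut_const(1)[OF off[OF that]] by (simp add: \<Psi>_def)
    show "\<Psi> e 0 = 0 \<or> flux h1 (src e) = 0" "\<Psi> e (len e) = 0 \<or> flux h1 (tgt e) = 0" for e
      using weak_solution_flux[OF h _ cl] by blast+
  qed
  moreover have "(LBINT x:{0..len e}. (\<kappa> *\<^sub>R h e x) \<bullet> \<Psi> e x) + (LBINT x:{0..len e}. h1 e x \<bullet> \<Psi>1 e x)
     = (LBINT x:{0..len e}. (cmod (cut \<phi> e x *\<^sub>R h1 e x + cut1 \<phi> e *\<^sub>R h0 e x))\<^sup>2 + \<kappa> * (cmod (cut \<phi> e x *\<^sub>R h0 e x))\<^sup>2)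
       - (cut1 \<phi> e)\<^sup>2 * (LBINT x:{0..len e}. (cmod (h0 e x))\<^sup>2)" for e
  proof -
    note c0 = classical_onD(4)[OF cl, of e] and c1 = classical_onD(5)[OF cl, of e]
    note cc = cut_continuous[of "{0..len e}" \<phi> e]
    have \<Psi>c: "continuous_on {0..len e} (\<Psi> e)" by (rule primitive_on_continuous[OF p])
    have \<Psi>1c: "continuous_on {0..len e} (\<Psi>1 e)"
      unfolding \<Psi>1_def[abs_def] by (intro continuous_intros c0 c1 cc)
    have i0: "set_integrable lborel {0..len e} (\<lambda>x. (\<kappa> *\<^sub>R h e x) \<bullet> \<Psi> e x)"
      by (rule set_integrable_continuous_inner[OF \<Psi>c primitive_onD(1)[OF classical_onD(2)[OF cl]]])
    have i1: "set_integrable lborel {0..len e} (\<lambda>x. (\<kappa> *\<^sub>R h0 e x) \<bullet> \<Psi> e x)"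
      "set_integrable lborel {0..len e} (\<lambda>x. h1 e x \<bullet> \<Psi>1 e x)"
      by (intro borel_integrable_atLeastAtMost' continuous_intros c0 c1 \<Psi>c \<Psi>1c)+
    have i2: "set_integrable lborel {0..len e} (\<lambda>x. (cmod (cut \<phi> e x *\<^sub>R h1 e x + cut1 \<phi> e *\<^sub>R h0 e x))\<^sup>2 + \<kappa> * (cmod (cut \<phi> e x *\<^sub>R h0 e x))\<^sup>2)"
      "set_integrable lborel {0..len e} (\<lambda>x. (cut1 \<phi> e)\<^sup>2 * (cmod (h0 e x))\<^sup>2)"
      by (intro borel_integrable_atLeastAtMost' continuous_intros c0 c1 cc)+
    have "(LBINT x:{0..len e}. (\<kappa> *\<^sub>R h e x) \<bullet> \<Psi> e x) = (LBINT x:{0..len e}. (\<kappa> *\<^sub>R h0 e x) \<bullet> \<Psi> e x)"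
      unfolding set_lebesgue_integral_def
    proof (rule integral_cong_AE)
      show "AE x in lborel. indicator {0..len e} x *\<^sub>R ((\<kappa> *\<^sub>R h e x) \<bullet> \<Psi> e x) = indicator {0..len e} x *\<^sub>R ((\<kappa> *\<^sub>R h0 e x) \<bullet> \<Psi> e x)"
        using classical_onD(3)[OF cl, of e] by eventually_elim (auto simp: indicator_def)
    qed (use i0 i1 in \<open>simp_all only: set_integrable_def borel_measurable_integrable\<close>)
    then have "(LBINT x:{0..len e}. (\<kappa> *\<^sub>R h e x) \<bullet> \<Psi> e x) + (LBINT x:{0..len e}. h1 e x \<bullet> \<Psi>1 e x)
       = (LBINT x:{0..len e}. (\<kappa> *\<^sub>R h0 e x) \<bullet> \<Psi> e x + h1 e x \<bullet> \<Psi>1 e x)"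
      using set_integral_add(2)[OF i1] by simp
    also have "\<dots> = (LBINT x:{0..len e}. ((cmod (cut \<phi> e x *\<^sub>R h1 e x + cut1 \<phi> e *\<^sub>R h0 e x))\<^sup>2 + \<kappa> * (cmod (cut \<phi> e x *\<^sub>R h0 e x))\<^sup>2) - (cut1 \<phi> e)\<^sup>2 * (cmod (h0 e x))\<^sup>2)"
    proof -
      have "(\<kappa> *\<^sub>R h0 e x) \<bullet> \<Psi> e x + h1 e x \<bullet> \<Psi>1 e x
        = ((cmod (cut \<phi> e x *\<^sub>R h1 e x + cut1 \<phi> e *\<^sub>R h0 e x))\<^sup>2 + \<kappa> * (cmod (cut \<phi> e x *\<^sub>R h0 e x))\<^sup>2) - (cut1 \<phi> e)\<^sup>2 * (cmod (h0 e x))\<^sup>2" for x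
        unfolding \<Psi>_def \<Psi>1_def power2_norm_eq_inner
        by (simp add: inner_add_left inner_add_right inner_commute[of "h0 e x" "h1 e x"] power2_eq_square algebra_simps)
      then show ?thesis by simp
    qed
    also have "\<dots> = (LBINT x:{0..len e}. (cmod (cut \<phi> e x *\<^sub>R h1 e x + cut1 \<phi> e *\<^sub>R h0 e x))\<^sup>2 + \<kappa> * (cmod (cut \<phi> e x *\<^sub>R h0 e x))\<^sup>2)
        - (LBINT x:{0..len e}. (cut1 \<phi> e)\<^sup>2 * (cmod (h0 e x))\<^sup>2)"
      by (rule set_integral_diff(2)[OF i2])
    finally show ?thesis by simp
  qed
  ultimately show ?thesis by (simp add: sum_subtractf)
qed

lemma integral_square_cong:
  assumes cl: "classical_on \<kappa> (len e) (h e) h0 h1" and h: "set_integrable lborel {0..len e} (\<lambda>x. (cmod (h e x))\<^sup>2)"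
  shows "(LBINT x:{0..len e}. (cmod (h e x))\<^sup>2) = (LBINT x:{0..len e}. (cmod (h0 x))\<^sup>2)"
  unfolding set_lebesgue_integral_def
proof (rule integral_cong_AE)
  show "AE x in lborel. indicator {0..len e} x *\<^sub>R (cmod (h e x))\<^sup>2 = indicator {0..len e} x *\<^sub>R (cmod (h0 x))\<^sup>2"
    using classical_onD(3)[OF cl] by eventually_elim (auto simp: indicator_def)
qed (use h set_integrable_square_continuous[OF classical_onD(4)[OF cl]] in \<open>simp_all add: set_integrable_def borel_measurable_integrable\<close>)

end

context complete_metric_graph
begin

text \<open>Letting the slope of the cutoff tend to zero in the localization identity.\<close>
lemma weak_solution_energy_zero:
  assumes h: "weak_solution \<kappa> {} h" and cl: "\<And>e. classical_on \<kappa> (len e) (h e) (h0 e) (h1 e)"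
    and \<kappa>: "0 \<le> \<kappa>" and bound: "\<And>E. finite E \<Longrightarrow> (\<Sum>e\<in>E. LBINT x:{0..len e}. (cmod (h e x))\<^sup>2) \<le> N"
  shows "(LBINT x:{0..len a}. (cmod (h1 a x))\<^sup>2 + \<kappa> * (cmod (h0 a x))\<^sup>2) = 0"
proof (rule antisym)
  have N: "0 \<le> N" using bound[of "{}"] by simp
  have hsq: "set_integrable lborel {0..len e} (\<lambda>x. (cmod (h e x))\<^sup>2)" for e using h by (simp add: weak_solution_def)
  have le: "(LBINT x:{0..len a}. (cmod (h1 a x))\<^sup>2 + \<kappa> * (cmod (h0 a x))\<^sup>2) \<le> \<eta>\<^sup>2 * N" if \<eta>: "\<eta> > 0" for \<eta>
  proof -
    obtain \<phi> where \<phi>: "finite {v. \<phi> v \<noteq> 0}" "\<phi> (src a) = 1" "\<phi> (tgt a) = 1"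
      "\<And>e. \<bar>\<phi> (src e) - \<phi> (tgt e)\<bar> \<le> \<eta> * len e"
      using cutoff_exists[OF \<eta>, of a] by blast
    let ?E = "touching {v. \<phi> v \<noteq> 0}"
    define F where "F e x = (cmod (cut \<phi> e x *\<^sub>R h1 e x + cut1 \<phi> e *\<^sub>R h0 e x))\<^sup>2 + \<kappa> * (cmod (cut \<phi> e x *\<^sub>R h0 e x))\<^sup>2" for e x
    have E: "finite ?E" by (rule finite_touching[OF \<phi>(1)])
    have "a \<in> ?E" using \<phi>(2) by (simp add: touching_def)
    have "(LBINT x:{0..len a}. (cmod (h1 a x))\<^sup>2 + \<kappa> * (cmod (h0 a x))\<^sup>2) = (LBINT x:{0..len a}. F a x)"
      by (simp add: F_def cut_const[where c=1] \<phi>)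
    also have "\<dots> \<le> (\<Sum>e\<in>?E. LBINT x:{0..len e}. F e x)"
      using \<open>a \<in> ?E\<close> E \<kappa> by (intro member_le_sum set_integral_nonneg) (auto simp: F_def)
    also have "\<dots> = (\<Sum>e\<in>?E. (cut1 \<phi> e)\<^sup>2 * (LBINT x:{0..len e}. (cmod (h0 e x))\<^sup>2))"
      unfolding F_def by (rule weak_solution_localization[OF h cl \<phi>(1)])
    also have "\<dots> \<le> (\<Sum>e\<in>?E. \<eta>\<^sup>2 * (LBINT x:{0..len e}. (cmod (h e x))\<^sup>2))"
    proof (rule sum_mono)
      fix e
      have "(LBINT x:{0..len e}. (cmod (h e x))\<^sup>2) = (LBINT x:{0..len e}. (cmod (h0 e x))\<^sup>2)"
        by (rule integral_square_cong[where h = h, OF cl hsq])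
      then show "(cut1 \<phi> e)\<^sup>2 * (LBINT x:{0..len e}. (cmod (h0 e x))\<^sup>2) \<le> \<eta>\<^sup>2 * (LBINT x:{0..len e}. (cmod (h e x))\<^sup>2)"
        by (simp only:) (intro mult_right_mono cut1_le \<phi> set_integral_nonneg, simp)
    qed
    also have "\<dots> \<le> \<eta>\<^sup>2 * N" unfolding sum_distrib_left[symmetric] by (intro mult_left_mono bound E) simp
    finally show ?thesis .
  qed
  show "(LBINT x:{0..len a}. (cmod (h1 a x))\<^sup>2 + \<kappa> * (cmod (h0 a x))\<^sup>2) \<le> 0"
  proof (rule field_le_epsilon)
    fix \<delta> :: real assume \<delta>: "\<delta> > 0"
    define \<eta> where "\<eta> = sqrt (\<delta> / (N + 1))"
    have "\<eta> > 0" using \<delta> N by (simp add: \<eta>_def)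
    have "\<eta>\<^sup>2 * N = \<delta> / (N + 1) * N" using \<delta> N by (simp add: \<eta>_def)
    also have "\<dots> \<le> \<delta>" using \<delta> N by (simp add: field_simps)
    finally show "(LBINT x:{0..len a}. (cmod (h1 a x))\<^sup>2 + \<kappa> * (cmod (h0 a x))\<^sup>2) \<le> 0 + \<delta>"
      using le[OF \<open>\<eta> > 0\<close>] by simp
  qed
  show "0 \<le> (LBINT x:{0..len a}. (cmod (h1 a x))\<^sup>2 + \<kappa> * (cmod (h0 a x))\<^sup>2)"
    using \<kappa> by (intro set_integral_nonneg) auto
qed

end

section \<open>The self-adjoint Laplacian, its quadratic form and its spectrum\<close>

section \<open>The Kirchhoff Laplacian as a closed relation\<close>

context metric_graph
begin

lemma emb_obtain: obtains h where "h \<in> L2G len" "emb len h = x"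
  using emb_surj[of len x, OF len_pos] by blast

text \<open>Square integrability of the image is a separate conjunct: admissibility controls second
  derivatives edge by edge, and \<open>emb\<close> has its meaning on \<open>L2G\<close>.\<close>

definition core :: "('e edge_l2 \<times> 'e edge_l2) set" where
  "core = {(emb len f, emb len (\<lambda>e x. - u2 e x)) | f u1 u2. admissible f u1 u2 \<and> (\<lambda>e x. - u2 e x) \<in> L2G len}"

definition Laplacian :: "('e edge_l2 \<times> 'e edge_l2) set" where "Laplacian = closure core"

text \<open>A class inside the form domain: continuity at the vertices but no Kirchhoff condition.
  Multiplication by cutoffs and smoothed absolute values therefore stay inside it, although they
  leave the operator domain.\<close>

definition form_fun :: "'e set \<Rightarrow> ('e \<Rightarrow> real \<Rightarrow> complex) \<Rightarrow> ('e \<Rightarrow> real \<Rightarrow> complex) \<Rightarrow> bool" where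
  "form_fun E \<phi> \<phi>1 \<longleftrightarrow> finite E \<and> (\<forall>e. primitive_on (len e) (\<phi> e) (\<phi>1 e) \<and> continuous_on {0..len e} (\<phi>1 e))
     \<and> vertex_continuous \<phi> \<and> (\<forall>e. e \<notin> E \<longrightarrow> (\<forall>x\<in>{0..len e}. \<phi> e x = 0 \<and> \<phi>1 e x = 0))"

definition energy :: "'e set \<Rightarrow> ('e \<Rightarrow> real \<Rightarrow> complex) \<Rightarrow> real" where
  "energy E u = (\<Sum>e\<in>E. LBINT x:{0..len e}. (cmod (u e x))\<^sup>2)"

lemma form_funD:
  assumes "form_fun E \<phi> \<phi>1"
  shows "finite E" "primitive_on (len e) (\<phi> e) (\<phi>1 e)" "continuous_on {0..len e} (\<phi>1 e)" "vertex_continuous \<phi>"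
    "e \<notin> E \<Longrightarrow> x \<in> {0..len e} \<Longrightarrow> \<phi> e x = 0" "e \<notin> E \<Longrightarrow> x \<in> {0..len e} \<Longrightarrow> \<phi>1 e x = 0"
    "continuous_on {0..len e} (\<phi> e)"
  using assms primitive_on_continuous unfolding form_fun_def by blast+

lemma L2G_continuous:
  assumes "finite E" "\<And>e x. e \<notin> E \<Longrightarrow> x \<in> {0<..<len e} \<Longrightarrow> f e x = 0" "\<And>e. e \<in> E \<Longrightarrow> continuous_on {0..len e} (f e)"
  shows "f \<in> L2G len"
  using assms by (intro L2G_finite_support borel_integrable_atLeastAtMost' set_integrable_square_continuous) auto

lemma form_fun_L2G:
  assumes "form_fun E \<phi> \<phi>1" shows "\<phi> \<in> L2G len"
  by (rule L2G_continuous[OF form_funD(1)[OF assms]]) (use form_funD(5,7)[OF assms] in auto)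

lemma form_fun_norm:
  assumes "form_fun E \<phi> \<phi>1"
  shows "(norm (emb len \<phi>))\<^sup>2 = energy E \<phi>"
  unfolding energy_def power2_norm_eq_inner
  by (subst inner_emb[OF len_pos form_fun_L2G[OF assms] form_fun_L2G[OF assms] form_funD(1)[OF assms]])
     (use form_funD(5)[OF assms] in auto)

text \<open>The Kirchhoff condition of \<open>f\<close> takes care of all vertices, so \<phi> may be
  any continuous test function of finite support. This identifies the sum of the edge integrals as
  the quadratic form of the operator.\<close>

lemma energy_identity:
  assumes f: "admissible f u1 u2" "(\<lambda>e x. - u2 e x) \<in> L2G len"
    and E: "finite E" "\<And>e x. e \<notin> E \<Longrightarrow> x \<in> {0<..<len e} \<Longrightarrow> \<phi> e x = 0"
    and \<phi>: "\<And>e. primitive_on (len e) (\<phi> e) (\<phi>1 e)" "vertex_continuous \<phi>" "\<phi> \<in> L2G len"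
  shows "emb len (\<lambda>e x. - u2 e x) \<bullet> emb len \<phi> = (\<Sum>e\<in>E. LBINT x:{0..len e}. u1 e x \<bullet> \<phi>1 e x)"
proof -
  have "(\<Sum>e\<in>E. (LBINT x:{0..len e}. u2 e x \<bullet> \<phi> e x) + (LBINT x:{0..len e}. u1 e x \<bullet> \<phi>1 e x)) = 0"
    by (rule green[OF E(1) admissibleD(2)[OF f(1)] \<phi>(1,2) E(2)]) (use admissibleD(5)[OF f(1)] in auto)
  moreover have "(LBINT x:{0..len e}. - u2 e x \<bullet> \<phi> e x) = - (LBINT x:{0..len e}. u2 e x \<bullet> \<phi> e x)" for e
  proof -
    have "set_integrable lborel {0..len e} (\<lambda>x. u2 e x \<bullet> \<phi> e x)"
      by (rule set_integrable_continuous_inner[OF primitive_on_continuous[OF \<phi>(1)] primitive_onD(1)[OF admissibleD(2)[OF f(1)]]])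
    then show ?thesis by (simp add: set_integral_uminus)
  qed
  ultimately show ?thesis
    by (subst inner_emb[OF len_pos f(2) \<phi>(3) E]) (auto simp: sum.distrib sum_negf)
qed

lemma emb_combine:
  assumes "f \<in> L2G len" "g \<in> L2G len"
  shows "(\<lambda>e x. f e x + z * g e x) \<in> L2G len" "emb len (\<lambda>e x. f e x + z * g e x) = emb len f + cmult z (emb len g)"
proof -
  have eq: "(\<lambda>e x. f e x + z * g e x) = f - gscale (- z) g" by (auto simp: gscale_def fun_eq_iff)
  show "(\<lambda>e x. f e x + z * g e x) \<in> L2G len"
    unfolding eq by (intro L2G_diff L2G_gscale len_pos assms)
  show "emb len (\<lambda>e x. f e x + z * g e x) = emb len f + cmult z (emb len g)"
    unfolding eq by (simp add: emb_diff L2G_gscale emb_gscale len_pos assms cmult_def)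
qed

lemma emb_zero: "emb len (\<lambda>e x. 0) = 0"
  by (rule emb_eq_zero[OF L2G_continuous[of "{}"]]) auto

lemma core_combine:
  assumes "(f, g) \<in> core" "(f', g') \<in> core"
  shows "(f + cmult z f', g + cmult z g') \<in> core"
proof -
  obtain F u1 u2 F' w1 w2 where F: "admissible F u1 u2" "(\<lambda>e x. - u2 e x) \<in> L2G len" "f = emb len F" "g = emb len (\<lambda>e x. - u2 e x)"
    and F': "admissible F' w1 w2" "(\<lambda>e x. - w2 e x) \<in> L2G len" "f' = emb len F'" "g' = emb len (\<lambda>e x. - w2 e x)"
    using assms by (auto simp: core_def)
  have eq: "(\<lambda>e x. - (u2 e x + z * w2 e x)) = (\<lambda>e x. - u2 e x + z * - w2 e x)" by (auto simp: fun_eq_iff)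
  show ?thesis
    unfolding core_def F(3,4) F'(3,4)
    using admissible_combine[OF F(1) F'(1), of z] emb_combine[OF admissible_L2G[OF F(1)] admissible_L2G[OF F'(1)], of z]
      emb_combine[OF F(2) F'(2), of z]
    by (intro CollectI exI[of _ "\<lambda>e x. F e x + z * F' e x"] exI[of _ "\<lambda>e x. u1 e x + z * w1 e x"] exI[of _ "\<lambda>e x. u2 e x + z * w2 e x"])
       (simp add: eq)
qed

lemma core_zero: "(0, 0) \<in> core"
  using admissible_zero emb_zero L2G_continuous[of "{}" "\<lambda>e x. 0"]
  by (auto simp: core_def intro!: exI[of _ "\<lambda>e x. 0"])

lemma cmult_real: "cmult (complex_of_real r) x = r *\<^sub>R x" by (simp add: cmult_def)

lemma core_subspace: "subspace core"
proof (rule subspaceI)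
  show "0 \<in> core" using core_zero by (simp add: zero_prod_def)
  show "x + y \<in> core" if "x \<in> core" "y \<in> core" for x y
    using core_combine[of "fst x" "snd x" "fst y" "snd y" "complex_of_real 1"] that unfolding cmult_real by (simp add: plus_prod_def)
  show "c *\<^sub>R x \<in> core" if "x \<in> core" for c x
    using core_combine[OF core_zero, of "fst x" "snd x" "complex_of_real c"] that
    by (simp add: cmult_real scaleR_prod_def)
qed

lemma core_imult: "(f, g) \<in> core \<Longrightarrow> (imult f, imult g) \<in> core"
  using core_combine[OF core_zero, of f g \<i>] by (simp add: cmult_def)

lemma core_sym:
  assumes "(f, g) \<in> core" "(f', g') \<in> core"
  shows "g \<bullet> f' = f \<bullet> g'"
proof -
  obtain F u1 u2 F' w1 w2 where F: "admissible F u1 u2" "(\<lambda>e x. - u2 e x) \<in> L2G len" "f = emb len F" "g = emb len (\<lambda>e x. - u2 e x)"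
    and F': "admissible F' w1 w2" "(\<lambda>e x. - w2 e x) \<in> L2G len" "f' = emb len F'" "g' = emb len (\<lambda>e x. - w2 e x)"
    using assms by (auto simp: core_def)
  define E where "E = {e. \<exists>x\<in>{0<..<len e}. F e x \<noteq> 0} \<union> {e. \<exists>x\<in>{0<..<len e}. F' e x \<noteq> 0}"
  have E: "finite E" using admissibleD(6)[OF F(1)] admissibleD(6)[OF F'(1)] by (simp add: E_def)
  have "g \<bullet> f' = (\<Sum>e\<in>E. LBINT x:{0..len e}. u1 e x \<bullet> w1 e x)"
    unfolding F(4) F'(3)
    by (rule energy_identity[OF F(1,2) E _ admissibleD(1,4)[OF F'(1)] admissible_L2G[OF F'(1)]]) (auto simp: E_def)
  moreover have "g' \<bullet> f = (\<Sum>e\<in>E. LBINT x:{0..len e}. w1 e x \<bullet> u1 e x)"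
    unfolding F'(4) F(3)
    by (rule energy_identity[OF F'(1,2) E _ admissibleD(1,4)[OF F(1)] admissible_L2G[OF F(1)]]) (auto simp: E_def)
  ultimately show ?thesis by (simp add: inner_commute)
qed

text \<open>Expansion of the energy plus squared norm of k - t \<phi>, which is nonnegative. Mixed
  terms go through the operator applied to \<open>k\<close>, so that \<open>k\<close> and
  \<open>k'\<close> occur continuously and the inequality extends to the closure without a closed
  form domain.\<close>

lemma core_form_quadratic:
  assumes "(k, k') \<in> core" and \<phi>: "form_fun E \<phi> \<phi>1"
  shows "0 \<le> (k' + k) \<bullet> k - 2 * t * ((k' + k) \<bullet> emb len \<phi>) + t\<^sup>2 * (energy E \<phi>1 + (norm (emb len \<phi>))\<^sup>2)"
proof -
  obtain F u1 u2 where F: "admissible F u1 u2" "(\<lambda>e x. - u2 e x) \<in> L2G len" "k = emb len F" "k' = emb len (\<lambda>e x. - u2 e x)"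
    using assms by (auto simp: core_def)
  define E' where "E' = {e. \<exists>x\<in>{0<..<len e}. F e x \<noteq> 0} \<union> E"
  have E': "finite E'" using admissibleD(6)[OF F(1)] form_funD(1)[OF \<phi>] by (simp add: E'_def)
  have a: "k' \<bullet> k = (\<Sum>e\<in>E'. LBINT x:{0..len e}. u1 e x \<bullet> u1 e x)"
    unfolding F(3,4)
    by (rule energy_identity[OF F(1,2) E' _ admissibleD(1,4)[OF F(1)] admissible_L2G[OF F(1)]]) (auto simp: E'_def)
  have b: "k' \<bullet> emb len \<phi> = (\<Sum>e\<in>E'. LBINT x:{0..len e}. u1 e x \<bullet> \<phi>1 e x)"
    unfolding F(4)
    by (rule energy_identity[OF F(1,2) E' _ form_funD(2,4)[OF \<phi>] form_fun_L2G[OF \<phi>]])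
       (use form_funD(5)[OF \<phi>] in \<open>auto simp: E'_def\<close>)
  have c: "energy E \<phi>1 = (\<Sum>e\<in>E'. LBINT x:{0..len e}. \<phi>1 e x \<bullet> \<phi>1 e x)"
    unfolding energy_def power2_norm_eq_inner
  proof (rule sum.mono_neutral_left[OF E'])
    show "\<forall>e\<in>E' - E. (LBINT x:{0..len e}. \<phi>1 e x \<bullet> \<phi>1 e x) = 0"
    proof
      fix e assume "e \<in> E' - E"
      then have "(LBINT x:{0..len e}. \<phi>1 e x \<bullet> \<phi>1 e x) = (LBINT x:{0..len e}. 0)"
        by (intro set_lebesgue_integral_cong) (use form_funD(6)[OF \<phi>] in auto)
      then show "(LBINT x:{0..len e}. \<phi>1 e x \<bullet> \<phi>1 e x) = 0" by simp
    qed
  qed (auto simp: E'_def)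
  have "0 \<le> (\<Sum>e\<in>E'. LBINT x:{0..len e}. (u1 e x - t *\<^sub>R \<phi>1 e x) \<bullet> (u1 e x - t *\<^sub>R \<phi>1 e x))"
    by (intro sum_nonneg set_integral_nonneg) simp
  also have "\<dots> = (\<Sum>e\<in>E'. (LBINT x:{0..len e}. u1 e x \<bullet> u1 e x) - 2 * t * (LBINT x:{0..len e}. u1 e x \<bullet> \<phi>1 e x) + t\<^sup>2 * (LBINT x:{0..len e}. \<phi>1 e x \<bullet> \<phi>1 e x))"
  proof (rule sum.cong[OF refl])
    fix e
    have cu: "continuous_on {0..len e} (u1 e)" by (rule primitive_on_continuous[OF admissibleD(2)[OF F(1)]])
    have i: "set_integrable lborel {0..len e} (\<lambda>x. u1 e x \<bullet> u1 e x)" "set_integrable lborel {0..len e} (\<lambda>x. 2 * t * (u1 e x \<bullet> \<phi>1 e x))"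
      "set_integrable lborel {0..len e} (\<lambda>x. t\<^sup>2 * (\<phi>1 e x \<bullet> \<phi>1 e x))"
      by (intro borel_integrable_atLeastAtMost' continuous_intros cu form_funD(3)[OF \<phi>])+
    have "(LBINT x:{0..len e}. (u1 e x - t *\<^sub>R \<phi>1 e x) \<bullet> (u1 e x - t *\<^sub>R \<phi>1 e x))
      = (LBINT x:{0..len e}. (u1 e x \<bullet> u1 e x - 2 * t * (u1 e x \<bullet> \<phi>1 e x)) + t\<^sup>2 * (\<phi>1 e x \<bullet> \<phi>1 e x))"
      by (intro arg_cong[of _ _ "set_lebesgue_integral lborel {0..len e}"])
         (auto simp: fun_eq_iff inner_diff_left inner_diff_right inner_commute power2_eq_square algebra_simps)
    also have "\<dots> = (LBINT x:{0..len e}. u1 e x \<bullet> u1 e x) - (LBINT x:{0..len e}. 2 * t * (u1 e x \<bullet> \<phi>1 e x)) + (LBINT x:{0..len e}. t\<^sup>2 * (\<phi>1 e x \<bullet> \<phi>1 e x))"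
      using set_integral_add(2)[OF set_integral_diff(1)[OF i(1,2)] i(3)] set_integral_diff(2)[OF i(1,2)] by simp
    finally show "(LBINT x:{0..len e}. (u1 e x - t *\<^sub>R \<phi>1 e x) \<bullet> (u1 e x - t *\<^sub>R \<phi>1 e x))
      = (LBINT x:{0..len e}. u1 e x \<bullet> u1 e x) - 2 * t * (LBINT x:{0..len e}. u1 e x \<bullet> \<phi>1 e x) + t\<^sup>2 * (LBINT x:{0..len e}. \<phi>1 e x \<bullet> \<phi>1 e x)"
      by simp
  qed
  also have "\<dots> = k' \<bullet> k - 2 * t * (k' \<bullet> emb len \<phi>) + t\<^sup>2 * energy E \<phi>1"
    unfolding a b c by (simp add: sum.distrib sum_subtractf sum_distrib_left)
  finally have 1: "0 \<le> k' \<bullet> k - 2 * t * (k' \<bullet> emb len \<phi>) + t\<^sup>2 * energy E \<phi>1" .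
  have "0 \<le> (k - t *\<^sub>R emb len \<phi>) \<bullet> (k - t *\<^sub>R emb len \<phi>)" by simp
  also have "\<dots> = k \<bullet> k - 2 * t * (k \<bullet> emb len \<phi>) + t\<^sup>2 * (norm (emb len \<phi>))\<^sup>2"
    unfolding power2_norm_eq_inner
    by (simp add: inner_diff_left inner_diff_right inner_commute power2_eq_square algebra_simps)
  finally show ?thesis using 1 by (simp add: inner_add_left algebra_simps)
qed

lemma closed_limit_in_closure:
  assumes "p \<in> closure S" "\<And>q. q \<in> S \<Longrightarrow> P q" "closed {q. P q}"
  shows "P p"
proof -
  have "closure S \<subseteq> {q. P q}" by (rule closure_minimal) (use assms in auto)
  then show ?thesis using assms(1) by blast
qed

lemma Laplacian_form_quadratic:
  assumes "(k, k') \<in> Laplacian" and \<phi>: "form_fun E \<phi> \<phi>1"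
  shows "0 \<le> (k' + k) \<bullet> k - 2 * t * ((k' + k) \<bullet> emb len \<phi>) + t\<^sup>2 * (energy E \<phi>1 + (norm (emb len \<phi>))\<^sup>2)"
proof -
  let ?P = "\<lambda>p. 0 \<le> (snd p + fst p) \<bullet> fst p - 2 * t * ((snd p + fst p) \<bullet> emb len \<phi>) + t\<^sup>2 * (energy E \<phi>1 + (norm (emb len \<phi>))\<^sup>2)"
  have "?P (k, k')"
  proof (rule closed_limit_in_closure[where P = ?P])
    show "(k, k') \<in> closure core" using assms(1) by (simp add: Laplacian_def)
    show "?P q" if "q \<in> core" for q using core_form_quadratic[OF _ \<phi>, of "fst q" "snd q"] that by simp
    show "closed {q. ?P q}" by (intro closed_Collect_le continuous_intros)
  qed
  then show ?thesis by simp
qed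

lemma form_fun_zero: "form_fun {} (\<lambda>e x. 0) (\<lambda>e x. 0)"
  by (auto simp: form_fun_def vertex_continuous_def primitive_on_zero)

lemma core_nonneg:
  assumes "(f, g) \<in> core" shows "0 \<le> f \<bullet> g"
proof -
  obtain F u1 u2 where F: "admissible F u1 u2" "(\<lambda>e x. - u2 e x) \<in> L2G len" "f = emb len F" "g = emb len (\<lambda>e x. - u2 e x)"
    using assms by (auto simp: core_def)
  have "g \<bullet> f = (\<Sum>e\<in>{e. \<exists>x\<in>{0<..<len e}. F e x \<noteq> 0}. LBINT x:{0..len e}. u1 e x \<bullet> u1 e x)"
    unfolding F(3,4)
    by (rule energy_identity[OF F(1,2) admissibleD(6)[OF F(1)] _ admissibleD(1,4)[OF F(1)] admissible_L2G[OF F(1)]]) auto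
  also have "\<dots> \<ge> 0" by (intro sum_nonneg set_integral_nonneg) simp
  finally show ?thesis by (simp add: inner_commute)
qed

lemma core_subset_Laplacian: "core \<subseteq> Laplacian" unfolding Laplacian_def by (rule closure_subset)

lemma Laplacian_sym:
  assumes "(f, g) \<in> Laplacian" "(f', g') \<in> Laplacian"
  shows "g \<bullet> f' = f \<bullet> g'"
proof -
  have 1: "snd p \<bullet> f' = fst p \<bullet> g'" if p: "p \<in> core" for p
  proof -
    have "snd p \<bullet> fst (f', g') = fst p \<bullet> snd (f', g')"
    proof (rule closed_limit_in_closure[where P = "\<lambda>q. snd p \<bullet> fst q = fst p \<bullet> snd q"])
      show "(f', g') \<in> closure core" using assms(2) by (simp add: Laplacian_def)
      show "snd p \<bullet> fst q = fst p \<bullet> snd q" if "q \<in> core" for q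
        using core_sym[of "fst p" "snd p" "fst q" "snd q"] p that by simp
      show "closed {q. snd p \<bullet> fst q = fst p \<bullet> snd q}" by (intro closed_Collect_eq continuous_intros)
    qed
    then show ?thesis by simp
  qed
  have "snd (f, g) \<bullet> f' = fst (f, g) \<bullet> g'"
  proof (rule closed_limit_in_closure[where P = "\<lambda>p. snd p \<bullet> f' = fst p \<bullet> g'", OF _ 1])
    show "(f, g) \<in> closure core" using assms(1) by (simp add: Laplacian_def)
    show "closed {p. snd p \<bullet> f' = fst p \<bullet> g'}" by (intro closed_Collect_eq continuous_intros)
  qed
  then show ?thesis by simp
qed

lemma Laplacian_nonneg:
  assumes "(f, g) \<in> Laplacian" shows "0 \<le> f \<bullet> g"
proof -
  have "0 \<le> fst (f, g) \<bullet> snd (f, g)"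
  proof (rule closed_limit_in_closure[where P = "\<lambda>p. 0 \<le> fst p \<bullet> snd p"])
    show "(f, g) \<in> closure core" using assms by (simp add: Laplacian_def)
    show "0 \<le> fst q \<bullet> snd q" if "q \<in> core" for q using core_nonneg[of "fst q" "snd q"] that by simp
    show "closed {p. 0 \<le> fst p \<bullet> snd p}" by (intro closed_Collect_le continuous_intros)
  qed
  then show ?thesis by simp
qed

lemma bounded_linear_imult: "bounded_linear (imult :: 'e edge_l2 \<Rightarrow> 'e edge_l2)"
proof (rule bounded_linear_intro[of _ 1])
  show "norm (imult x) \<le> norm x * 1" for x :: "'e edge_l2"
    by (simp add: norm_eq_sqrt_inner inner_imult)
qed (simp_all add: imult_add imult_scaleR)

lemma Laplacian_imult:
  assumes "(f, g) \<in> Laplacian" shows "(imult f, imult g) \<in> Laplacian"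
proof -
  obtain p where p: "\<And>n. p n \<in> core" "p \<longlonglongrightarrow> (f, g)"
    using assms closure_sequential unfolding Laplacian_def by blast
  have "(\<lambda>n. (imult (fst (p n)), imult (snd (p n)))) \<longlonglongrightarrow> (imult f, imult g)"
    using bounded_linear.tendsto[OF bounded_linear_imult tendsto_fst[OF p(2)]]
      bounded_linear.tendsto[OF bounded_linear_imult tendsto_snd[OF p(2)]]
    by (intro tendsto_Pair) simp_all
  moreover have "(imult (fst (p n)), imult (snd (p n))) \<in> core" for n
    using core_imult[of "fst (p n)" "snd (p n)"] p(1) by simp
  ultimately show ?thesis unfolding Laplacian_def closure_sequential
    by (intro exI[of _ "\<lambda>n. (imult (fst (p n)), imult (snd (p n)))"]) simp
qed

text \<open>Orthogonality to the range of T + \<kappa> over the core, read off on functions.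
  \<kappa> = 1 treats the vectors obstructing surjectivity, \<kappa> = -lam the
  eigenvectors.\<close>

lemma weak_solution_of_orthogonal:
  assumes h: "h \<in> L2G len" and orth: "\<And>f g. (f, g) \<in> core \<Longrightarrow> (g + \<kappa> *\<^sub>R f) \<bullet> emb len h = 0"
  shows "weak_solution \<kappa> {} h"
  unfolding weak_solution_def
proof (intro conjI allI impI)
  show "set_integrable lborel {0..len e} (h e)" "set_integrable lborel {0..len e} (\<lambda>x. (cmod (h e x))\<^sup>2)" for e
    by (rule L2G_edge[OF h])+
  fix f u1 u2 E
  assume f: "admissible f u1 u2" and E: "finite E" and supp: "\<forall>e x. e \<notin> E \<longrightarrow> f e x = 0 \<and> u1 e x = 0 \<and> u2 e x = 0"
  define G where "G e x = - u2 e x" for e x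
  note u2i = primitive_onD(1)[OF admissibleD(2)[OF f]] admissibleD(3)[OF f]
  have G: "G \<in> L2G len"
  proof (rule L2G_finite_support[OF E])
    show "set_integrable lborel {0..len e} (G e)" for e
      unfolding G_def using set_integrable_mult_right[of "-1" lborel "{0..len e}" "u2 e"] u2i(1)[of e] by simp
    show "set_integrable lborel {0..len e} (\<lambda>x. (cmod (G e x))\<^sup>2)" for e
      unfolding G_def using u2i(2)[of e] by simp
  qed (use supp in \<open>simp add: G_def\<close>)
  have "(emb len f, emb len G) \<in> core"
    unfolding core_def G_def using f G[unfolded G_def[abs_def]] by blast
  from orth[OF this] have "emb len h \<bullet> emb len G + \<kappa> * (emb len h \<bullet> emb len f) = 0"
    by (simp add: inner_add_left inner_commute[of "emb len h"])
  then have z: "(\<Sum>e\<in>E. LBINT x:{0..len e}. h e x \<bullet> G e x) + \<kappa> * (\<Sum>e\<in>E. LBINT x:{0..len e}. h e x \<bullet> f e x) = 0"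
    by (subst (asm) inner_emb[OF len_pos h G E], use supp in \<open>simp add: G_def\<close>)
       (subst (asm) inner_emb[OF len_pos h admissible_L2G[OF f] E], use supp in simp_all)
  have "(LBINT x:{0..len e}. h e x \<bullet> (\<kappa> *\<^sub>R f e x - u2 e x)) = (LBINT x:{0..len e}. h e x \<bullet> G e x) + \<kappa> * (LBINT x:{0..len e}. h e x \<bullet> f e x)" for e
  proof -
    have i1: "set_integrable lborel {0..len e} (\<lambda>x. h e x \<bullet> G e x)"
      by (rule set_integrable_inner_of_squares[OF L2G_edge[OF h] L2G_edge[OF G]])
    have i2: "set_integrable lborel {0..len e} (\<lambda>x. \<kappa> * (h e x \<bullet> f e x))"
      using set_integrable_inner_of_squares[OF L2G_edge[OF h] L2G_edge[OF admissible_L2G[OF f]]]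
      by (rule set_integrable_mult_right)
    have "(LBINT x:{0..len e}. h e x \<bullet> (\<kappa> *\<^sub>R f e x - u2 e x)) = (LBINT x:{0..len e}. h e x \<bullet> G e x + \<kappa> * (h e x \<bullet> f e x))"
      by (simp add: G_def inner_diff_right)
    also have "\<dots> = (LBINT x:{0..len e}. h e x \<bullet> G e x) + (LBINT x:{0..len e}. \<kappa> * (h e x \<bullet> f e x))"
      by (rule set_integral_add(2)[OF i1 i2])
    finally show ?thesis by simp
  qed
  then show "(\<Sum>e\<in>E. LBINT x:{0..len e}. h e x \<bullet> (\<kappa> *\<^sub>R f e x - u2 e x)) = 0"
    using z by (simp add: sum.distrib sum_distrib_left)
qed

end

context complete_metric_graph
begin

lemma Laplacian_surj: "\<exists>f. (f, h - f) \<in> Laplacian"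
proof -
  have "\<exists>f g. (f, g) \<in> Laplacian \<and> g - (- f) = h"
  proof (rule linear_relation_surj[where C = 1])
    show "subspace Laplacian" unfolding Laplacian_def by (rule subspace_closure[OF core_subspace])
    show "closed Laplacian" by (simp add: Laplacian_def)
    show "bounded_linear (\<lambda>f :: 'e edge_l2. - f)" by (rule bounded_linear_minus[OF bounded_linear_ident])
    show "(norm f)\<^sup>2 \<le> 1 * (norm (g - (- f)))\<^sup>2" if "(f, g) \<in> Laplacian" for f g
      using Laplacian_nonneg[OF that] unfolding power2_norm_eq_inner
      by (simp add: inner_add_left inner_add_right inner_commute)
    fix x assume x: "\<And>f g. (f, g) \<in> Laplacian \<Longrightarrow> (g - (- f)) \<bullet> x = 0"
    obtain h where h: "h \<in> L2G len" "emb len h = x" by (rule emb_obtain)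
    have w: "weak_solution 1 {} h"
      by (rule weak_solution_of_orthogonal[OF h(1)]) (use x core_subset_Laplacian h(2) in auto)
    have "\<exists>h0 h1. \<forall>e. classical_on 1 (len e) (h e) (h0 e) (h1 e)"
    proof -
      have "\<forall>e. \<exists>h0 h1. classical_on 1 (len e) (h e) h0 h1" using weak_solution_classical[OF w] by simp
      then show ?thesis by metis
    qed
    then obtain h0 h1 where cl: "\<And>e. classical_on 1 (len e) (h e) (h0 e) (h1 e)" by blast
    have "(LBINT x:{0..len e}. (cmod (h e x))\<^sup>2) = 0" for e
    proof -
      have "(LBINT x:{0..len e}. (cmod (h e x))\<^sup>2) = (LBINT x:{0..len e}. (cmod (h0 e x))\<^sup>2)"
        by (rule integral_square_cong[where h = h, OF cl L2G_edge(2)[OF h(1)]])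
      also have "\<dots> \<le> (LBINT x:{0..len e}. (cmod (h1 e x))\<^sup>2 + 1 * (cmod (h0 e x))\<^sup>2)"
        by (rule set_integral_mono)
           (auto intro!: borel_integrable_atLeastAtMost' continuous_intros classical_onD(4,5)[OF cl])
      also have "\<dots> = 0"
        by (rule weak_solution_energy_zero[OF w cl _ edge_sum_le[OF h(1)]]) auto
      finally show ?thesis using set_integral_nonneg[of "{0..len e}" "\<lambda>x. (cmod (h e x))\<^sup>2" lborel] by simp
    qed
    from emb_eq_zero[OF h(1) this] show "x = 0" using h(2) by simp
  qed
  then obtain f g where "(f, g) \<in> Laplacian" "h = g + f" by auto
  then show ?thesis by (intro exI[of _ f]) simp
qed

sublocale op: nonneg_selfadjoint Laplacian imult
proof (rule nonneg_selfadjoint.intro)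
  show "subspace Laplacian" unfolding Laplacian_def by (rule subspace_closure[OF core_subspace])
  show "closed Laplacian" by (simp add: Laplacian_def)
qed (auto intro: Laplacian_sym Laplacian_nonneg Laplacian_surj Laplacian_imult simp: imult_add imult_scaleR imult_imult inner_imult)

end

context metric_graph
begin

lemma gnorm2_tendsto_iff:
  assumes "\<And>n. F n \<in> L2G len" "f \<in> L2G len"
  shows "((\<lambda>n. gnorm2 len (F n - f)) \<longlonglongrightarrow> 0) \<longleftrightarrow> ((\<lambda>n. emb len (F n)) \<longlonglongrightarrow> emb len f)"
proof -
  have "((\<lambda>n. gnorm2 len (F n - f)) \<longlonglongrightarrow> 0) \<longleftrightarrow> ((\<lambda>n. ennreal ((norm (emb len (F n) - emb len f))\<^sup>2)) \<longlonglongrightarrow> ennreal 0)"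
    using assms by (simp add: gnorm2_emb L2G_diff len_pos emb_diff)
  also have "\<dots> \<longleftrightarrow> ((\<lambda>n. (norm (emb len (F n) - emb len f))\<^sup>2) \<longlonglongrightarrow> 0)"
    by (rule tendsto_ennreal_iff) auto
  also have "\<dots> \<longleftrightarrow> ((\<lambda>n. norm (emb len (F n) - emb len f)) \<longlonglongrightarrow> 0)"
  proof
    assume "(\<lambda>n. (norm (emb len (F n) - emb len f))\<^sup>2) \<longlonglongrightarrow> 0"
    from tendsto_real_sqrt[OF this] show "(\<lambda>n. norm (emb len (F n) - emb len f)) \<longlonglongrightarrow> 0" by simp
  next
    assume "(\<lambda>n. norm (emb len (F n) - emb len f)) \<longlonglongrightarrow> 0"
    from tendsto_power[OF this, of 2] show "(\<lambda>n. (norm (emb len (F n) - emb len f))\<^sup>2) \<longlonglongrightarrow> 0" by simp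
  qed
  also have "\<dots> \<longleftrightarrow> ((\<lambda>n. emb len (F n)) \<longlonglongrightarrow> emb len f)"
    by (simp add: tendsto_norm_zero_iff LIM_zero_iff)
  finally show ?thesis .
qed

lemma H0_L2G: "(f, g) \<in> H0 src tgt len \<Longrightarrow> f \<in> L2G len \<and> g \<in> L2G len"
  by (auto simp: H0_def)

lemma H0_iff_Laplacian:
  assumes f: "f \<in> L2G len" and g: "g \<in> L2G len"
  shows "(f, g) \<in> H0 src tgt len \<longleftrightarrow> (emb len f, emb len g) \<in> Laplacian"
proof
  assume "(f, g) \<in> H0 src tgt len"
  then obtain F G where FG: "\<And>n. (F n, G n) \<in> H0min src tgt len"
    "(\<lambda>n. gnorm2 len (F n - f)) \<longlonglongrightarrow> 0" "(\<lambda>n. gnorm2 len (G n - g)) \<longlonglongrightarrow> 0"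
    by (auto simp: H0_def)
  have F: "F n \<in> L2G len" for n using FG(1)[of n] by (auto simp: H0min_iff intro: admissible_L2G)
  have Gm: "edge_measurable len (G n)" for n
  proof -
    obtain u1 u2 where u: "admissible (F n) u1 u2" "G n = (\<lambda>e x. - u2 e x)" using FG(1)[of n] by (auto simp: H0min_iff)
    have "(\<lambda>x. - (indicator {0<..<len e} x *\<^sub>R u2 e x)) \<in> borel_measurable lborel" for e
      using set_integrable_open_measurable[OF primitive_onD(1)[OF admissibleD(2)[OF u(1)]], of e] by measurable
    then show ?thesis by (simp add: edge_measurable_def u(2))
  qed
  have "\<forall>\<^sub>F n in sequentially. gnorm2 len (G n - g) < \<infinity>"
    using FG(3) by (rule order_tendstoD) simp
  then obtain N where N: "\<And>n. n \<ge> N \<Longrightarrow> gnorm2 len (G n - g) < \<infinity>" by (auto simp: eventually_sequentially)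
  have G: "G (n + N) \<in> L2G len" for n
  proof -
    have d: "G (n + N) - g \<in> L2G len"
      using edge_measurable_diff[OF len_pos Gm L2G_edge_measurable[OF len_pos g]] N[of "n + N"]
      by (simp add: L2G_def edge_measurable_def)
    have "G (n + N) = (\<lambda>e x. (G (n + N) - g) e x + 1 * g e x)" by (auto simp: fun_eq_iff)
    then show ?thesis using emb_combine(1)[OF d g, of 1] by simp
  qed
  have "(\<lambda>n. emb len (F (n + N))) \<longlonglongrightarrow> emb len f"
    using LIMSEQ_ignore_initial_segment[OF FG(2), of N] by (subst (asm) gnorm2_tendsto_iff) (use F f in auto)
  moreover have "(\<lambda>n. emb len (G (n + N))) \<longlonglongrightarrow> emb len g"
    using LIMSEQ_ignore_initial_segment[OF FG(3), of N] by (subst (asm) gnorm2_tendsto_iff) (use G g in auto)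
  ultimately have "(\<lambda>n. (emb len (F (n + N)), emb len (G (n + N)))) \<longlonglongrightarrow> (emb len f, emb len g)"
    by (rule tendsto_Pair)
  moreover have "(emb len (F (n + N)), emb len (G (n + N))) \<in> core" for n
  proof -
    obtain u1 u2 where "admissible (F (n + N)) u1 u2" "G (n + N) = (\<lambda>e x. - u2 e x)"
      using FG(1)[of "n + N"] by (auto simp: H0min_iff)
    then show ?thesis using G[of n] unfolding core_def by auto
  qed
  ultimately show "(emb len f, emb len g) \<in> Laplacian"
    unfolding Laplacian_def closure_sequential
    by (intro exI[of _ "\<lambda>n. (emb len (F (n + N)), emb len (G (n + N)))"]) simp
next
  assume "(emb len f, emb len g) \<in> Laplacian"
  then obtain p where p: "\<And>n. p n \<in> core" "p \<longlonglongrightarrow> (emb len f, emb len g)"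
    using closure_sequential unfolding Laplacian_def by blast
  have "\<forall>n. \<exists>q. q \<in> H0min src tgt len \<and> fst q \<in> L2G len \<and> snd q \<in> L2G len \<and> p n = (emb len (fst q), emb len (snd q))"
  proof
    fix n
    obtain F u1 u2 where "admissible F u1 u2" "(\<lambda>e x. - u2 e x) \<in> L2G len" "p n = (emb len F, emb len (\<lambda>e x. - u2 e x))"
      using p(1)[of n] by (auto simp: core_def)
    then show "\<exists>q. q \<in> H0min src tgt len \<and> fst q \<in> L2G len \<and> snd q \<in> L2G len \<and> p n = (emb len (fst q), emb len (snd q))"
      using admissible_L2G by (intro exI[of _ "(F, \<lambda>e x. - u2 e x)"]) (auto simp: H0min_iff)
  qed
  then obtain q where q: "\<And>n. q n \<in> H0min src tgt len" "\<And>n. fst (q n) \<in> L2G len" "\<And>n. snd (q n) \<in> L2G len"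
    "\<And>n. p n = (emb len (fst (q n)), emb len (snd (q n)))"
    using choice[of "\<lambda>n q. q \<in> H0min src tgt len \<and> fst q \<in> L2G len \<and> snd q \<in> L2G len \<and> p n = (emb len (fst q), emb len (snd q))"] by blast
  have "(\<lambda>n. gnorm2 len (fst (q n) - f)) \<longlonglongrightarrow> 0"
    using tendsto_fst[OF p(2)] by (subst gnorm2_tendsto_iff) (use q f in auto)
  moreover have "(\<lambda>n. gnorm2 len (snd (q n) - g)) \<longlonglongrightarrow> 0"
    using tendsto_snd[OF p(2)] by (subst gnorm2_tendsto_iff) (use q g in auto)
  moreover have "(fst (q n), snd (q n)) \<in> H0min src tgt len" for n using q(1) by simp
  ultimately show "(f, g) \<in> H0 src tgt len"
    unfolding H0_def mem_Collect_eq split_conv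
    by (intro conjI f g exI[of _ "\<lambda>n. fst (q n)"] exI[of _ "\<lambda>n. snd (q n)"]) auto
qed

end

context complete_metric_graph
begin

lemma op_cm: "op.cm z x = cmult z x" by (simp add: op.cm_def cmult_def)

lemma gnorm2_shift:
  assumes "f \<in> L2G len" "g \<in> L2G len"
  shows "gnorm2 len (g - gscale z f) = ennreal ((norm (emb len g - op.cm z (emb len f)))\<^sup>2)"
  using assms by (simp add: gnorm2_emb len_pos L2G_diff L2G_gscale emb_diff emb_gscale op_cm)

lemma resolvent_set_iff: "z \<in> resolvent_set len (H0 src tgt len) \<longleftrightarrow> op.res z"
proof
  assume z: "z \<in> resolvent_set len (H0 src tgt len)"
  then obtain C :: real where C: "\<forall>(f, g)\<in>H0 src tgt len. gnorm2 len f \<le> ennreal C * gnorm2 len (g - gscale z f)"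
    by (auto simp: resolvent_set_def)
  \<comment> \<open>A negative constant is read as 0 by \<open>ennreal\<close>, so the real estimate
    holds with \<open>max 0 C\<close>.\<close>
  have "(norm x)\<^sup>2 \<le> max 0 C * (norm (y - op.cm z x))\<^sup>2" if xy: "(x, y) \<in> Laplacian" for x y
  proof -
    obtain f where f: "f \<in> L2G len" "emb len f = x" by (rule emb_obtain)
    obtain g where g: "g \<in> L2G len" "emb len g = y" by (rule emb_obtain)
    have "(f, g) \<in> H0 src tgt len" using H0_iff_Laplacian[OF f(1) g(1)] f(2) g(2) xy by simp
    then have "gnorm2 len f \<le> ennreal C * gnorm2 len (g - gscale z f)" using C by blast
    then have "ennreal ((norm x)\<^sup>2) \<le> ennreal C * ennreal ((norm (y - op.cm z x))\<^sup>2)"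
      unfolding gnorm2_emb[OF len_pos f(1)] gnorm2_shift[OF f(1) g(1)] f(2) g(2) .
    also have "ennreal C = ennreal (max 0 C)" by (simp add: max_def ennreal_neg)
    also have "ennreal (max 0 C) * ennreal ((norm (y - op.cm z x))\<^sup>2) = ennreal (max 0 C * (norm (y - op.cm z x))\<^sup>2)"
      by (simp add: ennreal_mult)
    finally show ?thesis by (subst (asm) ennreal_le_iff) auto
  qed
  then have "op.below z" unfolding op.below_def by blast
  moreover have "\<exists>(x, y)\<in>Laplacian. y - op.cm z x = w" for w
  proof -
    obtain h where h: "h \<in> L2G len" "emb len h = w" by (rule emb_obtain)
    obtain f g where fg: "(f, g) \<in> H0 src tgt len" "gnorm2 len (g - gscale z f - h) = 0"
      using z h(1) by (auto simp: resolvent_set_def)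
    have L: "f \<in> L2G len" "g \<in> L2G len" using H0_L2G[OF fg(1)] by auto
    have "ennreal ((norm (emb len g - op.cm z (emb len f) - w))\<^sup>2) = 0"
      using fg(2) L h by (simp add: gnorm2_emb len_pos L2G_diff L2G_gscale emb_diff emb_gscale op_cm)
    then have "emb len g - op.cm z (emb len f) = w" by simp
    then show ?thesis using fg(1) H0_iff_Laplacian[OF L] by (intro bexI[of _ "(emb len f, emb len g)"]) auto
  qed
  ultimately show "op.res z" unfolding op.res_def by blast
next
  assume r: "op.res z"
  then obtain C where C: "\<And>x y. (x, y) \<in> Laplacian \<Longrightarrow> (norm x)\<^sup>2 \<le> C * (norm (y - op.cm z x))\<^sup>2"
    unfolding op.res_def op.below_def by blast
  have "gnorm2 len f \<le> ennreal (max 0 C) * gnorm2 len (g - gscale z f)" if fg: "(f, g) \<in> H0 src tgt len" for f g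
  proof -
    have L: "f \<in> L2G len" "g \<in> L2G len" using H0_L2G[OF fg] by auto
    have "(norm (emb len f))\<^sup>2 \<le> C * (norm (emb len g - op.cm z (emb len f)))\<^sup>2"
      using C fg H0_iff_Laplacian[OF L] by blast
    also have "\<dots> \<le> max 0 C * (norm (emb len g - op.cm z (emb len f)))\<^sup>2" by (intro mult_right_mono) auto
    finally show ?thesis
      unfolding gnorm2_shift[OF L] gnorm2_emb[OF len_pos L(1)]
      by (subst ennreal_mult[symmetric]) (auto intro: ennreal_leI)
  qed
  moreover have "\<exists>(f, g)\<in>H0 src tgt len. gnorm2 len (g - gscale z f - h) = 0" if h: "h \<in> L2G len" for h
  proof -
    obtain x y where xy: "(x, y) \<in> Laplacian" "y - op.cm z x = emb len h" using r unfolding op.res_def by blast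
    obtain f where f: "f \<in> L2G len" "emb len f = x" by (rule emb_obtain)
    obtain g where g: "g \<in> L2G len" "emb len g = y" by (rule emb_obtain)
    have "(f, g) \<in> H0 src tgt len" using H0_iff_Laplacian[OF f(1) g(1)] f(2) g(2) xy by simp
    moreover have "gnorm2 len (g - gscale z f - h) = 0"
      using xy(2) f g h by (simp add: gnorm2_emb len_pos L2G_diff L2G_gscale emb_diff emb_gscale op_cm)
    ultimately show ?thesis by blast
  qed
  ultimately show "z \<in> resolvent_set len (H0 src tgt len)" unfolding resolvent_set_def by blast
qed

lemma spectrum_iff: "z \<in> spectrum_op len (H0 src tgt len) \<longleftrightarrow> \<not> op.res z"
  by (simp add: spectrum_op_def resolvent_set_iff)

lemma spectrum_nonneg:
  assumes "z \<in> spectrum_op len (H0 src tgt len)"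
  shows "Im z = 0" "0 \<le> Re z"
  using assms op.res_off_halfline[of z] by (auto simp: spectrum_iff not_less[symmetric])

lemma Inf_Re_spectrum:
  assumes "S \<subseteq> spectrum_op len (H0 src tgt len)" "0 \<in> S"
  shows "Inf (Re ` S) = 0"
  by (rule cInf_eq_minimum) (use assms spectrum_nonneg(2) in \<open>force+\<close>)

end

section \<open>Zero as a spectral point: test functions and the kernel\<close>

section \<open>Test functions of small energy\<close>

lemma LBINT_const: "0 \<le> l \<Longrightarrow> (LBINT x:{0..l}. (c::real)) = l * c"
  by (simp add: set_lebesgue_integral_def)

text \<open>With zero end slopes the derivative is 6 (a1 - a0) (t - t^2) / l, and t - t^2 \<le> 1/4.
  The factor 3/2 over linear interpolation is the price of flat ends.\<close>

lemma hermite1_bound: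
  assumes l: "0 < l" and x: "x \<in> {0..l}" and d: "cmod (a1 - a0) \<le> l / T" and T: "T > 0"
  shows "(cmod (hermite1 l a0 a1 0 0 x))\<^sup>2 \<le> 9 / (4 * T\<^sup>2)"
proof -
  define t where "t = x / l"
  have t: "0 \<le> t" "t \<le> 1" using l x by (auto simp: t_def)
  have xt: "x = t * l" using l by (simp add: t_def)
  have "hermite1 l a0 a1 0 0 x = (a1 - a0) * of_real (6 * (t - t\<^sup>2) / l)"
    using l by (simp add: hermite1_def hermite_c_def hermite_d_def xt field_simps power2_eq_square power3_eq_cube)
  then have "cmod (hermite1 l a0 a1 0 0 x) = cmod (a1 - a0) * \<bar>6 * (t - t\<^sup>2) / l\<bar>"
    by (simp only: norm_mult norm_of_real)
  also have "\<dots> = cmod (a1 - a0) * (6 * \<bar>t - t\<^sup>2\<bar> / l)" using l by (simp only: abs_mult abs_divide)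
  also have "\<dots> \<le> (l / T) * (6 * (1 / 4) / l)"
  proof (intro mult_mono divide_right_mono d)
    have "0 \<le> t - t\<^sup>2" using t by (simp add: power2_eq_square mult_left_le)
    moreover have "0 \<le> (t - 1/2)\<^sup>2" by simp
    ultimately show "\<bar>t - t\<^sup>2\<bar> \<le> 1 / 4" by (simp add: power2_eq_square algebra_simps)
  qed (use l T in auto)
  also have "\<dots> = 3 / (2 * T)" using l T by simp
  finally have "(cmod (hermite1 l a0 a1 0 0 x))\<^sup>2 \<le> (3 / (2 * T))\<^sup>2" by (rule power_mono) simp
  then show ?thesis by (simp add: power_divide power_mult_distrib)
qed

context complete_metric_graph
begin

text \<open>Cubics that are flat at the vertices satisfy the Kirchhoff condition trivially and equal
  1 on the plateau. The slope bound 9/(4 T^2) times the volume ratio 4 A gives 9 A / T^2.\<close>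

lemma test_function:
  assumes \<phi>: "test_profile \<phi> T A" and T: "T > 0" and A: "A > 0"
  obtains f u1 u2 where "admissible f u1 u2" "(\<lambda>e x. - u2 e x) \<in> L2G len" "emb len f \<noteq> 0"
    "\<And>e x. e \<notin> touching {v. \<phi> v \<noteq> 0} \<Longrightarrow> f e x = 0 \<and> u1 e x = 0 \<and> u2 e x = 0"
    "emb len f \<bullet> emb len (\<lambda>e x. - u2 e x) \<le> 9 * A / T\<^sup>2 * (norm (emb len f))\<^sup>2"
proof -
  let ?E = "touching {v. \<phi> v \<noteq> 0}"
  define I where "I = {e \<in> ?E. \<phi> (src e) = 1 \<and> \<phi> (tgt e) = 1}"
  have E: "finite ?E" and dif: "\<And>e. \<bar>\<phi> (src e) - \<phi> (tgt e)\<bar> \<le> len e / T"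
    and I: "0 < (\<Sum>e\<in>I. len e)" "(\<Sum>e\<in>?E. len e) \<le> 4 * A * (\<Sum>e\<in>I. len e)"
    using \<phi> finite_touching unfolding test_profile_def I_def by blast+
  define a0 where "a0 e = complex_of_real (\<phi> (src e))" for e
  define a1 where "a1 e = complex_of_real (\<phi> (tgt e))" for e
  define f where "f e = hermite (len e) (a0 e) (a1 e) 0 0" for e
  define u1 where "u1 e = hermite1 (len e) (a0 e) (a1 e) 0 0" for e
  define u2 where "u2 e = hermite2 (len e) (a0 e) (a1 e) 0 0" for e
  have off: "a0 e = 0" "a1 e = 0" if "e \<notin> ?E" for e using that by (auto simp: touching_def a0_def a1_def)
  have supp: "f e x = 0 \<and> u1 e x = 0 \<and> u2 e x = 0" if "e \<notin> ?E" for e x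
    using off[OF that] by (simp add: f_def u1_def u2_def)
  have adm: "admissible f u1 u2"
    unfolding f_def[abs_def] u1_def[abs_def] u2_def[abs_def]
    by (rule admissible_hermite[OF E, of a0 a1 _ _ "\<lambda>v. complex_of_real (\<phi> v)"])
       (use off in \<open>auto simp: a0_def a1_def intro!: sum.neutral\<close>)
  have u2c: "continuous_on {0..len e} (u2 e)" for e
    unfolding u2_def by (rule primitive_on_continuous[OF hermite_primitive(3)])
  have L2: "(\<lambda>e x. - u2 e x) \<in> L2G len"
    by (rule L2G_continuous[OF E]) (use supp u2c in \<open>auto intro: continuous_intros\<close>)
  note fL = admissible_L2G[OF adm]
  have "(\<Sum>e\<in>I. len e) = (\<Sum>e\<in>I. LBINT x:{0..len e}. (cmod (f e x))\<^sup>2)"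
  proof (rule sum.cong[OF refl])
    fix e assume "e \<in> I"
    then have "f e x = 1" for x by (simp add: I_def f_def a0_def a1_def)
    then show "len e = (LBINT x:{0..len e}. (cmod (f e x))\<^sup>2)" using len_nonneg[of e] by (simp add: LBINT_const)
  qed
  also have "\<dots> \<le> (norm (emb len f))\<^sup>2"
    by (rule edge_sum_le[OF fL]) (use E in \<open>auto simp: I_def\<close>)
  finally have lower: "(\<Sum>e\<in>I. len e) \<le> (norm (emb len f))\<^sup>2" .
  have "emb len (\<lambda>e x. - u2 e x) \<bullet> emb len f = (\<Sum>e\<in>?E. LBINT x:{0..len e}. u1 e x \<bullet> u1 e x)"
    by (rule energy_identity[OF adm L2 E _ admissibleD(1,4)[OF adm] fL]) (use supp in auto)
  also have "\<dots> \<le> (\<Sum>e\<in>?E. LBINT x:{0..len e}. 9 / (4 * T\<^sup>2))"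
  proof (intro sum_mono set_integral_mono)
    fix e
    have "continuous_on {0..len e} (u1 e)" by (rule primitive_on_continuous[OF admissibleD(2)[OF adm]])
    then show "set_integrable lborel {0..len e} (\<lambda>x. u1 e x \<bullet> u1 e x)"
      by (intro borel_integrable_atLeastAtMost' continuous_intros)
    show "set_integrable lborel {0..len e} (\<lambda>x. 9 / (4 * T\<^sup>2))"
      by (intro borel_integrable_atLeastAtMost' continuous_intros)
    fix x assume "x \<in> {0..len e}"
    moreover have "cmod (a1 e - a0 e) \<le> len e / T"
      using dif[of e] unfolding a0_def a1_def of_real_diff[symmetric] norm_of_real by (simp add: abs_minus_commute)
    ultimately show "u1 e x \<bullet> u1 e x \<le> 9 / (4 * T\<^sup>2)"
      unfolding u1_def power2_norm_eq_inner[symmetric] by (intro hermite1_bound len_pos T)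
  qed
  also have "\<dots> = 9 / (4 * T\<^sup>2) * (\<Sum>e\<in>?E. len e)"
    by (simp only: LBINT_const[OF len_nonneg] sum_distrib_right[symmetric] mult.commute)
  also have "\<dots> \<le> 9 / (4 * T\<^sup>2) * (4 * A * (\<Sum>e\<in>I. len e))" by (rule mult_left_mono[OF I(2)]) simp
  also have "\<dots> = 9 * A / T\<^sup>2 * (\<Sum>e\<in>I. len e)" by simp
  also have "\<dots> \<le> 9 * A / T\<^sup>2 * (norm (emb len f))\<^sup>2" by (rule mult_left_mono[OF lower]) (use A in simp)
  finally have en: "emb len f \<bullet> emb len (\<lambda>e x. - u2 e x) \<le> 9 * A / T\<^sup>2 * (norm (emb len f))\<^sup>2" by (simp add: inner_commute)
  have "emb len f \<noteq> 0" using lower I(1) by auto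
  then show thesis by (rule that[OF adm L2 _ supp en])
qed

lemma zero_in_spectrum:
  assumes A: "A > 0" and \<phi>: "\<And>T. T > 0 \<Longrightarrow> \<exists>\<phi>. test_profile \<phi> T A"
  shows "0 \<in> spectrum_op len (H0 src tgt len)"
proof (rule ccontr)
  assume "\<not> ?thesis"
  then have "op.res 0" by (simp add: spectrum_iff)
  then obtain C where C: "C > 0" "\<And>x y. (x, y) \<in> Laplacian \<Longrightarrow> (norm x)\<^sup>2 \<le> C * (x \<bullet> y)"
    using op.res_zero_form_bound by blast
  \<comment> \<open>Chosen so that the Rayleigh quotient 9 A / T^2 is 1/(2C), half the lower bound
    that invertibility would impose.\<close>
  define T where "T = sqrt (18 * A * C)"
  have T: "T > 0" "T\<^sup>2 = 18 * A * C" using A C by (simp_all add: T_def)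
  obtain \<phi> where "test_profile \<phi> T A" using \<phi>[OF T(1)] by blast
  then obtain f u1 u2 where f: "admissible f u1 u2" "(\<lambda>e x. - u2 e x) \<in> L2G len" "emb len f \<noteq> 0"
    "emb len f \<bullet> emb len (\<lambda>e x. - u2 e x) \<le> 9 * A / T\<^sup>2 * (norm (emb len f))\<^sup>2"
    by (rule test_function[OF _ T(1) A]) blast
  have "(emb len f, emb len (\<lambda>e x. - u2 e x)) \<in> Laplacian"
    using f core_subset_Laplacian unfolding core_def by blast
  then have "(norm (emb len f))\<^sup>2 \<le> C * (emb len f \<bullet> emb len (\<lambda>e x. - u2 e x))" by (rule C(2))
  also have "\<dots> \<le> C * (9 * A / T\<^sup>2 * (norm (emb len f))\<^sup>2)" by (rule mult_left_mono[OF f(4)]) (use C in simp)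
  also have "\<dots> = (norm (emb len f))\<^sup>2 / 2" using A C T(2) by (simp add: field_simps)
  finally show False using f(3) by simp
qed

text \<open>A zero exponent lies below ln 2 / (2 (l + T)) for every \<open>T\<close>, so the single
  value \<open>A = 2\<close> serves all slopes. The step is l + T because the profile extends that
  far beyond the ball.\<close>

lemma slow_growth_zero_in_spectrum:
  assumes "mu_unif src tgt len = 0 \<or> mu_exp src tgt len v = 0"
  shows "0 \<in> spectrum_op len (H0 src tgt len)"
proof (rule zero_in_spectrum)
  obtain l where l: "l > 0" "\<And>e. len e \<le> l" using len_bound by blast
  fix T :: real assume T: "T > 0"
  have lT: "l + T > 0" using l T by simp
  have "ereal (ln 2 / (2 * (l + T))) > 0" using lT by simp
  then have "mu_unif src tgt len < ereal (ln 2 / (2 * (l + T))) \<or> mu_exp src tgt len v < ereal (ln 2 / (2 * (l + T)))"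
    using assms by metis
  then have "\<exists>v s. s \<ge> 0 \<and> M (s + (l + T)) v \<le> 2 * M s v"
  proof
    assume "mu_unif src tgt len < ereal (ln 2 / (2 * (l + T)))"
    from slow_growth_uniform[OF this lT] obtain v s where "1 \<le> s" "M (s + (l + T)) v \<le> 2 * M s v" by auto
    then show ?thesis by (intro exI[of _ v] exI[of _ s]) auto
  next
    assume "mu_exp src tgt len v < ereal (ln 2 / (2 * (l + T)))"
    from slow_growth[OF this lT, of 0] show ?thesis by auto
  qed
  then show "\<exists>\<phi>. test_profile \<phi> T 2" using test_profile_of_slow_growth[OF T _ l(2)] by auto
qed simp

lemma eigen_weak_solution:
  assumes "h \<in> L2G len" "(emb len h, lam *\<^sub>R emb len h) \<in> Laplacian"
  shows "weak_solution (- lam) {} h"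
proof (rule weak_solution_of_orthogonal[OF assms(1)])
  fix f g assume "(f, g) \<in> core"
  then have "(f, g) \<in> Laplacian" using core_subset_Laplacian by blast
  from Laplacian_sym[OF this assms(2)] show "(g + - lam *\<^sub>R f) \<bullet> emb len h = 0"
    by (simp add: inner_diff_left)
qed

lemma weak_solution_classical_family:
  assumes "weak_solution \<kappa> E0 h"
  shows "\<exists>h0 h1. \<forall>e. e \<notin> E0 \<longrightarrow> classical_on \<kappa> (len e) (h e) (h0 e) (h1 e)"
proof -
  have "\<forall>e. \<exists>h0 h1. e \<notin> E0 \<longrightarrow> classical_on \<kappa> (len e) (h e) h0 h1" using weak_solution_classical[OF assms] by blast
  then show ?thesis by metis
qed

text \<open>The values of \<open>c\<close> may be of any type: it is applied to vertex values and
  also to the predicate that a vertex value vanishes.\<close>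

lemma constant_on_walk:
  assumes "\<And>e. c (src e) = c (tgt e)" and "walk u v L"
  shows "c u = c v"
  using assms(2)
proof (induction rule: walk_len.induct)
  case (walk_step e u w v L)
  then consider "src e = u" "tgt e = w" | "src e = w" "tgt e = u" by (auto simp: doubleton_eq_iff)
  then have "c u = c w" using assms(1)[of e] by cases auto
  then show ?case using walk_step.IH by simp
qed simp

lemma kernel_trivial:
  assumes vol: "(\<Sum>\<^sub>\<infinity>v. ennreal (mv src tgt len v)) = \<infinity>" and x: "(x, 0) \<in> Laplacian"
  shows "x = 0"
proof -
  obtain h where h: "h \<in> L2G len" "emb len h = x" by (rule emb_obtain)
  have w: "weak_solution 0 {} h" using eigen_weak_solution[OF h(1), of 0] x h(2) by simp
  obtain h0 h1 where "\<forall>e. e \<notin> {} \<longrightarrow> classical_on 0 (len e) (h e) (h0 e) (h1 e)"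
    using weak_solution_classical_family[OF w] by blast
  then have cl: "\<And>e. classical_on 0 (len e) (h e) (h0 e) (h1 e)" by simp
  have h1: "h1 e x = 0" if x: "x \<in> {0..len e}" for e x
  proof -
    define k where "k = h1 e 0"
    \<comment> \<open>For \<kappa> = 0 the derivative is constant on the edge, so the vanishing of
      its energy integral is the vanishing of this constant, with no almost-everywhere
      exception.\<close>
    have c: "h1 e y = k" if "y \<in> {0..len e}" for y
      unfolding k_def using primitive_onD(2)[OF classical_onD(2)[OF cl] that] by simp
    have "0 = (LBINT x:{0..len e}. (cmod (h1 e x))\<^sup>2 + 0 * (cmod (h0 e x))\<^sup>2)"
      using weak_solution_energy_zero[OF w cl _ edge_sum_le[OF h(1)], of e] by simp
    also have "\<dots> = (LBINT x:{0..len e}. (cmod k)\<^sup>2)"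
      by (rule set_lebesgue_integral_cong) (use c in auto)
    finally have "k = 0" using len_pos[of e] by (simp add: LBINT_const)
    then show ?thesis using c[OF x] by simp
  qed
  have h0: "h0 e x = h0 e 0" if x: "x \<in> {0..len e}" for e x
  proof -
    have "(LBINT t:{0..x}. h1 e t) = (LBINT t:{0..x}. 0)"
      by (rule set_lebesgue_integral_cong) (use x h1 in auto)
    then show ?thesis using primitive_onD(2)[OF classical_onD(1)[OF cl] x] by simp
  qed
  have "\<exists>c. \<forall>e. h0 e 0 = c (src e) \<and> h0 e (len e) = c (tgt e)"
    by (rule vertex_values[OF weak_solution_continuous[OF w cl]]) blast
  then obtain c where "\<forall>e. h0 e 0 = c (src e) \<and> h0 e (len e) = c (tgt e)" by blast
  then have c: "h0 e 0 = c (src e)" "h0 e (len e) = c (tgt e)" for e by simp_all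
  have "h0 e (len e) = h0 e 0" for e by (rule h0) (simp add: len_nonneg)
  then have "c (src e) = c (tgt e)" for e unfolding c by (rule sym)
  note cw = constant_on_walk[of c, OF this]
  \<comment> \<open>An arbitrary base vertex, taken as the source of an arbitrary edge.\<close>
  define a where "a = src undefined"
  have ca: "c u = c a" for u
    by (rule exE[OF connected[of u a]]) (rule cw)
  have h0a: "h0 e x = c a" if x: "x \<in> {0..len e}" for e x
    unfolding h0[OF x] c(1) by (rule ca)
  have edge: "(LBINT x:{0..len e}. (cmod (h e x))\<^sup>2) = len e * (cmod (c a))\<^sup>2" for e
  proof -
    have "(LBINT x:{0..len e}. (cmod (h e x))\<^sup>2) = (LBINT x:{0..len e}. (cmod (h0 e x))\<^sup>2)"
      by (rule integral_square_cong[where h = h, OF cl L2G_edge(2)[OF h(1)]])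
    also have "\<dots> = (LBINT x:{0..len e}. (cmod (c a))\<^sup>2)" by (rule set_lebesgue_integral_cong) (use h0a in auto)
    finally show ?thesis by (simp add: LBINT_const len_nonneg)
  qed
  have "c a = 0"
  proof (rule ccontr)
    assume "c a \<noteq> 0"
    define N where "N = (norm (emb len h))\<^sup>2 / (cmod (c a))\<^sup>2"
    obtain s where s: "2 * N + 1 \<le> M s a" using infinite_volume[OF vol, of "2 * N + 1" a] by blast
    let ?E = "touching (ball0 src tgt len s a)"
    have "(\<Sum>e\<in>?E. len e) * (cmod (c a))\<^sup>2 \<le> (norm (emb len h))\<^sup>2"
      using edge_sum_le[OF h(1) finite_touching[OF finite_ball0]] by (simp add: edge sum_distrib_right)
    then have "(\<Sum>e\<in>?E. len e) \<le> N" using \<open>c a \<noteq> 0\<close> by (simp add: N_def pos_le_divide_eq)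
    moreover have "M s a \<le> 2 * (\<Sum>e\<in>?E. len e)" unfolding mball_def by (rule volume_touching(1)[OF finite_ball0])
    ultimately show False using s by simp
  qed
  then have "emb len h = 0" by (intro emb_eq_zero[OF h(1)]) (simp add: edge)
  then show ?thesis using h(2) by simp
qed

lemma zero_not_eigenvalue:
  assumes vol: "(\<Sum>\<^sub>\<infinity>v. ennreal (mv src tgt len v)) = \<infinity>"
  shows "\<not> is_eigenvalue len (H0 src tgt len) 0"
proof
  assume "is_eigenvalue len (H0 src tgt len) 0"
  then obtain f g where fg: "(f, g) \<in> H0 src tgt len" "gnorm2 len (g - gscale 0 f) = 0" "gnorm2 len f \<noteq> 0"
    by (auto simp: is_eigenvalue_def)
  have L: "f \<in> L2G len" "g \<in> L2G len" using H0_L2G[OF fg(1)] by auto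
  have "emb len g = 0" using fg(2) unfolding gnorm2_shift[OF L] by (simp add: op.cm_def)
  then have "(emb len f, 0) \<in> Laplacian" using fg(1) H0_iff_Laplacian[OF L] by simp
  then have "emb len f = 0" by (rule kernel_trivial[OF vol])
  then show False using fg(3) gnorm2_emb[OF len_pos L(1)] by simp
qed

end

section \<open>Finite growth exponent: an eigenvalue of infinite multiplicity and its
  exclusion\<close>

section \<open>Existence of infinitely many eigenfunctions\<close>

text \<open>Dependent choice on pairs whose second component accumulates the finite supports used so
  far, so that a new support avoids all earlier ones and not just its predecessor.\<close>

lemma disjoint_sequence:
  fixes supp :: "'p \<Rightarrow> 'a set"
  assumes ex: "\<forall>E. finite E \<longrightarrow> (\<exists>p. P p \<and> finite (supp p) \<and> supp p \<inter> E = {})"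
  shows "\<exists>s::nat \<Rightarrow> 'p. (\<forall>n. P (s n)) \<and> (\<forall>m n. m \<noteq> n \<longrightarrow> supp (s m) \<inter> supp (s n) = {})"
proof -
  have "\<exists>x. \<forall>n. (P (fst (x n)) \<and> finite (snd (x n)) \<and> supp (fst (x n)) \<subseteq> snd (x n))
      \<and> (supp (fst (x (Suc n))) \<inter> snd (x n) = {} \<and> snd (x n) \<subseteq> snd (x (Suc n)))"
  proof (rule dependent_nat_choice[where P = "\<lambda>n x. P (fst x) \<and> finite (snd x) \<and> supp (fst x) \<subseteq> snd x"
        and Q = "\<lambda>n x y. supp (fst y) \<inter> snd x = {} \<and> snd x \<subseteq> snd y"])
    obtain p where "P p" "finite (supp p)" using ex[rule_format, of "{}"] by auto
    then show "\<exists>x. P (fst x) \<and> finite (snd x) \<and> supp (fst x) \<subseteq> snd x" by (intro exI[of _ "(p, supp p)"]) simp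
    fix x :: "'p \<times> 'a set" and n :: nat
    assume x: "P (fst x) \<and> finite (snd x) \<and> supp (fst x) \<subseteq> snd x"
    then obtain p where "P p" "finite (supp p)" "supp p \<inter> snd x = {}" using ex[rule_format, of "snd x"] by auto
    then show "\<exists>y. (P (fst y) \<and> finite (snd y) \<and> supp (fst y) \<subseteq> snd y) \<and> supp (fst y) \<inter> snd x = {} \<and> snd x \<subseteq> snd y"
      using x by (intro exI[of _ "(p, supp p \<union> snd x)"]) auto
  qed
  then obtain x where x: "\<forall>n. (P (fst (x n)) \<and> finite (snd (x n)) \<and> supp (fst (x n)) \<subseteq> snd (x n))
      \<and> (supp (fst (x (Suc n))) \<inter> snd (x n) = {} \<and> snd (x n) \<subseteq> snd (x (Suc n)))" by blast
  have mono: "snd (x m) \<subseteq> snd (x n)" if "m \<le> n" for m n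
    by (rule lift_Suc_mono_le[of "\<lambda>n. snd (x n)", OF _ that]) (use x in blast)
  have dis: "supp (fst (x m)) \<inter> supp (fst (x n)) = {}" if "m < n" for m n
  proof -
    obtain k where k: "n = Suc k" "m \<le> k" using \<open>m < n\<close> by (cases n) auto
    have "supp (fst (x m)) \<subseteq> snd (x m)" "supp (fst (x (Suc k))) \<inter> snd (x k) = {}" using x by blast+
    then show ?thesis using mono[OF k(2)] k(1) by blast
  qed
  show ?thesis
  proof (intro exI[of _ "\<lambda>n. fst (x n)"] conjI allI impI)
    show "P (fst (x n))" for n using x by blast
    show "supp (fst (x m)) \<inter> supp (fst (x n)) = {}" if "m \<noteq> n" for m n
      using dis[of m n] dis[of n m] that by (cases m n rule: linorder_cases) auto
  qed
qed

lemma inner_sum_orthogonal: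
  fixes e f :: "nat \<Rightarrow> 'h::real_inner"
  assumes "\<And>i j. i \<noteq> j \<Longrightarrow> e i \<bullet> f j = 0"
  shows "(\<Sum>i<n. a i *\<^sub>R e i) \<bullet> (\<Sum>i<n. a i *\<^sub>R f i) = (\<Sum>i<n. (a i)\<^sup>2 * (e i \<bullet> f i))"
proof -
  have "(\<Sum>i<n. a i *\<^sub>R e i) \<bullet> (\<Sum>i<n. a i *\<^sub>R f i) = (\<Sum>i<n. \<Sum>j<n. a i * a j * (e i \<bullet> f j))"
    unfolding inner_sum_left by (simp add: inner_sum_right sum_distrib_left mult_ac)
  also have "\<dots> = (\<Sum>i<n. (a i)\<^sup>2 * (e i \<bullet> f i))"
  proof (rule sum.cong[OF refl])
    fix i assume i: "i \<in> {..<n}"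
    have "(\<Sum>j<n. a i * a j * (e i \<bullet> f j)) = (\<Sum>j\<in>{i}. a i * a j * (e i \<bullet> f j))"
      by (rule sum.mono_neutral_right) (use i assms in auto)
    then show "(\<Sum>j<n. a i * a j * (e i \<bullet> f j)) = (a i)\<^sup>2 * (e i \<bullet> f i)" by (simp add: power2_eq_square)
  qed
  finally show ?thesis .
qed

text \<open>Both kinds of cross terms vanish, so the Rayleigh quotient of a combination is a
  weighted average of the individual ones and the bound \<open>K\<close> survives on the whole
  span.\<close>

lemma orthogonal_span_rayleigh:
  fixes e e' :: "nat \<Rightarrow> 'h::real_inner"
  assumes T: "subspace T" "\<And>n. (e n, e' n) \<in> T"
    and orth: "\<And>i j. i \<noteq> j \<Longrightarrow> e i \<bullet> e j = 0" "\<And>i j. i \<noteq> j \<Longrightarrow> e i \<bullet> e' j = 0"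
    and K: "\<And>n. e n \<bullet> e' n \<le> K * (norm (e n))\<^sup>2" and g: "g \<in> span (range e)"
  shows "\<exists>g'. (g, g') \<in> T \<and> g \<bullet> g' \<le> K * (norm g)\<^sup>2"
proof -
  obtain n a where ga: "g = (\<Sum>i<n. a i *\<^sub>R e i)" using span_range_finite_sum[OF g] by blast
  define g' where "g' = (\<Sum>i<n. a i *\<^sub>R e' i)"
  have "(\<Sum>i<n. a i *\<^sub>R (e i, e' i)) \<in> T" by (intro subspace_sum subspace_scale T)
  moreover have "(\<Sum>i<n. a i *\<^sub>R (e i, e' i)) = (g, g')" by (simp add: prod_eq_iff fst_sum snd_sum ga g'_def)
  moreover have "g \<bullet> g' \<le> K * (norm g)\<^sup>2"
  proof -
    have "g \<bullet> g' = (\<Sum>i<n. (a i)\<^sup>2 * (e i \<bullet> e' i))" unfolding ga g'_def by (rule inner_sum_orthogonal[OF orth(2)])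
    also have "\<dots> \<le> (\<Sum>i<n. (a i)\<^sup>2 * (K * (norm (e i))\<^sup>2))" by (intro sum_mono mult_left_mono K) simp
    also have "\<dots> = K * (\<Sum>i<n. (a i)\<^sup>2 * (e i \<bullet> e i))"
      by (simp add: sum_distrib_left power2_norm_eq_inner mult.left_commute)
    also have "(\<Sum>i<n. (a i)\<^sup>2 * (e i \<bullet> e i)) = (norm g)\<^sup>2"
      unfolding power2_norm_eq_inner ga by (rule inner_sum_orthogonal[OF orth(1), symmetric])
    finally show ?thesis .
  qed
  ultimately show ?thesis by auto
qed

context complete_metric_graph
begin

lemma emb_orthogonal:
  assumes "f \<in> L2G len" "g \<in> L2G len" "finite E"
    and "\<And>e x. e \<notin> E \<Longrightarrow> x \<in> {0<..<len e} \<Longrightarrow> g e x = 0" "\<And>e x. e \<in> E \<Longrightarrow> f e x = 0"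
  shows "emb len f \<bullet> emb len g = 0"
  by (subst inner_emb[OF len_pos assms(1-4)]) (simp_all add: assms(5))

text \<open>The operator is local: each image lives on the same edges as its test function, so
  disjoint supports give both orthogonality relations at once. With slope 1 the common bound is 9
  A.\<close>

lemma infinite_dim_small_energy:
  assumes mu: "mu_exp src tgt len v < \<infinity>" and vol: "(\<Sum>\<^sub>\<infinity>v. ennreal (mv src tgt len v)) = \<infinity>"
  obtains S K where "subspace S" "\<And>F. finite F \<Longrightarrow> \<not> S \<subseteq> span F" "0 \<le> K"
    "\<And>g. g \<in> S \<Longrightarrow> \<exists>g'. (g, g') \<in> Laplacian \<and> g \<bullet> g' \<le> K * (norm g)\<^sup>2"
proof -
  obtain A where A: "A > 0" "\<And>E. finite E \<Longrightarrow> \<exists>\<phi>. test_profile \<phi> 1 A \<and> touching {v. \<phi> v \<noteq> 0} \<inter> E = {}"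
    using far_test_profiles[OF mu vol] by blast
  let ?s = "\<lambda>\<phi>. touching {v. \<phi> v \<noteq> (0::real)}"
  have "\<forall>E. finite E \<longrightarrow> (\<exists>\<phi>. test_profile \<phi> 1 A \<and> finite (?s \<phi>) \<and> ?s \<phi> \<inter> E = {})"
    using A(2) finite_touching unfolding test_profile_def by blast
  from disjoint_sequence[of "\<lambda>\<phi>. test_profile \<phi> 1 A" ?s, OF this]
  obtain \<phi> :: "nat \<Rightarrow> 'v \<Rightarrow> real" where "(\<forall>n. test_profile (\<phi> n) 1 A) \<and> (\<forall>m n. m \<noteq> n \<longrightarrow> ?s (\<phi> m) \<inter> ?s (\<phi> n) = {})" ..
  note \<phi> = conjunct1[OF this] conjunct2[OF this]
  have "\<forall>n. \<exists>f G. (emb len f, emb len G) \<in> Laplacian \<and> f \<in> L2G len \<and> G \<in> L2G len \<and> emb len f \<noteq> 0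
      \<and> (\<forall>e x. e \<notin> ?s (\<phi> n) \<longrightarrow> f e x = 0 \<and> G e x = 0) \<and> emb len f \<bullet> emb len G \<le> 9 * A * (norm (emb len f))\<^sup>2"
  proof
    fix n
    obtain f u1 u2 where f: "admissible f u1 u2" "(\<lambda>e x. - u2 e x) \<in> L2G len" "emb len f \<noteq> 0"
      "\<forall>e x. e \<notin> ?s (\<phi> n) \<longrightarrow> f e x = 0 \<and> u1 e x = 0 \<and> u2 e x = 0"
      "emb len f \<bullet> emb len (\<lambda>e x. - u2 e x) \<le> 9 * A / 1\<^sup>2 * (norm (emb len f))\<^sup>2"
      by (rule test_function[OF \<phi>(1)[rule_format, of n] zero_less_one A(1)]) blast
    have "(emb len f, emb len (\<lambda>e x. - u2 e x)) \<in> Laplacian"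
      using f(1,2) core_subset_Laplacian unfolding core_def by blast
    then show "\<exists>f G. (emb len f, emb len G) \<in> Laplacian \<and> f \<in> L2G len \<and> G \<in> L2G len \<and> emb len f \<noteq> 0
      \<and> (\<forall>e x. e \<notin> ?s (\<phi> n) \<longrightarrow> f e x = 0 \<and> G e x = 0) \<and> emb len f \<bullet> emb len G \<le> 9 * A * (norm (emb len f))\<^sup>2"
      using f admissible_L2G[OF f(1)] by (intro exI[of _ f] exI[of _ "\<lambda>e x. - u2 e x"]) simp
  qed
  then obtain f G where fG: "\<forall>n. (emb len (f n), emb len (G n)) \<in> Laplacian \<and> f n \<in> L2G len \<and> G n \<in> L2G len \<and> emb len (f n) \<noteq> 0
      \<and> (\<forall>e x. e \<notin> ?s (\<phi> n) \<longrightarrow> f n e x = 0 \<and> G n e x = 0) \<and> emb len (f n) \<bullet> emb len (G n) \<le> 9 * A * (norm (emb len (f n)))\<^sup>2"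
    by metis
  have fin: "finite (?s (\<phi> n))" for n using \<phi>(1) finite_touching unfolding test_profile_def by blast
  have orth: "emb len (f i) \<bullet> emb len g = 0"
    if ij: "i \<noteq> j" and g: "g \<in> L2G len" "\<And>e x. e \<notin> ?s (\<phi> j) \<Longrightarrow> g e x = 0" for i j g
  proof (rule emb_orthogonal[OF _ g(1) fin[of j]])
    show "f i \<in> L2G len" using fG by blast
    show "g e x = 0" if "e \<notin> ?s (\<phi> j)" for e x using g(2)[OF that] .
    show "f i e x = 0" if e: "e \<in> ?s (\<phi> j)" for e x
    proof -
      have "e \<notin> ?s (\<phi> i)" using e \<phi>(2) ij by blast
      then show ?thesis using fG by blast
    qed
  qed
  have o1: "emb len (f i) \<bullet> emb len (f j) = 0" and o2: "emb len (f i) \<bullet> emb len (G j) = 0" if "i \<noteq> j" for i j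
    using fG by (auto intro!: orth[OF that])
  show thesis
  proof (rule that[of "span (range (\<lambda>n. emb len (f n)))" "9 * A"])
    show "\<not> span (range (\<lambda>n. emb len (f n))) \<subseteq> span F" if "finite F" for F
      by (rule orthonormal_sequence_infinite_dim[OF o1 _ that]) (use fG in auto)
    show "\<exists>g'. (g, g') \<in> Laplacian \<and> g \<bullet> g' \<le> 9 * A * (norm g)\<^sup>2" if g: "g \<in> span (range (\<lambda>n. emb len (f n)))" for g
      by (rule orthogonal_span_rayleigh[OF op.T_subspace _ o1 o2 _ g]) (use fG in auto)
  qed (use A in auto)
qed

lemma isolated_spectrum:
  assumes "ess_spectrum len (H0 src tgt len) = {}" and t: "\<not> op.below (complex_of_real t)"
  shows "\<exists>\<epsilon>>0. \<forall>t'::real. t' \<noteq> t \<longrightarrow> \<bar>t' - t\<bar> < \<epsilon> \<longrightarrow> op.below (complex_of_real t')"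
proof -
  let ?S = "spectrum_op len (H0 src tgt len)"
  have "complex_of_real t \<in> ?S" using t by (simp add: spectrum_iff op.res_def)
  then have "complex_of_real t \<in> disc_spectrum len (H0 src tgt len)" using assms(1) by (auto simp: ess_spectrum_def)
  then obtain \<epsilon> where \<epsilon>: "\<epsilon> > 0" "ball (complex_of_real t) \<epsilon> \<inter> ?S = {complex_of_real t}"
    by (auto simp: disc_spectrum_def)
  have "op.below (complex_of_real t')" if "t' \<noteq> t" "\<bar>t' - t\<bar> < \<epsilon>" for t'
  proof -
    have "dist (complex_of_real t) (complex_of_real t') < \<epsilon>"
      using that(2) by (simp add: dist_of_real dist_real_def abs_minus_commute)
    then have "complex_of_real t' \<in> ball (complex_of_real t) \<epsilon>" by simp
    moreover have "complex_of_real t' \<notin> {complex_of_real t}" using that(1) by simp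
    ultimately have "complex_of_real t' \<notin> ?S" using \<epsilon>(2) by blast
    then show ?thesis by (simp add: spectrum_iff op.res_def)
  qed
  then show ?thesis using \<epsilon>(1) by blast
qed

section \<open>The energy form\<close>

lemma form_fun_mono:
  assumes "form_fun E \<phi> \<phi>1" "E \<subseteq> E'" "finite E'"
  shows "form_fun E' \<phi> \<phi>1"
  using assms unfolding form_fun_def by blast

lemma energy_mono:
  assumes "finite E'" "E \<subseteq> E'" "\<And>e x. e \<in> E' - E \<Longrightarrow> x \<in> {0..len e} \<Longrightarrow> u e x = 0"
  shows "energy E' u = energy E u"
  unfolding energy_def
proof (rule sum.mono_neutral_right[OF assms(1,2)], rule ballI)
  fix e assume "e \<in> E' - E"
  then have "(LBINT x:{0..len e}. (cmod (u e x))\<^sup>2) = (LBINT x:{0..len e}. 0)"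
    by (intro set_lebesgue_integral_cong) (use assms(3) in auto)
  then show "(LBINT x:{0..len e}. (cmod (u e x))\<^sup>2) = 0" by simp
qed

lemma energy_nonneg: "0 \<le> energy E u"
  unfolding energy_def by (intro sum_nonneg set_integral_nonneg) simp

lemma form_fun_combine:
  assumes "form_fun E \<phi> \<phi>1" "form_fun E \<psi> \<psi>1"
  shows "form_fun E (\<lambda>e x. \<phi> e x + z * \<psi> e x) (\<lambda>e x. \<phi>1 e x + z * \<psi>1 e x)"
  unfolding form_fun_def
proof (intro conjI allI impI ballI)
  show "finite E" by (rule form_funD(1)[OF assms(1)])
  show "primitive_on (len e) (\<lambda>x. \<phi> e x + z * \<psi> e x) (\<lambda>x. \<phi>1 e x + z * \<psi>1 e x)" for e
    by (intro primitive_on_add primitive_on_mult form_funD(2)[OF assms(1)] form_funD(2)[OF assms(2)])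
  show "continuous_on {0..len e} (\<lambda>x. \<phi>1 e x + z * \<psi>1 e x)" for e
    by (intro continuous_intros form_funD(3)[OF assms(1)] form_funD(3)[OF assms(2)])
  obtain c d where cd: "\<forall>e. \<phi> e 0 = c (src e) \<and> \<phi> e (len e) = c (tgt e)" "\<forall>e. \<psi> e 0 = d (src e) \<and> \<psi> e (len e) = d (tgt e)"
    using vertex_values[OF form_funD(4)[OF assms(1)]] vertex_values[OF form_funD(4)[OF assms(2)]] by metis
  show "vertex_continuous (\<lambda>e x. \<phi> e x + z * \<psi> e x)"
    unfolding vertex_continuous_def by (intro allI exI[of _ "c _ + z * d _"]) (auto simp: cd)
  show "\<phi> e x + z * \<psi> e x = 0" "\<phi>1 e x + z * \<psi>1 e x = 0" if "e \<notin> E" "x \<in> {0..len e}" for e x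
    using form_funD(5,6)[OF assms(1) that] form_funD(5,6)[OF assms(2) that] by simp_all
qed

lemma energy_combine:
  assumes "\<And>e. continuous_on {0..len e} (u e)" "\<And>e. continuous_on {0..len e} (v e)"
  shows "energy E (\<lambda>e x. u e x + complex_of_real t * v e x)
    = energy E u + 2 * t * (\<Sum>e\<in>E. LBINT x:{0..len e}. u e x \<bullet> v e x) + t\<^sup>2 * energy E v"
proof -
  have "(LBINT x:{0..len e}. (cmod (u e x + complex_of_real t * v e x))\<^sup>2)
    = (LBINT x:{0..len e}. (cmod (u e x))\<^sup>2) + 2 * t * (LBINT x:{0..len e}. u e x \<bullet> v e x) + t\<^sup>2 * (LBINT x:{0..len e}. (cmod (v e x))\<^sup>2)" for e
  proof -
    have i: "set_integrable lborel {0..len e} (\<lambda>x. (cmod (u e x))\<^sup>2)" "set_integrable lborel {0..len e} (\<lambda>x. 2 * t * (u e x \<bullet> v e x))"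
      "set_integrable lborel {0..len e} (\<lambda>x. t\<^sup>2 * (cmod (v e x))\<^sup>2)"
      by (intro borel_integrable_atLeastAtMost' continuous_intros assms)+
    have "(\<lambda>x. (cmod (u e x + complex_of_real t * v e x))\<^sup>2) = (\<lambda>x. ((cmod (u e x))\<^sup>2 + 2 * t * (u e x \<bullet> v e x)) + t\<^sup>2 * (cmod (v e x))\<^sup>2)"
      unfolding power2_norm_eq_inner scaleR_conv_of_real[symmetric]
      by (simp add: fun_eq_iff inner_add_left inner_add_right inner_commute power2_eq_square algebra_simps)
    then show ?thesis
      using set_integral_add(2)[OF set_integral_add(1)[OF i(1,2)] i(3)] set_integral_add(2)[OF i(1,2)] by simp
  qed
  then show ?thesis unfolding energy_def by (simp add: sum.distrib sum_distrib_left)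
qed

text \<open>Energies are sums of squares over edges, so summands supported on disjoint edge sets
  have no mixed energy; this lets the form be evaluated on the span of infinitely many
  witnesses.\<close>

lemma disjoint_form_sum:
  fixes E :: "nat \<Rightarrow> 'e set"
  assumes ff: "\<And>n. form_fun (E n) (\<phi> n) (\<phi>1 n)" and dis: "\<And>m n. m \<noteq> n \<Longrightarrow> E m \<inter> E n = {}"
  shows "\<exists>\<psi> \<psi>1. form_fun (\<Union>i<n. E i) \<psi> \<psi>1 \<and> emb len \<psi> = (\<Sum>i<n. a i *\<^sub>R emb len (\<phi> i))
     \<and> energy (\<Union>i<n. E i) \<psi>1 = (\<Sum>i<n. (a i)\<^sup>2 * energy (E i) (\<phi>1 i))"
proof (induction n)
  case 0
  then show ?case using form_fun_zero emb_zero by (intro exI[of _ "\<lambda>e x. 0"]) (simp add: energy_def)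
next
  case (Suc n)
  then obtain \<psi> \<psi>1 where \<psi>: "form_fun (\<Union>i<n. E i) \<psi> \<psi>1" "emb len \<psi> = (\<Sum>i<n. a i *\<^sub>R emb len (\<phi> i))"
    "energy (\<Union>i<n. E i) \<psi>1 = (\<Sum>i<n. (a i)\<^sup>2 * energy (E i) (\<phi>1 i))" by blast
  let ?G = "\<Union>i<Suc n. E i"
  have G: "finite ?G" using form_funD(1)[OF ff] by simp
  have f1: "form_fun ?G \<psi> \<psi>1" by (rule form_fun_mono[OF \<psi>(1) _ G]) (auto simp: lessThan_Suc)
  have f2: "form_fun ?G (\<phi> n) (\<phi>1 n)" by (rule form_fun_mono[OF ff _ G]) auto
  have "energy ?G (\<lambda>e x. \<psi>1 e x + complex_of_real (a n) * \<phi>1 n e x)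
     = energy ?G \<psi>1 + 2 * a n * (\<Sum>e\<in>?G. LBINT x:{0..len e}. \<psi>1 e x \<bullet> \<phi>1 n e x) + (a n)\<^sup>2 * energy ?G (\<phi>1 n)"
    by (rule energy_combine[OF form_funD(3)[OF f1] form_funD(3)[OF f2]])
  also have "(\<Sum>e\<in>?G. LBINT x:{0..len e}. \<psi>1 e x \<bullet> \<phi>1 n e x) = 0"
  proof (rule sum.neutral, rule ballI)
    fix e
    have "E i \<inter> E n = {}" if "i < n" for i using dis[of i n] that by simp
    then have "e \<notin> (\<Union>i<n. E i) \<or> e \<notin> E n" by auto
    then have "\<psi>1 e x \<bullet> \<phi>1 n e x = 0" if "x \<in> {0..len e}" for x
      using form_funD(6)[OF \<psi>(1) _ that] form_funD(6)[OF ff _ that] by auto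
    then have "(LBINT x:{0..len e}. \<psi>1 e x \<bullet> \<phi>1 n e x) = (LBINT x:{0..len e}. 0)"
      by (intro set_lebesgue_integral_cong) auto
    then show "(LBINT x:{0..len e}. \<psi>1 e x \<bullet> \<phi>1 n e x) = 0" by simp
  qed
  also have "energy ?G \<psi>1 = energy (\<Union>i<n. E i) \<psi>1"
    by (rule energy_mono[OF G]) (use form_funD(6)[OF \<psi>(1)] in \<open>auto simp: lessThan_Suc\<close>)
  also have "energy ?G (\<phi>1 n) = energy (E n) (\<phi>1 n)"
    by (rule energy_mono[OF G]) (use form_funD(6)[OF ff] in \<open>auto simp: lessThan_Suc\<close>)
  finally have en: "energy ?G (\<lambda>e x. \<psi>1 e x + complex_of_real (a n) * \<phi>1 n e x) = (\<Sum>i<Suc n. (a i)\<^sup>2 * energy (E i) (\<phi>1 i))"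
    by (simp add: \<psi>(3))
  have em: "emb len (\<lambda>e x. \<psi> e x + complex_of_real (a n) * \<phi> n e x) = (\<Sum>i<Suc n. a i *\<^sub>R emb len (\<phi> i))"
    unfolding emb_combine(2)[OF form_fun_L2G[OF f1] form_fun_L2G[OF f2]] by (simp add: \<psi>(2) cmult_real)
  show ?case using form_fun_combine[OF f1 f2] en em by blast
qed

text \<open>If the form were smaller than \<open>lam\<close> arbitrarily far out, disjointly supported witnesses would
  span an infinite-dimensional space on which \<open>(lam + 1) B\<close> exceeds the identity.\<close>
lemma form_bound_off_finite:
  assumes lam: "lam > -1" and F: "finite F" "\<And>g. (\<forall>x\<in>F. x \<bullet> g = 0) \<Longrightarrow> (lam + 1) * (op.B g \<bullet> g) \<le> (norm g)\<^sup>2"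
  shows "\<exists>E0. finite E0 \<and> (\<forall>E \<phi> \<phi>1. form_fun E \<phi> \<phi>1 \<longrightarrow> E \<inter> E0 = {} \<longrightarrow> lam * energy E \<phi> \<le> energy E \<phi>1)"
proof (rule ccontr)
  assume neg: "\<not> ?thesis"
  let ?P = "\<lambda>p. form_fun (fst p) (fst (snd p)) (snd (snd p)) \<and> energy (fst p) (snd (snd p)) < lam * energy (fst p) (fst (snd p))"
  have "\<forall>E0. finite E0 \<longrightarrow> (\<exists>p. ?P p \<and> finite (fst p) \<and> fst p \<inter> E0 = {})"
  proof (intro allI impI)
    fix E0 :: "'e set" assume E0: "finite E0"
    obtain E \<phi> \<phi>1 where "form_fun E \<phi> \<phi>1" "E \<inter> E0 = {}" "energy E \<phi>1 < lam * energy E \<phi>"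
      using neg E0 by (auto simp: not_le)
    then show "\<exists>p. ?P p \<and> finite (fst p) \<and> fst p \<inter> E0 = {}"
      using form_funD(1) by (intro exI[of _ "(E, \<phi>, \<phi>1)"]) auto
  qed
  from disjoint_sequence[of ?P fst, OF this]
  obtain s :: "nat \<Rightarrow> 'e set \<times> ('e \<Rightarrow> real \<Rightarrow> complex) \<times> ('e \<Rightarrow> real \<Rightarrow> complex)" where "(\<forall>n. ?P (s n)) \<and> (\<forall>m n. m \<noteq> n \<longrightarrow> fst (s m) \<inter> fst (s n) = {})" ..
  note s = conjunct1[OF this] conjunct2[OF this]
  define E where "E n = fst (s n)" for n
  define \<phi> where "\<phi> n = fst (snd (s n))" for n
  define \<phi>1 where "\<phi>1 n = snd (snd (s n))" for n
  have ff: "form_fun (E n) (\<phi> n) (\<phi>1 n)" and less: "energy (E n) (\<phi>1 n) < lam * energy (E n) (\<phi> n)" for n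
    using s(1) unfolding E_def \<phi>_def \<phi>1_def by blast+
  have dis: "E m \<inter> E n = {}" if "m \<noteq> n" for m n using s(2) that unfolding E_def by blast
  have L: "\<phi> n \<in> L2G len" for n by (rule form_fun_L2G[OF ff])
  have orth: "emb len (\<phi> i) \<bullet> emb len (\<phi> j) = 0" if ij: "i \<noteq> j" for i j
  proof -
    have "(\<Sum>e\<in>E j. LBINT x:{0..len e}. \<phi> i e x \<bullet> \<phi> j e x) = (\<Sum>e\<in>E j. LBINT x:{0..len e}. 0)"
    proof (intro sum.cong refl set_lebesgue_integral_cong allI impI)
      fix e x assume e: "e \<in> E j" and x: "x \<in> {0..len e}"
      have "e \<notin> E i" using e dis[OF ij] by blast
      then show "\<phi> i e x \<bullet> \<phi> j e x = 0" using form_funD(5)[OF ff _ x] by simp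
    qed auto
    moreover have "emb len (\<phi> i) \<bullet> emb len (\<phi> j) = (\<Sum>e\<in>E j. LBINT x:{0..len e}. \<phi> i e x \<bullet> \<phi> j e x)"
      by (rule inner_emb[OF len_pos L L form_funD(1)[OF ff]]) (use form_funD(5)[OF ff] in auto)
    ultimately show ?thesis by simp
  qed
  have nz: "emb len (\<phi> n) \<noteq> 0" for n
  proof
    assume "emb len (\<phi> n) = 0"
    then have "energy (E n) (\<phi> n) = 0" using form_fun_norm[OF ff, of n] by simp
    then show False using less[of n] energy_nonneg[of "E n" "\<phi>1 n"] by simp
  qed
  have "\<exists>g\<in>span (range (\<lambda>n. emb len (\<phi> n))). g \<noteq> 0 \<and> (\<forall>x\<in>F. x \<bullet> g = 0)"
  proof (rule infinite_dim_orthogonal[OF subspace_span _ F(1)])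
    show "\<not> span (range (\<lambda>n. emb len (\<phi> n))) \<subseteq> span F'" if "finite F'" for F'
      by (rule orthonormal_sequence_infinite_dim[OF orth nz that])
  qed
  then obtain g where g: "g \<in> span (range (\<lambda>n. emb len (\<phi> n)))" "g \<noteq> 0" "\<forall>x\<in>F. x \<bullet> g = 0" by blast
  obtain n a where ga: "g = (\<Sum>i<n. a i *\<^sub>R emb len (\<phi> i))" using span_range_finite_sum[OF g(1)] by blast
  have "\<exists>\<psi> \<psi>1. form_fun (\<Union>i<n. E i) \<psi> \<psi>1 \<and> emb len \<psi> = (\<Sum>i<n. a i *\<^sub>R emb len (\<phi> i))
     \<and> energy (\<Union>i<n. E i) \<psi>1 = (\<Sum>i<n. (a i)\<^sup>2 * energy (E i) (\<phi>1 i))"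
    by (rule disjoint_form_sum[OF ff dis])
  then obtain \<psi> \<psi>1 where \<psi>: "form_fun (\<Union>i<n. E i) \<psi> \<psi>1" "emb len \<psi> = g"
    "energy (\<Union>i<n. E i) \<psi>1 = (\<Sum>i<n. (a i)\<^sup>2 * energy (E i) (\<phi>1 i))"
    unfolding ga by blast
  have gg: "(norm g)\<^sup>2 = (\<Sum>i<n. (a i)\<^sup>2 * energy (E i) (\<phi> i))"
  proof -
    have "(norm g)\<^sup>2 = (\<Sum>i<n. (a i)\<^sup>2 * (emb len (\<phi> i) \<bullet> emb len (\<phi> i)))"
      unfolding power2_norm_eq_inner ga by (rule inner_sum_orthogonal[OF orth])
    then show ?thesis by (simp only: form_fun_norm[OF ff, symmetric] power2_norm_eq_inner)
  qed
  have "\<exists>i<n. a i \<noteq> 0"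
  proof (rule ccontr)
    assume "\<not> ?thesis"
    then have "g = 0" unfolding ga by (intro sum.neutral) auto
    then show False using g(2) by simp
  qed
  then obtain i where i: "i < n" "a i \<noteq> 0" by blast
  have "energy (\<Union>i<n. E i) \<psi>1 < (\<Sum>i<n. (a i)\<^sup>2 * (lam * energy (E i) (\<phi> i)))"
    unfolding \<psi>(3)
  proof (rule sum_strict_mono_ex1)
    show "\<forall>i\<in>{..<n}. (a i)\<^sup>2 * energy (E i) (\<phi>1 i) \<le> (a i)\<^sup>2 * (lam * energy (E i) (\<phi> i))"
      by (intro ballI mult_left_mono less_imp_le[OF less]) simp
    show "\<exists>i\<in>{..<n}. (a i)\<^sup>2 * energy (E i) (\<phi>1 i) < (a i)\<^sup>2 * (lam * energy (E i) (\<phi> i))"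
      by (rule bexI[of _ i]) (use i less in \<open>auto intro!: mult_strict_left_mono\<close>)
  qed simp
  also have "\<dots> = lam * (norm g)\<^sup>2" unfolding gg by (simp add: sum_distrib_left mult.left_commute)
  finally have en: "energy (\<Union>i<n. E i) \<psi>1 + (norm g)\<^sup>2 < (lam + 1) * (norm g)\<^sup>2" by (simp add: algebra_simps)
  \<comment> \<open>The minimizer of -2t + (lam + 1) t^2. Inserted into the quadratic inequality for
    \<open>op.B g\<close>, it yields t |g|^2 < <B g, g>, against the bound off
    \<open>F\<close>.\<close>
  define t where "t = 1 / (lam + 1)"
  have t: "t > 0" "t * (lam + 1) = 1" using lam by (simp_all add: t_def)
  have "0 \<le> ((g - op.B g) + op.B g) \<bullet> op.B g - 2 * t * (((g - op.B g) + op.B g) \<bullet> emb len \<psi>)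
      + t\<^sup>2 * (energy (\<Union>i<n. E i) \<psi>1 + (norm (emb len \<psi>))\<^sup>2)"
    by (rule Laplacian_form_quadratic[OF op.B_T \<psi>(1)])
  then have "2 * t * (norm g)\<^sup>2 \<le> op.B g \<bullet> g + t\<^sup>2 * (energy (\<Union>i<n. E i) \<psi>1 + (norm g)\<^sup>2)"
    by (simp add: \<psi>(2) power2_norm_eq_inner inner_commute)
  also have "\<dots> < op.B g \<bullet> g + t\<^sup>2 * ((lam + 1) * (norm g)\<^sup>2)" using en t by simp
  also have "t\<^sup>2 * ((lam + 1) * (norm g)\<^sup>2) = t * (t * (lam + 1)) * (norm g)\<^sup>2" by (simp add: power2_eq_square mult.assoc)
  finally have "t * (norm g)\<^sup>2 < op.B g \<bullet> g" using t(2) by simp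
  then have "(lam + 1) * (t * (norm g)\<^sup>2) < (lam + 1) * (op.B g \<bullet> g)" using lam by simp
  then have "(norm g)\<^sup>2 < (lam + 1) * (op.B g \<bullet> g)" using t(2) by (simp add: mult.assoc[symmetric] mult.commute)
  then show False using F(2)[OF g(3)] by simp
qed

end

section \<open>Eigenfunctions vanishing on finitely many edges\<close>

context metric_graph
begin

lemma classical_on_combine:
  assumes "classical_on \<kappa> l h h0 h1" "classical_on \<kappa> l k k0 k1"
  shows "classical_on \<kappa> l (\<lambda>x. h x + z * k x) (\<lambda>x. h0 x + z * k0 x) (\<lambda>x. h1 x + z * k1 x)"
  unfolding classical_on_def
proof (intro conjI)
  show "primitive_on l (\<lambda>x. h0 x + z * k0 x) (\<lambda>x. h1 x + z * k1 x)"
    by (intro primitive_on_add primitive_on_mult classical_onD(1)[OF assms(1)] classical_onD(1)[OF assms(2)])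
  have "primitive_on l (\<lambda>x. h1 x + z * k1 x) (\<lambda>x. \<kappa> *\<^sub>R h x + z * (\<kappa> *\<^sub>R k x))"
    by (intro primitive_on_add primitive_on_mult classical_onD(2)[OF assms(1)] classical_onD(2)[OF assms(2)])
  then show "primitive_on l (\<lambda>x. h1 x + z * k1 x) (\<lambda>x. \<kappa> *\<^sub>R (h x + z * k x))"
    by (simp add: scaleR_add_right)
  show "AE x in lborel. x \<in> {0..l} \<longrightarrow> h x + z * k x = h0 x + z * k0 x"
    using classical_onD(3)[OF assms(1)] classical_onD(3)[OF assms(2)] by eventually_elim simp
qed

lemma classical_on_zero: "classical_on \<kappa> l (\<lambda>x. 0) (\<lambda>x. 0) (\<lambda>x. 0)"
  unfolding classical_on_def by (simp add: primitive_on_zero)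

lemma classical_on_unique:
  assumes cl: "classical_on \<kappa> l w w0 w1" and w: "continuous_on {0..l} w" and l: "0 < l" and x: "x \<in> {0..l}"
  shows "w0 x = w x"
proof -
  define d where "d y = cmod (w0 y - w y)" for y
  have d: "continuous_on {0..l} d"
    unfolding d_def by (intro continuous_intros w classical_onD(4)[OF cl])
  have di: "set_integrable lborel {0..l} d" by (rule borel_integrable_atLeastAtMost'[OF d])
  have "(LBINT y:{0..l}. d y) = 0"
    unfolding set_lebesgue_integral_def
  proof (rule integral_eq_zero_AE)
    show "AE y in lborel. indicator {0..l} y *\<^sub>R d y = 0"
      using classical_onD(3)[OF cl] by eventually_elim (auto simp: d_def indicator_def)
  qed
  then have "integral {0..l} d = 0" using set_borel_integral_eq_integral(2)[OF di] by simp
  then have "d x = 0" using integral_eq_0_iff[OF d l] x by (simp add: d_def)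
  then show ?thesis by (simp add: d_def)
qed

end

context complete_metric_graph
begin

text \<open>The value and derivative at the start of each edge of \<open>E1\<close> are finitely
  many complex numbers; if they determined an eigenvector, the eigenspace would be
  finite-dimensional. In the index set \<open>False\<close> marks the value and \<open>True\<close>
  the derivative. \<open>R\<close> is a relation because the representatives are not
  canonical.\<close>

lemma vanishing_eigenfunction:
  assumes inf: "\<And>F. finite F \<Longrightarrow> \<exists>f. (f, lam *\<^sub>R f) \<in> Laplacian \<and> f \<notin> span F" and E1: "finite E1"
  shows "\<exists>h h0 h1. h \<in> L2G len \<and> (emb len h, lam *\<^sub>R emb len h) \<in> Laplacian \<and> emb len h \<noteq> 0
    \<and> (\<forall>e. classical_on (- lam) (len e) (h e) (h0 e) (h1 e)) \<and> (\<forall>e\<in>E1. h0 e 0 = 0 \<and> h1 e 0 = 0)"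
proof (rule ccontr)
  assume neg: "\<not> ?thesis"
  define R where "R x c \<longleftrightarrow> (x, lam *\<^sub>R x) \<in> Laplacian \<and> (\<exists>h h0 h1. h \<in> L2G len \<and> emb len h = x
      \<and> (\<forall>e. classical_on (- lam) (len e) (h e) (h0 e) (h1 e)) \<and> (\<forall>e\<in>E1. h0 e 0 = c (e, False) \<and> h1 e 0 = c (e, True)))"
    for x and c :: "'e \<times> bool \<Rightarrow> complex"
  define Z where "Z = {x. (x, lam *\<^sub>R x) \<in> Laplacian}"
  have Z: "subspace Z"
  proof (rule subspaceI)
    show "0 \<in> Z" using subspace_0[OF op.T_subspace] by (simp add: Z_def zero_prod_def)
    show "x + y \<in> Z" if "x \<in> Z" "y \<in> Z" for x y
      using op.T_add[of x "lam *\<^sub>R x" y "lam *\<^sub>R y"] that by (simp add: Z_def scaleR_add_right)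
    show "c *\<^sub>R x \<in> Z" if "x \<in> Z" for c x
      using subspace_scale[OF op.T_subspace, of "(x, lam *\<^sub>R x)" c] that by (simp add: Z_def mult.commute)
  qed
  have ZJ: "imult x \<in> Z" if "x \<in> Z" for x
    using Laplacian_imult[of x "lam *\<^sub>R x"] that by (simp add: Z_def imult_scaleR)
  have comb: "R (x + cmult z y) (\<lambda>b. c b + z * d b)" if x: "R x c" and y: "R y d" for x y z c d
  proof -
    obtain h h0 h1 where h: "h \<in> L2G len" "emb len h = x" "\<forall>e. classical_on (- lam) (len e) (h e) (h0 e) (h1 e)"
      "\<forall>e\<in>E1. h0 e 0 = c (e, False) \<and> h1 e 0 = c (e, True)" using x unfolding R_def by blast
    obtain k k0 k1 where k: "k \<in> L2G len" "emb len k = y" "\<forall>e. classical_on (- lam) (len e) (k e) (k0 e) (k1 e)"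
      "\<forall>e\<in>E1. k0 e 0 = d (e, False) \<and> k1 e 0 = d (e, True)" using y unfolding R_def by blast
    have "x \<in> Z" "y \<in> Z" using x y by (auto simp: R_def Z_def)
    then have "x + cmult z y \<in> Z"
      unfolding cmult_def by (intro subspace_add[OF Z] subspace_scale[OF Z] ZJ)
    moreover have "\<forall>e. classical_on (- lam) (len e) (\<lambda>x. h e x + z * k e x) (\<lambda>x. h0 e x + z * k0 e x) (\<lambda>x. h1 e x + z * k1 e x)"
      using h(3) k(3) classical_on_combine by blast
    ultimately show ?thesis
      unfolding R_def Z_def using emb_combine[OF h(1) k(1), of z] h(2,4) k(2,4)
      by (intro conjI exI[of _ "\<lambda>e x. h e x + z * k e x"] exI[of _ "\<lambda>e x. h0 e x + z * k0 e x"] exI[of _ "\<lambda>e x. h1 e x + z * k1 e x"])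
         auto
  qed
  have zero: "R 0 (\<lambda>b. 0)"
    unfolding R_def using subspace_0[OF Z] emb_zero L2G_continuous[of "{}" "\<lambda>e x. 0"] classical_on_zero
    by (intro conjI exI[of _ "\<lambda>e x. 0"]) (auto simp: Z_def)
  have "\<exists>F. finite F \<and> Z \<subseteq> span F"
  proof (rule finite_span_of_coefficients[where J = imult and R = R and P = "E1 \<times> (UNIV :: bool set)"])
    show "finite (E1 \<times> (UNIV :: bool set))" using E1 by simp
    show "x = 0" if "R x (\<lambda>b. 0)" for x using neg that unfolding R_def by blast
    show "R (x - y) (\<lambda>b. c b - d b)" if "R x c" "R y d" for x y c d
      using comb[OF that, of "-1"] by (simp add: cmult_def)
    show "R (Re z *\<^sub>R x + Im z *\<^sub>R imult x) (\<lambda>b. z * c b)" if "R x c" for x c z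
      using comb[OF zero that, of z] by (simp add: cmult_def)
    show "subspace Z" by (rule Z)
    show "imult x \<in> Z" if "x \<in> Z" for x by (rule ZJ[OF that])
    show "\<exists>c. R x c \<and> (\<forall>b. b \<notin> E1 \<times> UNIV \<longrightarrow> c b = 0)" if x: "x \<in> Z" for x
    proof -
      obtain h where h: "h \<in> L2G len" "emb len h = x" by (rule emb_obtain)
      have w: "weak_solution (- lam) {} h"
        by (rule eigen_weak_solution[OF h(1)]) (use x h(2) in \<open>simp add: Z_def\<close>)
      obtain h0 h1 where cl: "\<forall>e. e \<notin> {} \<longrightarrow> classical_on (- lam) (len e) (h e) (h0 e) (h1 e)"
        using weak_solution_classical_family[OF w] by blast
      define c where "c b = (if fst b \<in> E1 then if snd b then h1 (fst b) 0 else h0 (fst b) 0 else 0)" for b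
      have "R x c" unfolding R_def using x h cl by (intro conjI exI[of _ h] exI[of _ h0] exI[of _ h1]) (auto simp: Z_def c_def)
      moreover have "\<forall>b. b \<notin> E1 \<times> UNIV \<longrightarrow> c b = 0" by (auto simp: c_def)
      ultimately show ?thesis by blast
    qed
  qed
  then obtain F where F: "finite F" "Z \<subseteq> span F" by blast
  obtain f where "(f, lam *\<^sub>R f) \<in> Laplacian" "f \<notin> span F" using inf[OF F(1)] by blast
  then show False using F(2) by (auto simp: Z_def)
qed

end

section \<open>Smoothed absolute values\<close>

text \<open>The regularized modulus of Kato's inequality. Subtracting \<epsilon> makes it vanish at
  0, so that finite supports and zeros on given edges are kept.\<close>

definition smooth_abs :: "real \<Rightarrow> complex \<Rightarrow> real" where
  "smooth_abs \<epsilon> z = sqrt ((cmod z)\<^sup>2 + \<epsilon>\<^sup>2) - \<epsilon>"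

lemma smooth_abs_bounds:
  assumes "0 \<le> \<epsilon>"
  shows "0 \<le> smooth_abs \<epsilon> z" "smooth_abs \<epsilon> z \<le> cmod z" "cmod z - \<epsilon> \<le> smooth_abs \<epsilon> z"
  using real_sqrt_sum_squares_ge2[of \<epsilon> "cmod z"] real_sqrt_sum_squares_ge1[of "cmod z" \<epsilon>]
    sqrt_sum_squares_le_sum[of "cmod z" \<epsilon>] assms by (simp_all add: smooth_abs_def)

lemma smooth_abs_zero: "0 \<le> \<epsilon> \<Longrightarrow> smooth_abs \<epsilon> 0 = 0"
  by (simp add: smooth_abs_def)

text \<open>For negative \<kappa> the replacement of the modulus by a smaller quantity increases the
  term; the error is of first order in \<epsilon> and thus harmless in the limit.\<close>

lemma smooth_abs_square:
  assumes "0 \<le> \<epsilon>"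
  shows "\<kappa> * (smooth_abs \<epsilon> z)\<^sup>2 \<le> \<kappa> * (cmod z)\<^sup>2 + 2 * \<bar>\<kappa>\<bar> * \<epsilon> * cmod z"
proof -
  note b = smooth_abs_bounds[OF assms, of z]
  have "(cmod z)\<^sup>2 - (smooth_abs \<epsilon> z)\<^sup>2 = (cmod z - smooth_abs \<epsilon> z) * (cmod z + smooth_abs \<epsilon> z)"
    by (simp add: power2_eq_square algebra_simps)
  also have "\<dots> \<le> \<epsilon> * (2 * cmod z)" by (rule mult_mono) (use b assms in auto)
  finally have u: "(cmod z)\<^sup>2 - (smooth_abs \<epsilon> z)\<^sup>2 \<le> 2 * \<epsilon> * cmod z" by simp
  have l: "0 \<le> (cmod z)\<^sup>2 - (smooth_abs \<epsilon> z)\<^sup>2" using power_mono[OF b(2,1), of 2] by simp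
  have "- \<kappa> * ((cmod z)\<^sup>2 - (smooth_abs \<epsilon> z)\<^sup>2) \<le> \<bar>\<kappa>\<bar> * ((cmod z)\<^sup>2 - (smooth_abs \<epsilon> z)\<^sup>2)"
    by (rule mult_right_mono[OF _ l]) simp
  also have "\<dots> \<le> \<bar>\<kappa>\<bar> * (2 * \<epsilon> * cmod z)" by (rule mult_left_mono[OF u]) simp
  finally show ?thesis by (simp add: algebra_simps)
qed

text \<open>The diamagnetic inequality: the expression on the left is the derivative of
  \<open>smooth_abs \<epsilon>\<close> along a curve through \<open>z\<close> with velocity
  \<open>w\<close>, and Cauchy-Schwarz shows that regularizing the modulus does not raise the
  energy.\<close>

lemma smooth_abs_deriv_le:
  assumes "0 < \<epsilon>"
  shows "(cmod (complex_of_real ((z \<bullet> w) / sqrt ((cmod z)\<^sup>2 + \<epsilon>\<^sup>2))))\<^sup>2 \<le> (cmod w)\<^sup>2"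
proof -
  have s: "0 < sqrt ((cmod z)\<^sup>2 + \<epsilon>\<^sup>2)" "cmod z \<le> sqrt ((cmod z)\<^sup>2 + \<epsilon>\<^sup>2)"
    using assms by (simp_all add: add_nonneg_pos real_sqrt_sum_squares_ge1)
  have "\<bar>z \<bullet> w\<bar> \<le> cmod z * cmod w" by (rule Cauchy_Schwarz_ineq2)
  also have "\<dots> \<le> sqrt ((cmod z)\<^sup>2 + \<epsilon>\<^sup>2) * cmod w" by (rule mult_right_mono[OF s(2)]) simp
  finally have "\<bar>z \<bullet> w\<bar> / sqrt ((cmod z)\<^sup>2 + \<epsilon>\<^sup>2) \<le> cmod w" using s(1) by (simp add: pos_divide_le_eq mult.commute)
  moreover have "cmod (complex_of_real ((z \<bullet> w) / sqrt ((cmod z)\<^sup>2 + \<epsilon>\<^sup>2))) = \<bar>z \<bullet> w\<bar> / sqrt ((cmod z)\<^sup>2 + \<epsilon>\<^sup>2)"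
    unfolding norm_of_real abs_divide using s(1) by simp
  ultimately show ?thesis by (intro power_mono) simp_all
qed

lemma smooth_abs_primitive:
  assumes g: "primitive_on l g g1" "continuous_on {0..l} g1" and \<epsilon>: "0 < \<epsilon>"
  shows "primitive_on l (\<lambda>x. complex_of_real (smooth_abs \<epsilon> (g x)))
      (\<lambda>x. complex_of_real ((g x \<bullet> g1 x) / sqrt ((cmod (g x))\<^sup>2 + \<epsilon>\<^sup>2)))"
    and "continuous_on {0..l} (\<lambda>x. complex_of_real ((g x \<bullet> g1 x) / sqrt ((cmod (g x))\<^sup>2 + \<epsilon>\<^sup>2)))"
proof -
  have pos: "0 < (cmod z)\<^sup>2 + \<epsilon>\<^sup>2" for z using \<epsilon> by (simp add: add_nonneg_pos)
  then have "sqrt ((cmod z)\<^sup>2 + \<epsilon>\<^sup>2) \<noteq> 0" for z by (metis less_irrefl real_sqrt_eq_zero_cancel_iff)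
  then show c: "continuous_on {0..l} (\<lambda>x. complex_of_real ((g x \<bullet> g1 x) / sqrt ((cmod (g x))\<^sup>2 + \<epsilon>\<^sup>2)))"
    by (intro continuous_intros primitive_on_continuous[OF g(1)] g(2)) auto
  show "primitive_on l (\<lambda>x. complex_of_real (smooth_abs \<epsilon> (g x)))
      (\<lambda>x. complex_of_real ((g x \<bullet> g1 x) / sqrt ((cmod (g x))\<^sup>2 + \<epsilon>\<^sup>2)))"
  proof (rule primitive_onI_deriv[OF _ c])
    fix x assume x: "x \<in> {0..l}"
    have d: "(g has_vector_derivative g1 x) (at x within {0..l})" by (rule primitive_on_deriv[OF g x])
    have "((\<lambda>x. g x \<bullet> g x) has_vector_derivative g x \<bullet> g1 x + g1 x \<bullet> g x) (at x within {0..l})"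
      by (rule bounded_bilinear.has_vector_derivative[OF bounded_bilinear_inner d d])
    then have "((\<lambda>x. g x \<bullet> g x) has_real_derivative 2 * (g x \<bullet> g1 x)) (at x within {0..l})"
      by (simp add: has_real_derivative_iff_has_vector_derivative inner_commute)
    then have "((\<lambda>x. (cmod (g x))\<^sup>2 + \<epsilon>\<^sup>2) has_real_derivative 2 * (g x \<bullet> g1 x)) (at x within {0..l})"
      unfolding power2_norm_eq_inner by (auto intro!: derivative_eq_intros)
    from DERIV_diff[OF DERIV_chain2[OF DERIV_real_sqrt[OF pos] this] DERIV_const]
    have "((\<lambda>x. sqrt ((cmod (g x))\<^sup>2 + \<epsilon>\<^sup>2) - \<epsilon>) has_real_derivative
        inverse (sqrt ((cmod (g x))\<^sup>2 + \<epsilon>\<^sup>2)) / 2 * (2 * (g x \<bullet> g1 x)) - 0) (at x within {0..l})" .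
    moreover have "inverse s / 2 * (2 * d) - 0 = d / s" for s d :: real
      by (cases "s = 0") (simp_all add: field_simps)
    ultimately have "((\<lambda>x. smooth_abs \<epsilon> (g x)) has_real_derivative (g x \<bullet> g1 x) / sqrt ((cmod (g x))\<^sup>2 + \<epsilon>\<^sup>2)) (at x within {0..l})"
      unfolding smooth_abs_def by (simp only:)
    then show "((\<lambda>x. complex_of_real (smooth_abs \<epsilon> (g x))) has_vector_derivative
        complex_of_real ((g x \<bullet> g1 x) / sqrt ((cmod (g x))\<^sup>2 + \<epsilon>\<^sup>2))) (at x within {0..l})"
      unfolding has_real_derivative_iff_has_vector_derivative
      by (rule bounded_linear.has_vector_derivative[OF bounded_linear_of_real])
  qed
qed

lemma clamped_max_diff:
  fixes a b c d B :: real
  assumes "\<bar>a - c\<bar> \<le> B" "\<bar>b - d\<bar> \<le> B"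
  shows "\<bar>min 1 (max a b) - min 1 (max c d)\<bar> \<le> B"
  using assms by (auto simp: max_def min_def abs_if split: if_splits)

section \<open>The absolute value of an eigenfunction\<close>

context complete_metric_graph
begin

text \<open>Maxima of cutoffs, capped at 1, respect a common slope bound, which gives a plateau over
  finitely many edges.\<close>

lemma cutoff_exists_finite:
  assumes \<eta>: "\<eta> > 0" and E: "finite E"
  shows "\<exists>\<phi>::'v \<Rightarrow> real. finite {v. \<phi> v \<noteq> 0} \<and> (\<forall>e\<in>E. \<phi> (src e) = 1 \<and> \<phi> (tgt e) = 1)
     \<and> (\<forall>e. \<bar>\<phi> (src e) - \<phi> (tgt e)\<bar> \<le> \<eta> * len e)"
  using E
proof induction
  case empty
  show ?case using \<eta> len_nonneg by (intro exI[of _ "\<lambda>v. 0"]) simp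
next
  case (insert a E)
  then obtain \<phi> :: "'v \<Rightarrow> real" where \<phi>: "finite {v. \<phi> v \<noteq> 0}" "\<forall>e\<in>E. \<phi> (src e) = 1 \<and> \<phi> (tgt e) = 1"
    "\<forall>e. \<bar>\<phi> (src e) - \<phi> (tgt e)\<bar> \<le> \<eta> * len e" by blast
  obtain \<psi> :: "'v \<Rightarrow> real" where \<psi>: "finite {v. \<psi> v \<noteq> 0}" "\<psi> (src a) = 1" "\<psi> (tgt a) = 1"
    "\<forall>e. \<bar>\<psi> (src e) - \<psi> (tgt e)\<bar> \<le> \<eta> * len e" using cutoff_exists[OF \<eta>] by blast
  show ?case
  proof (intro exI[of _ "\<lambda>v. min 1 (max (\<phi> v) (\<psi> v))"] conjI allI ballI)
    show "finite {v. min 1 (max (\<phi> v) (\<psi> v)) \<noteq> 0}"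
      by (rule finite_subset[OF _ finite_UnI[OF \<phi>(1) \<psi>(1)]]) auto
    show "\<bar>min 1 (max (\<phi> (src e)) (\<psi> (src e))) - min 1 (max (\<phi> (tgt e)) (\<psi> (tgt e)))\<bar> \<le> \<eta> * len e" for e
      by (rule clamped_max_diff[OF \<phi>(3)[rule_format] \<psi>(4)[rule_format]])
    show "min 1 (max (\<phi> (src e)) (\<psi> (src e))) = 1" "min 1 (max (\<phi> (tgt e)) (\<psi> (tgt e))) = 1" if "e \<in> insert a E" for e
      using that \<phi>(2) \<psi>(2,3) by auto
  qed
qed

end

context complete_metric_graph
begin

text \<open>Smoothed absolute values of \<open>\<chi> f\<close>, with \<open>f\<close> the eigenfunction and \<open>\<chi>\<close> a flat cutoff, are almost null
  vectors of the form; by Cauchy--Schwarz they are almost orthogonal to every test function, and this passes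
  to the limit \<open>\<bar>f\<bar>\<close>.\<close>
lemma abs_weak_solution:
  assumes h: "h \<in> L2G len" and ws: "weak_solution \<kappa> {} h" and cl: "\<And>e. classical_on \<kappa> (len e) (h e) (h0 e) (h1 e)"
    and van: "\<And>e x. e \<in> E0 \<Longrightarrow> x \<in> {0..len e} \<Longrightarrow> h0 e x = 0" "\<And>e x. e \<in> E0 \<Longrightarrow> x \<in> {0..len e} \<Longrightarrow> h1 e x = 0"
    and form: "\<And>E \<phi> \<phi>1. form_fun E \<phi> \<phi>1 \<Longrightarrow> E \<inter> E0 = {} \<Longrightarrow> 0 \<le> energy E \<phi>1 + \<kappa> * energy E \<phi>"
  shows "weak_solution \<kappa> E0 (\<lambda>e x. complex_of_real (cmod (h0 e x)))"
  unfolding weak_solution_def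
proof (intro conjI allI impI)
  note c0 = classical_onD(4)[OF cl] and c1 = classical_onD(5)[OF cl]
  have ac: "continuous_on {0..len e} (\<lambda>x. complex_of_real (cmod (h0 e x)))" for e
    by (intro continuous_intros c0)
  show "set_integrable lborel {0..len e} (\<lambda>x. complex_of_real (cmod (h0 e x)))"
    "set_integrable lborel {0..len e} (\<lambda>x. (cmod (complex_of_real (cmod (h0 e x))))\<^sup>2)" for e
    by (intro borel_integrable_atLeastAtMost' ac set_integrable_square_continuous)+
  have hv: "vertex_continuous h0" by (rule weak_solution_continuous[OF ws cl])
  have "\<exists>c. \<forall>e. h0 e 0 = c (src e) \<and> h0 e (len e) = c (tgt e)" by (rule vertex_values[OF hv]) blast
  then obtain c where "\<forall>e. h0 e 0 = c (src e) \<and> h0 e (len e) = c (tgt e)" by blast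
  then have c: "h0 e 0 = c (src e)" "h0 e (len e) = c (tgt e)" for e by simp_all
  define N where "N = (norm (emb len h))\<^sup>2"
  have hsq: "set_integrable lborel {0..len e} (\<lambda>x. (cmod (h e x))\<^sup>2)" for e by (rule L2G_edge(2)[OF h])
  have heq: "(LBINT x:{0..len e}. (cmod (h e x))\<^sup>2) = (LBINT x:{0..len e}. (cmod (h0 e x))\<^sup>2)" for e
    by (rule integral_square_cong[where h = h, OF cl hsq])
  fix f u1 u2 E
  assume f: "admissible f u1 u2" and E: "finite E" "E \<inter> E0 = {}"
    and supp: "\<forall>e x. e \<notin> E \<longrightarrow> f e x = 0 \<and> u1 e x = 0 \<and> u2 e x = 0"
  define w where "w e x = \<kappa> *\<^sub>R f e x - u2 e x" for e x
  have fc: "continuous_on {0..len e} (f e)" and uc: "continuous_on {0..len e} (u1 e)" for e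
    using primitive_on_continuous[OF admissibleD(1)[OF f]] primitive_on_continuous[OF admissibleD(2)[OF f]] by blast+
  have u2i: "set_integrable lborel {0..len e} (u2 e)" for e by (rule primitive_onD(1)[OF admissibleD(2)[OF f]])
  have wi: "set_integrable lborel {0..len e} (w e)" for e
  proof -
    have "set_integrable lborel {0..len e} (\<lambda>x. \<kappa> *\<^sub>R f e x)"
      by (intro borel_integrable_atLeastAtMost' continuous_intros fc)
    from set_integral_diff(1)[OF this u2i] show ?thesis by (simp add: w_def[abs_def])
  qed
  have wn: "set_integrable lborel {0..len e} (\<lambda>x. cmod (w e x))" for e by (rule set_integrable_norm[OF wi])
  have ff: "form_fun E f u1"
    unfolding form_fun_def using E(1) admissibleD(1,4)[OF f] uc supp by blast
  define X where "X = (\<Sum>e\<in>E. LBINT x:{0..len e}. complex_of_real (cmod (h0 e x)) \<bullet> w e x)"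
  define C1 where "C1 = (\<Sum>e\<in>E. LBINT x:{0..len e}. cmod (w e x))"
  define C2 where "C2 = energy E u1 + \<kappa> * energy E f"
  \<comment> \<open>\<open>X\<close> is the weak equation for |h0|, and \<open>Z\<close> below is
    the same expression for the regularized cutoff function. Both |Z| and |X - Z| are of order
    \<eta>, with constants independent of the cutoff.\<close>
  have "\<bar>X\<bar> \<le> \<eta> * (C1 + (N + 1 + C2) / 2)" if \<eta>: "\<eta> > 0" for \<eta>
  proof -
    obtain \<phi> :: "'v \<Rightarrow> real" where \<phi>: "finite {v. \<phi> v \<noteq> 0}" "\<forall>e\<in>E. \<phi> (src e) = 1 \<and> \<phi> (tgt e) = 1"
      "\<forall>e. \<bar>\<phi> (src e) - \<phi> (tgt e)\<bar> \<le> \<eta> * len e" using cutoff_exists_finite[OF \<eta> E(1)] by blast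
    define D where "D = touching {v. \<phi> v \<noteq> 0}"
    have D: "finite D" unfolding D_def by (rule finite_touching[OF \<phi>(1)])
    define g where "g e x = cut \<phi> e x *\<^sub>R h0 e x" for e x
    define g1 where "g1 e x = cut \<phi> e x *\<^sub>R h1 e x + cut1 \<phi> e *\<^sub>R h0 e x" for e x
    have g: "primitive_on (len e) (g e) (g1 e)" for e
      unfolding g_def[abs_def] g1_def[abs_def]
      by (rule primitive_on_scaleR[OF classical_onD(1)[OF cl] c1 cut_deriv]) (rule continuous_on_const)
    have gc: "continuous_on {0..len e} (g e)" for e by (rule primitive_on_continuous[OF g])
    have g1c: "continuous_on {0..len e} (g1 e)" for e
      unfolding g1_def by (intro continuous_intros cut_continuous c0 c1)
    have goff: "g e x = 0" "g1 e x = 0" if "e \<notin> D - E0" "x \<in> {0..len e}" for e x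
    proof -
      have "g e x = 0 \<and> g1 e x = 0"
      proof (cases "e \<in> E0")
        case True
        then show ?thesis using van that(2) by (simp add: g_def g1_def)
      next
        case False
        then have "\<phi> (src e) = 0" "\<phi> (tgt e) = 0" using that(1) by (auto simp: D_def touching_def)
        then show ?thesis by (simp add: g_def g1_def cut_const[where c = 0])
      qed
      then show "g e x = 0" "g1 e x = 0" by auto
    qed
    have gE: "g e x = h0 e x" if "e \<in> E" for e x
      using \<phi>(2) that by (simp add: g_def cut_const(1)[where c = 1])
    define I where "I = (\<Sum>e\<in>D. LBINT x:{0..len e}. cmod (g e x))"
    have I: "0 \<le> I" unfolding I_def by (intro sum_nonneg set_integral_nonneg) simp
    \<comment> \<open>The bound by \<eta> controls the pointwise error of the regularization; the
      second term makes the error 2 |\<kappa>| \<epsilon> I in the form at most \<eta>^2.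
      \<open>I\<close> depends on the cutoff, so \<epsilon> is chosen after it.\<close>
    define \<epsilon> where "\<epsilon> = min \<eta> (\<eta>\<^sup>2 / (2 * \<bar>\<kappa>\<bar> * I + 1))"
    have den: "0 < 2 * \<bar>\<kappa>\<bar> * I + 1" using I by (simp add: add_nonneg_pos)
    have \<epsilon>: "0 < \<epsilon>" "\<epsilon> \<le> \<eta>" using \<eta> den by (simp_all add: \<epsilon>_def)
    have \<epsilon>I: "2 * \<bar>\<kappa>\<bar> * \<epsilon> * I \<le> \<eta>\<^sup>2"
    proof -
      have "\<epsilon> * (2 * \<bar>\<kappa>\<bar> * I + 1) \<le> \<eta>\<^sup>2"
        using den by (simp add: \<epsilon>_def pos_le_divide_eq[symmetric])
      then show ?thesis using \<epsilon>(1) by (simp add: algebra_simps)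
    qed
    have \<epsilon>0: "0 \<le> \<epsilon>" using \<epsilon>(1) by simp
    define v where "v e x = complex_of_real (smooth_abs \<epsilon> (g e x))" for e x
    define v1 where "v1 e x = complex_of_real ((g e x \<bullet> g1 e x) / sqrt ((cmod (g e x))\<^sup>2 + \<epsilon>\<^sup>2))" for e x
    have v: "primitive_on (len e) (v e) (v1 e)" and v1c: "continuous_on {0..len e} (v1 e)" for e
      unfolding v_def[abs_def] v1_def[abs_def] by (rule smooth_abs_primitive[OF g g1c \<epsilon>(1)])+
    have vc: "continuous_on {0..len e} (v e)" for e by (rule primitive_on_continuous[OF v])
    have voff: "v e x = 0" "v1 e x = 0" if "e \<notin> D - E0" "x \<in> {0..len e}" for e x
      using goff[OF that] by (simp_all add: v_def v1_def smooth_abs_zero \<epsilon>0)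
    have vv: "vertex_continuous v"
      unfolding vertex_continuous_def
    proof (intro allI exI[of _ "complex_of_real (smooth_abs \<epsilon> (\<phi> _ *\<^sub>R c _))"])
      show "(src e = a \<longrightarrow> v e 0 = complex_of_real (smooth_abs \<epsilon> (\<phi> a *\<^sub>R c a)))
          \<and> (tgt e = a \<longrightarrow> v e (len e) = complex_of_real (smooth_abs \<epsilon> (\<phi> a *\<^sub>R c a)))" for a e
        by (auto simp: v_def g_def cut_ends c)
    qed
    \<comment> \<open>A common support for \<open>v\<close> and the test function that avoids
      \<open>E0\<close>, so that the nonnegativity of the form applies to all their
      combinations.\<close>
    define G where "G = (D \<union> E) - E0"
    have G: "finite G" "E \<subseteq> G" "D - E0 \<subseteq> G" using D E by (auto simp: G_def)
    have fv: "form_fun G v v1"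
      unfolding form_fun_def using v v1c vv voff G by blast
    have fG: "form_fun G f u1" by (rule form_fun_mono[OF ff G(2,1)])
    have en_v: "energy G v = energy D v" "energy G v1 = energy D v1"
    proof -
      have DE: "finite (D \<union> E)" "G \<subseteq> D \<union> E" "D \<subseteq> D \<union> E" using D E(1) by (auto simp: G_def)
      have off: "e \<notin> D - E0" if "e \<in> D \<union> E - G \<or> e \<in> D \<union> E - D" for e using that by (auto simp: G_def)
      show "energy G v = energy D v"
        by (rule trans[OF energy_mono[OF DE(1,2), symmetric] energy_mono[OF DE(1,3)]]) (use voff(1) off in blast)+
      show "energy G v1 = energy D v1"
        by (rule trans[OF energy_mono[OF DE(1,2), symmetric] energy_mono[OF DE(1,3)]]) (use voff(2) off in blast)+
    qed
    \<comment> \<open>The diamagnetic inequality compares \<open>v\<close> with the cut-off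
      eigenfunction \<open>g\<close>; the localization formula leaves for \<open>g\<close> just the
      squared cutoff slope, at most \<eta>^2 times the squared norm.\<close>
    have Qv: "energy G v1 + \<kappa> * energy G v \<le> \<eta>\<^sup>2 * (N + 1)"
    proof -
      have "energy G v1 + \<kappa> * energy G v = (\<Sum>e\<in>D. (LBINT x:{0..len e}. (cmod (v1 e x))\<^sup>2) + \<kappa> * (LBINT x:{0..len e}. (cmod (v e x))\<^sup>2))"
        unfolding en_v by (simp add: energy_def sum.distrib sum_distrib_left)
      also have "\<dots> \<le> (\<Sum>e\<in>D. (LBINT x:{0..len e}. (cmod (g1 e x))\<^sup>2 + \<kappa> * (cmod (g e x))\<^sup>2) + 2 * \<bar>\<kappa>\<bar> * \<epsilon> * (LBINT x:{0..len e}. cmod (g e x)))"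
      proof (rule sum_mono)
        fix e
        have i: "set_integrable lborel {0..len e} (\<lambda>x. (cmod (v1 e x))\<^sup>2)" "set_integrable lborel {0..len e} (\<lambda>x. \<kappa> * (cmod (v e x))\<^sup>2)"
          "set_integrable lborel {0..len e} (\<lambda>x. (cmod (g1 e x))\<^sup>2 + \<kappa> * (cmod (g e x))\<^sup>2)"
          "set_integrable lborel {0..len e} (\<lambda>x. 2 * \<bar>\<kappa>\<bar> * \<epsilon> * cmod (g e x))"
          by (intro borel_integrable_atLeastAtMost' continuous_intros vc v1c gc g1c)+
        have "(LBINT x:{0..len e}. (cmod (v1 e x))\<^sup>2) + \<kappa> * (LBINT x:{0..len e}. (cmod (v e x))\<^sup>2)
          = (LBINT x:{0..len e}. (cmod (v1 e x))\<^sup>2 + \<kappa> * (cmod (v e x))\<^sup>2)"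
          using set_integral_add(2)[OF i(1,2)] by simp
        also have "\<dots> \<le> (LBINT x:{0..len e}. ((cmod (g1 e x))\<^sup>2 + \<kappa> * (cmod (g e x))\<^sup>2) + 2 * \<bar>\<kappa>\<bar> * \<epsilon> * cmod (g e x))"
        proof (rule set_integral_mono[OF set_integral_add(1)[OF i(1,2)] set_integral_add(1)[OF i(3,4)]])
          fix x
          have "(cmod (v1 e x))\<^sup>2 \<le> (cmod (g1 e x))\<^sup>2" unfolding v1_def by (rule smooth_abs_deriv_le[OF \<epsilon>(1)])
          moreover have "\<kappa> * (cmod (v e x))\<^sup>2 \<le> \<kappa> * (cmod (g e x))\<^sup>2 + 2 * \<bar>\<kappa>\<bar> * \<epsilon> * cmod (g e x)"
            using smooth_abs_square[OF \<epsilon>0, of \<kappa> "g e x"] by (simp add: v_def)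
          ultimately show "(cmod (v1 e x))\<^sup>2 + \<kappa> * (cmod (v e x))\<^sup>2 \<le> ((cmod (g1 e x))\<^sup>2 + \<kappa> * (cmod (g e x))\<^sup>2) + 2 * \<bar>\<kappa>\<bar> * \<epsilon> * cmod (g e x)"
            by linarith
        qed
        also have "\<dots> = (LBINT x:{0..len e}. (cmod (g1 e x))\<^sup>2 + \<kappa> * (cmod (g e x))\<^sup>2) + 2 * \<bar>\<kappa>\<bar> * \<epsilon> * (LBINT x:{0..len e}. cmod (g e x))"
          using set_integral_add(2)[OF i(3,4)] by simp
        finally show "(LBINT x:{0..len e}. (cmod (v1 e x))\<^sup>2) + \<kappa> * (LBINT x:{0..len e}. (cmod (v e x))\<^sup>2)
          \<le> (LBINT x:{0..len e}. (cmod (g1 e x))\<^sup>2 + \<kappa> * (cmod (g e x))\<^sup>2) + 2 * \<bar>\<kappa>\<bar> * \<epsilon> * (LBINT x:{0..len e}. cmod (g e x))" .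
      qed
      also have "\<dots> = (\<Sum>e\<in>D. LBINT x:{0..len e}. (cmod (g1 e x))\<^sup>2 + \<kappa> * (cmod (g e x))\<^sup>2) + 2 * \<bar>\<kappa>\<bar> * \<epsilon> * I"
        unfolding I_def by (simp only: sum.distrib sum_distrib_left)
      also have "(\<Sum>e\<in>D. LBINT x:{0..len e}. (cmod (g1 e x))\<^sup>2 + \<kappa> * (cmod (g e x))\<^sup>2)
          = (\<Sum>e\<in>D. (cut1 \<phi> e)\<^sup>2 * (LBINT x:{0..len e}. (cmod (h0 e x))\<^sup>2))"
        unfolding g_def g1_def D_def by (rule weak_solution_localization[OF ws cl \<phi>(1)])
      also have "\<dots> \<le> (\<Sum>e\<in>D. \<eta>\<^sup>2 * (LBINT x:{0..len e}. (cmod (h e x))\<^sup>2))"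
        unfolding heq by (intro sum_mono mult_right_mono cut1_le \<phi>(3)[rule_format] set_integral_nonneg) simp
      also have "\<dots> \<le> \<eta>\<^sup>2 * N"
        unfolding sum_distrib_left[symmetric] N_def by (intro mult_left_mono edge_sum_le[OF h] D) simp
      finally show ?thesis using \<epsilon>I by (simp add: algebra_simps)
    qed
    define Z where "Z = (\<Sum>e\<in>E. LBINT x:{0..len e}. v e x \<bullet> w e x)"
    \<comment> \<open>The polarized form at \<open>v\<close> and \<open>f\<close> is moved onto
      \<open>f\<close>, whose Kirchhoff condition removes the boundary terms.\<close>
    have cross: "(\<Sum>e\<in>G. LBINT x:{0..len e}. v1 e x \<bullet> u1 e x) + \<kappa> * (\<Sum>e\<in>G. LBINT x:{0..len e}. v e x \<bullet> f e x) = Z"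
    proof -
      have "(\<Sum>e\<in>G. (LBINT x:{0..len e}. u2 e x \<bullet> v e x) + (LBINT x:{0..len e}. u1 e x \<bullet> v1 e x)) = 0"
      proof (rule green[OF G(1) admissibleD(2)[OF f] v vv])
        show "v e x = 0" if "e \<notin> G" "x \<in> {0<..<len e}" for e x
          by (rule voff(1)) (use that G(3) in auto)
      qed (use admissibleD(5)[OF f] in auto)
      then have "(\<Sum>e\<in>G. LBINT x:{0..len e}. v1 e x \<bullet> u1 e x) = - (\<Sum>e\<in>G. LBINT x:{0..len e}. v e x \<bullet> u2 e x)"
        by (simp add: sum.distrib inner_commute)
      moreover have "(\<Sum>e\<in>G. LBINT x:{0..len e}. v e x \<bullet> w e x)
          = \<kappa> * (\<Sum>e\<in>G. LBINT x:{0..len e}. v e x \<bullet> f e x) - (\<Sum>e\<in>G. LBINT x:{0..len e}. v e x \<bullet> u2 e x)"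
      proof -
        have "(LBINT x:{0..len e}. v e x \<bullet> w e x) = \<kappa> * (LBINT x:{0..len e}. v e x \<bullet> f e x) - (LBINT x:{0..len e}. v e x \<bullet> u2 e x)" for e
        proof -
          have i1: "set_integrable lborel {0..len e} (\<lambda>x. \<kappa> * (v e x \<bullet> f e x))"
            by (intro borel_integrable_atLeastAtMost' continuous_intros vc fc)
          have i2: "set_integrable lborel {0..len e} (\<lambda>x. v e x \<bullet> u2 e x)"
            by (rule set_integrable_inner_continuous[OF vc u2i])
          show ?thesis using set_integral_diff(2)[OF i1 i2] by (simp add: w_def inner_diff_right)
        qed
        then show ?thesis by (simp add: sum_subtractf sum_distrib_left)
      qed
      moreover have "(\<Sum>e\<in>G. LBINT x:{0..len e}. v e x \<bullet> w e x) = Z"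
        unfolding Z_def by (rule sum.mono_neutral_right[OF G(1,2)]) (use supp in \<open>simp add: w_def\<close>)
      ultimately show ?thesis by simp
    qed
    have C2G: "energy G u1 + \<kappa> * energy G f = C2"
      unfolding C2_def using energy_mono[OF G(1,2), of u1] energy_mono[OF G(1,2), of f] supp by simp
    have quad: "0 \<le> \<eta>\<^sup>2 * (N + 1) + 2 * t * Z + t\<^sup>2 * C2" for t
    proof -
      have "0 \<le> energy G (\<lambda>e x. v1 e x + complex_of_real t * u1 e x) + \<kappa> * energy G (\<lambda>e x. v e x + complex_of_real t * f e x)"
        by (rule form[OF form_fun_combine[OF fv fG]]) (auto simp: G_def)
      also have "\<dots> = (energy G v1 + \<kappa> * energy G v)
          + 2 * t * ((\<Sum>e\<in>G. LBINT x:{0..len e}. v1 e x \<bullet> u1 e x) + \<kappa> * (\<Sum>e\<in>G. LBINT x:{0..len e}. v e x \<bullet> f e x))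
          + t\<^sup>2 * (energy G u1 + \<kappa> * energy G f)"
        unfolding energy_combine[OF v1c uc] energy_combine[OF vc fc] by (simp add: algebra_simps)
      finally show ?thesis unfolding cross C2G using Qv by linarith
    qed
    \<comment> \<open>The values t = \<eta> and t = -\<eta> put all three terms of the quadratic
      inequality on the scale needed for a bound linear in \<eta>.\<close>
    have "\<bar>Z\<bar> \<le> \<eta> * ((N + 1 + C2) / 2)"
    proof -
      have "2 * \<eta> * \<bar>Z\<bar> \<le> \<eta>\<^sup>2 * (N + 1) + \<eta>\<^sup>2 * C2"
        using quad[of \<eta>] quad[of "- \<eta>"] \<eta> by (cases "Z \<ge> 0") auto
      also have "\<dots> = (2 * \<eta>) * (\<eta> * ((N + 1 + C2) / 2))" by (simp add: power2_eq_square algebra_simps add_divide_distrib)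
      finally show ?thesis using \<eta> by simp
    qed
    moreover have "\<bar>X - Z\<bar> \<le> \<eta> * C1"
    proof -
      have "\<bar>X - Z\<bar> \<le> (\<Sum>e\<in>E. \<bar>(LBINT x:{0..len e}. complex_of_real (cmod (h0 e x)) \<bullet> w e x) - (LBINT x:{0..len e}. v e x \<bullet> w e x)\<bar>)"
        unfolding X_def Z_def sum_subtractf[symmetric] by (rule sum_abs)
      also have "\<dots> \<le> (\<Sum>e\<in>E. \<eta> * (LBINT x:{0..len e}. cmod (w e x)))"
      proof (rule sum_mono)
        fix e assume e: "e \<in> E"
        have i: "set_integrable lborel {0..len e} (\<lambda>x. complex_of_real (cmod (h0 e x)) \<bullet> w e x)"
          "set_integrable lborel {0..len e} (\<lambda>x. v e x \<bullet> w e x)" "set_integrable lborel {0..len e} (\<lambda>x. \<eta> * cmod (w e x))"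
          using set_integrable_inner_continuous[OF ac wi] set_integrable_inner_continuous[OF vc wi] set_integrable_mult_right[OF wn] by blast+
        have b: "\<bar>complex_of_real (cmod (h0 e x)) \<bullet> w e x - v e x \<bullet> w e x\<bar> \<le> \<eta> * cmod (w e x)" for x
        proof -
          have "\<bar>(complex_of_real (cmod (h0 e x)) - v e x) \<bullet> w e x\<bar> \<le> cmod (complex_of_real (cmod (h0 e x)) - v e x) * cmod (w e x)"
            by (rule Cauchy_Schwarz_ineq2)
          also have "\<dots> \<le> \<eta> * cmod (w e x)"
          proof (rule mult_right_mono)
            have "cmod (complex_of_real (cmod (h0 e x)) - v e x) = \<bar>cmod (h0 e x) - smooth_abs \<epsilon> (h0 e x)\<bar>"
              unfolding v_def gE[OF e] of_real_diff[symmetric] norm_of_real ..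
            also have "\<dots> \<le> \<epsilon>" using smooth_abs_bounds[OF \<epsilon>0, of "h0 e x"] by simp
            finally show "cmod (complex_of_real (cmod (h0 e x)) - v e x) \<le> \<eta>" using \<epsilon>(2) by simp
          qed simp
          finally show ?thesis by (simp add: inner_diff_left)
        qed
        have "(LBINT x:{0..len e}. complex_of_real (cmod (h0 e x)) \<bullet> w e x - v e x \<bullet> w e x) \<le> (LBINT x:{0..len e}. \<eta> * cmod (w e x))"
          by (rule set_integral_mono[OF set_integral_diff(1)[OF i(1,2)] i(3)]) (use b abs_le_D1 in blast)
        moreover have "(LBINT x:{0..len e}. v e x \<bullet> w e x - complex_of_real (cmod (h0 e x)) \<bullet> w e x) \<le> (LBINT x:{0..len e}. \<eta> * cmod (w e x))"
          by (rule set_integral_mono[OF set_integral_diff(1)[OF i(2,1)] i(3)]) (use b abs_le_D2 in fastforce)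
        ultimately show "\<bar>(LBINT x:{0..len e}. complex_of_real (cmod (h0 e x)) \<bullet> w e x) - (LBINT x:{0..len e}. v e x \<bullet> w e x)\<bar> \<le> \<eta> * (LBINT x:{0..len e}. cmod (w e x))"
          using set_integral_diff(2)[OF i(1,2)] set_integral_diff(2)[OF i(2,1)] by (simp add: abs_le_iff)
      qed
      also have "\<dots> = \<eta> * C1" by (simp add: C1_def sum_distrib_left)
      finally show ?thesis .
    qed
    ultimately show ?thesis unfolding distrib_left[of \<eta> C1] by linarith
  qed
  note bound = this
  have "X = 0"
  proof (rule ccontr)
    assume X: "X \<noteq> 0"
    define K where "K = \<bar>C1 + (N + 1 + C2) / 2\<bar> + 1"
    have K: "0 < K" by (simp add: K_def add_nonneg_pos)
    have "\<bar>X\<bar> \<le> \<bar>X\<bar> / (2 * K) * (C1 + (N + 1 + C2) / 2)" by (rule bound) (use X K in simp)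
    also have "\<dots> \<le> \<bar>X\<bar> / (2 * K) * K" by (rule mult_left_mono) (use K in \<open>auto simp: K_def\<close>)
    also have "\<dots> = \<bar>X\<bar> / 2" using K by simp
    finally show False using X by simp
  qed
  then show "(\<Sum>e\<in>E. LBINT x:{0..len e}. complex_of_real (cmod (h0 e x)) \<bullet> (\<kappa> *\<^sub>R f e x - u2 e x)) = 0"
    by (simp add: X_def w_def)
qed

end

section \<open>Propagation of zeros\<close>

lemma derivative_ge_zero_start:
  fixes r :: "real \<Rightarrow> real"
  assumes d: "(r has_real_derivative d) (at 0 within {0..l})" and l: "0 < l"
    and nn: "\<And>x. x \<in> {0..l} \<Longrightarrow> 0 \<le> r x" and z: "r 0 = 0"
  shows "0 \<le> d"
proof (rule ccontr)
  assume "\<not> 0 \<le> d"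
  then obtain \<delta> where \<delta>: "\<delta> > 0" "\<And>h. h > 0 \<Longrightarrow> 0 + h \<in> {0..l} \<Longrightarrow> h < \<delta> \<Longrightarrow> r (0 + h) < r 0"
    using has_real_derivative_neg_dec_right[OF d] by force
  define h where "h = min l (\<delta> / 2)"
  have h: "h > 0" "h \<le> l" "h < \<delta>" using l \<delta>(1) by (auto simp: h_def)
  show False using \<delta>(2)[of h] nn[of h] h z by simp
qed

lemma derivative_le_zero_end:
  fixes r :: "real \<Rightarrow> real"
  assumes d: "(r has_real_derivative d) (at l within {0..l})" and l: "0 < l"
    and nn: "\<And>x. x \<in> {0..l} \<Longrightarrow> 0 \<le> r x" and z: "r l = 0"
  shows "d \<le> 0"
proof (rule ccontr)
  assume "\<not> d \<le> 0"
  then obtain \<delta> where \<delta>: "\<delta> > 0" "\<And>h. h > 0 \<Longrightarrow> l - h \<in> {0..l} \<Longrightarrow> h < \<delta> \<Longrightarrow> r (l - h) < r l"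
    using has_real_derivative_pos_inc_left[OF d] by force
  define h where "h = min l (\<delta> / 2)"
  have h: "h > 0" "h \<le> l" "h < \<delta>" using l \<delta>(1) by (auto simp: h_def)
  show False using \<delta>(2)[of h] nn[of "l - h"] h z by simp
qed

text \<open>A nonnegative function that vanishes at an end cannot decrease on leaving it. Applied to
  the imaginary part and its negative, both identically zero here, this also shows that the
  derivative is real.\<close>

lemma nonneg_primitive_end_derivatives:
  assumes p: "primitive_on l w0 w1" "continuous_on {0..l} w1" and l: "0 < l"
    and r: "\<And>x. x \<in> {0..l} \<Longrightarrow> w0 x = complex_of_real (r x)" "\<And>x. x \<in> {0..l} \<Longrightarrow> 0 \<le> r x"
  shows "w0 0 = 0 \<Longrightarrow> Im (w1 0) = 0 \<and> 0 \<le> Re (w1 0)" and "w0 l = 0 \<Longrightarrow> Im (w1 l) = 0 \<and> Re (w1 l) \<le> 0"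
proof -
  have Re: "((\<lambda>x. Re (w0 x)) has_real_derivative Re (w1 x)) (at x within {0..l})"
    and Im: "((\<lambda>x. Im (w0 x)) has_real_derivative Im (w1 x)) (at x within {0..l})" if "x \<in> {0..l}" for x
    unfolding has_real_derivative_iff_has_vector_derivative
    by (rule bounded_linear.has_vector_derivative[OF bounded_linear_Re primitive_on_deriv[OF p that]]
          bounded_linear.has_vector_derivative[OF bounded_linear_Im primitive_on_deriv[OF p that]])+
  have mIm: "((\<lambda>x. - Im (w0 x)) has_real_derivative - Im (w1 x)) (at x within {0..l})" if "x \<in> {0..l}" for x
    by (rule DERIV_minus[OF Im[OF that]])
  have val: "0 \<le> Re (w0 x)" "0 \<le> Im (w0 x)" "0 \<le> - Im (w0 x)" if "x \<in> {0..l}" for x using r that by simp_all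
  have e: "0 \<in> {0..l}" "l \<in> {0..l}" using l by simp_all
  show "Im (w1 0) = 0 \<and> 0 \<le> Re (w1 0)" if "w0 0 = 0"
    using derivative_ge_zero_start[OF Re[OF e(1)] l val(1)] derivative_ge_zero_start[OF Im[OF e(1)] l val(2)]
      derivative_ge_zero_start[OF mIm[OF e(1)] l val(3)] that by simp
  show "Im (w1 l) = 0 \<and> Re (w1 l) \<le> 0" if "w0 l = 0"
    using derivative_le_zero_end[OF Re[OF e(2)] l val(1)] derivative_le_zero_end[OF Im[OF e(2)] l val(2)]
      derivative_le_zero_end[OF mIm[OF e(2)] l val(3)] that by simp
qed

context complete_metric_graph
begin

text \<open>At a zero of a nonnegative solution the derivatives into the edges are nonnegative
  reals, and the Kirchhoff condition makes their sum 0, so each is 0; vanishing initial data then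
  propagate along every edge at \<open>v\<close>.\<close>

lemma zero_at_vertex:
  assumes ws: "weak_solution \<kappa> E0 (\<lambda>e x. complex_of_real (r e x))"
    and r: "\<And>e. continuous_on {0..len e} (r e)" "\<And>e x. 0 \<le> r e x"
    and v: "edges_at src tgt v \<inter> E0 = {}"
    and z: "\<And>e. src e = v \<Longrightarrow> r e 0 = 0" "\<And>e. tgt e = v \<Longrightarrow> r e (len e) = 0"
    and e: "e \<in> edges_at src tgt v" and x: "x \<in> {0..len e}"
  shows "r e x = 0"
proof -
  let ?A = "edges_at src tgt v"
  obtain w0 w1 where "\<forall>e. e \<notin> E0 \<longrightarrow> classical_on \<kappa> (len e) (\<lambda>x. complex_of_real (r e x)) (w0 e) (w1 e)"
    using weak_solution_classical_family[OF ws] by blast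
  then have cl: "classical_on \<kappa> (len e) (\<lambda>x. complex_of_real (r e x)) (w0 e) (w1 e)" if "e \<in> ?A" for e
    using v that by blast
  have w0: "w0 e x = complex_of_real (r e x)" if "e \<in> ?A" "x \<in> {0..len e}" for e x
    by (rule classical_on_unique[OF cl[OF that(1)] _ len_pos that(2)]) (intro continuous_intros r(1))
  have ends: "0 \<in> {0..len e}" "len e \<in> {0..len e}" for e using len_nonneg[of e] by simp_all
  define d where "d e = (if src e = v then w1 e 0 else - w1 e (len e))" for e
  have val: "w0 e (if src e = v then 0 else len e) = 0" if "e \<in> ?A" for e
    using w0[OF that ends(1)] w0[OF that ends(2)] z that by (auto simp: edges_at_def)
  have d: "Im (d e) = 0 \<and> 0 \<le> Re (d e)" if e: "e \<in> ?A" for e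
    using nonneg_primitive_end_derivatives[OF classical_onD(1)[OF cl[OF e]] classical_onD(5)[OF cl[OF e]] len_pos w0[OF e] r(2)] val[OF e]
    by (auto simp: d_def)
  have "flux w1 v = 0" by (rule weak_solution_flux[OF ws v cl])
  then have "(\<Sum>e\<in>?A. Re (d e)) = 0" unfolding flux_edges_at d_def Re_sum[symmetric] by simp
  then have "Re (d e) = 0" using sum_nonneg_eq_0_iff[OF finite_edges_at, of v "\<lambda>e. Re (d e)"] d e by simp
  then have "d e = 0" using d[OF e] by (simp add: complex_eq_iff)
  then have "w1 e (if src e = v then 0 else len e) = 0" by (auto simp: d_def split: if_splits)
  then have "w0 e x = 0"
    by (intro initial_value_zero[OF classical_onD(1-3)[OF cl[OF e]] _ val[OF e] _ x]) auto
  then show ?thesis using w0[OF e x] by simp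
qed

text \<open>Test functions must avoid \<open>E0\<close>, so |h0| has no Kirchhoff condition at the
  endpoints of \<open>E0\<close>. There \<open>van\<close> supplies zeros on all touching edges; at
  every other vertex \<open>zero_at_vertex\<close> applies, so a vanishing vertex value passes
  across each edge in both directions.\<close>

lemma eigenfunction_zero:
  assumes h: "h \<in> L2G len" "(emb len h, lam *\<^sub>R emb len h) \<in> Laplacian"
    and cl: "\<And>e. classical_on (- lam) (len e) (h e) (h0 e) (h1 e)"
    and a: "a \<in> E0" and van: "\<And>e. e \<in> touching (src ` E0 \<union> tgt ` E0) \<Longrightarrow> h0 e 0 = 0 \<and> h1 e 0 = 0"
    and form: "\<And>E \<phi> \<phi>1. form_fun E \<phi> \<phi>1 \<Longrightarrow> E \<inter> E0 = {} \<Longrightarrow> lam * energy E \<phi> \<le> energy E \<phi>1"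
  shows "emb len h = 0"
proof -
  let ?V = "src ` E0 \<union> tgt ` E0"
  have ws: "weak_solution (- lam) {} h" by (rule eigen_weak_solution[OF h])
  have ends: "0 \<in> {0..len e}" "len e \<in> {0..len e}" for e using len_nonneg[of e] by simp_all
  have near: "h0 e x = 0" if "e \<in> touching ?V" "x \<in> {0..len e}" for e x
    using initial_value_zero[OF classical_onD(1-3)[OF cl], of 0 e x] van[OF that(1)] that(2) by simp
  have near1: "h1 e x = 0" if e: "e \<in> touching ?V" and x: "x \<in> {0..len e}" for e x
  proof -
    have "(LBINT t:{0..x}. - lam *\<^sub>R h e t) = 0"
      unfolding set_lebesgue_integral_def
    proof (rule integral_eq_zero_AE)
      show "AE t in lborel. indicator {0..x} t *\<^sub>R - lam *\<^sub>R h e t = 0"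
        using classical_onD(3)[OF cl, of e] by eventually_elim (use near[OF e] x in \<open>auto simp: indicator_def\<close>)
    qed
    then show ?thesis using primitive_onD(2)[OF classical_onD(2)[OF cl] x] van[OF e] by simp
  qed
  have sub: "e \<in> touching ?V" if "e \<in> E0" for e using that by (auto simp: touching_def)
  have abs: "weak_solution (- lam) E0 (\<lambda>e x. complex_of_real (cmod (h0 e x)))"
  proof (rule abs_weak_solution[OF h(1) ws cl])
    show "h0 e x = 0" "h1 e x = 0" if "e \<in> E0" "x \<in> {0..len e}" for e x
      using near near1 sub that by blast+
    show "0 \<le> energy E \<phi>1 + - lam * energy E \<phi>" if "form_fun E \<phi> \<phi>1" "E \<inter> E0 = {}" for E \<phi> \<phi>1
      using form[OF that] by simp
  qed
  have "\<exists>c. \<forall>e. h0 e 0 = c (src e) \<and> h0 e (len e) = c (tgt e)"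
    by (rule vertex_values[OF weak_solution_continuous[OF ws cl]]) blast
  then obtain c where "\<forall>e. h0 e 0 = c (src e) \<and> h0 e (len e) = c (tgt e)" by blast
  then have c: "h0 e 0 = c (src e)" "h0 e (len e) = c (tgt e)" for e by simp_all
  have edge: "h0 e x = 0" if v: "c v = 0" and e: "e \<in> edges_at src tgt v" and x: "x \<in> {0..len e}" for v e x
  proof (cases "v \<in> ?V")
    case True
    then have "e \<in> touching ?V" using e by (auto simp: touching_def edges_at_def)
    then show ?thesis using x by (rule near)
  next
    case False
    have "cmod (h0 e x) = 0"
    proof (rule zero_at_vertex[OF abs _ _ _ _ _ e x])
      show "continuous_on {0..len e} (\<lambda>x. cmod (h0 e x))" for e by (intro continuous_intros classical_onD(4)[OF cl])
      show "edges_at src tgt v \<inter> E0 = {}" using False by (auto simp: edges_at_def)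
      show "cmod (h0 e 0) = 0" if "src e = v" for e using c(1)[of e] that v by simp
      show "cmod (h0 e (len e)) = 0" if "tgt e = v" for e using c(2)[of e] that v by simp
    qed simp
    then show ?thesis by simp
  qed
  have step: "(c (src e) = 0) = (c (tgt e) = 0)" for e
  proof -
    have "e \<in> edges_at src tgt (src e)" "e \<in> edges_at src tgt (tgt e)" by (auto simp: edges_at_def)
    then have "c (src e) = 0 \<Longrightarrow> h0 e (len e) = 0" "c (tgt e) = 0 \<Longrightarrow> h0 e 0 = 0"
      using edge ends by blast+
    then show ?thesis unfolding c by blast
  qed
  have "c (src a) = 0" using near[OF sub[OF a] ends(1)] unfolding c .
  have all: "c u = 0" for u
  proof -
    obtain L where "walk (src a) u L" using connected[of "src a" u] by blast
    from constant_on_walk[of "\<lambda>v. c v = 0", OF step this] show ?thesis using \<open>c (src a) = 0\<close> by simp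
  qed
  have h0: "h0 e x = 0" if "x \<in> {0..len e}" for e x
    by (rule edge[OF all[of "src e"] _ that]) (simp add: edges_at_def)
  show ?thesis
  proof (rule emb_eq_zero[OF h(1)])
    fix e
    have "(LBINT x:{0..len e}. (cmod (h e x))\<^sup>2) = (LBINT x:{0..len e}. (cmod (h0 e x))\<^sup>2)"
      by (rule integral_square_cong[where h = h, OF cl L2G_edge(2)[OF h(1)]])
    also have "\<dots> = (LBINT x:{0..len e}. 0)" by (rule set_lebesgue_integral_cong) (use h0 in auto)
    finally show "(LBINT x:{0..len e}. (cmod (h e x))\<^sup>2) = 0" by simp
  qed
qed

theorem ess_spectrum_nonempty:
  assumes mu: "mu_exp src tgt len v < \<infinity>" and vol: "(\<Sum>\<^sub>\<infinity>v. ennreal (mv src tgt len v)) = \<infinity>"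
  shows "ess_spectrum len (H0 src tgt len) \<noteq> {}"
proof
  assume empty: "ess_spectrum len (H0 src tgt len) = {}"
  obtain S K where S: "subspace S" "\<And>F. finite F \<Longrightarrow> \<not> S \<subseteq> span F" "0 \<le> K"
    "\<And>g. g \<in> S \<Longrightarrow> \<exists>g'. (g, g') \<in> Laplacian \<and> g \<bullet> g' \<le> K * (norm g)\<^sup>2"
    using infinite_dim_small_energy[OF mu vol] by metis
  obtain lam where lam: "lam > -1" "\<And>F. finite F \<Longrightarrow> \<exists>f. (f, lam *\<^sub>R f) \<in> Laplacian \<and> f \<notin> span F"
    "\<exists>F. finite F \<and> (\<forall>g. (\<forall>x\<in>F. x \<bullet> g = 0) \<longrightarrow> (lam + 1) * (op.B g \<bullet> g) \<le> (norm g)\<^sup>2)"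
    by (rule op.infinite_multiplicity_bottom[OF S isolated_spectrum[OF empty]]) blast+
  obtain F where F: "finite F" "\<And>g. (\<forall>x\<in>F. x \<bullet> g = 0) \<Longrightarrow> (lam + 1) * (op.B g \<bullet> g) \<le> (norm g)\<^sup>2"
    using lam(3) by blast
  obtain E1 where E1: "finite E1" "\<forall>E \<phi> \<phi>1. form_fun E \<phi> \<phi>1 \<longrightarrow> E \<inter> E1 = {} \<longrightarrow> lam * energy E \<phi> \<le> energy E \<phi>1"
    using form_bound_off_finite[OF lam(1) F] by blast
  \<comment> \<open>An arbitrary edge is added to make the set nonempty: it provides the first
    vertex at which the eigenfunction vanishes. Enlarging the set preserves the form bound.\<close>
  define E0 where "E0 = insert undefined E1"
  have fin: "finite (touching (src ` E0 \<union> tgt ` E0))" by (rule finite_touching) (use E1 in \<open>simp add: E0_def\<close>)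
  obtain h h0 h1 where h: "h \<in> L2G len" "(emb len h, lam *\<^sub>R emb len h) \<in> Laplacian" "emb len h \<noteq> 0"
    "\<forall>e. classical_on (- lam) (len e) (h e) (h0 e) (h1 e)" "\<forall>e\<in>touching (src ` E0 \<union> tgt ` E0). h0 e 0 = 0 \<and> h1 e 0 = 0"
    using vanishing_eigenfunction[OF lam(2) fin] by blast
  have "emb len h = 0"
  proof (rule eigenfunction_zero[OF h(1,2) h(4)[rule_format]])
    show "undefined \<in> E0" by (simp add: E0_def)
    show "h0 e 0 = 0 \<and> h1 e 0 = 0" if "e \<in> touching (src ` E0 \<union> tgt ` E0)" for e using h(5) that by blast
    show "lam * energy E \<phi> \<le> energy E \<phi>1" if "form_fun E \<phi> \<phi>1" "E \<inter> E0 = {}" for E \<phi> \<phi>1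
      using E1(2) that by (simp add: E0_def)
  qed
  then show False using h(3) by simp
qed

end

theorem mainTheorem11:
  fixes src tgt :: "'e::countable \<Rightarrow> 'v::countable"
    and len :: "'e \<Rightarrow> real"
    and v0 :: 'v
  assumes setting: "graph_setting src tgt len"
    and complete: "rho0_complete src tgt len"
  shows "(mu_unif src tgt len = 0 \<longrightarrow>
            spectrum_op len (H0 src tgt len) \<noteq> {} \<and>
            Inf (Re ` spectrum_op len (H0 src tgt len)) = 0)
       \<and> ((\<Sum>\<^sub>\<infinity>v. ennreal (mv src tgt len v)) = \<infinity> \<longrightarrow>
            (mu_exp src tgt len v0 = 0 \<longrightarrow>
               ess_spectrum len (H0 src tgt len) \<noteq> {} \<and>
               Inf (Re ` ess_spectrum len (H0 src tgt len)) = 0)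
          \<and> (mu_exp src tgt len v0 < \<infinity> \<longrightarrow>
               ess_spectrum len (H0 src tgt len) \<noteq> {}))"
proof -
  interpret complete_metric_graph src tgt len
    by unfold_locales (rule setting, rule complete)
  let ?S = "spectrum_op len (H0 src tgt len)" and ?E = "ess_spectrum len (H0 src tgt len)"
  have 1: "?S \<noteq> {} \<and> Inf (Re ` ?S) = 0" if "mu_unif src tgt len = 0"
    using slow_growth_zero_in_spectrum[of v0] that Inf_Re_spectrum[of ?S] by auto
  have 2: "?E \<noteq> {} \<and> Inf (Re ` ?E) = 0"
    if vol: "(\<Sum>\<^sub>\<infinity>v. ennreal (mv src tgt len v)) = \<infinity>" and mu: "mu_exp src tgt len v0 = 0"
  proof -
    have "0 \<in> ?E"
      using slow_growth_zero_in_spectrum[of v0] mu zero_not_eigenvalue[OF vol] by (simp add: ess_spectrum_def disc_spectrum_def)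
    moreover have "?E \<subseteq> ?S" by (auto simp: ess_spectrum_def)
    ultimately show ?thesis using Inf_Re_spectrum[of ?E] by blast
  qed
  show ?thesis using 1 2 ess_spectrum_nonempty[of v0] by blast
qed

end
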